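(* Let $1<p<\infty$. Suppose that $C_p$ is a constant, independent of $\alpha,\beta$, such that the Jacobi–Littlewood–Paley $g$-functions satisfy $$\|g^{(\alpha,\beta)}f\|_{p,(\alpha,\beta)}\le C_p\,\|f\|_{p,(\alpha,\beta)}$$ for all $\alpha,\beta>-1$ and all $f\in L^p((-1,1),\mu_{\alpha,\beta})$. Then, with the same constant $C_p$: (i) the Gaussian–Littlewood–Paley $g$-function satisfies $\|g^{\gamma}f\|_{p,\gamma}\le C_p\,\|f\|_{p,\gamma}$ for all $f\in L^p(\mathbb{R},\gamma)$; (ii) for every $\alpha>-1$, the Laguerre–Littlewood–Paley $g$-function satisfies $\|g^{\alpha}f\|_{p,\alpha}\le C_p\,\|f\|_{p,\alpha}$ for all $f\in L^p((0,\infty),\mu_\alpha)$.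
   Context: Everything is in dimension one; functions are real valued. Polynomials are normalized as in Szegő's book. **Subordination.** Given a semigroup $\{T_t\}_{t>0}$, its Poisson (subordinated) semigroup is $P_tf(x)=\frac{1}{\sqrt\pi}\int_0^\infty \frac{e^{-u}}{\sqrt u}\,T_{t^2/(4u)}f(x)\,du$, $t>0$. **Jacobi setting.** For $\alpha,\beta>-1$, $\mu_{\alpha,\beta}$ is the probability measure on $(-1,1)$ given by $\mu_{\alpha,\beta}(dx)=\eta_{\alpha,\beta}(1-x)^\alpha(1+x)^\beta dx$, with $\eta_{\alpha,\beta}=\frac{\Gamma(\alpha+\beta+2)}{2^{\alpha+\beta+1}\Gamma(\alpha+1)\Gamma(\beta+1)}$. Let $P_k^{(\alpha,\beta)}$, $k\ge0$, be the Jacobi polynomials (orthogonal with respect to $\mu_{\alpha,\beta}$, $\deg P_k^{(\alpha,\beta)}=k$), $\hat h_k^{(\alpha,\beta)}=\int_{-1}^1 (P_k^{(\alpha,\beta)})^2\,d\mu_{\alpha,\beta}$ and $\lambda_k=k(k+\alpha+\beta+1)$. The Jacobi semigroup is $$T_t^{\alpha,\beta}f(x)=\int_{-1}^1\Big(\sum_{k\ge0}\frac{e^{-\lambda_k t}}{\hat h_k^{(\alpha,\beta)}}P_k^{(\alpha,\beta)}(x)P_k^{(\alpha,\beta)}(y)\Big)f(y)\,\mu_{\alpha,\beta}(dy),$$ and $P_t^{(\alpha,\beta)}$ is its subordinated semigroup; so $P_t^{(\alpha,\beta)}P_k^{(\alpha,\beta)}=e^{-t\sqrt{\lambda_k}}P_k^{(\alpha,\beta)}$.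 The Jacobi–Littlewood–Paley $g$-function is $$g^{(\alpha,\beta)}f(x)=\Big(\int_0^\infty t\Big[\big(\tfrac{\partial}{\partial t}P_t^{(\alpha,\beta)}f(x)\big)^2+(1-x^2)\big(\tfrac{\partial}{\partial x}P_t^{(\alpha,\beta)}f(x)\big)^2\Big]dt\Big)^{1/2}.$$ **Hermite (Gaussian) setting.** $\gamma(dx)=\pi^{-1/2}e^{-x^2}dx$ on $\mathbb{R}$; $H_k$ are the Hermite polynomials, orthogonal with respect to $\gamma$ with $\int H_k^2\,d\gamma=2^kk!$. The semigroup is $T_t^\gamma f(x)=\int_{\mathbb{R}}\big(\sum_{k\ge0}\frac{e^{-kt}}{2^kk!}H_k(x)H_k(y)\big)f(y)\,\gamma(dy)$ and $P_t^\gamma$ is its subordinated semigroup; so $P_t^\gamma H_k=e^{-t\sqrt k}H_k$. The Gaussian–Littlewood–Paley $g$-function is $$g^{\gamma}f(x)=\Big(\int_0^\infty t\Big[\big(\tfrac{\partial}{\partial t}P_t^{\gamma}f(x)\big)^2+\tfrac12\big(\tfrac{\partial}{\partial x}P_t^{\gamma}f(x)\big)^2\Big]dt\Big)^{1/2}.$$ **Laguerre setting.** For $\alpha>-1$, $\mu_\alpha(dx)=\frac{x^\alpha e^{-x}}{\Gamma(\alpha+1)}dx$ on $(0,\infty)$; $L_k^\alpha$ are the Laguerre polynomials, orthogonal with respect to $\mu_\alpha$ with $\int (L_k^\alpha)^2\,d\mu_\alpha=\frac{\Gamma(k+\alpha+1)}{\Gamma(\alpha+1)k!}$. The semigroup is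 $T_t^\alpha f(x)=\int_0^\infty\big(\sum_{k\ge0}e^{-kt}\frac{\Gamma(\alpha+1)k!}{\Gamma(k+\alpha+1)}L_k^\alpha(x)L_k^\alpha(y)\big)f(y)\,\mu_\alpha(dy)$ and $P_t^\alpha$ is its subordinated semigroup; so $P_t^\alpha L_k^\alpha=e^{-t\sqrt k}L_k^\alpha$. The Laguerre–Littlewood–Paley $g$-function is $$g^{\alpha}f(x)=\Big(\int_0^\infty t\Big[\big(\tfrac{\partial}{\partial t}P_t^{\alpha}f(x)\big)^2+x\big(\tfrac{\partial}{\partial x}P_t^{\alpha}f(x)\big)^2\Big]dt\Big)^{1/2}.$$ **Norms.** $\|\cdot\|_{p,(\alpha,\beta)}$, $\|\cdot\|_{p,\gamma}$, $\|\cdot\|_{p,\alpha}$ denote the norms of $L^p((-1,1),\mu_{\alpha,\beta})$, $L^p(\mathbb{R},\gamma)$ and $L^p((0,\infty),\mu_\alpha)$ respectively. *)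

theory Defs
  imports "HOL-Analysis.Analysis"
begin

subsection \<open>$L^p$ norms\<close>

text \<open>Powers of extended nonnegative numbers, meant for exponents \<open>a > 0\<close>
  (so that \<open>\<infinity>\<close> is mapped to \<open>\<infinity>\<close> and \<open>0\<close> to \<open>0\<close>).\<close>

definition enn_powr :: "ennreal \<Rightarrow> real \<Rightarrow> ennreal"
  where "enn_powr r a = (if r = \<infinity> then \<infinity> else ennreal (enn2real r powr a))"

text \<open>The norm is taken of a \<open>[0,\<infinity>]\<close>-valued function, since a $g$-function may a priori be
  infinite; for a real function \<open>f\<close> it is applied to \<open>\<lambda>x. ennreal \<bar>f x\<bar>\<close>.\<close>

definition Lp_norm_enn :: "real \<Rightarrow> real measure \<Rightarrow> (real \<Rightarrow> ennreal) \<Rightarrow> ennreal"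
  where "Lp_norm_enn p M h = enn_powr (\<integral>\<^sup>+ x. enn_powr (h x) p \<partial>M) (1 / p)"

definition Lp_norm :: "real \<Rightarrow> real measure \<Rightarrow> (real \<Rightarrow> real) \<Rightarrow> ennreal"
  where "Lp_norm p M f = Lp_norm_enn p M (\<lambda>x. ennreal \<bar>f x\<bar>)"

definition Lp_space :: "real \<Rightarrow> real measure \<Rightarrow> (real \<Rightarrow> real) set"
  where "Lp_space p M = {f. f \<in> borel_measurable M \<and> integrable M (\<lambda>x. \<bar>f x\<bar> powr p)}"


subsection \<open>Subordination and $g$-functions\<close>

definition subordinated ::
    "(real \<Rightarrow> (real \<Rightarrow> real) \<Rightarrow> real \<Rightarrow> real) \<Rightarrow> real \<Rightarrow> (real \<Rightarrow> real) \<Rightarrow> real \<Rightarrow> real"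
  where "subordinated T t f x =
    1 / sqrt pi * (LBINT u:{0<..}. exp (- u) / sqrt u * T (t\<^sup>2 / (4 * u)) f x)"

text \<open>\<open>w\<close> is the coefficient in front of the squared space derivative.\<close>

definition g_function ::
    "(real \<Rightarrow> (real \<Rightarrow> real) \<Rightarrow> real \<Rightarrow> real) \<Rightarrow> (real \<Rightarrow> real) \<Rightarrow> (real \<Rightarrow> real) \<Rightarrow> real \<Rightarrow> ennreal"
  where "g_function P w f x =
    enn_powr
      (\<integral>\<^sup>+ t\<in>{0<..}. ennreal (t * ((deriv (\<lambda>s. P s f x) t)\<^sup>2
                                  + w x * (deriv (\<lambda>z. P t f z) x)\<^sup>2)) \<partial>lborel)
      (1 / 2)"


subsection \<open>Jacobi setting\<close>

definition jacobi_measure :: "real \<Rightarrow> real \<Rightarrow> real measure"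
  where "jacobi_measure \<alpha> \<beta> =
    density (restrict_space lborel {-1<..<1})
      (\<lambda>x. ennreal (Gamma (\<alpha> + \<beta> + 2)
                    / (2 powr (\<alpha> + \<beta> + 1) * Gamma (\<alpha> + 1) * Gamma (\<beta> + 1))
                    * (1 - x) powr \<alpha> * (1 + x) powr \<beta>))"

text \<open>Szego, Orthogonal Polynomials, (4.3.2); thus \<open>P\<^sub>k(1) = (k + \<alpha>) gchoose k\<close>.\<close>

definition jacobi_poly :: "real \<Rightarrow> real \<Rightarrow> nat \<Rightarrow> real \<Rightarrow> real"
  where "jacobi_poly \<alpha> \<beta> k x =
    (\<Sum>j\<le>k. ((real k + \<alpha>) gchoose (k - j)) * ((real k + \<beta>) gchoose j)
             * ((x - 1) / 2) ^ j * ((x + 1) / 2) ^ (k - j))"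

definition jacobi_sqnorm :: "real \<Rightarrow> real \<Rightarrow> nat \<Rightarrow> real"
  where "jacobi_sqnorm \<alpha> \<beta> k = (\<integral>x. (jacobi_poly \<alpha> \<beta> k x)\<^sup>2 \<partial>jacobi_measure \<alpha> \<beta>)"

definition jacobi_eigenvalue :: "real \<Rightarrow> real \<Rightarrow> nat \<Rightarrow> real"
  where "jacobi_eigenvalue \<alpha> \<beta> k = real k * (real k + \<alpha> + \<beta> + 1)"

definition jacobi_semigroup ::
    "real \<Rightarrow> real \<Rightarrow> real \<Rightarrow> (real \<Rightarrow> real) \<Rightarrow> real \<Rightarrow> real"
  where "jacobi_semigroup \<alpha> \<beta> t f x =
    (\<integral>y. (\<Sum>k. exp (- jacobi_eigenvalue \<alpha> \<beta> k * t) / jacobi_sqnorm \<alpha> \<beta> k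
               * jacobi_poly \<alpha> \<beta> k x * jacobi_poly \<alpha> \<beta> k y) * f y \<partial>jacobi_measure \<alpha> \<beta>)"

definition jacobi_poisson ::
    "real \<Rightarrow> real \<Rightarrow> real \<Rightarrow> (real \<Rightarrow> real) \<Rightarrow> real \<Rightarrow> real"
  where "jacobi_poisson \<alpha> \<beta> = subordinated (jacobi_semigroup \<alpha> \<beta>)"

definition jacobi_g :: "real \<Rightarrow> real \<Rightarrow> (real \<Rightarrow> real) \<Rightarrow> real \<Rightarrow> ennreal"
  where "jacobi_g \<alpha> \<beta> = g_function (jacobi_poisson \<alpha> \<beta>) (\<lambda>x. 1 - x\<^sup>2)"


subsection \<open>Hermite (Gaussian) setting\<close>

definition gauss_measure :: "real measure"
  where "gauss_measure = density lborel (\<lambda>x. ennreal (exp (- x\<^sup>2) / sqrt pi))"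

text \<open>Szego, Orthogonal Polynomials, (5.5.4); thus \<open>H\<^sub>k\<close> has leading coefficient \<open>2 ^ k\<close>.\<close>

definition hermite_poly :: "nat \<Rightarrow> real \<Rightarrow> real"
  where "hermite_poly k x =
    fact k * (\<Sum>j\<le>k div 2. (- 1) ^ j / fact j * (2 * x) ^ (k - 2 * j) / fact (k - 2 * j))"

definition gauss_semigroup :: "real \<Rightarrow> (real \<Rightarrow> real) \<Rightarrow> real \<Rightarrow> real"
  where "gauss_semigroup t f x =
    (\<integral>y. (\<Sum>k. exp (- real k * t) / (2 ^ k * fact k) * hermite_poly k x * hermite_poly k y)
          * f y \<partial>gauss_measure)"

definition gauss_poisson :: "real \<Rightarrow> (real \<Rightarrow> real) \<Rightarrow> real \<Rightarrow> real"
  where "gauss_poisson = subordinated gauss_semigroup"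

definition gauss_g :: "(real \<Rightarrow> real) \<Rightarrow> real \<Rightarrow> ennreal"
  where "gauss_g = g_function gauss_poisson (\<lambda>x. 1 / 2)"


subsection \<open>Laguerre setting\<close>

definition laguerre_measure :: "real \<Rightarrow> real measure"
  where "laguerre_measure \<alpha> =
    density (restrict_space lborel {0<..})
      (\<lambda>x. ennreal (x powr \<alpha> * exp (- x) / Gamma (\<alpha> + 1)))"

text \<open>Szego, Orthogonal Polynomials, (5.1.6); thus \<open>L\<^sub>k\<close> has leading coefficient
  \<open>(- 1) ^ k / fact k\<close>.\<close>

definition laguerre_poly :: "real \<Rightarrow> nat \<Rightarrow> real \<Rightarrow> real"
  where "laguerre_poly \<alpha> k x =
    (\<Sum>j\<le>k. ((real k + \<alpha>) gchoose (k - j)) * (- x) ^ j / fact j)"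

definition laguerre_semigroup :: "real \<Rightarrow> real \<Rightarrow> (real \<Rightarrow> real) \<Rightarrow> real \<Rightarrow> real"
  where "laguerre_semigroup \<alpha> t f x =
    (\<integral>y. (\<Sum>k. exp (- real k * t) * (Gamma (\<alpha> + 1) * fact k / Gamma (real k + \<alpha> + 1))
               * laguerre_poly \<alpha> k x * laguerre_poly \<alpha> k y) * f y \<partial>laguerre_measure \<alpha>)"

definition laguerre_poisson :: "real \<Rightarrow> real \<Rightarrow> (real \<Rightarrow> real) \<Rightarrow> real \<Rightarrow> real"
  where "laguerre_poisson \<alpha> = subordinated (laguerre_semigroup \<alpha>)"

definition laguerre_g :: "real \<Rightarrow> (real \<Rightarrow> real) \<Rightarrow> real \<Rightarrow> ennreal"
  where "laguerre_g \<alpha> = g_function (laguerre_poisson \<alpha>) (\<lambda>x. x)"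

end

theory Submission
  imports Defs "HOL-Probability.Probability" "HOL-Real_Asymp.Real_Asymp"
    "HOL-Complex_Analysis.Complex_Analysis"
begin

text \<open>For a polynomial \<open>f\<close> the integral in \<open>t\<close> can be evaluated: the square of its $g$-function is a
  finite quadratic form (\<open>g_form\<close>) in the coefficients of \<open>f\<close> with respect to the orthogonal
  polynomials. Under \<open>x = z / sqrt n\<close> with \<open>\<alpha> = \<beta> = n\<close>, respectively \<open>x = 1 - 2 * z / n\<close> with
  \<open>\<beta> = n\<close>, the normalised Jacobi densities \<open>(1 - z\<^sup>2 / n) powr n\<close> and
  \<open>z powr \<alpha> * (1 - z / n) powr n\<close> lie below their limits \<open>exp (- z\<^sup>2)\<close> and
  \<open>z powr \<alpha> * exp (- z)\<close>, and the rescaled eigenvalues tend to \<open>k\<close>. Hence moments, monic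
  orthogonal polynomials and quadratic forms converge, and Fatou's lemma carries the inequality
  for polynomials to the limit.

  Polynomials are dense in \<open>L\<^sup>p\<close> because the limit measures have exponential moments. The closed
  formulas of Mehler and of Hille and Hardy bound the heat kernels and their derivatives by
  powers of \<open>1 + 1 / s\<close>, so both derivatives of the Poisson integral at a point depend
  continuously on \<open>f\<close> in \<open>L\<^sup>1\<close>; a second application of Fatou's lemma reaches all of \<open>L\<^sup>p\<close>.\<close>

subsection \<open>Preliminaries\<close>

text \<open>The Jacobi hypothesis is tested on polynomials only. There the g-function is a finite
  expression in eigenvalues, expansion coefficients and values of orthogonal polynomials, each of
  which passes to the limit on its own, so convergence of the Jacobi semigroups themselves never
  enters. Keeping the same constant shapes the rest. Normalising constants cancel because both sides
  of the p-th power inequality are linear in the measure. The factor t dt makes the g-function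
  invariant under a change of time scale, so eigenvalues may be divided by a common factor as long
  as the coefficient of the space derivative is rescaled with them. The step from polynomials to
  general functions splits the p-th power of a sum with main coefficient (1 + d) powr p, and d tends
  to 0 at the end. For a general function in the two limit settings the derivatives of its Poisson
  integral must be controlled at each point. This is why explicit kernels come in: their bounds are
  uniform in the integration variable, and the price, a power of 1 / s, becomes polynomial growth
  under subordination, which exp (- u) absorbs.\<close>

lemma poly_borel_measurable [measurable]: "poly q \<in> borel_measurable borel" for q :: "real poly"
  by (intro borel_measurable_continuous_onI continuous_intros)

lemma emeasure_space_eq_1:
  assumes "has_bochner_integral M (\<lambda>x. 1::real) 1"
  shows "emeasure M (space M) = 1"
proof -
  have "integrable M (\<lambda>x. 1::real)" "(\<integral>x. (1::real) \<partial>M) = 1" using assms by (auto simp: has_bochner_integral_iff)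
  then have "(\<integral>\<^sup>+x. ennreal 1 \<partial>M) = ennreal 1" by (subst nn_integral_eq_integral) auto
  then show ?thesis by simp
qed

lemma enn_powr_ennreal: "0 \<le> x \<Longrightarrow> enn_powr (ennreal x) a = ennreal (x powr a)"
  by (simp add: enn_powr_def)

lemma enn_powr_enn_powr:
  assumes "0 < a" "0 < b"
  shows "enn_powr (enn_powr x a) b = enn_powr x (a * b)"
  by (cases x) (auto simp: enn_powr_def powr_powr)

lemma enn_powr_less_iff:
  assumes a: "0 < a"
  shows "enn_powr x a < enn_powr y a \<longleftrightarrow> x < y"
proof -
  have "ennreal (r powr a) < ennreal (s powr a) \<longleftrightarrow> ennreal r < ennreal s" if "0 \<le> r" "0 \<le> s" for r s
    using that a by (auto simp: ennreal_less_iff powr_less_mono2 not_less intro: powr_mono2 ccontr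
        dest: powr_mono2[of a s r])
       (metis a less_eq_real_def linorder_not_less powr_mono2)
  then show ?thesis
    by (cases x; cases y) (auto simp: enn_powr_def)
qed

lemma enn_powr_le_iff:
  assumes a: "0 < a"
  shows "enn_powr x a \<le> enn_powr y a \<longleftrightarrow> x \<le> y"
  using enn_powr_less_iff[OF a, of y x] by (simp add: not_less[symmetric])

text \<open>A positive power is an invertible, strictly increasing map of the extended half-line, so
  every bound below the left side is itself a power of a number below the lower limit. This is the
  direction needed after an application of Fatou's lemma.\<close>

lemma enn_powr_liminf_le:
  fixes X :: "nat \<Rightarrow> ennreal"
  assumes a: "0 < a"
  shows "enn_powr (liminf X) a \<le> liminf (\<lambda>n. enn_powr (X n) a)"
proof (subst le_Liminf_iff, intro allI impI)
  fix y :: ennreal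
  assume y: "y < enn_powr (liminf X) a"
  have y_eq: "y = enn_powr (enn_powr y (1 / a)) a"
    using a by (cases y) (auto simp: enn_powr_enn_powr, auto simp: enn_powr_def)
  then have "enn_powr y (1 / a) < liminf X"
    using y enn_powr_less_iff[OF a] by metis
  then have "eventually (\<lambda>n. enn_powr y (1 / a) < X n) sequentially"
    by (rule less_LiminfD)
  then show "eventually (\<lambda>n. y < enn_powr (X n) a) sequentially"
    by eventually_elim (metis y_eq enn_powr_less_iff[OF a])
qed

text \<open>Both sides are raised to the power \<open>p\<close>; membership in
  \<open>Lp_space\<close> makes the right integral a finite real number. Changes of variables and
  Fatou's lemma act on these integrals, not on the norms.\<close>

lemma Lp_norm_enn_le_iff:
  assumes p: "0 < p" and C: "0 \<le> C" and f: "f \<in> Lp_space p M"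
  shows "Lp_norm_enn p M h \<le> ennreal C * Lp_norm p M f \<longleftrightarrow>
    (\<integral>\<^sup>+ x. enn_powr (h x) p \<partial>M) \<le> ennreal (C powr p) * (\<integral>\<^sup>+ x. ennreal (\<bar>f x\<bar> powr p) \<partial>M)"
proof -
  define J where "J = (\<integral>x. \<bar>f x\<bar> powr p \<partial>M)"
  have J: "(\<integral>\<^sup>+ x. ennreal (\<bar>f x\<bar> powr p) \<partial>M) = ennreal J" "0 \<le> J"
    using f unfolding J_def Lp_space_def by (auto intro!: nn_integral_eq_integral)
  have "ennreal C * Lp_norm p M f = enn_powr (ennreal (C powr p) * ennreal J) (1 / p)"
    using p C J by (simp add: Lp_norm_def Lp_norm_enn_def enn_powr_ennreal ennreal_mult[symmetric]
        powr_mult powr_powr)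
  then show ?thesis
    unfolding J Lp_norm_enn_def using p by (simp add: enn_powr_le_iff)
qed

text \<open>Dominated convergence of difference quotients: on the convex set \<open>S\<close> the
  mean value inequality turns the bound on \<open>f'\<close> into a bound on the quotients.
  Measurability of \<open>f' x\<close> is derived, as it is a pointwise limit of quotients along a
  sequence inside \<open>S\<close>.\<close>

lemma has_derivative_under_integral:
  fixes f :: "real \<Rightarrow> 'a \<Rightarrow> real"
  assumes S: "open S" "x \<in> S" "convex S"
    and int: "\<And>z. z \<in> S \<Longrightarrow> integrable M (f z)"
    and der: "\<And>z y. z \<in> S \<Longrightarrow> y \<in> space M \<Longrightarrow> ((\<lambda>z. f z y) has_real_derivative f' z y) (at z)"
    and bound: "\<And>z y. z \<in> S \<Longrightarrow> y \<in> space M \<Longrightarrow> \<bar>f' z y\<bar> \<le> g y"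
    and g: "integrable M g"
  shows "((\<lambda>z. \<integral>y. f z y \<partial>M) has_real_derivative (\<integral>y. f' x y \<partial>M)) (at x)"
    and "integrable M (f' x)" and "\<bar>\<integral>y. f' x y \<partial>M\<bar> \<le> (\<integral>y. g y \<partial>M)"
proof -
  have quot: "((\<lambda>z. (f z y - f x y) / (z - x)) \<longlongrightarrow> f' x y) (at x)" if "y \<in> space M" for y
    using der[OF S(2) that] by (simp add: has_field_derivative_iff)
  obtain d where d: "0 < d" "ball x d \<subseteq> S" using S by (auto simp: open_contains_ball)
  have meas: "f' x \<in> borel_measurable M"
  proof (rule borel_measurable_LIMSEQ_real)
    define u where "u n = x + d / (real n + 2)" for n
    have u: "filterlim u (at x) sequentially"
    proof -
      have "u \<longlonglongrightarrow> x" unfolding u_def by real_asymp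
      moreover have "u n \<noteq> x" for n using d by (simp add: u_def add_eq_0_iff)
      ultimately show ?thesis by (auto simp: filterlim_at)
    qed
    show "(\<lambda>n. (f (u n) y - f x y) / (u n - x)) \<longlonglongrightarrow> f' x y" if "y \<in> space M" for y
      using filterlim_compose[OF quot[OF that] u] by simp
    have uS: "u n \<in> S" for n
      using d(1) by (intro subsetD[OF d(2)]) (auto simp: u_def dist_real_def field_simps intro!: add_strict_increasing)
    show "(\<lambda>y. (f (u n) y - f x y) / (u n - x)) \<in> borel_measurable M" for n
      using int[OF uS[of n]] int[OF S(2)] by measurable
  qed
  show i: "integrable M (f' x)"
    by (rule Bochner_Integration.integrable_bound[OF g meas])
      (use bound[OF S(2)] in \<open>auto intro!: AE_I2 intro: order_trans[OF _ abs_ge_self]\<close>)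
  have "((\<lambda>z. \<integral>y. (f z y - f x y) / (z - x) \<partial>M) \<longlongrightarrow> (\<integral>y. f' x y \<partial>M)) (at x)"
  proof (subst tendsto_at_iff_sequentially, intro allI impI)
    fix X :: "nat \<Rightarrow> real"
    assume X: "\<forall>i. X i \<in> UNIV - {x}" "X \<longlonglongrightarrow> x"
    then have lim: "filterlim X (at x) sequentially" by (auto simp: filterlim_at)
    have "eventually (\<lambda>i. X i \<in> S) sequentially"
      using X(2) S by (auto simp: tendsto_def)
    \<comment> \<open>Dominated convergence asks for the bound at every index, so the sequence is
      shifted until it stays in \<open>S\<close>.\<close>
    then obtain n0 where n0: "\<And>n. n \<ge> n0 \<Longrightarrow> X n \<in> S" by (auto simp: eventually_sequentially)
    have "(\<lambda>n. \<integral>y. (f (X (n + n0)) y - f x y) / (X (n + n0) - x) \<partial>M) \<longlonglongrightarrow> (\<integral>y. f' x y \<partial>M)"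
    proof (rule integral_dominated_convergence[OF meas _ g])
      show "(\<lambda>y. (f (X (n + n0)) y - f x y) / (X (n + n0) - x)) \<in> borel_measurable M" for n
        using int[OF n0[of "n + n0"]] int[OF S(2)] by measurable
      show "AE y in M. (\<lambda>n. (f (X (n + n0)) y - f x y) / (X (n + n0) - x)) \<longlonglongrightarrow> f' x y"
        using filterlim_compose[OF quot lim] by (intro AE_I2 LIMSEQ_ignore_initial_segment) simp
      show "AE y in M. norm ((f (X (n + n0)) y - f x y) / (X (n + n0) - x)) \<le> g y" for n
      proof (rule AE_I2)
        fix y assume y: "y \<in> space M"
        have "norm (f (X (n + n0)) y - f x y) \<le> g y * norm (X (n + n0) - x)"
          by (rule field_differentiable_bound[OF S(3), where f' = "\<lambda>z. f' z y"])
            (use n0 S(2) y bound in \<open>auto intro: has_field_derivative_at_within der\<close>)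
        then show "norm ((f (X (n + n0)) y - f x y) / (X (n + n0) - x)) \<le> g y"
          using X(1) by (auto simp: divide_simps)
      qed
    qed
    then show "((\<lambda>z. \<integral>y. (f z y - f x y) / (z - x) \<partial>M) \<circ> X) \<longlonglongrightarrow> (\<integral>y. f' x y \<partial>M)"
      unfolding o_def by (rule LIMSEQ_offset)
  qed
  moreover have "eventually (\<lambda>z. (\<integral>y. (f z y - f x y) / (z - x) \<partial>M) =
      ((\<integral>y. f z y \<partial>M) - (\<integral>y. f x y \<partial>M)) / (z - x)) (at x)"
    unfolding eventually_at_topological using S int
    by (intro exI[of _ S]) (simp add: Bochner_Integration.integral_diff)
  ultimately show "((\<lambda>z. \<integral>y. f z y \<partial>M) has_real_derivative (\<integral>y. f' x y \<partial>M)) (at x)"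
    unfolding has_field_derivative_iff by (rule Lim_transform_eventually)
  show "\<bar>\<integral>y. f' x y \<partial>M\<bar> \<le> (\<integral>y. g y \<partial>M)"
    by (rule order_trans[OF integral_abs_bound integral_mono_AE])
      (use i g bound[OF S(2)] in auto)
qed

subsection \<open>Subordination\<close>

text \<open>\<open>E\<close> is \<open>sqrt pi / 2\<close> times the error function. The limit at
  \<open>at_top\<close> is half the Gaussian integral; the one at \<open>at_bot\<close> follows
  because \<open>E z + E (- z)\<close> has derivative zero.\<close>

lemma ex_gauss_antiderivative:
  obtains E :: "real \<Rightarrow> real" where
    "\<And>z. (E has_real_derivative exp (- z\<^sup>2)) (at z)"
    "E 0 = 0" "(E \<longlongrightarrow> sqrt pi / 2) at_top" "(E \<longlongrightarrow> - (sqrt pi / 2)) at_bot"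
proof
  define E :: "real \<Rightarrow> real" where "E z = (LBINT s=ereal 0..ereal z. exp (- s\<^sup>2))" for z
  show der: "(E has_real_derivative exp (- z\<^sup>2)) (at z)" for z
  proof -
    have "((\<lambda>u. LBINT s=ereal 0..ereal u. exp (- s\<^sup>2)) has_vector_derivative exp (- z\<^sup>2))
        (at z within {- \<bar>z\<bar> - 1..\<bar>z\<bar> + 1})"
      by (rule interval_integral_FTC2) (auto intro!: continuous_intros)
    moreover have "at z within {- \<bar>z\<bar> - 1..\<bar>z\<bar> + 1} = at z"
      by (rule at_within_interior) auto
    ultimately show ?thesis
      unfolding E_def[abs_def] has_real_derivative_iff_has_vector_derivative by (simp only:)
  qed
  show zero: "E 0 = 0" unfolding E_def by (rule interval_integral_endpoints_same)
  define f :: "real \<Rightarrow> real" where "f s = indicator {0..} s *\<^sub>R exp (- s\<^sup>2)" for s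
  have "((\<lambda>z. LBINT s. indicator {..z} s *\<^sub>R f s) \<longlongrightarrow> (LBINT s. f s)) at_top"
    using gaussian_moment_0 by (intro tendsto_integral_at_top) (auto simp: has_bochner_integral_iff f_def)
  moreover have "(LBINT s. indicator {..z} s *\<^sub>R f s) = (LBINT s::real:{0..z}. exp (- s\<^sup>2))" for z
    unfolding set_lebesgue_integral_def
    by (intro Bochner_Integration.integral_cong) (auto simp: f_def split: split_indicator)
  moreover have "(LBINT s. f s) = (LBINT s::real:{0..}. exp (- s\<^sup>2))"
    unfolding set_lebesgue_integral_def f_def ..
  ultimately have a1: "((\<lambda>z. LBINT s::real:{0..z}. exp (- s\<^sup>2)) \<longlongrightarrow> (LBINT s::real:{0..}. exp (- s\<^sup>2))) at_top"
    by (simp only:)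
  have a2: "(LBINT s::real:{0..}. exp (- s\<^sup>2)) = sqrt pi / 2"
    using gaussian_moment_0 by (simp add: set_lebesgue_integral_def has_bochner_integral_iff)
  have a3: "eventually (\<lambda>z. (LBINT s::real:{0..z}. exp (- s\<^sup>2)) = E z) at_top"
    using eventually_ge_at_top[of 0]
    by eventually_elim (simp only: E_def interval_integral_Icc)
  show lim: "(E \<longlongrightarrow> sqrt pi / 2) at_top"
    using Lim_transform_eventually[OF a1 a3] unfolding a2 .
  have odd: "E (- z) = - E z" for z
  proof -
    have "((\<lambda>z. E z + E (- z)) has_real_derivative 0) (at w)" for w
    proof -
      have m: "((\<lambda>x. E (- x)) has_real_derivative exp (- (- w)\<^sup>2) * (- 1)) (at w)"
        by (rule DERIV_chain2[where f = E and g = uminus, OF der]) (auto intro!: derivative_eq_intros)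
      show ?thesis by (rule DERIV_cong[OF DERIV_add[OF der m]]) simp
    qed
    then have "E z + E (- z) = E 0 + E (- 0)" by (intro DERIV_isconst_all allI)
    then show ?thesis by (simp add: zero)
  qed
  show "(E \<longlongrightarrow> - (sqrt pi / 2)) at_bot"
    unfolding filterlim_at_bot_mirror odd by (intro tendsto_intros lim)
qed

text \<open>With \<open>E\<close> an antiderivative of \<open>exp (- z\<^sup>2)\<close>, an antiderivative of the integrand is
  \<open>exp (2 * c) * E (sqrt u + c / sqrt u) + exp (- 2 * c) * E (sqrt u - c / sqrt u)\<close>.\<close>

lemma subordination_integral:
  assumes c: "0 \<le> c"
  shows "set_integrable lborel {0<..} (\<lambda>u. exp (- u) / sqrt u * exp (- (c\<^sup>2 / u)))" (is ?A)
    and "(LBINT u:{0<..}. exp (- u) / sqrt u * exp (- (c\<^sup>2 / u))) = sqrt pi * exp (- (2 * c))" (is ?B)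
proof -
  obtain E :: "real \<Rightarrow> real" where E: "\<And>z. (E has_real_derivative exp (- z\<^sup>2)) (at z)"
    and E0: "E 0 = 0" and Elim: "(E \<longlongrightarrow> sqrt pi / 2) at_top" "(E \<longlongrightarrow> - (sqrt pi / 2)) at_bot"
    by (rule ex_gauss_antiderivative) (rule that)
  define f where "f u = exp (- u) / sqrt u * exp (- (c\<^sup>2 / u))" for u :: real
  define F where "F u = exp (2 * c) * E (sqrt u + c / sqrt u) + exp (- (2 * c)) * E (sqrt u - c / sqrt u)" for u
  have sq: "(sqrt u + c / sqrt u)\<^sup>2 = u + 2 * c + c\<^sup>2 / u" "(sqrt u - c / sqrt u)\<^sup>2 = u - 2 * c + c\<^sup>2 / u"
    if "0 < u" for u
    using that by (auto simp: power2_sum power2_diff power_divide)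
  have dF: "DERIV F u :> f u" if u: "0 < u" for u
  proof -
    have d0: "((\<lambda>u. sqrt u + k / sqrt u) has_real_derivative 1 / (2 * sqrt u) - k / (2 * u * sqrt u)) (at u)" for k
    proof -
      have "(sqrt has_real_derivative inverse (sqrt u) / 2) (at u)"
        by (rule DERIV_real_sqrt[OF u])
      moreover from DERIV_divide[OF DERIV_const[of k] this]
      have "((\<lambda>u. k / sqrt u) has_real_derivative - (k / (2 * u * sqrt u))) (at u)"
        using u by (simp add: inverse_eq_divide mult.commute mult.left_commute)
      ultimately show ?thesis
        by (rule DERIV_cong[OF DERIV_add]) (simp add: inverse_eq_divide)
    qed
    note d1 = DERIV_chain2[where f = E and g = "\<lambda>u. sqrt u + c / sqrt u", OF E(1) d0]
    note d2 = DERIV_chain2[where f = E and g = "\<lambda>u. sqrt u + - c / sqrt u", OF E(1) d0]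
    \<comment> \<open>The square of \<open>sqrt u + c / sqrt u\<close> or
      \<open>sqrt u - c / sqrt u\<close> has cross term \<open>2 * c\<close> or
      \<open>- 2 * c\<close>, which the exponential prefactor cancels. Both summands of
      \<open>F'\<close> then carry the same exponential and the terms with
      \<open>c / (2 * u * sqrt u)\<close> annihilate each other.\<close>
    have e1: "exp (2 * c) * exp (- (sqrt u + c / sqrt u)\<^sup>2) = exp (- u) * exp (- (c\<^sup>2 / u))"
      and e2: "exp (- (2 * c)) * exp (- (sqrt u - c / sqrt u)\<^sup>2) = exp (- u) * exp (- (c\<^sup>2 / u))"
      using u by (simp_all add: sq mult_exp_exp)
    have "(F has_real_derivative
      exp (2 * c) * (exp (- (sqrt u + c / sqrt u)\<^sup>2) * (1 / (2 * sqrt u) - c / (2 * u * sqrt u))) +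
      exp (- (2 * c)) * (exp (- (sqrt u - c / sqrt u)\<^sup>2) * (1 / (2 * sqrt u) + c / (2 * u * sqrt u)))) (at u)"
      using DERIV_add[OF DERIV_cmult[OF d1] DERIV_cmult[OF d2], of "exp (2 * c)" "exp (- (2 * c))"]
      by (simp add: F_def[abs_def])
    also have "exp (2 * c) * (exp (- (sqrt u + c / sqrt u)\<^sup>2) * (1 / (2 * sqrt u) - c / (2 * u * sqrt u))) +
      exp (- (2 * c)) * (exp (- (sqrt u - c / sqrt u)\<^sup>2) * (1 / (2 * sqrt u) + c / (2 * u * sqrt u)))
      = f u"
      unfolding mult.assoc[symmetric] e1 e2 right_diff_distrib distrib_left using u by (simp add: f_def)
    finally show ?thesis .
  qed
  have top: "(F \<longlongrightarrow> exp (2 * c) * (sqrt pi / 2) + exp (- (2 * c)) * (sqrt pi / 2)) at_top"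
  proof -
    have a: "((\<lambda>u. c / sqrt u) \<longlongrightarrow> 0) at_top" for c
      by (intro tendsto_divide_0[OF tendsto_const] filterlim_at_top_imp_at_infinity sqrt_at_top)
    have "filterlim (\<lambda>u. c / sqrt u + sqrt u) at_top at_top"
      "filterlim (\<lambda>u. - c / sqrt u + sqrt u) at_top at_top"
      by (intro filterlim_tendsto_add_at_top[OF a] sqrt_at_top)+
    then show ?thesis
      unfolding F_def by (intro tendsto_intros filterlim_compose[OF Elim(1)]) (simp_all add: add.commute)
  qed
  \<comment> \<open>For \<open>c > 0\<close> the two arguments of \<open>E\<close> tend to plus and
    minus infinity at \<open>0\<close>; for \<open>c = 0\<close> both tend to \<open>0\<close>,
    where \<open>E\<close> vanishes, and the stated limit is also \<open>0\<close>.\<close>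
  have bot: "(F \<longlongrightarrow> exp (2 * c) * (sqrt pi / 2) - exp (- (2 * c)) * (sqrt pi / 2)) (at_right 0)"
  proof (cases "c = 0")
    case True
    have "((\<lambda>u. E (sqrt u)) \<longlongrightarrow> E 0) (at_right 0)"
      by (rule tendsto_compose[OF DERIV_isCont[OF E(1), unfolded isCont_def]]) real_asymp
    have "F = (\<lambda>u. 2 * E (sqrt u))" using True by (simp add: F_def fun_eq_iff)
    then show ?thesis
      using E0 \<open>((\<lambda>u. E (sqrt u)) \<longlongrightarrow> E 0) (at_right 0)\<close> True by (auto intro!: tendsto_eq_intros)
  next
    case False
    then have c': "0 < c" using c by simp
    have s: "(sqrt \<longlongrightarrow> 0) (at_right 0)" by real_asymp
    have "filterlim (\<lambda>u. 1 / sqrt u) at_top (at_right 0)" by real_asymp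
    then have i: "filterlim (\<lambda>u. c * (1 / sqrt u)) at_top (at_right 0)"
      by (rule filterlim_tendsto_pos_mult_at_top[OF tendsto_const c'])
    have b: "filterlim (\<lambda>u. sqrt u + c / sqrt u) at_top (at_right 0)"
      "filterlim (\<lambda>u. sqrt u - c / sqrt u) at_bot (at_right 0)"
      using filterlim_tendsto_add_at_top[OF s i]
        filterlim_tendsto_add_at_top[OF tendsto_minus[OF s] i]
      by (simp_all add: filterlim_uminus_at_bot)
    have "(F \<longlongrightarrow> exp (2 * c) * (sqrt pi / 2) + exp (- (2 * c)) * (- (sqrt pi / 2))) (at_right 0)"
      unfolding F_def
      by (intro tendsto_intros filterlim_compose[OF Elim(1) b(1)] filterlim_compose[OF Elim(2) b(2)])
    then show ?thesis by simp
  qed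
  have ein: "einterval 0 \<infinity> = {0<..}" by (auto simp: einterval_def)
  have lims: "((F \<circ> real_of_ereal) \<longlongrightarrow> exp (2 * c) * (sqrt pi / 2) - exp (- (2 * c)) * (sqrt pi / 2)) (at_right 0)"
    "((F \<circ> real_of_ereal) \<longlongrightarrow> exp (2 * c) * (sqrt pi / 2) + exp (- (2 * c)) * (sqrt pi / 2)) (at_left \<infinity>)"
    unfolding zero_ereal_def ereal_tendsto_simps by (fact bot, fact top)
  have isC: "isCont f u" if "0 < u" for u
    using that unfolding f_def by (auto intro!: continuous_intros)
  have nn: "AE x in lborel. 0 < ereal x \<longrightarrow> ereal x < \<infinity> \<longrightarrow> 0 \<le> f x"
    by (auto simp: f_def)
  have "set_integrable lborel (einterval 0 \<infinity>) f"
    by (rule interval_integral_FTC_nonneg(1)[OF _ _ _ nn lims]) (use dF isC in auto)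
  then show ?A by (simp add: ein f_def[abs_def])
  have "(LBINT x=0..\<infinity>. f x) = exp (2 * c) * (sqrt pi / 2) + exp (- (2 * c)) * (sqrt pi / 2) -
     (exp (2 * c) * (sqrt pi / 2) - exp (- (2 * c)) * (sqrt pi / 2))"
    by (rule interval_integral_FTC_nonneg(2)[OF _ _ _ nn lims]) (use dF isC in auto)
  then show ?B
    by (simp add: interval_lebesgue_integral_def ein f_def[abs_def])
qed

text \<open>With \<open>c = t * sqrt lam / 2\<close> one has
  \<open>c\<^sup>2 / u = lam * (t\<^sup>2 / (4 * u))\<close>. This is how the heat multiplier
  \<open>exp (- lam * s)\<close> becomes the Poisson multiplier
  \<open>exp (- t * sqrt lam)\<close>.\<close>

lemma subordinated_exp:
  assumes t: "0 < t" and l: "0 \<le> lam"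
  shows "set_integrable lborel {0<..} (\<lambda>u. exp (- u) / sqrt u * exp (- lam * (t\<^sup>2 / (4 * u))))"
    and "1 / sqrt pi * (LBINT u:{0<..}. exp (- u) / sqrt u * exp (- lam * (t\<^sup>2 / (4 * u)))) = exp (- t * sqrt lam)"
proof -
  define c where "c = t * sqrt lam / 2"
  have c: "0 \<le> c" using t l by (simp add: c_def)
  have eq: "- lam * (t\<^sup>2 / (4 * u)) = - (c\<^sup>2 / u)" for u :: real
    using l by (simp add: c_def power_divide power_mult_distrib)
  show "set_integrable lborel {0<..} (\<lambda>u. exp (- u) / sqrt u * exp (- lam * (t\<^sup>2 / (4 * u))))"
    using subordination_integral(1)[OF c] by (simp only: eq)
  show "1 / sqrt pi * (LBINT u:{0<..}. exp (- u) / sqrt u * exp (- lam * (t\<^sup>2 / (4 * u)))) = exp (- t * sqrt lam)"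
    unfolding eq subordination_integral(2)[OF c] by (simp add: c_def mult.commute)
qed

lemma power_le_fact_exp:
  fixes y :: real
  assumes "0 \<le> y"
  shows "y ^ N \<le> fact N * exp y"
proof -
  have "(\<Sum>n\<in>{N}. y ^ n /\<^sub>R fact n) \<le> (\<Sum>n. y ^ n /\<^sub>R fact n)"
    by (rule sum_le_suminf[OF summable_exp_generic]) (use assms in auto)
  then show ?thesis by (simp add: exp_def field_simps)
qed

text \<open>A dilation by \<open>a\<close> of the subordination integrand at
  \<open>c = 0\<close>.\<close>

lemma integrable_exp_over_sqrt:
  assumes a: "0 < a"
  shows "set_integrable lborel {0<..} (\<lambda>v::real. exp (- a * v) / sqrt v)"
proof -
  have "integrable lborel (\<lambda>u. indicator {0<..} u *\<^sub>R (exp (- u) / sqrt u) :: real)"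
    using subordination_integral(1)[of 0] by (simp add: set_integrable_def)
  then have "integrable lborel (\<lambda>v. indicator {0<..} (0 + a * v) *\<^sub>R (exp (- (0 + a * v)) / sqrt (0 + a * v)) :: real)"
    by (rule lborel_integrable_real_affine) (use a in simp)
  then have "integrable lborel (\<lambda>v. sqrt a * (indicator {0<..} (0 + a * v) *\<^sub>R (exp (- (0 + a * v)) / sqrt (0 + a * v))) :: real)"
    by (rule integrable_mult_right)
  moreover have "sqrt a * (indicator {0<..} (0 + a * v) *\<^sub>R (exp (- (0 + a * v)) / sqrt (0 + a * v))) =
     indicator {0<..} v *\<^sub>R (exp (- a * v) / sqrt v)" for v :: real
    using a by (auto simp: indicator_def zero_less_mult_iff real_sqrt_mult)
  ultimately show ?thesis by (simp only: set_integrable_def)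
qed

lemma integrable_exp_power_over_sqrt:
  assumes a: "0 < a" and b: "0 \<le> b"
  shows "set_integrable lborel {0<..} (\<lambda>v::real. exp (- a * v) / sqrt v * (1 + b * v) ^ N)"
proof (rule set_integrable_bound)
  \<comment> \<open>Chosen so that \<open>e * b \<le> a / 2\<close>: half of the exponential decay
    pays for the polynomial factor. The summand 1 in the denominator covers
    \<open>b = 0\<close>.\<close>
  define e where "e = a / (2 * (b + 1))"
  have e: "0 < e" "e * b \<le> a / 2" using a b by (auto simp: e_def field_simps)
  show "set_integrable lborel {0<..} (\<lambda>v. fact N / e ^ N * exp e * (exp (- (a / 2) * v) / sqrt v))"
    by (rule set_integrable_mult_right) (rule integrable_exp_over_sqrt, use a in simp)
  show "set_borel_measurable lborel {0<..} (\<lambda>v. exp (- a * v) / sqrt v * (1 + b * v) ^ N)"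
    unfolding set_borel_measurable_def by measurable
  show "AE v in lborel. v \<in> {0<..} \<longrightarrow> norm (exp (- a * v) / sqrt v * (1 + b * v) ^ N)
      \<le> norm (fact N / e ^ N * exp e * (exp (- (a / 2) * v) / sqrt v))"
  proof (intro AE_I2 impI)
    fix v :: real assume v: "v \<in> {0<..}"
    have "(e * (1 + b * v)) ^ N \<le> fact N * exp (e * (1 + b * v))"
      using e b v by (intro power_le_fact_exp) auto
    also have "exp (e * (1 + b * v)) \<le> exp (e + a / 2 * v)"
      using mult_right_mono[OF e(2), of v] v by (simp add: algebra_simps)
    finally have "(1 + b * v) ^ N * e ^ N \<le> fact N * exp (e + a / 2 * v)"
      by (simp only: power_mult_distrib mult.commute) simp
    then have *: "(1 + b * v) ^ N \<le> fact N / e ^ N * exp (e + a / 2 * v)"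
      using e(1) by (simp add: pos_le_divide_eq)
    have "exp (- a * v) / sqrt v * (1 + b * v) ^ N \<le> exp (- a * v) / sqrt v * (fact N / e ^ N * exp (e + a / 2 * v))"
      using v by (intro mult_left_mono *) auto
    also have "\<dots> = fact N / e ^ N * exp e * (exp (- (a / 2) * v) / sqrt v)"
    proof -
      have "exp (- a * v) * exp (e + a / 2 * v) = exp e * exp (- (a / 2) * v)"
        unfolding mult_exp_exp by (rule arg_cong[of _ _ exp]) (simp add: field_simps)
      then show ?thesis by (simp add: mult_ac)
    qed
    finally show "norm (exp (- a * v) / sqrt v * (1 + b * v) ^ N) \<le> norm (fact N / e ^ N * exp e * (exp (- (a / 2) * v) / sqrt v))"
      using v e b by (simp add: abs_mult)
  qed
qed

section \<open>Derivatives of subordination integrals in time and in a parameter\<close>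

text \<open>The subordination integral of a scalar function of time. The function \<open>f\<close>
  and the point \<open>x\<close> enter later estimates only through bounds on
  \<open>\<tau>\<close>.\<close>

definition subord :: "(real \<Rightarrow> real) \<Rightarrow> real \<Rightarrow> real"
  where "subord \<tau> t = 1 / sqrt pi * (LBINT u:{0<..}. exp (- u) / sqrt u * \<tau> (t\<^sup>2 / (4 * u)))"

text \<open>At \<open>s = t\<^sup>2 / (4 * u)\<close> the factor \<open>1 + 1 / s\<close> is
  \<open>1 + 4 / t\<^sup>2 * u\<close>, so growth of \<open>\<tau>\<close> at small times becomes
  polynomial growth in \<open>u\<close>, which \<open>exp (- u)\<close> absorbs.\<close>

lemma subord_integrable:
  assumes t: "0 < t" and [measurable]: "\<tau> \<in> borel_measurable borel"
    and b: "\<And>s. 0 < s \<Longrightarrow> \<bar>\<tau> s\<bar> \<le> A * (1 + 1 / s) ^ N"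
  shows "set_integrable lborel {0<..} (\<lambda>u. exp (- u) / sqrt u * \<tau> (t\<^sup>2 / (4 * u)))"
proof (rule set_integrable_bound)
  show "set_integrable lborel {0<..} (\<lambda>u. A * (exp (- 1 * u) / sqrt u * (1 + 4 / t\<^sup>2 * u) ^ N))"
    by (intro set_integrable_mult_right integrable_exp_power_over_sqrt) auto
  show "set_borel_measurable lborel {0<..} (\<lambda>u. exp (- u) / sqrt u * \<tau> (t\<^sup>2 / (4 * u)))"
    unfolding set_borel_measurable_def by measurable
  show "AE u in lborel. u \<in> {0<..} \<longrightarrow> norm (exp (- u) / sqrt u * \<tau> (t\<^sup>2 / (4 * u)))
      \<le> norm (A * (exp (- 1 * u) / sqrt u * (1 + 4 / t\<^sup>2 * u) ^ N))"
  proof (intro AE_I2 impI)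
    fix u :: real assume u: "u \<in> {0<..}"
    have "\<bar>\<tau> (t\<^sup>2 / (4 * u))\<bar> \<le> A * (1 + 4 / t\<^sup>2 * u) ^ N"
      using b[of "t\<^sup>2 / (4 * u)"] t u by (simp add: mult.commute)
    then have "exp (- u) / sqrt u * \<bar>\<tau> (t\<^sup>2 / (4 * u))\<bar> \<le> exp (- u) / sqrt u * (A * (1 + 4 / t\<^sup>2 * u) ^ N)"
      using u by (intro mult_left_mono) auto
    also have "\<dots> = A * (exp (- 1 * u) / sqrt u * (1 + 4 / t\<^sup>2 * u) ^ N)" by simp
    finally show "norm (exp (- u) / sqrt u * \<tau> (t\<^sup>2 / (4 * u))) \<le> norm (A * (exp (- 1 * u) / sqrt u * (1 + 4 / t\<^sup>2 * u) ^ N))"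
      using u by (intro order_trans[OF _ abs_ge_self[of "A * (exp (- 1 * u) / sqrt u * (1 + 4 / t\<^sup>2 * u) ^ N)", folded real_norm_def]])
        (simp add: abs_mult)
  qed
qed

text \<open>The substitution \<open>u = t\<^sup>2 v\<close> moves \<open>t\<close> into the smooth factor.\<close>

lemma subord_eq:
  assumes t: "0 < t"
  shows "subord \<tau> t = t / sqrt pi * (LBINT v:{0<..}. exp (- t\<^sup>2 * v) / sqrt v * \<tau> (1 / (4 * v)))"
proof -
  have "(LBINT u:{0<..}. exp (- u) / sqrt u * \<tau> (t\<^sup>2 / (4 * u))) =
    \<bar>t\<^sup>2\<bar> *\<^sub>R (LBINT v. indicator {0<..} (0 + t\<^sup>2 * v) *\<^sub>R
      (exp (- (0 + t\<^sup>2 * v)) / sqrt (0 + t\<^sup>2 * v) * \<tau> (t\<^sup>2 / (4 * (0 + t\<^sup>2 * v)))))"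
    unfolding set_lebesgue_integral_def by (rule lborel_integral_real_affine) (use t in simp)
  also have "(LBINT v. indicator {0<..} (0 + t\<^sup>2 * v) *\<^sub>R
      (exp (- (0 + t\<^sup>2 * v)) / sqrt (0 + t\<^sup>2 * v) * \<tau> (t\<^sup>2 / (4 * (0 + t\<^sup>2 * v))))) =
    (LBINT v. 1 / t * (indicator {0<..} v *\<^sub>R (exp (- t\<^sup>2 * v) / sqrt v * \<tau> (1 / (4 * v)))))"
    using t by (intro Bochner_Integration.integral_cong)
      (auto simp: indicator_def zero_less_mult_iff real_sqrt_mult)
  also have "\<dots> = 1 / t * (LBINT v:{0<..}. exp (- t\<^sup>2 * v) / sqrt v * \<tau> (1 / (4 * v)))"
    unfolding set_lebesgue_integral_def by (rule integral_mult_right_zero)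
  finally show ?thesis using t by (simp add: subord_def power2_eq_square)
qed

text \<open>The order of quantifiers is the point: \<open>c\<close> depends on \<open>t\<close> and
  \<open>N\<close> only and the bound is linear in \<open>A\<close>, so it will become continuity in
  \<open>f\<close>. After \<open>subord_eq\<close> the time sits in
  \<open>exp (- t\<^sup>2 * v)\<close> and a prefactor; differentiating the exponential costs one
  factor \<open>v\<close>, absorbed by raising \<open>N\<close> to \<open>Suc N\<close>.\<close>

lemma subord_derivative_bound:
  assumes t: "0 < t"
  shows "\<exists>c\<ge>0. \<forall>\<tau> A. \<tau> \<in> borel_measurable borel \<longrightarrow> 0 \<le> A \<longrightarrow>
    (\<forall>s>0. \<bar>\<tau> s\<bar> \<le> A * (1 + 1 / s) ^ N) \<longrightarrow>
    (\<exists>D. (subord \<tau> has_real_derivative D) (at t) \<and> \<bar>D\<bar> \<le> A * c)"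
proof -
  \<comment> \<open>A common majorant for all times \<open>z\<close> between \<open>t / 2\<close>
    and \<open>2 * t\<close>, where \<open>z\<^sup>2 \<ge> t\<^sup>2 / 4\<close>.\<close>
  define g where "g v = indicator {0<..} v *\<^sub>R (exp (- (t\<^sup>2 / 4) * v) / sqrt v * (1 + 4 * v) ^ Suc N)" for v :: real
  have g: "integrable lborel g"
    unfolding g_def set_integrable_def[symmetric] by (intro integrable_exp_power_over_sqrt) (use t in auto)
  have g0: "0 \<le> g v" for v by (auto simp: g_def indicator_def)
  define G where "G = (LBINT v. g v)"
  have G: "0 \<le> G" unfolding G_def by (intro integral_nonneg_AE AE_I2 g0)
  \<comment> \<open>Product rule: the first summand comes from the prefactor
    \<open>z / sqrt pi\<close>, the second from the integral, whose derivative is at most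
    \<open>A * t * G\<close>.\<close>
  define c where "c = G / sqrt pi + t / sqrt pi * (t * G)"
  show ?thesis
  proof (rule exI[of _ c], intro conjI allI impI)
    show "0 \<le> c" using G t by (simp add: c_def)
    fix \<tau> :: "real \<Rightarrow> real" and A :: real
    assume [measurable]: "\<tau> \<in> borel_measurable borel" and A: "0 \<le> A"
      and b: "\<forall>s>0. \<bar>\<tau> s\<bar> \<le> A * (1 + 1 / s) ^ N"
    define S where "S = {t/2<..<2*t}"
    have S: "open S" "t \<in> S" "convex S" using t by (auto simp: S_def)
    define k where "k v = indicator {0<..} v / sqrt v * \<tau> (1 / (4 * v))" for v :: real
    define h where "h z v = exp (- z\<^sup>2 * v) * k v" for z v :: real
    define h' where "h' z v = exp (- z\<^sup>2 * v) * (- 2 * z * v) * k v" for z v :: real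
    have [measurable]: "h z \<in> borel_measurable borel" for z
      unfolding h_def k_def by measurable
    have main: "\<bar>exp (- z\<^sup>2 * v) / sqrt v * \<tau> (1 / (4 * v))\<bar> \<le> A * (exp (- (t\<^sup>2 / 4) * v) / sqrt v * (1 + 4 * v) ^ N)"
      if "z \<in> S" "0 < v" for z v
    proof -
      have "(t / 2)\<^sup>2 \<le> z\<^sup>2" using that t by (intro power_mono) (auto simp: S_def)
      then have "exp (- z\<^sup>2 * v) \<le> exp (- (t\<^sup>2 / 4) * v)"
        using that(2) by (simp add: power_divide)
      moreover have "\<bar>\<tau> (1 / (4 * v))\<bar> \<le> A * (1 + 4 * v) ^ N"
        using b[rule_format, of "1 / (4 * v)"] that by simp
      ultimately have "exp (- z\<^sup>2 * v) / sqrt v * \<bar>\<tau> (1 / (4 * v))\<bar> \<le> exp (- (t\<^sup>2 / 4) * v) / sqrt v * (A * (1 + 4 * v) ^ N)"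
        using that by (intro mult_mono divide_right_mono) auto
      then show ?thesis using that by (simp add: abs_mult mult_ac)
    qed
    have pw: "(1 + 4 * v) ^ N \<le> (1 + 4 * v) ^ Suc N" "v * (1 + 4 * v) ^ N \<le> (1 + 4 * v) ^ Suc N / 4" if "0 < v" for v :: real
      using that by (auto simp: mult_right_mono algebra_simps)
    have hb: "\<bar>h z v\<bar> \<le> A * g v" if z: "z \<in> S" for z v
    proof (cases "0 < v")
      case True
      have "\<bar>h z v\<bar> \<le> A * (exp (- (t\<^sup>2 / 4) * v) / sqrt v * (1 + 4 * v) ^ N)"
        using main[OF z True] True by (simp add: h_def k_def)
      also have "\<dots> \<le> A * (exp (- (t\<^sup>2 / 4) * v) / sqrt v * (1 + 4 * v) ^ Suc N)"
        using True A pw(1)[OF True] by (intro mult_left_mono) auto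
      finally show ?thesis using True by (simp add: g_def)
    qed (simp add: h_def k_def g_def)
    have hb': "\<bar>h' z v\<bar> \<le> A * t * g v" if z: "z \<in> S" for z v
    proof (cases "0 < v")
      case True
      have z0: "0 < z" "z < 2 * t" using z t by (auto simp: S_def)
      have "\<bar>h' z v\<bar> = (2 * z * v) * \<bar>exp (- z\<^sup>2 * v) / sqrt v * \<tau> (1 / (4 * v))\<bar>"
        using True z0 by (simp add: h'_def k_def abs_mult)
      also have "\<dots> \<le> (4 * t * v) * (A * (exp (- (t\<^sup>2 / 4) * v) / sqrt v * (1 + 4 * v) ^ N))"
        using True z0 by (intro mult_mono[OF _ main[OF z True]]) auto
      also have "\<dots> = (4 * t) * (A * (exp (- (t\<^sup>2 / 4) * v) / sqrt v)) * (v * (1 + 4 * v) ^ N)"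
        by (simp add: mult_ac)
      also have "\<dots> \<le> (4 * t) * (A * (exp (- (t\<^sup>2 / 4) * v) / sqrt v)) * ((1 + 4 * v) ^ Suc N / 4)"
        using True t A by (intro mult_left_mono pw(2)) auto
      also have "\<dots> = A * t * g v" using True by (simp add: g_def)
      finally show ?thesis .
    qed (simp add: h'_def k_def g_def)
    have hi: "integrable lborel (h z)" if "z \<in> S" for z
      by (rule Bochner_Integration.integrable_bound[OF integrable_mult_right[OF g, of A]])
        (use hb[OF that] A g0 in \<open>auto simp: abs_mult\<close>)
    have der: "((\<lambda>z. h z v) has_real_derivative h' z v) (at z)" for z v
      unfolding h_def h'_def by (auto intro!: derivative_eq_intros)
    have gi: "integrable lborel (\<lambda>v. A * t * g v)" using g by simp
    note D = has_derivative_under_integral[OF S hi der hb' gi]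
    define I where "I = (LBINT v. h t v)"
    define I' where "I' = (LBINT v. h' t v)"
    have "((\<lambda>z. z / sqrt pi * (LBINT v. h z v)) has_real_derivative (1 / sqrt pi * I + t / sqrt pi * I')) (at t)"
      using DERIV_mult[OF DERIV_cdivide[OF DERIV_ident, of "sqrt pi"] D(1)]
      by (simp add: I_def I'_def algebra_simps)
    then have "(subord \<tau> has_real_derivative (1 / sqrt pi * I + t / sqrt pi * I')) (at t)"
    proof (rule has_field_derivative_transform_within_open[OF _ S(1,2)])
      fix z assume "z \<in> S"
      then have "0 < z" using t by (auto simp: S_def)
      then show "z / sqrt pi * (LBINT v. h z v) = subord \<tau> z"
        by (simp add: subord_eq h_def k_def set_lebesgue_integral_def mult_ac)
    qed
    moreover have I: "\<bar>I\<bar> \<le> A * G"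
    proof -
      have "\<bar>I\<bar> \<le> (LBINT v. A * g v)"
        unfolding I_def by (rule order_trans[OF integral_abs_bound integral_mono])
          (use hi[OF S(2)] hb[OF S(2)] g in auto)
      then show ?thesis by (simp add: G_def)
    qed
    moreover have I': "\<bar>I'\<bar> \<le> A * t * G"
      using D(3) by (simp add: I'_def G_def)
    moreover have "\<bar>1 / sqrt pi * I + t / sqrt pi * I'\<bar> \<le> A * c"
    proof -
      have "\<bar>1 / sqrt pi * I + t / sqrt pi * I'\<bar> \<le> 1 / sqrt pi * \<bar>I\<bar> + t / sqrt pi * \<bar>I'\<bar>"
        using t by (intro order_trans[OF abs_triangle_ineq]) (simp add: abs_mult)
      also have "\<dots> \<le> 1 / sqrt pi * (A * G) + t / sqrt pi * (A * t * G)"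
        using t I I' by (intro add_mono mult_left_mono) auto
      also have "\<dots> = A * c" by (simp add: c_def algebra_simps)
      finally show ?thesis .
    qed
    ultimately show "\<exists>D. (subord \<tau> has_real_derivative D) (at t) \<and> \<bar>D\<bar> \<le> A * c" by blast
  qed
qed

lemma subordinated_eq_subord: "subordinated T t f x = subord (\<lambda>s. T s f x) t"
  by (simp add: subordinated_def subord_def)

text \<open>The counterpart for the space variable. The parameter enters through
  \<open>\<tau>\<close> alone, so differentiation under the integral applies directly; again
  \<open>c\<close> depends only on \<open>t\<close> and \<open>N\<close>.\<close>

lemma subord_param_derivative_bound:
  assumes t: "0 < t"
  shows "\<exists>c\<ge>0. \<forall>\<tau> \<tau>' A S x. open S \<longrightarrow> convex S \<longrightarrow> x \<in> S \<longrightarrow>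
    (\<forall>z\<in>S. (\<lambda>s. \<tau> s z) \<in> borel_measurable borel) \<longrightarrow>
    (\<forall>z\<in>S. \<forall>s>0. ((\<lambda>z. \<tau> s z) has_real_derivative \<tau>' s z) (at z)) \<longrightarrow>
    (\<forall>z\<in>S. \<forall>s>0. \<bar>\<tau> s z\<bar> \<le> A * (1 + 1 / s) ^ N) \<longrightarrow>
    (\<forall>z\<in>S. \<forall>s>0. \<bar>\<tau>' s z\<bar> \<le> A * (1 + 1 / s) ^ N) \<longrightarrow>
    (\<exists>D. ((\<lambda>z. subord (\<lambda>s. \<tau> s z) t) has_real_derivative D) (at x) \<and> \<bar>D\<bar> \<le> A * c)"
proof -
  define g where "g u = indicator {0<..} u *\<^sub>R (exp (- 1 * u) / sqrt u * (1 + 4 / t\<^sup>2 * u) ^ N)" for u :: real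
  have g: "integrable lborel g"
    unfolding g_def set_integrable_def[symmetric] by (intro integrable_exp_power_over_sqrt) (use t in auto)
  have g0: "0 \<le> g v" for v by (auto simp: g_def indicator_def)
  define G where "G = (LBINT v. g v)"
  have G: "0 \<le> G" unfolding G_def by (intro integral_nonneg_AE AE_I2 g0)
  show ?thesis
  proof (rule exI[of _ "1 / sqrt pi * G"], intro conjI allI impI)
    show "0 \<le> 1 / sqrt pi * G" using G t by simp
    fix \<tau> \<tau>' :: "real \<Rightarrow> real \<Rightarrow> real" and A :: real and S :: "real set" and x
    assume S: "open S" "convex S" "x \<in> S"
      and m: "\<forall>z\<in>S. (\<lambda>s. \<tau> s z) \<in> borel_measurable borel"
      and d: "\<forall>z\<in>S. \<forall>s>0. ((\<lambda>z. \<tau> s z) has_real_derivative \<tau>' s z) (at z)"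
      and b: "\<forall>z\<in>S. \<forall>s>0. \<bar>\<tau> s z\<bar> \<le> A * (1 + 1 / s) ^ N"
      and b': "\<forall>z\<in>S. \<forall>s>0. \<bar>\<tau>' s z\<bar> \<le> A * (1 + 1 / s) ^ N"
    define h where "h z u = indicator {0<..} u *\<^sub>R (exp (- u) / sqrt u * \<tau> (t\<^sup>2 / (4 * u)) z)" for z u :: real
    define h' where "h' z u = indicator {0<..} u *\<^sub>R (exp (- u) / sqrt u * \<tau>' (t\<^sup>2 / (4 * u)) z)" for z u :: real
    have hi: "integrable lborel (h z)" if "z \<in> S" for z
      unfolding h_def set_integrable_def[symmetric]
      using m b that by (intro subord_integrable[OF t]) auto
    have der: "((\<lambda>z. h z u) has_real_derivative h' z u) (at z)" if "z \<in> S" for z u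
    proof (cases "0 < u")
      case True
      then have "((\<lambda>z. \<tau> (t\<^sup>2 / (4 * u)) z) has_real_derivative \<tau>' (t\<^sup>2 / (4 * u)) z) (at z)"
        using d that t by simp
      from DERIV_cmult[OF this, of "exp (- u) / sqrt u"] show ?thesis using True by (simp add: h_def h'_def)
    qed (simp add: h_def h'_def)
    have hb': "\<bar>h' z u\<bar> \<le> A * g u" if "z \<in> S" for z u
    proof (cases "0 < u")
      case True
      have "\<bar>\<tau>' (t\<^sup>2 / (4 * u)) z\<bar> \<le> A * (1 + 4 / t\<^sup>2 * u) ^ N"
        using b'[rule_format, OF that, of "t\<^sup>2 / (4 * u)"] t True by (simp add: mult.commute)
      then have "exp (- u) / sqrt u * \<bar>\<tau>' (t\<^sup>2 / (4 * u)) z\<bar> \<le> exp (- u) / sqrt u * (A * (1 + 4 / t\<^sup>2 * u) ^ N)"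
        using True by (intro mult_left_mono) auto
      then show ?thesis using True by (simp add: h'_def g_def abs_mult mult_ac)
    qed (simp add: h'_def g_def)
    have gi: "integrable lborel (\<lambda>v. A * g v)" using g by simp
    note D = has_derivative_under_integral[OF S(1,3,2) hi der hb' gi]
    have "((\<lambda>z. subord (\<lambda>s. \<tau> s z) t) has_real_derivative 1 / sqrt pi * (LBINT v. h' x v)) (at x)"
      using DERIV_cmult[OF D(1), of "1 / sqrt pi"] by (simp add: subord_def h_def set_lebesgue_integral_def)
    moreover have "\<bar>1 / sqrt pi * (LBINT v. h' x v)\<bar> \<le> A * (1 / sqrt pi * G)"
      using D(3) by (simp add: G_def abs_mult divide_right_mono)
    ultimately show "\<exists>D. ((\<lambda>z. subord (\<lambda>s. \<tau> s z) t) has_real_derivative D) (at x) \<and> \<bar>D\<bar> \<le> A * (1 / sqrt pi * G)"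
      by blast
  qed
qed

subsection \<open>Semigroups with smooth kernels\<close>

text \<open>What the Poisson integral needs from a heat kernel, shared by the Gaussian and the
  Laguerre case. The bounds are local in \<open>x\<close>, uniform over \<open>space M\<close> in
  \<open>y\<close>, so that the norm of \<open>f\<close> in L^1 controls everything, and at most
  polynomial in \<open>1 / s\<close>, which subordination tolerates.\<close>

locale kernel_semigroup = finite_measure M for M :: "real measure" +
  fixes S :: "real set" and k k' :: "real \<Rightarrow> real \<Rightarrow> real \<Rightarrow> real"
  assumes kernel_measurable: "x \<in> S \<Longrightarrow> (\<lambda>(s, y). k s x y) \<in> borel_measurable (borel \<Otimes>\<^sub>M M)"
    and kernel_deriv: "0 < s \<Longrightarrow> x \<in> S \<Longrightarrow> y \<in> space M \<Longrightarrow> ((\<lambda>z. k s z y) has_real_derivative k' s x y) (at x)"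
    and kernel_bound: "x \<in> S \<Longrightarrow> \<exists>d>0. \<exists>A\<ge>0. \<exists>N. \<forall>z\<in>ball x d. z \<in> S \<and>
      (\<forall>s>0. \<forall>y\<in>space M. \<bar>k s z y\<bar> \<le> A * (1 + 1 / s) ^ N \<and> \<bar>k' s z y\<bar> \<le> A * (1 + 1 / s) ^ N)"
begin

definition T :: "real \<Rightarrow> (real \<Rightarrow> real) \<Rightarrow> real \<Rightarrow> real"
  where "T s f x = (\<integral>y. k s x y * f y \<partial>M)"

lemma kernel_integrable:
  assumes "0 < s" "x \<in> S" "integrable M f"
  shows "integrable M (\<lambda>y. k s x y * f y)"
proof -
  obtain d A N where d: "0 < d" "0 \<le> A"
    "\<And>z. z \<in> ball x d \<Longrightarrow> z \<in> S \<and> (\<forall>s>0. \<forall>y\<in>space M. \<bar>k s z y\<bar> \<le> A * (1 + 1 / s) ^ N \<and> \<bar>k' s z y\<bar> \<le> A * (1 + 1 / s) ^ N)"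
    using kernel_bound[OF assms(2)] by blast
  have [measurable]: "(\<lambda>y. k s x y) \<in> borel_measurable M"
    using measurable_compose[OF measurable_Pair1' kernel_measurable[OF assms(2)], of s] by simp
  show ?thesis
  proof (rule Bochner_Integration.integrable_bound)
    show "integrable M (\<lambda>y. A * (1 + 1 / s) ^ N * f y)" using assms by simp
    show "AE y in M. norm (k s x y * f y) \<le> norm (A * (1 + 1 / s) ^ N * f y)"
    proof (rule AE_I2)
      fix y assume "y \<in> space M"
      then have "\<bar>k s x y\<bar> \<le> A * (1 + 1 / s) ^ N" using d(3)[of x] d(1) assms by auto
      then show "norm (k s x y * f y) \<le> norm (A * (1 + 1 / s) ^ N * f y)"
        using assms d by (auto simp: abs_mult intro!: mult_right_mono)
    qed
  qed (use assms in measurable)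
qed

lemma T_measurable:
  assumes "x \<in> S" and [measurable]: "f \<in> borel_measurable M"
  shows "(\<lambda>s. T s f x) \<in> borel_measurable borel"
proof -
  have [measurable]: "(\<lambda>(s, y). k s x y) \<in> borel_measurable (borel \<Otimes>\<^sub>M M)"
    by (rule kernel_measurable[OF assms(1)])
  have "(\<lambda>(s, y). k s x y * f y) \<in> borel_measurable (borel \<Otimes>\<^sub>M M)" by measurable
  then show ?thesis unfolding T_def by (rule borel_measurable_lebesgue_integral)
qed

text \<open>The kernel bounds are integrated against \<open>\<bar>f\<bar>\<close>. The radius, the
  constant and the exponent are fixed before \<open>f\<close>, which therefore enters only through
  its L^1 norm.\<close>

lemma T_bounds:
  assumes x: "x \<in> S"
  shows "\<exists>d>0. \<exists>A\<ge>0. \<exists>N. ball x d \<subseteq> S \<and> (\<forall>f. integrable M f \<longrightarrow> (\<exists>T'.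
    \<forall>z\<in>ball x d. \<forall>s>0. ((\<lambda>z. T s f z) has_real_derivative T' s z) (at z) \<and>
      \<bar>T s f z\<bar> \<le> (A * (\<integral>y. \<bar>f y\<bar> \<partial>M)) * (1 + 1 / s) ^ N \<and>
      \<bar>T' s z\<bar> \<le> (A * (\<integral>y. \<bar>f y\<bar> \<partial>M)) * (1 + 1 / s) ^ N))"
proof -
  obtain d A N where d: "0 < d" "0 \<le> A"
    "\<And>z. z \<in> ball x d \<Longrightarrow> z \<in> S \<and> (\<forall>s>0. \<forall>y\<in>space M. \<bar>k s z y\<bar> \<le> A * (1 + 1 / s) ^ N \<and> \<bar>k' s z y\<bar> \<le> A * (1 + 1 / s) ^ N)"
    using kernel_bound[OF x] by blast
  have "\<exists>T'. \<forall>z\<in>ball x d. \<forall>s>0. ((\<lambda>z. T s f z) has_real_derivative T' s z) (at z) \<and>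
      \<bar>T s f z\<bar> \<le> (A * (\<integral>y. \<bar>f y\<bar> \<partial>M)) * (1 + 1 / s) ^ N \<and>
      \<bar>T' s z\<bar> \<le> (A * (\<integral>y. \<bar>f y\<bar> \<partial>M)) * (1 + 1 / s) ^ N" if f: "integrable M f" for f
  proof (intro exI[of _ "\<lambda>s z. \<integral>y. k' s z y * f y \<partial>M"] ballI allI impI)
    fix z s :: real assume z: "z \<in> ball x d" and s: "0 < s"
    let ?g = "\<lambda>y. A * (1 + 1 / s) ^ N * \<bar>f y\<bar>"
    have gi: "integrable M ?g" using f by simp
    have i: "\<And>z. z \<in> ball x d \<Longrightarrow> integrable M (\<lambda>y. k s z y * f y)"
      using d(3) by (intro kernel_integrable s f) auto
    have der: "((\<lambda>z. k s z y * f y) has_real_derivative k' s z y * f y) (at z)" if "z \<in> ball x d" "y \<in> space M" for z y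
      using d(3) that by (intro DERIV_cmult_right kernel_deriv s) auto
    have b: "\<bar>k' s z y * f y\<bar> \<le> ?g y" "\<bar>k s z y * f y\<bar> \<le> ?g y" if "z \<in> ball x d" "y \<in> space M" for z y
      using d(3)[OF that(1)] that s by (auto simp: abs_mult intro!: mult_right_mono)
    note D = has_derivative_under_integral[OF open_ball z convex_ball i der b(1) gi]
    have "\<bar>\<integral>y. k s z y * f y \<partial>M\<bar> \<le> (\<integral>y. ?g y \<partial>M)"
      by (rule order_trans[OF integral_abs_bound integral_mono]) (use i[OF z] gi b(2)[OF z] in auto)
    then show "((\<lambda>z. T s f z) has_real_derivative (\<integral>y. k' s z y * f y \<partial>M)) (at z) \<and>
      \<bar>T s f z\<bar> \<le> (A * (\<integral>y. \<bar>f y\<bar> \<partial>M)) * (1 + 1 / s) ^ N \<and>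
      \<bar>\<integral>y. k' s z y * f y \<partial>M\<bar> \<le> (A * (\<integral>y. \<bar>f y\<bar> \<partial>M)) * (1 + 1 / s) ^ N"
      using D by (simp add: T_def[abs_def] mult_ac)
  qed
  moreover have "ball x d \<subseteq> S" using d(3) by auto
  ultimately show ?thesis using d(1,2) by blast
qed

text \<open>Both subordination estimates, applied with \<open>A\<close> proportional to the L^1 norm
  of \<open>f\<close>. Since \<open>c\<close> precedes \<open>f\<close>, each derivative of the
  Poisson integral at a fixed point is a bounded functional on L^1.\<close>

lemma poisson_derivative_bounds:
  assumes x: "x \<in> S" and t: "0 < t"
  shows "\<exists>c\<ge>0. \<forall>f. integrable M f \<longrightarrow>
    (\<exists>D. ((\<lambda>s. subordinated T s f x) has_real_derivative D) (at t) \<and> \<bar>D\<bar> \<le> c * (\<integral>y. \<bar>f y\<bar> \<partial>M)) \<and>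
    (\<exists>D. ((\<lambda>z. subordinated T t f z) has_real_derivative D) (at x) \<and> \<bar>D\<bar> \<le> c * (\<integral>y. \<bar>f y\<bar> \<partial>M))"
proof -
  obtain d A N where d: "0 < d" "0 \<le> A" and dS: "ball x d \<subseteq> S" and
    T: "\<And>f. integrable M f \<Longrightarrow> (\<exists>T'.
    \<forall>z\<in>ball x d. \<forall>s>0. ((\<lambda>z. T s f z) has_real_derivative T' s z) (at z) \<and>
      \<bar>T s f z\<bar> \<le> (A * (\<integral>y. \<bar>f y\<bar> \<partial>M)) * (1 + 1 / s) ^ N \<and>
      \<bar>T' s z\<bar> \<le> (A * (\<integral>y. \<bar>f y\<bar> \<partial>M)) * (1 + 1 / s) ^ N)"
    using T_bounds[OF x] by metis
  obtain c1 where c1: "0 \<le> c1" "\<And>\<tau> A. \<tau> \<in> borel_measurable borel \<Longrightarrow> 0 \<le> A \<Longrightarrow>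
    (\<forall>s>0. \<bar>\<tau> s\<bar> \<le> A * (1 + 1 / s) ^ N) \<Longrightarrow>
    (\<exists>D. (subord \<tau> has_real_derivative D) (at t) \<and> \<bar>D\<bar> \<le> A * c1)"
    using subord_derivative_bound[OF t, of N] by blast
  obtain c2 where c2: "0 \<le> c2" "\<forall>\<tau> \<tau>' A S x. open S \<longrightarrow> convex S \<longrightarrow> x \<in> S \<longrightarrow>
    (\<forall>z\<in>S. (\<lambda>s. \<tau> s z) \<in> borel_measurable borel) \<longrightarrow>
    (\<forall>z\<in>S. \<forall>s>0. ((\<lambda>z. \<tau> s z) has_real_derivative \<tau>' s z) (at z)) \<longrightarrow>
    (\<forall>z\<in>S. \<forall>s>0. \<bar>\<tau> s z\<bar> \<le> A * (1 + 1 / s) ^ N) \<longrightarrow>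
    (\<forall>z\<in>S. \<forall>s>0. \<bar>\<tau>' s z\<bar> \<le> A * (1 + 1 / s) ^ N) \<longrightarrow>
    (\<exists>D. ((\<lambda>z. subord (\<lambda>s. \<tau> s z) t) has_real_derivative D) (at x) \<and> \<bar>D\<bar> \<le> A * c2)"
    using subord_param_derivative_bound[OF t, of N] by blast
  define c where "c = A * c1 + A * c2"
  have c: "0 \<le> c" using d c1 c2 by (simp add: c_def)
  show ?thesis
  proof (rule exI[of _ c], rule conjI[OF c], rule allI, rule impI)
    fix f :: "real \<Rightarrow> real" assume f: "integrable M f"
    then have fm: "f \<in> borel_measurable M" by simp
    define I where "I = (\<integral>y. \<bar>f y\<bar> \<partial>M)"
    have I: "0 \<le> I" by (simp add: I_def)
    obtain T' where T': "\<And>z s. z \<in> ball x d \<Longrightarrow> 0 < s \<Longrightarrow> ((\<lambda>z. T s f z) has_real_derivative T' s z) (at z) \<and>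
      \<bar>T s f z\<bar> \<le> (A * I) * (1 + 1 / s) ^ N \<and> \<bar>T' s z\<bar> \<le> (A * I) * (1 + 1 / s) ^ N"
      using T[OF f] unfolding I_def by blast
    have xd: "x \<in> ball x d" using d by simp
    have le: "A * I * c1 \<le> c * I" "A * I * c2 \<le> c * I"
      using d c1(1) c2(1) I by (simp_all add: c_def algebra_simps)
    have "\<exists>D. (subord (\<lambda>s. T s f x) has_real_derivative D) (at t) \<and> \<bar>D\<bar> \<le> (A * I) * c1"
      by (rule c1(2)[OF T_measurable[OF x fm]]) (use T'[OF xd] d I in auto)
    moreover have "\<exists>D. ((\<lambda>z. subord (\<lambda>s. T s f z) t) has_real_derivative D) (at x) \<and> \<bar>D\<bar> \<le> (A * I) * c2"
      by (rule c2(2)[rule_format, where S = "ball x d" and \<tau>' = T'])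
        (use T' T_measurable[OF _ fm] xd dS in auto)
    ultimately show "(\<exists>D. ((\<lambda>s. subordinated T s f x) has_real_derivative D) (at t) \<and> \<bar>D\<bar> \<le> c * (\<integral>y. \<bar>f y\<bar> \<partial>M)) \<and>
      (\<exists>D. ((\<lambda>z. subordinated T t f z) has_real_derivative D) (at x) \<and> \<bar>D\<bar> \<le> c * (\<integral>y. \<bar>f y\<bar> \<partial>M))"
      unfolding subordinated_eq_subord I_def[symmetric] using le by (meson order_trans)
  qed
qed

lemma poisson_diff:
  assumes x: "x \<in> S" and t: "0 < t" and f: "integrable M f" and g: "integrable M g"
  shows "subordinated T t (\<lambda>y. f y - g y) x = subordinated T t f x - subordinated T t g x"
proof -
  have T: "T s (\<lambda>y. f y - g y) x = T s f x - T s g x" if "0 < s" for s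
    using kernel_integrable[OF that x f] kernel_integrable[OF that x g]
    by (simp add: T_def right_diff_distrib)
  obtain d A N where d: "0 < d" and
    T': "\<And>f. integrable M f \<Longrightarrow> (\<exists>T'.
    \<forall>z\<in>ball x d. \<forall>s>0. ((\<lambda>z. T s f z) has_real_derivative T' s z) (at z) \<and>
      \<bar>T s f z\<bar> \<le> (A * (\<integral>y. \<bar>f y\<bar> \<partial>M)) * (1 + 1 / s) ^ N \<and>
      \<bar>T' s z\<bar> \<le> (A * (\<integral>y. \<bar>f y\<bar> \<partial>M)) * (1 + 1 / s) ^ N)"
    using T_bounds[OF x] by metis
  have i: "set_integrable lborel {0<..} (\<lambda>u. exp (- u) / sqrt u * T (t\<^sup>2 / (4 * u)) f x)" if "integrable M f" for f
    by (rule subord_integrable[OF t T_measurable[OF x], where A = "A * (\<integral>y. \<bar>f y\<bar> \<partial>M)" and N = N])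
      (use T'[OF that] d that in auto)
  have "(LBINT u:{0<..}. exp (- u) / sqrt u * T (t\<^sup>2 / (4 * u)) (\<lambda>y. f y - g y) x) =
    (LBINT u:{0<..}. exp (- u) / sqrt u * T (t\<^sup>2 / (4 * u)) f x - exp (- u) / sqrt u * T (t\<^sup>2 / (4 * u)) g x)"
    using t by (intro set_lebesgue_integral_cong) (auto simp: T right_diff_distrib)
  also have "\<dots> = (LBINT u:{0<..}. exp (- u) / sqrt u * T (t\<^sup>2 / (4 * u)) f x) - (LBINT u:{0<..}. exp (- u) / sqrt u * T (t\<^sup>2 / (4 * u)) g x)"
    by (rule set_integral_diff(2)[OF i[OF f] i[OF g]])
  finally show ?thesis by (simp add: subordinated_def right_diff_distrib)
qed

text \<open>The derivative bounds are applied to \<open>f y - q n y\<close>. Linearity of the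
  Poisson integral is available only for positive times and points of \<open>S\<close>, so
  derivatives are compared through equality near \<open>t\<close> and near \<open>x\<close>.\<close>

lemma poisson_derivs_tendsto:
  assumes x: "x \<in> S" and t: "0 < t" and f: "integrable M f" and q: "\<And>n. integrable M (q n)"
    and lim: "(\<lambda>n. \<integral>y. \<bar>f y - q n y\<bar> \<partial>M) \<longlonglongrightarrow> 0"
  shows "(\<lambda>n. deriv (\<lambda>s. subordinated T s (q n) x) t) \<longlonglongrightarrow> deriv (\<lambda>s. subordinated T s f x) t"
    and "(\<lambda>n. deriv (\<lambda>z. subordinated T t (q n) z) x) \<longlonglongrightarrow> deriv (\<lambda>z. subordinated T t f z) x"
proof -
  obtain c where c: "\<And>f. integrable M f \<Longrightarrow>
    (\<exists>D. ((\<lambda>s. subordinated T s f x) has_real_derivative D) (at t) \<and> \<bar>D\<bar> \<le> c * (\<integral>y. \<bar>f y\<bar> \<partial>M)) \<and>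
    (\<exists>D. ((\<lambda>z. subordinated T t f z) has_real_derivative D) (at x) \<and> \<bar>D\<bar> \<le> c * (\<integral>y. \<bar>f y\<bar> \<partial>M))"
    using poisson_derivative_bounds[OF x t] by blast
  have i: "integrable M (\<lambda>y. f y - q n y)" for n using f q by simp
  have cl: "(\<lambda>n. c * (\<integral>y. \<bar>f y - q n y\<bar> \<partial>M)) \<longlonglongrightarrow> 0" using tendsto_mult_right_zero[OF lim] .
  have ev1: "eventually (\<lambda>s. subordinated T s f x - subordinated T s (q n) x = subordinated T s (\<lambda>y. f y - q n y) x) (nhds t)" for n
    using eventually_nhds_in_open[of "{0<..}" t] t
    by (auto elim!: eventually_mono simp: poisson_diff[OF x _ f q])
  obtain d where d: "0 < d" "ball x d \<subseteq> S" using T_bounds[OF x] by blast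
  have ev2: "eventually (\<lambda>z. subordinated T t f z - subordinated T t (q n) z = subordinated T t (\<lambda>y. f y - q n y) z) (nhds x)" for n
    using eventually_nhds_in_open[of "ball x d" x] d
    by (auto elim!: eventually_mono simp: poisson_diff[OF _ t f q] subset_iff)
  have b1: "\<bar>deriv (\<lambda>s. subordinated T s (q n) x) t - deriv (\<lambda>s. subordinated T s f x) t\<bar> \<le> c * (\<integral>y. \<bar>f y - q n y\<bar> \<partial>M)" for n
  proof -
    obtain D where D: "((\<lambda>s. subordinated T s (\<lambda>y. f y - q n y) x) has_real_derivative D) (at t)" "\<bar>D\<bar> \<le> c * (\<integral>y. \<bar>f y - q n y\<bar> \<partial>M)"
      using c[OF i] by blast
    obtain D1 D2 where D': "((\<lambda>s. subordinated T s f x) has_real_derivative D1) (at t)"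
      "((\<lambda>s. subordinated T s (q n) x) has_real_derivative D2) (at t)" using c[OF f] c[OF q[of n]] by blast
    have "((\<lambda>s. subordinated T s (\<lambda>y. f y - q n y) x) has_real_derivative D1 - D2) (at t)"
      using DERIV_diff[OF D'] DERIV_cong_ev[OF refl ev1 refl] by blast
    then have "D = D1 - D2" by (rule DERIV_unique[OF D(1)])
    then show ?thesis using D(2) DERIV_imp_deriv[OF D'(1)] DERIV_imp_deriv[OF D'(2)] by simp
  qed
  have b2: "\<bar>deriv (\<lambda>z. subordinated T t (q n) z) x - deriv (\<lambda>z. subordinated T t f z) x\<bar> \<le> c * (\<integral>y. \<bar>f y - q n y\<bar> \<partial>M)" for n
  proof -
    obtain D where D: "((\<lambda>z. subordinated T t (\<lambda>y. f y - q n y) z) has_real_derivative D) (at x)" "\<bar>D\<bar> \<le> c * (\<integral>y. \<bar>f y - q n y\<bar> \<partial>M)"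
      using c[OF i] by blast
    obtain D1 D2 where D': "((\<lambda>z. subordinated T t f z) has_real_derivative D1) (at x)"
      "((\<lambda>z. subordinated T t (q n) z) has_real_derivative D2) (at x)" using c[OF f] c[OF q[of n]] by blast
    have "((\<lambda>z. subordinated T t (\<lambda>y. f y - q n y) z) has_real_derivative D1 - D2) (at x)"
      using DERIV_diff[OF D'] DERIV_cong_ev[OF refl ev2 refl] by blast
    then have "D = D1 - D2" by (rule DERIV_unique[OF D(1)])
    then show ?thesis using D(2) DERIV_imp_deriv[OF D'(1)] DERIV_imp_deriv[OF D'(2)] by simp
  qed
  show "(\<lambda>n. deriv (\<lambda>s. subordinated T s (q n) x) t) \<longlonglongrightarrow> deriv (\<lambda>s. subordinated T s f x) t"
    by (rule LIM_zero_cancel, rule tendsto_0_le[OF cl, of _ 1], rule always_eventually)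
      (use order_trans[OF b1 abs_ge_self] in simp)
  show "(\<lambda>n. deriv (\<lambda>z. subordinated T t (q n) z) x) \<longlonglongrightarrow> deriv (\<lambda>z. subordinated T t f z) x"
    by (rule LIM_zero_cancel, rule tendsto_0_le[OF cl, of _ 1], rule always_eventually)
      (use order_trans[OF b2 abs_ge_self] in simp)
qed

end

subsection \<open>Eigenfunction expansions\<close>

text \<open>Orthogonality picks out one term once sum and integral are exchanged. The exchange rests
  on the L^1 norms of the terms: by Cauchy-Schwarz they are at most a constant multiple of the
  summable sequence in \<open>sm\<close>.\<close>

lemma orthogonal_kernel_eigenfunction:
  fixes e :: "nat \<Rightarrow> real \<Rightarrow> real" and h lam :: "nat \<Rightarrow> real"
  assumes h: "\<And>k. 0 < h k" and lam: "\<And>k. 0 \<le> lam k"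
    and int: "\<And>j k. integrable M (\<lambda>y. e j y * e k y)"
    and orth: "\<And>j k. (\<integral>y. e j y * e k y \<partial>M) = (if j = k then h k else 0)"
    and S: "space M \<subseteq> S" "x \<in> S"
    and sm: "\<And>s x. 0 < s \<Longrightarrow> x \<in> S \<Longrightarrow> summable (\<lambda>k. exp (- lam k * s) * \<bar>e k x\<bar> / sqrt (h k))"
    and s: "0 < s"
  shows "integrable M (\<lambda>y. (\<Sum>k. exp (- lam k * s) / h k * e k x * e k y) * e n y)"
    and "(\<integral>y. (\<Sum>k. exp (- lam k * s) / h k * e k x * e k y) * e n y \<partial>M) = exp (- lam n * s) * e n x"
proof -
  \<comment> \<open>Half of the time is given to each of the two variables, so that every term of
    the kernel is a product of two summable sequences.\<close>
  define u where "u k y = exp (- lam k * (s / 2)) * \<bar>e k y\<bar> / sqrt (h k)" for k y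
  have u0: "0 \<le> u k y" for k y using h[of k] by (simp add: u_def)
  have us: "summable (\<lambda>k. u k y)" if "y \<in> S" for y
    unfolding u_def using s that by (intro sm) auto
  define a where "a k y = exp (- lam k * s) / h k * e k x * e k y" for k y
  have a_eq: "\<bar>a k y\<bar> = u k x * u k y" for k y
  proof -
    have "exp (- lam k * s) = exp (- lam k * (s / 2)) * exp (- lam k * (s / 2))"
      by (simp add: mult_exp_exp)
    moreover have "h k = sqrt (h k) * sqrt (h k)" using h[of k] by simp
    ultimately have "\<bar>a k y\<bar> = exp (- lam k * (s / 2)) * exp (- lam k * (s / 2)) / (sqrt (h k) * sqrt (h k)) * \<bar>e k x\<bar> * \<bar>e k y\<bar>"
      unfolding a_def abs_mult abs_divide using h[of k] by simp
    then show ?thesis by (simp add: u_def)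
  qed
  have as: "summable (\<lambda>k. \<bar>a k y\<bar>)" if y: "y \<in> S" for y
  proof -
    obtain K where K: "\<And>k. norm (u k x) \<le> K"
      using summable_imp_Bseq[OF us[OF S(2)]] by (auto simp: Bseq_def)
    show ?thesis
    proof (rule summable_comparison_test'[of "\<lambda>k. K * u k y" 0])
      show "summable (\<lambda>k. K * u k y)" by (intro summable_mult us y)
      show "norm \<bar>a k y\<bar> \<le> K * u k y" for k
        using mult_right_mono[OF K u0[of k y], of k] u0[of k x] by (simp add: a_eq u0)
    qed
  qed
  have ab: "(\<integral>y. \<bar>e k y * e n y\<bar> \<partial>M) \<le> sqrt (h k) * sqrt (h n)" for k
  proof -
    \<comment> \<open>This weight makes the two terms of the arithmetic-geometric mean inequality
      integrate to the same value, which reproduces the Cauchy-Schwarz bound.\<close>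
    define r where "r = sqrt (h n) / sqrt (h k)"
    have r: "0 < r" using h[of n] h[of k] by (simp add: r_def)
    have "(\<integral>y. \<bar>e k y * e n y\<bar> \<partial>M) \<le> (\<integral>y. r / 2 * (e k y * e k y) + 1 / (2 * r) * (e n y * e n y) \<partial>M)"
    proof (rule integral_mono)
      fix y
      have "0 \<le> (r * \<bar>e k y\<bar> - \<bar>e n y\<bar>)\<^sup>2" by simp
      then have "2 * r * (\<bar>e k y\<bar> * \<bar>e n y\<bar>) \<le> r * r * (e k y * e k y) + e n y * e n y"
        by (simp add: power2_eq_square algebra_simps)
      then have "\<bar>e k y\<bar> * \<bar>e n y\<bar> \<le> (r * r * (e k y * e k y) + e n y * e n y) / (2 * r)"
        using r by (simp add: pos_le_divide_eq mult_ac)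
      also have "\<dots> = r / 2 * (e k y * e k y) + 1 / (2 * r) * (e n y * e n y)"
        using r by (simp add: add_divide_distrib)
      finally show "\<bar>e k y * e n y\<bar> \<le> r / 2 * (e k y * e k y) + 1 / (2 * r) * (e n y * e n y)"
        by (simp add: abs_mult)
    qed (use int in auto)
    also have "\<dots> = r / 2 * h k + 1 / (2 * r) * h n"
      using int orth by simp
    also have "r * h k = sqrt (h k) * sqrt (h n)" "h n / r = sqrt (h k) * sqrt (h n)"
      using h[of k] h[of n] unfolding r_def by (simp_all add: field_simps)
    then have "r / 2 * h k + 1 / (2 * r) * h n = sqrt (h k) * sqrt (h n)" by simp
    finally show ?thesis .
  qed
  define b where "b k y = a k y * e n y" for k y
  have bi: "integrable M (b k)" for k
    using integrable_mult_right[OF int[of k n], of "exp (- lam k * s) / h k * e k x"]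
    by (simp add: b_def[abs_def] a_def mult_ac)
  have bs: "AE y in M. summable (\<lambda>k. norm (b k y))"
    using as S by (intro AE_I2) (auto simp: b_def abs_mult intro!: summable_mult2)
  have "(\<integral>y. norm (b k y) \<partial>M) \<le> sqrt (h n) * (exp (- lam k * s) * \<bar>e k x\<bar> / sqrt (h k))" for k
  proof -
    have "(\<integral>y. norm (b k y) \<partial>M) = exp (- lam k * s) / h k * \<bar>e k x\<bar> * (\<integral>y. \<bar>e k y * e n y\<bar> \<partial>M)"
      using h[of k] by (subst integral_mult_right_zero[symmetric]) (simp add: b_def a_def abs_mult mult_ac)
    also have "\<dots> \<le> exp (- lam k * s) / h k * \<bar>e k x\<bar> * (sqrt (h k) * sqrt (h n))"
      using h[of k] by (intro mult_left_mono ab) auto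
    also have "\<dots> = sqrt (h n) * (exp (- lam k * s) * \<bar>e k x\<bar> / sqrt (h k))"
    proof -
      have "h k = sqrt (h k) * sqrt (h k)" using h[of k] by simp
      then have "sqrt (h k) / h k = 1 / sqrt (h k)" using h[of k] by (metis div_by_1 divide_divide_eq_left' nonzero_divide_mult_cancel_left real_sqrt_eq_0_iff less_irrefl)
      then have "exp (- lam k * s) * \<bar>e k x\<bar> * sqrt (h n) * (sqrt (h k) / h k) = exp (- lam k * s) * \<bar>e k x\<bar> * sqrt (h n) * (1 / sqrt (h k))"
        by (simp only:)
      then show ?thesis by (simp add: mult_ac)
    qed
    finally show ?thesis .
  qed
  then have ns: "summable (\<lambda>k. \<integral>y. norm (b k y) \<partial>M)"
    by (intro summable_comparison_test'[OF summable_mult[OF sm[OF s S(2)], of "sqrt (h n)"], of 0]) simp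
  have eq: "(\<Sum>k. b k y) = (\<Sum>k. exp (- lam k * s) / h k * e k x * e k y) * e n y" if "y \<in> space M" for y
    using suminf_mult2[OF summable_rabs_cancel[OF as[of y]], of "e n y"] S that
    by (auto simp: b_def a_def[abs_def])
  show "integrable M (\<lambda>y. (\<Sum>k. exp (- lam k * s) / h k * e k x * e k y) * e n y)"
    using integrable_suminf[OF bi bs ns] by (simp add: eq cong: Bochner_Integration.integrable_cong)
  have "(\<integral>y. (\<Sum>k. b k y) \<partial>M) = (\<Sum>k. \<integral>y. b k y \<partial>M)"
    by (rule integral_suminf[OF bi bs ns])
  also have "(\<lambda>k. \<integral>y. b k y \<partial>M) = (\<lambda>k. if k = n then exp (- lam n * s) * e n x else 0)"
  proof
    fix k
    have "(\<integral>y. b k y \<partial>M) = exp (- lam k * s) / h k * e k x * (\<integral>y. e k y * e n y \<partial>M)"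
      by (simp add: b_def a_def mult.assoc)
    then show "(\<integral>y. b k y \<partial>M) = (if k = n then exp (- lam n * s) * e n x else 0)"
      using h[of n] by (simp add: orth)
  qed
  also have "(\<Sum>k. if k = n then exp (- lam n * s) * e n x else 0) = exp (- lam n * s) * e n x"
    by (subst suminf_finite[of "{n}"]) auto
  finally show "(\<integral>y. (\<Sum>k. exp (- lam k * s) / h k * e k x * e k y) * e n y \<partial>M) = exp (- lam n * s) * e n x"
    by (simp add: eq cong: Bochner_Integration.integral_cong)
qed

text \<open>On a finite combination \<open>T\<close> acts through the multipliers
  \<open>exp (- lam n * s)\<close>, and \<open>subordinated_exp\<close> converts each of them. The
  subordination integral evaluates \<open>T\<close> only at positive times
  \<open>t\<^sup>2 / (4 * u)\<close>, so the kernel formula is assumed there.\<close>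

lemma orthogonal_poisson:
  fixes e :: "nat \<Rightarrow> real \<Rightarrow> real" and h lam c :: "nat \<Rightarrow> real"
  assumes h: "\<And>k. 0 < h k" and lam: "\<And>k. 0 \<le> lam k"
    and int: "\<And>j k. integrable M (\<lambda>y. e j y * e k y)"
    and orth: "\<And>j k. (\<integral>y. e j y * e k y \<partial>M) = (if j = k then h k else 0)"
    and S: "space M \<subseteq> S" "x \<in> S"
    and sm: "\<And>s x. 0 < s \<Longrightarrow> x \<in> S \<Longrightarrow> summable (\<lambda>k. exp (- lam k * s) * \<bar>e k x\<bar> / sqrt (h k))"
    and T: "\<And>s f. 0 < s \<Longrightarrow> T s f x = (\<integral>y. (\<Sum>k. exp (- lam k * s) / h k * e k x * e k y) * f y \<partial>M)"
    and t: "0 < t"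
  shows "subordinated T t (\<lambda>y. \<Sum>n\<le>N. c n * e n y) x = (\<Sum>n\<le>N. c n * exp (- t * sqrt (lam n)) * e n x)"
proof -
  have E: "integrable M (\<lambda>y. (\<Sum>k. exp (- lam k * s) / h k * e k x * e k y) * e n y)"
    "(\<integral>y. (\<Sum>k. exp (- lam k * s) / h k * e k x * e k y) * e n y \<partial>M) = exp (- lam n * s) * e n x"
    if s: "0 < s" for s n
    by (rule orthogonal_kernel_eigenfunction[OF h lam int orth S _ s], rule sm, assumption+)+
  have Tc: "T s (\<lambda>y. \<Sum>n\<le>N. c n * e n y) x = (\<Sum>n\<le>N. c n * e n x * exp (- lam n * s))" if s: "0 < s" for s
  proof -
    let ?K = "\<lambda>y. \<Sum>k. exp (- lam k * s) / h k * e k x * e k y"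
    have "T s (\<lambda>y. \<Sum>n\<le>N. c n * e n y) x = (\<integral>y. (\<Sum>n\<le>N. c n * (?K y * e n y)) \<partial>M)"
      unfolding T[OF s] by (simp only: sum_distrib_left mult.left_commute)
    also have "\<dots> = (\<Sum>n\<le>N. \<integral>y. c n * (?K y * e n y) \<partial>M)"
      by (rule Bochner_Integration.integral_sum) (intro integrable_mult_right E(1) s)
    also have "\<dots> = (\<Sum>n\<le>N. c n * e n x * exp (- lam n * s))"
      unfolding integral_mult_right_zero E(2)[OF s] by (simp add: mult_ac)
    finally show ?thesis .
  qed
  have i: "set_integrable lborel {0<..} (\<lambda>u. c n * e n x * (exp (- u) / sqrt u * exp (- lam n * (t\<^sup>2 / (4 * u)))))" for n
    by (intro set_integrable_mult_right subordinated_exp t lam)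
  have "(LBINT u:{0<..}. exp (- u) / sqrt u * T (t\<^sup>2 / (4 * u)) (\<lambda>y. \<Sum>n\<le>N. c n * e n y) x) =
    (LBINT u:{0<..}. \<Sum>n\<le>N. c n * e n x * (exp (- u) / sqrt u * exp (- lam n * (t\<^sup>2 / (4 * u)))))"
    by (rule set_lebesgue_integral_cong)
      (use t in \<open>auto simp: Tc sum_distrib_left mult_ac simp del: times_divide_eq_right times_divide_eq_left\<close>)
  also have "\<dots> = (\<Sum>n\<le>N. LBINT u:{0<..}. c n * e n x * (exp (- u) / sqrt u * exp (- lam n * (t\<^sup>2 / (4 * u)))))"
    using i unfolding set_lebesgue_integral_def set_integrable_def scaleR_sum_right
    by (rule Bochner_Integration.integral_sum)
  also have "\<dots> = (\<Sum>n\<le>N. c n * e n x * (sqrt pi * exp (- t * sqrt (lam n))))"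
  proof (intro sum.cong refl)
    fix n
    define L where "L = (LBINT u:{0<..}. exp (- u) / sqrt u * exp (- lam n * (t\<^sup>2 / (4 * u))))"
    have "1 / sqrt pi * L = exp (- t * sqrt (lam n))"
      unfolding L_def by (rule subordinated_exp(2)[OF t lam])
    then have L: "L = sqrt pi * exp (- t * sqrt (lam n))" by (simp add: field_simps)
    show "(LBINT u:{0<..}. c n * e n x * (exp (- u) / sqrt u * exp (- lam n * (t\<^sup>2 / (4 * u))))) =
      c n * e n x * (sqrt pi * exp (- t * sqrt (lam n)))"
      unfolding L[symmetric] L_def set_lebesgue_integral_def
      by (subst integral_mult_right_zero[symmetric]) (simp add: mult_ac)
  qed
  finally show ?thesis
    unfolding subordinated_def by (simp add: sum_distrib_left mult_ac)
qed

text \<open>The diagonal of a kernel controls the growth of the eigenfunctions, since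
  \<open>u \<le> (1 + u\<^sup>2) / 2\<close> for \<open>u = \<bar>e k\<bar> / sqrt (h k)\<close>.\<close>

lemma summable_of_diagonal:
  fixes e h :: "nat \<Rightarrow> real"
  assumes r: "0 \<le> r" "r < 1" and h: "\<And>k. 0 < h k" and sm: "summable (\<lambda>k. r ^ k / h k * e k * e k)"
  shows "summable (\<lambda>k. r ^ k * \<bar>e k\<bar> / sqrt (h k))"
proof (rule summable_comparison_test'[where N = 0])
  show "summable (\<lambda>k. (r ^ k + r ^ k / h k * e k * e k) / 2)"
    using r by (intro summable_divide summable_add summable_geometric sm) auto
  fix k
  define L where "L = \<bar>e k\<bar> / sqrt (h k)"
  have "0 \<le> (1 - L)\<^sup>2" by simp
  then have "L \<le> (1 + L * L) / 2" by (simp add: power2_eq_square algebra_simps)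
  moreover have "L * L = e k * e k / h k" using h[of k] by (simp add: L_def)
  ultimately have "r ^ k * L \<le> r ^ k * ((1 + e k * e k / h k) / 2)"
    using r by (intro mult_left_mono) auto
  then show "norm (r ^ k * \<bar>e k\<bar> / sqrt (h k)) \<le> (r ^ k + r ^ k / h k * e k * e k) / 2"
    using h[of k] r unfolding L_def by (simp add: algebra_simps add_divide_distrib)
qed

text \<open>The denominators are the values \<open>1 / (a + b)\<^sup>2\<close> of the integrals of \<open>t * exp (- (a + b) * t)\<close>
  over \<open>t > 0\<close>.\<close>

definition g_form :: "nat \<Rightarrow> (nat \<Rightarrow> real) \<Rightarrow> (nat \<Rightarrow> real) \<Rightarrow> (nat \<Rightarrow> real) \<Rightarrow> real \<Rightarrow> real"
  where "g_form N lam a b w = (\<Sum>k=1..N. \<Sum>l=1..N.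
    (sqrt (lam k) * sqrt (lam l) * a k * a l + w * b k * b l) / (sqrt (lam k) + sqrt (lam l))\<^sup>2)"

lemma nn_integral_t_exp:
  assumes a: "0 < a"
  shows "has_bochner_integral lborel (\<lambda>t::real. indicator {0<..} t * (t * exp (- a * t))) (1 / a\<^sup>2)"
proof -
  have F: "((\<lambda>t::real. - (t / a + 1 / a\<^sup>2) * exp (- a * t)) has_real_derivative t * exp (- a * t)) (at t)" for t :: real
    using a by (auto intro!: derivative_eq_intros simp: field_simps power2_eq_square)
  have lim: "((\<lambda>t::real. - (t / a + 1 / a\<^sup>2) * exp (- a * t)) \<longlongrightarrow> 0) at_top"
    using a by real_asymp
  have "(\<integral>\<^sup>+t. ennreal (t * exp (- a * t)) * indicator {0..} t \<partial>lborel) = ennreal (0 - (- (0 / a + 1 / a\<^sup>2) * exp (- a * 0)))"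
    by (rule nn_integral_FTC_atLeast[OF _ F _ lim]) auto
  also have "(\<integral>\<^sup>+t. ennreal (t * exp (- a * t)) * indicator {0..} t \<partial>lborel) =
    (\<integral>\<^sup>+t. ennreal (indicator {0<..} t * (t * exp (- a * t))) \<partial>lborel)"
    by (intro nn_integral_cong) (auto split: split_indicator)
  finally show ?thesis
    by (intro has_bochner_integral_nn_integral) (auto split: split_indicator)
qed

text \<open>Expanding the squares leaves one integral of \<open>t * exp (- (a + b) * t)\<close> for
  each pair of indices. The sums start at 1: a zero eigenvalue would give a divergent integral, but
  constants have no derivatives. Nonnegativity of \<open>g_form\<close> is not visible from its
  formula and is read off the integral.\<close>

lemma g_integral_exp_sum:
  assumes lam: "\<And>k. 1 \<le> k \<Longrightarrow> 0 < lam k" and w: "0 \<le> w"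
  shows "(\<integral>\<^sup>+t\<in>{0<..}. ennreal (t * ((\<Sum>k=1..N. sqrt (lam k) * exp (- t * sqrt (lam k)) * a k)\<^sup>2 +
            w * (\<Sum>k=1..N. exp (- t * sqrt (lam k)) * b k)\<^sup>2)) \<partial>lborel) = ennreal (g_form N lam a b w)"
    and "0 \<le> g_form N lam a b w"
proof -
  define C where "C k l = sqrt (lam k) * sqrt (lam l) * a k * a l + w * b k * b l" for k l
  define h where "h t = t * ((\<Sum>k=1..N. sqrt (lam k) * exp (- t * sqrt (lam k)) * a k)\<^sup>2 +
            w * (\<Sum>k=1..N. exp (- t * sqrt (lam k)) * b k)\<^sup>2)" for t
  have h: "h t = (\<Sum>k=1..N. \<Sum>l=1..N. C k l * (t * exp (- (sqrt (lam k) + sqrt (lam l)) * t)))" for t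
  proof -
    have "exp (- (sqrt (lam k) + sqrt (lam l)) * t) = exp (- t * sqrt (lam k)) * exp (- t * sqrt (lam l))" for k l
      by (simp add: mult_exp_exp algebra_simps)
    then show ?thesis
      unfolding h_def power2_eq_square sum_product unfolding sum_distrib_left sum.distrib[symmetric]
      by (intro sum.cong refl) (simp add: C_def algebra_simps)
  qed
  have "has_bochner_integral lborel (\<lambda>t. \<Sum>k=1..N. \<Sum>l=1..N. C k l * (indicator {0<..} t * (t * exp (- (sqrt (lam k) + sqrt (lam l)) * t))))
     (\<Sum>k=1..N. \<Sum>l=1..N. C k l * (1 / (sqrt (lam k) + sqrt (lam l))\<^sup>2))"
    using lam by (intro has_bochner_integral_sum has_bochner_integral_mult_right nn_integral_t_exp) (auto intro!: add_pos_pos)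
  moreover have "(\<Sum>k=1..N. \<Sum>l=1..N. C k l * (indicator {0<..} t * (t * exp (- (sqrt (lam k) + sqrt (lam l)) * t)))) = indicator {0<..} t * h t" for t
    unfolding h by (simp add: sum_distrib_left mult_ac)
  ultimately have bi: "has_bochner_integral lborel (\<lambda>t. indicator {0<..} t * h t) (g_form N lam a b w)"
    by (simp add: g_form_def C_def)
  have h0: "0 \<le> h t" if "0 < t" for t using that w by (simp add: h_def)
  have "(\<integral>\<^sup>+t. ennreal (indicator {0<..} t * h t) \<partial>lborel) = ennreal (g_form N lam a b w)"
    using bi h0 by (subst nn_integral_eq_integral) (auto simp: has_bochner_integral_iff split: split_indicator)
  moreover have "(\<integral>\<^sup>+t. ennreal (indicator {0<..} t * h t) \<partial>lborel) = (\<integral>\<^sup>+t. ennreal (h t) * indicator {0<..} t \<partial>lborel)"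
    by (intro nn_integral_cong) (auto split: split_indicator)
  ultimately show "(\<integral>\<^sup>+t\<in>{0<..}. ennreal (t * ((\<Sum>k=1..N. sqrt (lam k) * exp (- t * sqrt (lam k)) * a k)\<^sup>2 +
            w * (\<Sum>k=1..N. exp (- t * sqrt (lam k)) * b k)\<^sup>2)) \<partial>lborel) = ennreal (g_form N lam a b w)"
    by (simp add: h_def)
  have "g_form N lam a b w = (LBINT t. indicator {0<..} t * h t)"
    using bi by (simp add: has_bochner_integral_iff)
  also have "0 \<le> \<dots>" using h0 by (intro integral_nonneg_AE AE_I2) (auto split: split_indicator)
  finally show "0 \<le> g_form N lam a b w" .
qed

text \<open>Index 0 drops out of both derivatives, by \<open>lam 0 = 0\<close> in time and by
  \<open>degree (E 0) = 0\<close> in space. The expansion is assumed for positive times and on the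
  open set \<open>S\<close>, enough to differentiate.\<close>

lemma g_function_exp_sum:
  fixes E :: "nat \<Rightarrow> real poly"
  assumes S: "open S" "x \<in> S"
    and P: "\<And>t z. 0 < t \<Longrightarrow> z \<in> S \<Longrightarrow> P t f z = (\<Sum>k\<le>N. c k * exp (- t * sqrt (lam k)) * poly (E k) z)"
    and lam: "lam 0 = 0" "\<And>k. 1 \<le> k \<Longrightarrow> 0 < lam k" and E0: "degree (E 0) = 0" and w: "0 \<le> w x"
  shows "0 < t \<Longrightarrow> deriv (\<lambda>s. P s f x) t = - (\<Sum>k=1..N. sqrt (lam k) * exp (- t * sqrt (lam k)) * (c k * poly (E k) x))"
    and "0 < t \<Longrightarrow> deriv (\<lambda>z. P t f z) x = (\<Sum>k=1..N. exp (- t * sqrt (lam k)) * (c k * poly (pderiv (E k)) x))"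
    and "(\<integral>\<^sup>+ t\<in>{0<..}. ennreal (t * ((deriv (\<lambda>s. P s f x) t)\<^sup>2 + w x * (deriv (\<lambda>z. P t f z) x)\<^sup>2)) \<partial>lborel) =
      ennreal (g_form N lam (\<lambda>k. c k * poly (E k) x) (\<lambda>k. c k * poly (pderiv (E k)) x) (w x))"
proof -
  have set: "{..N} = insert 0 {1..N}" by auto
  show dt: "deriv (\<lambda>s. P s f x) t = - (\<Sum>k=1..N. sqrt (lam k) * exp (- t * sqrt (lam k)) * (c k * poly (E k) x))"
    if t: "0 < t" for t
  proof -
    have "((\<lambda>s. \<Sum>k\<le>N. c k * exp (- s * sqrt (lam k)) * poly (E k) x) has_real_derivative
      (\<Sum>k\<le>N. c k * (exp (- t * sqrt (lam k)) * - sqrt (lam k)) * poly (E k) x)) (at t)"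
      by (auto intro!: derivative_eq_intros simp: mult_ac)
    also have "(\<Sum>k\<le>N. c k * (exp (- t * sqrt (lam k)) * - sqrt (lam k)) * poly (E k) x) =
      - (\<Sum>k=1..N. sqrt (lam k) * exp (- t * sqrt (lam k)) * (c k * poly (E k) x))"
      unfolding set by (simp add: lam(1) sum_negf[symmetric] mult_ac)
    finally have "((\<lambda>s. P s f x) has_real_derivative - (\<Sum>k=1..N. sqrt (lam k) * exp (- t * sqrt (lam k)) * (c k * poly (E k) x))) (at t)"
      by (rule has_field_derivative_transform_within_open[of _ _ _ "{0<..}"]) (use t P S in auto)
    then show ?thesis by (rule DERIV_imp_deriv)
  qed
  show dx: "deriv (\<lambda>z. P t f z) x = (\<Sum>k=1..N. exp (- t * sqrt (lam k)) * (c k * poly (pderiv (E k)) x))"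
    if t: "0 < t" for t
  proof -
    have "pderiv (E 0) = 0" using E0 by (simp add: pderiv_eq_0_iff)
    have "((\<lambda>z. \<Sum>k\<le>N. c k * exp (- t * sqrt (lam k)) * poly (E k) z) has_real_derivative
      (\<Sum>k\<le>N. c k * exp (- t * sqrt (lam k)) * poly (pderiv (E k)) x)) (at x)"
      by (intro DERIV_sum DERIV_cmult poly_DERIV)
    also have "(\<Sum>k\<le>N. c k * exp (- t * sqrt (lam k)) * poly (pderiv (E k)) x) =
      (\<Sum>k=1..N. exp (- t * sqrt (lam k)) * (c k * poly (pderiv (E k)) x))"
      unfolding set using \<open>pderiv (E 0) = 0\<close> by (simp add: mult_ac)
    finally have "((\<lambda>z. P t f z) has_real_derivative (\<Sum>k=1..N. exp (- t * sqrt (lam k)) * (c k * poly (pderiv (E k)) x))) (at x)"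
      by (rule has_field_derivative_transform_within_open[OF _ S]) (use t P in auto)
    then show ?thesis by (rule DERIV_imp_deriv)
  qed
  show "(\<integral>\<^sup>+ t\<in>{0<..}. ennreal (t * ((deriv (\<lambda>s. P s f x) t)\<^sup>2 + w x * (deriv (\<lambda>z. P t f z) x)\<^sup>2)) \<partial>lborel) =
      ennreal (g_form N lam (\<lambda>k. c k * poly (E k) x) (\<lambda>k. c k * poly (pderiv (E k)) x) (w x))"
    by (subst g_integral_exp_sum(1)[symmetric, OF lam(2) w], assumption, rule nn_integral_cong)
      (auto simp: dt dx split: split_indicator)
qed

subsection \<open>Density of polynomials\<close>

text \<open>Comparison with the larger of the two numbers works for every positive \<open>p\<close>.
  The loss of \<open>2 powr p\<close> is harmless for density questions.\<close>

lemma abs_add_powr_le: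
  fixes a b :: real
  assumes "0 < p"
  shows "\<bar>a + b\<bar> powr p \<le> 2 powr p * (\<bar>a\<bar> powr p + \<bar>b\<bar> powr p)"
proof -
  have "\<bar>a + b\<bar> powr p \<le> (2 * max \<bar>a\<bar> \<bar>b\<bar>) powr p"
    using assms by (intro powr_mono2) auto
  also have "\<dots> = 2 powr p * (max \<bar>a\<bar> \<bar>b\<bar>) powr p" by (simp add: powr_mult)
  also have "\<dots> \<le> 2 powr p * (\<bar>a\<bar> powr p + \<bar>b\<bar> powr p)"
    by (intro mult_left_mono) (auto simp: max_def)
  finally show ?thesis .
qed

text \<open>\<open>ac\<close> is absolute continuity with respect to Lebesgue measure and carries
  almost everywhere approximation by continuous functions over to \<open>N\<close>. The exponential
  moment provides the majorant for the Taylor series of cosine and sine.\<close>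

locale exp_moment_measure = finite_measure N for N :: "real measure" +
  fixes p c :: real
  assumes sets_N [measurable_cong]: "sets N = sets borel"
    and ac: "\<And>P. AE x in lborel. P x \<Longrightarrow> AE x in N. P x"
    and p: "0 < p" and c: "0 < c"
    and exp_moment: "(\<integral>\<^sup>+x. ennreal (exp (c * \<bar>x\<bar>)) \<partial>N) < \<infinity>"
begin

definition apx :: "(real \<Rightarrow> real) \<Rightarrow> bool"
  where "apx f \<longleftrightarrow> f \<in> borel_measurable borel \<and>
    (\<forall>\<epsilon>>0. \<exists>q::real poly. (\<integral>\<^sup>+x. ennreal (\<bar>f x - poly q x\<bar> powr p) \<partial>N) < ennreal \<epsilon>)"

text \<open>The class \<open>apx\<close> is closed in L^p; the denominator in \<open>d\<close> is
  the constant of \<open>abs_add_powr_le\<close> times two.\<close>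

lemma apx_of_close:
  assumes f [measurable]: "f \<in> borel_measurable borel"
    and cl: "\<And>\<epsilon>. 0 < \<epsilon> \<Longrightarrow> \<exists>g. apx g \<and> (\<integral>\<^sup>+x. ennreal (\<bar>f x - g x\<bar> powr p) \<partial>N) < ennreal \<epsilon>"
  shows "apx f"
  unfolding apx_def
proof (intro conjI allI impI f)
  fix \<epsilon> :: real assume e: "0 < \<epsilon>"
  define d where "d = \<epsilon> / (2 * 2 powr p)"
  have d: "0 < d" using e by (simp add: d_def)
  obtain g where g: "apx g" "(\<integral>\<^sup>+x. ennreal (\<bar>f x - g x\<bar> powr p) \<partial>N) < ennreal d"
    using cl[OF d] by blast
  have [measurable]: "g \<in> borel_measurable borel" using g by (simp add: apx_def)
  obtain q :: "real poly" where q: "(\<integral>\<^sup>+x. ennreal (\<bar>g x - poly q x\<bar> powr p) \<partial>N) < ennreal d"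
    using g d by (auto simp: apx_def)
  have "(\<integral>\<^sup>+x. ennreal (\<bar>f x - poly q x\<bar> powr p) \<partial>N) \<le>
    (\<integral>\<^sup>+x. ennreal (2 powr p) * (ennreal (\<bar>f x - g x\<bar> powr p) + ennreal (\<bar>g x - poly q x\<bar> powr p)) \<partial>N)"
  proof (rule nn_integral_mono)
    fix x
    show "ennreal (\<bar>f x - poly q x\<bar> powr p) \<le> ennreal (2 powr p) * (ennreal (\<bar>f x - g x\<bar> powr p) + ennreal (\<bar>g x - poly q x\<bar> powr p))"
      using abs_add_powr_le[OF p, of "f x - g x" "g x - poly q x"]
      by (simp add: ennreal_plus[symmetric] ennreal_mult[symmetric] del: ennreal_plus)
  qed
  also have "\<dots> = ennreal (2 powr p) * ((\<integral>\<^sup>+x. ennreal (\<bar>f x - g x\<bar> powr p) \<partial>N) + (\<integral>\<^sup>+x. ennreal (\<bar>g x - poly q x\<bar> powr p) \<partial>N))"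
    by (simp add: nn_integral_cmult nn_integral_add)
  also have "\<dots> < ennreal (2 powr p) * (ennreal d + ennreal d)"
    by (intro ennreal_mult_strict_left_mono add_strict_mono g q) auto
  also have "\<dots> = ennreal \<epsilon>"
    using d by (simp add: ennreal_plus[symmetric] ennreal_mult[symmetric] del: ennreal_plus) (simp add: d_def)
  finally show "\<exists>q::real poly. (\<integral>\<^sup>+x. ennreal (\<bar>f x - poly q x\<bar> powr p) \<partial>N) < ennreal \<epsilon>" by blast
qed

text \<open>Dominated convergence with a majorant for the error, not for the functions. It is the
  only way limits are taken below: Taylor sums, growing periods, cut-offs and truncations.\<close>

lemma apx_limit:
  assumes f [measurable]: "f \<in> borel_measurable borel" and g: "\<And>n. apx (g n)"
    and lim: "AE x in N. (\<lambda>n. g n x) \<longlonglongrightarrow> f x"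
    and dom: "\<And>n x. \<bar>f x - g n x\<bar> \<le> G x" and [measurable]: "G \<in> borel_measurable borel"
    and G: "(\<integral>\<^sup>+x. ennreal (G x powr p) \<partial>N) < \<infinity>"
  shows "apx f"
proof (rule apx_of_close[OF f])
  fix \<epsilon> :: real assume e: "0 < \<epsilon>"
  have [measurable]: "g n \<in> borel_measurable borel" for n using g by (simp add: apx_def)
  have "(\<lambda>n. \<integral>\<^sup>+x. ennreal (\<bar>f x - g n x\<bar> powr p) \<partial>N) \<longlonglongrightarrow> (\<integral>\<^sup>+x. 0 \<partial>N)"
  proof (rule nn_integral_dominated_convergence[OF _ _ _ _ G])
    show "AE x in N. ennreal (\<bar>f x - g n x\<bar> powr p) \<le> ennreal (G x powr p)" for n
      using p dom by (intro AE_I2 ennreal_leI powr_mono2) auto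
    show "AE x in N. (\<lambda>n. ennreal (\<bar>f x - g n x\<bar> powr p)) \<longlonglongrightarrow> 0"
      using lim
    proof eventually_elim
      fix x assume "(\<lambda>n. g n x) \<longlonglongrightarrow> f x"
      then have "(\<lambda>n. \<bar>f x - g n x\<bar>) \<longlonglongrightarrow> 0"
        by (intro tendsto_eq_intros refl) auto
      then have "(\<lambda>n. \<bar>f x - g n x\<bar> powr p) \<longlonglongrightarrow> 0"
        using tendsto_powr'[of _ 0 sequentially "\<lambda>_. p" p] p by auto
      then show "(\<lambda>n. ennreal (\<bar>f x - g n x\<bar> powr p)) \<longlonglongrightarrow> 0"
        using tendsto_ennrealI by fastforce
    qed
  qed auto
  then have "eventually (\<lambda>n. (\<integral>\<^sup>+x. ennreal (\<bar>f x - g n x\<bar> powr p) \<partial>N) < ennreal \<epsilon>) sequentially"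
    using e by (intro order_tendstoD(2)[of _ 0]) auto
  then show "\<exists>h. apx h \<and> (\<integral>\<^sup>+x. ennreal (\<bar>f x - h x\<bar> powr p) \<partial>N) < ennreal \<epsilon>"
    using g by (auto simp: eventually_sequentially)
qed

lemma apx_poly: "apx (poly q)"
  unfolding apx_def using p by (intro conjI allI impI exI[of _ q]) auto

lemma apx_add:
  assumes "apx f" "apx g"
  shows "apx (\<lambda>x. f x + g x)"
  unfolding apx_def
proof (intro conjI allI impI)
  have [measurable]: "f \<in> borel_measurable borel" "g \<in> borel_measurable borel" using assms by (auto simp: apx_def)
  show "(\<lambda>x. f x + g x) \<in> borel_measurable borel" by measurable
  fix \<epsilon> :: real assume e: "0 < \<epsilon>"
  define d where "d = \<epsilon> / (2 * 2 powr p)"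
  have d: "0 < d" using e by (simp add: d_def)
  obtain q :: "real poly" where q: "(\<integral>\<^sup>+x. ennreal (\<bar>f x - poly q x\<bar> powr p) \<partial>N) < ennreal d"
    using assms d by (auto simp: apx_def)
  obtain r :: "real poly" where r: "(\<integral>\<^sup>+x. ennreal (\<bar>g x - poly r x\<bar> powr p) \<partial>N) < ennreal d"
    using assms d by (auto simp: apx_def)
  have "(\<integral>\<^sup>+x. ennreal (\<bar>f x + g x - poly (q + r) x\<bar> powr p) \<partial>N) \<le>
    (\<integral>\<^sup>+x. ennreal (2 powr p) * (ennreal (\<bar>f x - poly q x\<bar> powr p) + ennreal (\<bar>g x - poly r x\<bar> powr p)) \<partial>N)"
  proof (rule nn_integral_mono)
    fix x
    have eq: "f x + g x - poly (q + r) x = (f x - poly q x) + (g x - poly r x)" by simp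
    show "ennreal (\<bar>f x + g x - poly (q + r) x\<bar> powr p) \<le> ennreal (2 powr p) * (ennreal (\<bar>f x - poly q x\<bar> powr p) + ennreal (\<bar>g x - poly r x\<bar> powr p))"
      unfolding eq using abs_add_powr_le[OF p, of "f x - poly q x" "g x - poly r x"]
      by (simp add: ennreal_plus[symmetric] ennreal_mult[symmetric] del: ennreal_plus)
  qed
  also have "\<dots> = ennreal (2 powr p) * ((\<integral>\<^sup>+x. ennreal (\<bar>f x - poly q x\<bar> powr p) \<partial>N) + (\<integral>\<^sup>+x. ennreal (\<bar>g x - poly r x\<bar> powr p) \<partial>N))"
    by (simp add: nn_integral_cmult nn_integral_add)
  also have "\<dots> < ennreal (2 powr p) * (ennreal d + ennreal d)"
    by (intro ennreal_mult_strict_left_mono add_strict_mono q r) auto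
  also have "\<dots> = ennreal \<epsilon>"
    using d by (simp add: ennreal_plus[symmetric] ennreal_mult[symmetric] del: ennreal_plus) (simp add: d_def)
  finally show "\<exists>q::real poly. (\<integral>\<^sup>+x. ennreal (\<bar>f x + g x - poly q x\<bar> powr p) \<partial>N) < ennreal \<epsilon>" by blast
qed

text \<open>This class is stable under multiplication by \<open>cos (\<xi> * x)\<close> and \<open>sin (\<xi> * x)\<close> for small \<open>\<xi>\<close>:
  the partial sums of their Taylor series are dominated by \<open>exp (\<xi> * \<bar>x\<bar>)\<close>. Iteration yields all
  trigonometric polynomials of that frequency.\<close>

definition apx_mult :: "(real \<Rightarrow> real) \<Rightarrow> bool"
  where "apx_mult h \<longleftrightarrow> bounded (range h) \<and> (\<forall>q. apx (\<lambda>x. h x * poly q x))"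

lemma apx_mult_add: "apx_mult f \<Longrightarrow> apx_mult g \<Longrightarrow> apx_mult (\<lambda>x. f x + g x)"
  unfolding apx_mult_def using apx_add
  by (auto simp: distrib_right intro: bounded_plus_comp)

lemma apx_mult_scale:
  assumes "apx_mult f"
  shows "apx_mult (\<lambda>x. a * f x)"
  unfolding apx_mult_def
proof (intro conjI allI)
  show "bounded (range (\<lambda>x. a * f x))"
    using assms bounded_scaling[of "range f" a] by (simp add: apx_mult_def image_image)
  show "apx (\<lambda>x. a * f x * poly q x)" for q
    using assms unfolding apx_mult_def by (auto dest: spec[of _ "smult a q"] simp: mult_ac)
qed

text \<open>The gap \<open>b = c / p - d\<close> is positive, so
  \<open>exp (b * \<bar>x\<bar>)\<close> can swallow the polynomial and the p-th power of the
  product stays below a multiple of \<open>exp (c * \<bar>x\<bar>)\<close>.\<close>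

lemma poly_exp_moment:
  assumes "0 \<le> K" "0 \<le> d" "p * d < c"
  shows "(\<integral>\<^sup>+x. ennreal ((K * \<bar>poly q x\<bar> * exp (d * \<bar>x\<bar>)) powr p) \<partial>N) < \<infinity>"
proof -
  define b where "b = c / p - d"
  have b: "0 < b" using assms p by (simp add: b_def field_simps)
  have "\<exists>C\<ge>0. \<forall>x. \<bar>poly q x\<bar> \<le> C * exp (b * \<bar>x\<bar>)"
  proof -
    \<comment> \<open>Induction over coefficients with a variable rate: one half of the rate bounds
      the new factor \<open>x\<close>, the other half the remaining polynomial.\<close>
    have "\<exists>C\<ge>0. \<forall>x. \<bar>poly q x\<bar> \<le> C * exp (b / 2 * \<bar>x\<bar>)" if "0 < b" for b and q :: "real poly"
      using that
    proof (induction q arbitrary: b)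
      case 0
      then show ?case by (auto intro: exI[of _ 0])
    next
      case (pCons a q)
      obtain C where C: "0 \<le> C" "\<And>x. \<bar>poly q x\<bar> \<le> C * exp (b / 2 / 2 * \<bar>x\<bar>)" using pCons.IH[of "b / 2"] pCons.prems by auto
      show ?case
      proof (intro exI[of _ "\<bar>a\<bar> + 4 / b * C"] conjI allI)
        show "0 \<le> \<bar>a\<bar> + 4 / b * C" using C pCons.prems by simp
        fix x :: real
        have "b / 4 * \<bar>x\<bar> \<le> exp (b / 4 * \<bar>x\<bar>)" using exp_ge_add_one_self[of "b / 4 * \<bar>x\<bar>"] by linarith
        then have x: "\<bar>x\<bar> \<le> 4 / b * exp (b / 4 * \<bar>x\<bar>)" using pCons.prems by (simp add: field_simps)
        have "\<bar>poly (pCons a q) x\<bar> \<le> \<bar>a\<bar> + \<bar>x\<bar> * \<bar>poly q x\<bar>"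
          by (simp add: abs_mult[symmetric])
        also have "\<bar>x\<bar> * \<bar>poly q x\<bar> \<le> (4 / b * exp (b / 4 * \<bar>x\<bar>)) * (C * exp (b / 2 / 2 * \<bar>x\<bar>))"
          using x C pCons.prems by (intro mult_mono) auto
        also have "\<dots> = 4 / b * C * (exp (b / 4 * \<bar>x\<bar>) * exp (b / 2 / 2 * \<bar>x\<bar>))" by simp
        also have "exp (b / 4 * \<bar>x\<bar>) * exp (b / 2 / 2 * \<bar>x\<bar>) = exp (b / 2 * \<bar>x\<bar>)"
          unfolding mult_exp_exp by (rule arg_cong[of _ _ exp]) simp
        also have "\<bar>a\<bar> \<le> \<bar>a\<bar> * exp (b / 2 * \<bar>x\<bar>)" using pCons.prems by (simp add: mult_le_cancel_left1)
        finally show "\<bar>poly (pCons a q) x\<bar> \<le> (\<bar>a\<bar> + 4 / b * C) * exp (b / 2 * \<bar>x\<bar>)"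
          by (simp add: algebra_simps)
      qed
    qed
    from this[of "2 * b" q] show ?thesis using b by simp
  qed
  then obtain C where C: "0 \<le> C" "\<And>x. \<bar>poly q x\<bar> \<le> C * exp (b * \<bar>x\<bar>)" by blast
  have "(\<integral>\<^sup>+x. ennreal ((K * \<bar>poly q x\<bar> * exp (d * \<bar>x\<bar>)) powr p) \<partial>N) \<le> (\<integral>\<^sup>+x. ennreal ((\<bar>K\<bar> * C) powr p) * ennreal (exp (c * \<bar>x\<bar>)) \<partial>N)"
  proof (rule nn_integral_mono)
    fix x
    have "\<bar>poly q x\<bar> * exp (d * \<bar>x\<bar>) \<le> C * exp (b * \<bar>x\<bar>) * exp (d * \<bar>x\<bar>)"
      by (intro mult_right_mono C) auto
    also have "\<dots> = C * exp (c / p * \<bar>x\<bar>)"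
      by (simp add: mult.assoc mult_exp_exp b_def algebra_simps)
    finally have "\<bar>K\<bar> * (\<bar>poly q x\<bar> * exp (d * \<bar>x\<bar>)) \<le> \<bar>K\<bar> * (C * exp (c / p * \<bar>x\<bar>))"
      by (rule mult_left_mono) simp
    then have "\<bar>K * \<bar>poly q x\<bar> * exp (d * \<bar>x\<bar>)\<bar> \<le> \<bar>K\<bar> * C * exp (c / p * \<bar>x\<bar>)"
      by (simp add: abs_mult mult_ac)
    then have "\<bar>K * \<bar>poly q x\<bar> * exp (d * \<bar>x\<bar>)\<bar> powr p \<le> (\<bar>K\<bar> * C * exp (c / p * \<bar>x\<bar>)) powr p"
      using p by (intro powr_mono2) auto
    also have "\<dots> = (\<bar>K\<bar> * C) powr p * exp (c * \<bar>x\<bar>)"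
      using C p by (simp add: powr_mult exp_powr_real)
    finally have "\<bar>K * \<bar>poly q x\<bar> * exp (d * \<bar>x\<bar>)\<bar> powr p \<le> (\<bar>K\<bar> * C) powr p * exp (c * \<bar>x\<bar>)" .
    moreover have "0 \<le> K * \<bar>poly q x\<bar> * exp (d * \<bar>x\<bar>)" using assms by simp
    ultimately have "(K * \<bar>poly q x\<bar> * exp (d * \<bar>x\<bar>)) powr p \<le> (\<bar>K\<bar> * C) powr p * exp (c * \<bar>x\<bar>)"
      by (simp only: abs_of_nonneg)
    then show "ennreal ((K * \<bar>poly q x\<bar> * exp (d * \<bar>x\<bar>)) powr p) \<le> ennreal ((\<bar>K\<bar> * C) powr p) * ennreal (exp (c * \<bar>x\<bar>))"
      by (simp add: ennreal_mult[symmetric])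
  qed
  also have "\<dots> = ennreal ((\<bar>K\<bar> * C) powr p) * (\<integral>\<^sup>+x. ennreal (exp (c * \<bar>x\<bar>)) \<partial>N)"
    by (rule nn_integral_cmult) measurable
  also have "\<dots> < \<infinity>" using exp_moment by (simp add: ennreal_mult_less_top)
  finally show ?thesis .
qed

text \<open>Cosine and sine at once: what counts is that the coefficients are at most
  \<open>1 / fact n\<close> in modulus and that \<open>\<bar>\<phi>\<bar> \<le> 1\<close>. A Taylor
  polynomial times \<open>q\<close> is again a polynomial, so the approximants lie in the class by
  the assumption on \<open>h\<close>.\<close>

lemma apx_mult_taylor:
  assumes h: "apx_mult h" and x: "0 \<le> \<xi>" "p * \<xi> < c"
    and a: "\<And>x::real. (\<lambda>n. a n *\<^sub>R x ^ n) sums \<phi> x" "\<And>n. \<bar>a n\<bar> \<le> inverse (fact n)"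
    and \<phi>: "continuous_on UNIV \<phi>" "\<And>x. \<bar>\<phi> x\<bar> \<le> 1"
  shows "apx_mult (\<lambda>x. \<phi> (\<xi> * x) * h x)"
  unfolding apx_mult_def
proof (intro conjI allI)
  obtain B where B: "\<And>x. \<bar>h x\<bar> \<le> B" using h by (auto simp: apx_mult_def bounded_iff)
  then have B0: "0 \<le> B" using order_trans[OF abs_ge_zero] by blast
  have [measurable]: "h \<in> borel_measurable borel"
    using h unfolding apx_mult_def by (auto dest!: spec[of _ 1] simp: apx_def)
  have [measurable]: "\<phi> \<in> borel_measurable borel" by (intro borel_measurable_continuous_onI \<phi>)
  have "\<bar>\<phi> (\<xi> * x) * h x\<bar> \<le> 1 * B" for x
    unfolding abs_mult by (intro mult_mono \<phi> B) auto
  then show "bounded (range (\<lambda>x. \<phi> (\<xi> * x) * h x))" by (auto simp: bounded_iff)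
  fix q :: "real poly"
  define Tn where "Tn n = (\<Sum>k<n. monom (a k * \<xi> ^ k) k)" for n
  have Tn: "poly (Tn n) x = (\<Sum>k<n. a k *\<^sub>R (\<xi> * x) ^ k)" for n x
    by (simp add: Tn_def poly_sum poly_monom power_mult_distrib mult.assoc)
  have T_lim: "(\<lambda>n. poly (Tn n) x) \<longlonglongrightarrow> \<phi> (\<xi> * x)" for x
    using a(1)[of "\<xi> * x"] unfolding Tn sums_def .
  have T_bd: "\<bar>poly (Tn n) x\<bar> \<le> exp (\<xi> * \<bar>x\<bar>)" for n x
  proof -
    have "\<bar>poly (Tn n) x\<bar> \<le> (\<Sum>k<n. (\<xi> * \<bar>x\<bar>) ^ k /\<^sub>R fact k)"
      unfolding Tn using x(1)
      by (intro order_trans[OF sum_abs] sum_mono)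
        (auto simp: abs_mult power_abs mult.commute[of _ "inverse _"] intro!: mult_mono a(2))
    also have "\<dots> \<le> exp (\<xi> * \<bar>x\<bar>)"
      unfolding exp_def using x(1) by (intro sum_le_suminf summable_exp_generic) auto
    finally show ?thesis .
  qed
  show "apx (\<lambda>x. \<phi> (\<xi> * x) * h x * poly q x)"
  proof (rule apx_limit[where g = "\<lambda>n x. h x * poly (Tn n * q) x" and G = "\<lambda>x. (2 * B) * \<bar>poly q x\<bar> * exp (\<xi> * \<bar>x\<bar>)"])
    show "apx (\<lambda>x. h x * poly (Tn n * q) x)" for n using h by (auto simp: apx_mult_def simp del: poly_mult)
    show "AE x in N. (\<lambda>n. h x * poly (Tn n * q) x) \<longlonglongrightarrow> \<phi> (\<xi> * x) * h x * poly q x"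
      by (intro AE_I2) (auto intro!: tendsto_eq_intros T_lim)
    show "\<bar>\<phi> (\<xi> * x) * h x * poly q x - h x * poly (Tn n * q) x\<bar> \<le> (2 * B) * \<bar>poly q x\<bar> * exp (\<xi> * \<bar>x\<bar>)" for n x
    proof -
      have "\<bar>\<phi> (\<xi> * x) * h x * poly q x - h x * poly (Tn n * q) x\<bar> = \<bar>h x\<bar> * \<bar>poly q x\<bar> * \<bar>\<phi> (\<xi> * x) - poly (Tn n) x\<bar>"
        by (simp add: abs_mult[symmetric] algebra_simps)
      also have "\<dots> \<le> B * \<bar>poly q x\<bar> * (2 * exp (\<xi> * \<bar>x\<bar>))"
      proof (intro mult_mono B)
        have "1 \<le> exp (\<xi> * \<bar>x\<bar>)" using x(1) by simp
        then show "\<bar>\<phi> (\<xi> * x) - poly (Tn n) x\<bar> \<le> 2 * exp (\<xi> * \<bar>x\<bar>)"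
          using T_bd[of n x] \<phi>(2)[of "\<xi> * x"] by linarith
      qed (use B0 in auto)
      finally show ?thesis by (simp add: mult_ac)
    qed
    show "(\<integral>\<^sup>+x. ennreal (((2 * B) * \<bar>poly q x\<bar> * exp (\<xi> * \<bar>x\<bar>)) powr p) \<partial>N) < \<infinity>"
      by (rule poly_exp_moment) (use x B0 in auto)
  qed measurable
qed

text \<open>A real-linear function on the complex plane is a combination of \<open>Re\<close> and
  \<open>Im\<close>, which yields cosine and sine. The function \<open>h\<close> stays arbitrary
  because a product \<open>f * g\<close> is treated by applying the claim for \<open>f\<close> to
  \<open>g\<close> times \<open>h\<close>.\<close>

lemma apx_mult_trig:
  assumes x: "0 \<le> \<xi>" "p * \<xi> < c" and g: "real_polynomial_function (g :: complex \<Rightarrow> real)"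
  shows "apx_mult h \<Longrightarrow> apx_mult (\<lambda>x. g (cis (\<xi> * x)) * h x)"
  using g
proof (induction arbitrary: h)
  case (linear f)
  have "f z = f 1 * Re z + f \<i> * Im z" for z
  proof -
    have "z = Re z *\<^sub>R 1 + Im z *\<^sub>R \<i>" by (simp add: complex_eq_iff)
    then have "f z = f (Re z *\<^sub>R 1 + Im z *\<^sub>R \<i>)" by simp
    also have "\<dots> = Re z * f 1 + Im z * f \<i>"
      using linear(1) by (simp add: bounded_linear.linear linear_add linear_scale)
    finally show ?thesis by (simp add: mult.commute)
  qed
  note feq = this
  have eq: "f (cis (\<xi> * x)) * h x = f 1 * (cos (\<xi> * x) * h x) + f \<i> * (sin (\<xi> * x) * h x)" for x
    using feq[of "cis (\<xi> * x)"] by (simp add: algebra_simps)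
  have "apx_mult (\<lambda>x. cos (\<xi> * x) * h x)"
    by (rule apx_mult_taylor[OF linear(2) x cos_converges]) (auto simp: cos_coeff_def power_abs field_simps intro!: continuous_intros)
  moreover have "apx_mult (\<lambda>x. sin (\<xi> * x) * h x)"
    by (rule apx_mult_taylor[OF linear(2) x sin_converges]) (auto simp: sin_coeff_def power_abs field_simps intro!: continuous_intros)
  ultimately show ?case
    unfolding eq by (intro apx_mult_add apx_mult_scale)
next
  case (const a)
  then show ?case by (rule apx_mult_scale)
next
  case (add f g)
  then show ?case by (simp add: distrib_right apx_mult_add)
next
  case (mult f g)
  then show ?case by (simp add: mult.assoc)
qed

lemma apx_mult_one: "apx_mult (\<lambda>x. 1)"
  using apx_poly by (simp add: apx_mult_def)

text \<open>Stone--Weierstrass on the unit circle approximates \<open>f\<close> on one period of \<open>cis (\<xi> * x)\<close>; letting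
  \<open>\<xi>\<close> tend to 0 exhausts the line.\<close>

lemma apx_compact_support:
  assumes f: "continuous_on UNIV f" and R: "0 < R" "\<And>x. R \<le> \<bar>x\<bar> \<Longrightarrow> f x = 0" and B: "\<And>x. \<bar>f x\<bar> \<le> B"
  shows "apx f"
proof -
  \<comment> \<open>The first entry keeps \<open>p * \<xi>0\<close> below \<open>c\<close>, as the
    trigonometric step requires; the second keeps the support of \<open>f\<close>, rescaled by
    \<open>\<xi>0\<close>, within \<open>[-1, 1]\<close> and hence well inside one period.\<close>
  define \<xi>0 where "\<xi>0 = min (c / (2 * p)) (1 / R)"
  have \<xi>0: "0 < \<xi>0" "p * \<xi>0 < c" "\<xi>0 * R \<le> 1"
  proof -
    show "0 < \<xi>0" using p c R by (simp add: \<xi>0_def)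
    have "\<xi>0 \<le> c / (2 * p)" by (simp add: \<xi>0_def)
    then have "p * \<xi>0 \<le> c / 2" using p by (simp add: field_simps)
    then show "p * \<xi>0 < c" using c by simp
    have "\<xi>0 \<le> 1 / R" by (simp add: \<xi>0_def)
    then show "\<xi>0 * R \<le> 1" using R(1) by (simp add: field_simps)
  qed
  define \<xi> where "\<xi> n = \<xi>0 / (real n + 1)" for n
  have le: "\<xi> n \<le> \<xi>0" for n using \<xi>0(1) by (simp add: \<xi>_def field_simps)
  have \<xi>: "0 < \<xi> n" "p * \<xi> n < c" "\<xi> n * R < 3" for n
  proof -
    show "0 < \<xi> n" using \<xi>0 by (simp add: \<xi>_def)
    show "p * \<xi> n < c" using mult_left_mono[OF le[of n], of p] p \<xi>0(2) by linarith
    show "\<xi> n * R < 3" using mult_right_mono[OF le[of n], of R] R(1) \<xi>0(3) by linarith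
  qed
  have B0: "0 \<le> B" using B[of 0] by simp
  have "\<exists>g. real_polynomial_function g \<and> (\<forall>z\<in>sphere 0 1. \<bar>f (Arg z / \<xi> n) - g z\<bar> < 1 / (real n + 1))" for n
  proof -
    have pi3: "\<xi> n * R < pi" "0 < \<xi> n * R" using \<xi>[of n] R(1) pi_gt3 by auto
    have "continuous_on (sphere 0 1) (\<lambda>z. f (Arg z / \<xi> n))"
    proof (rule continuous_on_eq_continuous_within[THEN iffD2], rule ballI)
      fix z :: complex assume z: "z \<in> sphere 0 1"
      show "continuous (at z within sphere 0 1) (\<lambda>z. f (Arg z / \<xi> n))"
      proof (cases "z \<in> \<real>\<^sub>\<le>\<^sub>0")
        case False
        have fc: "isCont f w" for w using f by (simp add: continuous_on_eq_continuous_at)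
        have "isCont (\<lambda>z. Arg z / \<xi> n) z"
          by (rule isCont_divide[OF continuous_at_Arg[OF False] continuous_const]) (use \<xi>(1)[of n] in simp)
        then have "isCont (\<lambda>z. f (Arg z / \<xi> n)) z" by (rule isCont_o2[OF _ fc])
        then show ?thesis by (rule continuous_at_imp_continuous_within)
      next
        case True
        then have z1: "z = - 1" using z by (auto elim!: nonpos_Reals_cases)
        \<comment> \<open>\<open>Arg\<close> jumps only at -1. The open condition on
          \<open>Re w\<close> says that the modulus of \<open>Arg w\<close> exceeds
          \<open>\<xi> n * R\<close>, where \<open>f\<close> vanishes, so the jump is
          invisible.\<close>
        have zero: "f (Arg w / \<xi> n) = 0" if w: "w \<in> sphere 0 1" "Re w < cos (\<xi> n * R)" for w
        proof -
          have "w = cis (Arg w)" using cis_Arg[of w] w(1) by (cases "w = 0") (auto simp: sgn_eq)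
          then have "Re w = cos \<bar>Arg w\<bar>" by (metis cis.sel(1) cos_abs_real)
          then have "\<xi> n * R < \<bar>Arg w\<bar>"
            using w(2) cos_mono_less_eq[of "\<bar>Arg w\<bar>" "\<xi> n * R"] pi3 Arg_bounded[of w] by auto
          then have "R \<le> \<bar>Arg w / \<xi> n\<bar>" using \<xi>(1)[of n] by (simp add: field_simps)
          then show ?thesis by (rule R(2))
        qed
        have c1: "- 1 < cos (\<xi> n * R)" using cos_monotone_0_pi[of "\<xi> n * R" pi] pi3 by simp
        have "eventually (\<lambda>w. Re w < cos (\<xi> n * R)) (nhds z)"
          using c1 z1 by (intro order_tendstoD(2)[OF tendsto_Re[OF filterlim_ident]]) auto
        then have "eventually (\<lambda>w. f (Arg w / \<xi> n) = 0) (at z within sphere 0 1)"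
          unfolding eventually_at_filter by (rule eventually_mono) (use zero in blast)
        moreover have "f (Arg z / \<xi> n) = 0" by (rule zero) (use z z1 c1 in auto)
        ultimately show ?thesis
          unfolding continuous_within by (simp add: tendsto_eventually)
      qed
    qed
    then obtain g where "real_polynomial_function g" "\<And>z. z \<in> sphere 0 1 \<Longrightarrow> \<bar>f (Arg z / \<xi> n) - g z\<bar> < 1 / (real n + 1)"
      by (rule Stone_Weierstrass_real_polynomial_function[where e = "1 / (real n + 1)", OF compact_sphere]) (simp, rule that)
    then show ?thesis by blast
  qed
  then obtain g where g: "\<And>n. real_polynomial_function (g n)"
    "\<And>n z. z \<in> sphere 0 1 \<Longrightarrow> \<bar>f (Arg z / \<xi> n) - g n z\<bar> < 1 / (real n + 1)"
    by metis
  define t where "t n x = g n (cis (\<xi> n * x))" for n x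
  have apx_t: "apx (t n)" for n
  proof -
    have "apx_mult (\<lambda>x. g n (cis (\<xi> n * x)) * 1)"
      by (rule apx_mult_trig[OF _ \<xi>(2) g(1) apx_mult_one]) (use \<xi>(1)[of n] in simp)
    then show ?thesis unfolding apx_mult_def by (auto dest!: spec[of _ 1] simp: t_def[abs_def])
  qed
  have t_close: "\<bar>f x - t n x\<bar> < 1 / (real n + 1)" if "\<bar>\<xi> n * x\<bar> < pi" for n x
  proof -
    have "Arg (cis (\<xi> n * x)) = \<xi> n * x" using that by (intro Arg_cis) auto
    then show ?thesis using g(2)[of "cis (\<xi> n * x)" n] \<xi>(1)[of n] by (simp add: t_def)
  qed
  \<comment> \<open>Outside the central period \<open>t n\<close> repeats itself and need not be
    close to \<open>f\<close>; a uniform bound is all that dominated convergence asks there.\<close>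
  have t_bd: "\<bar>f x - t n x\<bar> \<le> 2 * B + 1" for n x
  proof -
    have "\<bar>f (Arg (cis (\<xi> n * x)) / \<xi> n) - t n x\<bar> < 1 / (real n + 1)"
      unfolding t_def by (intro g(2)) simp
    moreover have "1 / (real n + 1) \<le> 1" by simp
    ultimately show ?thesis using B[of x] B[of "Arg (cis (\<xi> n * x)) / \<xi> n"] by linarith
  qed
  show ?thesis
  proof (rule apx_limit[where g = t and G = "\<lambda>x. 2 * B + 1"])
    show "f \<in> borel_measurable borel" by (intro borel_measurable_continuous_onI f)
    show "apx (t n)" for n by (rule apx_t)
    show "AE x in N. (\<lambda>n. t n x) \<longlonglongrightarrow> f x"
    proof (rule AE_I2)
      fix x
      have "(\<lambda>n. \<xi>0 * x * inverse (real (Suc n))) \<longlonglongrightarrow> 0"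
        by (rule tendsto_mult_right_zero[OF LIMSEQ_inverse_real_of_nat])
      then have "(\<lambda>n. \<bar>\<xi> n * x\<bar>) \<longlonglongrightarrow> 0"
        by (intro tendsto_rabs_zero) (simp add: \<xi>_def divide_inverse mult_ac add.commute)
      then have ev: "eventually (\<lambda>n. \<bar>\<xi> n * x\<bar> < pi) sequentially"
        by (rule order_tendstoD(2)) simp
      have "eventually (\<lambda>n. norm (t n x - f x) \<le> inverse (real (Suc n))) sequentially"
        using ev
      proof eventually_elim
        fix n assume "\<bar>\<xi> n * x\<bar> < pi"
        from t_close[OF this] show "norm (t n x - f x) \<le> inverse (real (Suc n))"
          by (simp add: abs_minus_commute inverse_eq_divide add.commute)
      qed
      then have "(\<lambda>n. t n x - f x) \<longlonglongrightarrow> 0"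
        by (rule Lim_null_comparison[OF _ LIMSEQ_inverse_real_of_nat])
      then show "(\<lambda>n. t n x) \<longlonglongrightarrow> f x" by (rule LIM_zero_cancel)
    qed
    show "\<bar>f x - t n x\<bar> \<le> 2 * B + 1" for n x by (rule t_bd)
    show "(\<integral>\<^sup>+x. ennreal ((2 * B + 1) powr p) \<partial>N) < \<infinity>"
      by (simp add: emeasure_eq_measure ennreal_mult[symmetric])
  qed simp
qed

text \<open>A Lebesgue measurable function is almost everywhere a limit of continuous ones.
  Truncation to \<open>[- B, B]\<close> and a cut-off equal to 1 for
  \<open>\<bar>x\<bar> \<le> real n\<close> give them compact support and a common bound without
  changing the limit.\<close>

lemma apx_bounded:
  assumes [measurable]: "f \<in> borel_measurable borel" and B: "\<And>x. \<bar>f x\<bar> \<le> B"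
  shows "apx f"
proof -
  have B0: "0 \<le> B" using B[of 0] by simp
  have "f measurable_on UNIV"
    by (rule lebesgue_measurable_imp_measurable_on_real) (auto intro: measurable_completion)
  then obtain Z g where Z: "negligible Z" and g: "\<And>n. continuous_on UNIV (g n)"
    "\<And>x. x \<notin> Z \<Longrightarrow> (\<lambda>n. g n x) \<longlonglongrightarrow> f x"
    unfolding measurable_on_def by auto
  define h where "h n x = max 0 (min 1 (real n + 1 - \<bar>x\<bar>)) * max (- B) (min B (g n x))" for n x
  have hB: "\<bar>h n x\<bar> \<le> B" for n x
  proof -
    have "\<bar>h n x\<bar> \<le> 1 * B"
      unfolding h_def abs_mult using B0 by (intro mult_mono) auto
    then show ?thesis by simp
  qed
  have "AE x in lebesgue. x \<notin> Z" using Z by (intro AE_not_in) (simp add: negligible_iff_null_sets)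
  then have "AE x in lborel. x \<notin> Z" by (simp add: AE_completion_iff)
  then have Zae: "AE x in N. x \<notin> Z" by (rule ac)
  show ?thesis
  proof (rule apx_limit[where g = h and G = "\<lambda>x. 2 * B"])
    show "apx (h n)" for n
      by (rule apx_compact_support[where R = "real n + 1" and B = B])
        (use hB in \<open>auto simp: h_def[abs_def] intro!: continuous_intros g\<close>)
    show "AE x in N. (\<lambda>n. h n x) \<longlonglongrightarrow> f x"
      using Zae
    proof eventually_elim
      fix x assume "x \<notin> Z"
      then have "(\<lambda>n. max 0 (min 1 (real n + 1 - \<bar>x\<bar>)) * max (- B) (min B (g n x))) \<longlonglongrightarrow> 1 * max (- B) (min B (f x))"
      proof (intro tendsto_mult tendsto_max tendsto_min tendsto_const g(2))
        have "eventually (\<lambda>n. max 0 (min 1 (real n + 1 - \<bar>x\<bar>)) = 1) sequentially"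
          using eventually_ge_at_top[of "nat \<lceil>\<bar>x\<bar>\<rceil>"]
        proof eventually_elim
          fix n assume "nat \<lceil>\<bar>x\<bar>\<rceil> \<le> n"
          then have "\<bar>x\<bar> \<le> real n" by linarith
          then show "max 0 (min 1 (real n + 1 - \<bar>x\<bar>)) = 1" by simp
        qed
        then show "(\<lambda>n. max 0 (min 1 (real n + 1 - \<bar>x\<bar>))) \<longlonglongrightarrow> 1" by (rule tendsto_eventually)
      qed
      moreover have "max (- B) (min B (f x)) = f x" using B[of x] by (auto simp: max_def min_def abs_le_iff)
      ultimately show "(\<lambda>n. h n x) \<longlonglongrightarrow> f x" by (simp add: h_def)
    qed
    show "\<bar>f x - h n x\<bar> \<le> 2 * B" for n x using B[of x] hB[of n x] by linarith
    show "(\<integral>\<^sup>+x. ennreal ((2 * B) powr p) \<partial>N) < \<infinity>"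
      by (simp add: emeasure_eq_measure ennreal_mult[symmetric])
  qed simp_all
qed

text \<open>Truncation at height \<open>n\<close> reduces to the bounded case; the truncation error
  is dominated by \<open>\<bar>f\<bar>\<close> itself.\<close>

theorem polynomials_dense:
  assumes [measurable]: "f \<in> borel_measurable borel" and f: "(\<integral>\<^sup>+x. ennreal (\<bar>f x\<bar> powr p) \<partial>N) < \<infinity>" and e: "0 < \<epsilon>"
  shows "\<exists>q::real poly. (\<integral>\<^sup>+x. ennreal (\<bar>f x - poly q x\<bar> powr p) \<partial>N) < ennreal \<epsilon>"
proof -
  define g where "g n x = max (- real n) (min (real n) (f x))" for n x
  have [measurable]: "g n \<in> borel_measurable borel" for n unfolding g_def by measurable
  have "apx f"
  proof (rule apx_limit[where g = g and G = "\<lambda>x. \<bar>f x\<bar>"])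
    show "apx (g n)" for n by (rule apx_bounded[where B = "real n"]) (auto simp: g_def)
    show "AE x in N. (\<lambda>n. g n x) \<longlonglongrightarrow> f x"
    proof (rule AE_I2, rule tendsto_eventually)
      fix x
      show "eventually (\<lambda>n. g n x = f x) sequentially"
        using eventually_ge_at_top[of "nat \<lceil>\<bar>f x\<bar>\<rceil>"]
      proof eventually_elim
        fix n assume "nat \<lceil>\<bar>f x\<bar>\<rceil> \<le> n"
        then have "\<bar>f x\<bar> \<le> real n" by linarith
        then show "g n x = f x" by (auto simp: g_def max_def min_def)
      qed
    qed
    show "\<bar>f x - g n x\<bar> \<le> \<bar>f x\<bar>" for n x by (auto simp: g_def max_def min_def)
  qed (use f in auto)
  then show ?thesis using e by (auto simp: apx_def)
qed

end

subsection \<open>Convergence of orthogonal polynomials\<close>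

definition linear_functional :: "(real poly \<Rightarrow> real) \<Rightarrow> bool"
  where "linear_functional \<Lambda> \<longleftrightarrow> (\<forall>p q. \<Lambda> (p + q) = \<Lambda> p + \<Lambda> q) \<and> (\<forall>c p. \<Lambda> (smult c p) = c * \<Lambda> p)"

lemma linear_functional_sum:
  assumes "linear_functional \<Lambda>"
  shows "\<Lambda> (\<Sum>i\<in>A. smult (c i) (p i)) = (\<Sum>i\<in>A. c i * \<Lambda> (p i))"
proof -
  have "\<Lambda> 0 = 0" using assms unfolding linear_functional_def by (metis mult_zero_left smult_0_left)
  then show ?thesis
    using assms by (induction A rule: infinite_finite_induct) (auto simp: linear_functional_def)
qed

definition orthogonal_polys :: "(real poly \<Rightarrow> real) \<Rightarrow> (nat \<Rightarrow> real poly) \<Rightarrow> bool"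
  where "orthogonal_polys \<Lambda> E \<longleftrightarrow> linear_functional \<Lambda> \<and> (\<forall>k. degree (E k) = k \<and> E k \<noteq> 0) \<and>
    (\<forall>j k. j \<noteq> k \<longrightarrow> \<Lambda> (E j * E k) = 0) \<and> (\<forall>k. \<Lambda> (E k * E k) \<noteq> 0)"

lemma orthogonal_polys_expansion:
  assumes E: "orthogonal_polys \<Lambda> E"
  shows "degree p < n \<Longrightarrow> p = (\<Sum>k<n. smult (\<Lambda> (p * E k) / \<Lambda> (E k * E k)) (E k))"
proof -
  \<comment> \<open>The alternative \<open>p = 0\<close> covers the empty sum and the case in which
    subtracting the leading term leaves nothing.\<close>
  have span: "\<exists>c. p = (\<Sum>k<n. smult (c k) (E k))" if "degree p < n \<or> p = 0" for p n
    using that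
  proof (induction n arbitrary: p)
    case (Suc n)
    define a where "a = coeff p n / coeff (E n) n"
    have "E n \<noteq> 0" and dE: "degree (E n) = n" using E by (auto simp: orthogonal_polys_def)
    then have lc: "coeff (E n) n \<noteq> 0" "degree (E n) = n" using leading_coeff_0_iff[of "E n"] by auto
    have "degree (p - smult a (E n)) < n \<or> p - smult a (E n) = 0"
    proof (cases "p - smult a (E n) = 0")
      case False
      have "degree (p - smult a (E n)) \<le> n"
        using Suc.prems lc by (intro degree_diff_le) (auto intro: order_trans[OF degree_smult_le])
      moreover have "coeff (p - smult a (E n)) n = 0" using lc by (simp add: a_def)
      ultimately show ?thesis using False by (metis leading_coeff_0_iff nat_less_le)
    qed simp
    then obtain c where "p - smult a (E n) = (\<Sum>k<n. smult (c k) (E k))" using Suc.IH by blast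
    then have "p = (\<Sum>k<Suc n. smult ((c(n := a)) k) (E k))"
      by (simp add: algebra_simps)
    then show ?case by blast
  qed auto
  assume "degree p < n"
  then obtain c where c: "p = (\<Sum>k<n. smult (c k) (E k))" using span by blast
  have "\<Lambda> (p * E j) = c j * \<Lambda> (E j * E j)" if j: "j < n" for j
  proof -
    have "\<Lambda> (p * E j) = \<Lambda> (\<Sum>k<n. smult (c k) (E k * E j))" by (simp add: c sum_distrib_right)
    also have "\<dots> = (\<Sum>k<n. c k * \<Lambda> (E k * E j))" by (rule linear_functional_sum) (use E in \<open>simp add: orthogonal_polys_def\<close>)
    also have "\<dots> = (\<Sum>k<n. if k = j then c j * \<Lambda> (E j * E j) else 0)"
      by (rule sum.cong) (use E in \<open>auto simp: orthogonal_polys_def\<close>)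
    finally show ?thesis using j by simp
  qed
  then have cj: "c j = \<Lambda> (p * E j) / \<Lambda> (E j * E j)" if "j < n" for j
    using that E by (simp add: orthogonal_polys_def)
  show "p = (\<Sum>k<n. smult (\<Lambda> (p * E k) / \<Lambda> (E k * E k)) (E k))"
    by (rule trans[OF c], rule sum.cong) (simp_all only: lessThan_iff cj)
qed

text \<open>In terms of coefficients and moments both sides are double sums whose ranges are fixed
  by the uniform degree bounds, so termwise convergence suffices.\<close>

lemma functional_prod_tendsto:
  assumes lin: "\<And>n::nat. linear_functional (\<Lambda>s n)" "linear_functional \<Lambda>"
    and conv: "\<And>p. (\<lambda>n. \<Lambda>s n p) \<longlonglongrightarrow> \<Lambda> p"
    and P: "\<And>i. (\<lambda>n. coeff (P n) i) \<longlonglongrightarrow> coeff P' i" "\<And>n. degree (P n) \<le> d" "degree P' \<le> d"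
    and Q: "\<And>i. (\<lambda>n. coeff (Q n) i) \<longlonglongrightarrow> coeff Q' i" "\<And>n. degree (Q n) \<le> d'" "degree Q' \<le> d'"
  shows "(\<lambda>n. \<Lambda>s n (P n * Q n)) \<longlonglongrightarrow> \<Lambda> (P' * Q')"
proof -
  have expand: "L (p * q) = (\<Sum>i\<le>d. coeff p i * (\<Sum>j\<le>d'. coeff q j * L (monom 1 (i + j))))"
    if "linear_functional L" "degree p \<le> d" "degree q \<le> d'" for L and p q :: "real poly"
  proof -
    have "p = (\<Sum>i\<le>d. smult (coeff p i) (monom 1 i))" "q = (\<Sum>i\<le>d'. smult (coeff q i) (monom 1 i))"
      using poly_as_sum_of_monoms'[OF that(2)] poly_as_sum_of_monoms'[OF that(3)] by (simp_all add: smult_monom)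
    then have pe: "p = (\<Sum>i\<le>d. smult (coeff p i) (monom 1 i))" and qe: "q = (\<Sum>i\<le>d'. smult (coeff q i) (monom 1 i))" .
    have mon: "L (monom 1 i * q) = (\<Sum>j\<le>d'. coeff q j * L (monom 1 (i + j)))" for i
    proof -
      have "L (monom 1 i * q) = L (\<Sum>j\<le>d'. smult (coeff q j) (monom 1 (i + j)))"
        by (rule arg_cong[of _ _ L], subst qe) (simp add: sum_distrib_left mult_monom)
      also have "\<dots> = (\<Sum>j\<le>d'. coeff q j * L (monom 1 (i + j)))" by (rule linear_functional_sum[OF that(1)])
      finally show ?thesis .
    qed
    have "L (p * q) = L (\<Sum>i\<le>d. smult (coeff p i) (monom 1 i * q))"
      by (rule arg_cong[of _ _ L], subst pe) (simp add: sum_distrib_right)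
    also have "\<dots> = (\<Sum>i\<le>d. coeff p i * L (monom 1 i * q))" by (rule linear_functional_sum[OF that(1)])
    also have "\<dots> = (\<Sum>i\<le>d. coeff p i * (\<Sum>j\<le>d'. coeff q j * L (monom 1 (i + j))))"
      by (simp only: mon)
    finally show ?thesis .
  qed
  have "(\<lambda>n. \<Sum>i\<le>d. coeff (P n) i * (\<Sum>j\<le>d'. coeff (Q n) j * \<Lambda>s n (monom 1 (i + j)))) \<longlonglongrightarrow>
    (\<Sum>i\<le>d. coeff P' i * (\<Sum>j\<le>d'. coeff Q' j * \<Lambda> (monom 1 (i + j))))"
    by (intro tendsto_sum tendsto_mult P Q conv)
  then show ?thesis by (simp add: expand[OF lin(1) P(2) Q(2)] expand[OF lin(2) P(3) Q(3)])
qed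

text \<open>Both polynomials are monic, so \<open>E k - En n k\<close> has lower degree and is a
  combination of the \<open>En n j\<close> with \<open>j < k\<close>. Its coefficients tend to
  \<open>\<Lambda> (E k * E j) / \<Lambda> (E j * E j) = 0\<close> by the induction hypothesis for
  the smaller indices.\<close>

lemma orthogonal_polys_tendsto:
  assumes E: "orthogonal_polys \<Lambda> E" "\<And>k. lead_coeff (E k) = 1"
    and En: "\<And>n::nat. orthogonal_polys (\<Lambda>s n) (En n)" "\<And>n k. lead_coeff (En n k) = 1"
    and conv: "\<And>p. (\<lambda>n. \<Lambda>s n p) \<longlonglongrightarrow> \<Lambda> p"
  shows "(\<lambda>n. coeff (En n k) i) \<longlonglongrightarrow> coeff (E k) i"
proof (induction k arbitrary: i rule: less_induct)
  case (less k)
  have lin: "linear_functional (\<Lambda>s n)" "linear_functional \<Lambda>" for n using E En by (auto simp: orthogonal_polys_def)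
  have deg: "degree (En n k) = k" "degree (E k) = k" for n k using E En by (auto simp: orthogonal_polys_def)
  define d where "d n j = \<Lambda>s n (E k * En n j) / \<Lambda>s n (En n j * En n j)" for n j
  have d: "(\<lambda>n. d n j) \<longlonglongrightarrow> 0" if j: "j < k" for j
  proof -
    have "(\<lambda>n. d n j) \<longlonglongrightarrow> \<Lambda> (E k * E j) / \<Lambda> (E j * E j)"
      unfolding d_def
    proof (rule tendsto_divide)
      show "(\<lambda>n. \<Lambda>s n (E k * En n j)) \<longlonglongrightarrow> \<Lambda> (E k * E j)"
        by (rule functional_prod_tendsto[where d = k and d' = j]) (use lin conv less.IH[OF j] deg in auto)
      show "(\<lambda>n. \<Lambda>s n (En n j * En n j)) \<longlonglongrightarrow> \<Lambda> (E j * E j)"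
        by (rule functional_prod_tendsto[where d = j and d' = j]) (use lin conv less.IH[OF j] deg in auto)
      show "\<Lambda> (E j * E j) \<noteq> 0" using E by (simp add: orthogonal_polys_def)
    qed
    moreover have "\<Lambda> (E k * E j) = 0" using E j by (auto simp: orthogonal_polys_def)
    ultimately show ?thesis by simp
  qed
  have eq: "coeff (En n k) i = coeff (E k) i - (\<Sum>j<k. d n j * coeff (En n j) i)" for n
  proof (cases "k = 0")
    case True
    have "degree (En n 0) = 0" "lead_coeff (En n 0) = 1" "degree (E 0) = 0" "lead_coeff (E 0) = 1" using deg E En by auto
    then have "En n 0 = 1" "E 0 = 1" by (metis degree_0_id of_nat_0 one_pCons degree_eq_zeroE lead_coeff_pCons(2) pCons_0_0 coeff_pCons_0)+
    then show ?thesis using True by simp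
  next
    case False
    define p where "p = E k - En n k"
    have "degree p < k"
    proof (cases "p = 0")
      case p0: False
      have "degree p \<le> k" unfolding p_def by (intro degree_diff_le) (simp_all add: deg)
      moreover have "coeff p k = 0" using E(2)[of k] En(2)[of n k] by (simp add: p_def deg)
      ultimately show ?thesis using p0 by (metis leading_coeff_0_iff nat_less_le)
    qed (use False in simp)
    from orthogonal_polys_expansion[OF En(1)[of n] this]
    have "p = (\<Sum>j<k. smult (\<Lambda>s n (p * En n j) / \<Lambda>s n (En n j * En n j)) (En n j))" .
    moreover have "\<Lambda>s n (p * En n j) = \<Lambda>s n (E k * En n j)" if "j < k" for j
    proof -
      have "\<Lambda>s n (E k * En n j) = \<Lambda>s n (p * En n j + En n k * En n j)" by (simp add: p_def algebra_simps)
      also have "\<dots> = \<Lambda>s n (p * En n j)" using lin(1)[of n] En(1)[of n] that by (auto simp: linear_functional_def orthogonal_polys_def)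
      finally show ?thesis by simp
    qed
    ultimately have "p = (\<Sum>j<k. smult (d n j) (En n j))" by (simp add: d_def)
    then have "coeff p i = (\<Sum>j<k. d n j * coeff (En n j) i)" by (simp add: coeff_sum)
    then show ?thesis by (simp add: p_def)
  qed
  have "(\<lambda>n. coeff (E k) i - (\<Sum>j<k. d n j * coeff (En n j) i)) \<longlonglongrightarrow> coeff (E k) i - (\<Sum>j<k. 0 * coeff (E j) i)"
    by (intro tendsto_intros d less.IH) auto
  then show ?case by (simp add: eq)
qed

lemma poly_tendsto_of_coeff:
  assumes "\<And>i. (\<lambda>n. coeff (P n) i) \<longlonglongrightarrow> coeff P' i" "\<And>n::nat. degree (P n) \<le> d" "degree P' \<le> d"
  shows "(\<lambda>n. poly (P n) (z::real)) \<longlonglongrightarrow> poly P' z"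
proof -
  have "poly q z = (\<Sum>i\<le>d. coeff q i * z ^ i)" if "degree q \<le> d" for q
    unfolding poly_altdef using that
    by (intro sum.mono_neutral_left) (auto simp: coeff_eq_0)
  then show ?thesis using assms by (simp add: tendsto_intros)
qed

section \<open>The quadratic form under limits and rescaling\<close>

lemma g_form_tendsto:
  assumes "\<And>k. k \<in> {1..N} \<Longrightarrow> (\<lambda>n. lams n k) \<longlonglongrightarrow> lam k" "\<And>k. k \<in> {1..N} \<Longrightarrow> 0 < lam k"
    and "\<And>k. k \<in> {1..N} \<Longrightarrow> (\<lambda>n. as n k) \<longlonglongrightarrow> a k" "\<And>k. k \<in> {1..N} \<Longrightarrow> (\<lambda>n::nat. bs n k) \<longlonglongrightarrow> b k" "ws \<longlonglongrightarrow> w"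
  shows "(\<lambda>n. g_form N (lams n) (as n) (bs n) (ws n)) \<longlonglongrightarrow> g_form N lam a b w"
  unfolding g_form_def
proof (intro tendsto_sum tendsto_divide)
  fix k l assume k: "k \<in> {1..N}" and l: "l \<in> {1..N}"
  show "(\<lambda>n. sqrt (lams n k) * sqrt (lams n l) * as n k * as n l + ws n * bs n k * bs n l)
         \<longlonglongrightarrow> sqrt (lam k) * sqrt (lam l) * a k * a l + w * b k * b l"
    using k l assms by (intro tendsto_intros) auto
  show "(\<lambda>n. (sqrt (lams n k) + sqrt (lams n l))\<^sup>2) \<longlonglongrightarrow> (sqrt (lam k) + sqrt (lam l))\<^sup>2"
    using k l assms by (intro tendsto_intros) auto
  have "0 < sqrt (lam k) + sqrt (lam l)" using assms(2)[OF k] assms(2)[OF l] by (simp add: add_pos_pos)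
  then show "(sqrt (lam k) + sqrt (lam l))\<^sup>2 \<noteq> 0" by simp
qed

text \<open>Dividing the eigenvalues by \<open>\<theta>\<close> divides the denominators and the
  time terms alike. In the use below \<open>b k\<close> is a derivative with respect to
  \<open>z\<close>, where \<open>x\<close> is affine in \<open>z\<close> with slope
  \<open>c\<close>; the factor \<open>c\<^sup>2\<close> in the weight undoes the chain rule.\<close>

lemma g_form_scale:
  assumes th: "0 < \<theta>" and lam: "\<And>k. 1 \<le> k \<Longrightarrow> 0 < lam k"
  shows "g_form N (\<lambda>k. lam k / \<theta>) a b (w / (c\<^sup>2 * \<theta>)) = g_form N lam a (\<lambda>k. b k / c) w"
  unfolding g_form_def
proof (intro sum.cong refl)
  fix k l assume "k \<in> {1..N}" "l \<in> {1..N}"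
  then have "0 < sqrt (lam k)" "0 < sqrt (lam l)" using lam by auto
  then have pos: "0 < (sqrt (lam k) + sqrt (lam l))\<^sup>2" by (intro zero_less_power add_pos_pos)
  have "(sqrt (lam k / \<theta>) + sqrt (lam l / \<theta>))\<^sup>2 = (sqrt (lam k) + sqrt (lam l))\<^sup>2 / \<theta>"
    using th by (simp add: real_sqrt_divide add_divide_distrib[symmetric] power_divide)
  moreover have "sqrt (lam k / \<theta>) * sqrt (lam l / \<theta>) = sqrt (lam k) * sqrt (lam l) / \<theta>"
    using th by (simp add: real_sqrt_divide)
  moreover have "X / \<theta> * a k * a l + w / (c\<^sup>2 * \<theta>) * b k * b l = (X * a k * a l + w * (b k / c) * (b l / c)) / \<theta>" for X
    by (simp add: add_divide_distrib power2_eq_square mult.assoc)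
  ultimately show "(sqrt (lam k / \<theta>) * sqrt (lam l / \<theta>) * a k * a l + w / (c\<^sup>2 * \<theta>) * b k * b l) / (sqrt (lam k / \<theta>) + sqrt (lam l / \<theta>))\<^sup>2 =
    (sqrt (lam k) * sqrt (lam l) * a k * a l + w * (b k / c) * (b l / c)) / (sqrt (lam k) + sqrt (lam l))\<^sup>2"
    using th by (simp only:) simp
qed

text \<open>The weight need not have mass one: a constant factor cancels in the expansion
  coefficients, which are quotients of two values of the functional.\<close>

definition weight_functional :: "(real \<Rightarrow> real) \<Rightarrow> real poly \<Rightarrow> real"
  where "weight_functional \<rho> p = (LBINT z. poly p z * \<rho> z)"

lemma weight_functional_linear:
  assumes "\<And>p. integrable lborel (\<lambda>z. poly p z * \<rho> z)"
  shows "linear_functional (weight_functional \<rho>)"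
  unfolding linear_functional_def weight_functional_def
  using assms by (auto simp: distrib_right mult.assoc)

text \<open>The bound \<open>\<rho>s n z \<le> \<rho> z\<close> is used twice: as majorant for the
  moments, and to replace the weight on the right by its limit without enlarging \<open>K\<close>.
  On the left Fatou's lemma suffices. Nonnegativity of the form is asked only where the weight is
  nonzero, since the rescaled \<open>1 - x\<^sup>2\<close> is negative outside the interval.\<close>

lemma polynomial_g_inequality_limit:
  fixes \<rho> :: "real \<Rightarrow> real" and f :: "real poly"
  assumes [measurable]: "\<rho> \<in> borel_measurable borel" "\<And>n. \<rho>s n \<in> borel_measurable borel"
    and \<rho>s: "\<And>n z. 0 \<le> \<rho>s n z" "\<And>n z. \<rho>s n z \<le> \<rho> z" "\<And>z. (\<lambda>n. \<rho>s n z) \<longlonglongrightarrow> \<rho> z"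
    and int: "\<And>p. integrable lborel (\<lambda>z. poly p z * \<rho> z)"
    and E: "orthogonal_polys (weight_functional \<rho>) E" "\<And>k. lead_coeff (E k) = 1"
    and En: "\<And>n. orthogonal_polys (weight_functional (\<rho>s n)) (En n)" "\<And>n k. lead_coeff (En n k) = 1"
    and lam: "\<And>k. (\<lambda>n. lams n k) \<longlonglongrightarrow> lam k" "\<And>k. 1 \<le> k \<Longrightarrow> 0 < lam k"
    and w: "\<And>z. (\<lambda>n. ws n z) \<longlonglongrightarrow> w z" and [measurable]: "\<And>n. ws n \<in> borel_measurable borel"
    and f: "degree f \<le> N"
    and ineq: "\<And>n::nat. (\<integral>\<^sup>+z. ennreal ((g_form N (lams n)
        (\<lambda>k. weight_functional (\<rho>s n) (f * En n k) / weight_functional (\<rho>s n) (En n k * En n k) * poly (En n k) z)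
        (\<lambda>k. weight_functional (\<rho>s n) (f * En n k) / weight_functional (\<rho>s n) (En n k * En n k) * poly (pderiv (En n k)) z)
        (ws n z)) powr (p / 2)) * ennreal (\<rho>s n z) \<partial>lborel)
      \<le> K * (\<integral>\<^sup>+z. ennreal (\<bar>poly f z\<bar> powr p) * ennreal (\<rho>s n z) \<partial>lborel)"
    and p: "0 < p"
    and nonneg: "\<And>n z. 0 \<le> g_form N (lams n)
        (\<lambda>k. weight_functional (\<rho>s n) (f * En n k) / weight_functional (\<rho>s n) (En n k * En n k) * poly (En n k) z)
        (\<lambda>k. weight_functional (\<rho>s n) (f * En n k) / weight_functional (\<rho>s n) (En n k * En n k) * poly (pderiv (En n k)) z)
        (ws n z) \<or> \<rho>s n z = 0"
  shows "(\<integral>\<^sup>+z. ennreal ((g_form N lam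
        (\<lambda>k. weight_functional \<rho> (f * E k) / weight_functional \<rho> (E k * E k) * poly (E k) z)
        (\<lambda>k. weight_functional \<rho> (f * E k) / weight_functional \<rho> (E k * E k) * poly (pderiv (E k)) z)
        (w z)) powr (p / 2)) * ennreal (\<rho> z) \<partial>lborel)
      \<le> K * (\<integral>\<^sup>+z. ennreal (\<bar>poly f z\<bar> powr p) * ennreal (\<rho> z) \<partial>lborel)"
proof -
  define c where "c k = weight_functional \<rho> (f * E k) / weight_functional \<rho> (E k * E k)" for k
  define cs where "cs n k = weight_functional (\<rho>s n) (f * En n k) / weight_functional (\<rho>s n) (En n k * En n k)" for n k
  define Q where "Q z = g_form N lam (\<lambda>k. c k * poly (E k) z) (\<lambda>k. c k * poly (pderiv (E k)) z) (w z)" for z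
  define Qs where "Qs n z = g_form N (lams n) (\<lambda>k. cs n k * poly (En n k) z) (\<lambda>k. cs n k * poly (pderiv (En n k)) z) (ws n z)" for n z
  have \<rho>0: "0 \<le> \<rho> z" for z using \<rho>s(1,2) order_trans by blast
  have conv: "(\<lambda>n. weight_functional (\<rho>s n) p) \<longlonglongrightarrow> weight_functional \<rho> p" for p
    unfolding weight_functional_def
  proof (rule integral_dominated_convergence[where w = "\<lambda>z. \<bar>poly p z * \<rho> z\<bar>"])
    show "AE z in lborel. (\<lambda>n. poly p z * \<rho>s n z) \<longlonglongrightarrow> poly p z * \<rho> z"
      by (intro AE_I2 tendsto_intros \<rho>s)
    show "AE z in lborel. norm (poly p z * \<rho>s n z) \<le> \<bar>poly p z * \<rho> z\<bar>" for n
      using \<rho>s \<rho>0 by (intro AE_I2) (auto simp: abs_mult intro!: mult_left_mono)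
  qed (use int in auto)
  have lin: "linear_functional (weight_functional (\<rho>s n))" "linear_functional (weight_functional \<rho>)" for n
    using E En by (auto simp: orthogonal_polys_def)
  have deg: "degree (En n k) = k" "degree (E k) = k" for n k using E En by (auto simp: orthogonal_polys_def)
  have Ec: "(\<lambda>n. coeff (En n k) i) \<longlonglongrightarrow> coeff (E k) i" for k i
    by (rule orthogonal_polys_tendsto[OF E En conv])
  have cs: "(\<lambda>n. cs n k) \<longlonglongrightarrow> c k" for k
    unfolding cs_def c_def
  proof (rule tendsto_divide)
    show "(\<lambda>n. weight_functional (\<rho>s n) (f * En n k)) \<longlonglongrightarrow> weight_functional \<rho> (f * E k)"
      by (rule functional_prod_tendsto[where d = "degree f" and d' = k]) (use lin conv Ec deg in auto)
    show "(\<lambda>n. weight_functional (\<rho>s n) (En n k * En n k)) \<longlonglongrightarrow> weight_functional \<rho> (E k * E k)"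
      by (rule functional_prod_tendsto[where d = k and d' = k]) (use lin conv Ec deg in auto)
    show "weight_functional \<rho> (E k * E k) \<noteq> 0" using E by (simp add: orthogonal_polys_def)
  qed
  have p1: "(\<lambda>n. poly (En n k) z) \<longlonglongrightarrow> poly (E k) z" for k z
    by (rule poly_tendsto_of_coeff[OF Ec, where d = k]) (use deg in auto)
  have p2: "(\<lambda>n. poly (pderiv (En n k)) z) \<longlonglongrightarrow> poly (pderiv (E k)) z" for k z
    by (rule poly_tendsto_of_coeff[where d = k]) (use deg in \<open>auto simp: coeff_pderiv degree_pderiv intro!: tendsto_intros Ec\<close>)
  have Q: "(\<lambda>n. Qs n z) \<longlonglongrightarrow> Q z" for z
    unfolding Q_def Qs_def using lam w by (intro g_form_tendsto tendsto_mult cs p1 p2) auto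
  have [measurable]: "Qs n \<in> borel_measurable borel" for n
    unfolding Qs_def g_form_def by measurable
  \<comment> \<open>Real powers converge here only along eventually nonnegative bases. Where
    \<open>\<rho> z\<close> is nonzero the approximating weights are eventually positive, which
    forces \<open>Qs n z\<close> to be nonnegative; elsewhere all weights vanish.\<close>
  have lim: "(\<lambda>n. ennreal (Qs n z powr (p / 2) * \<rho>s n z)) \<longlonglongrightarrow> ennreal (Q z powr (p / 2) * \<rho> z)" for z
  proof (cases "\<rho> z = 0")
    case True
    then have "\<rho>s n z = 0" for n using \<rho>s(1,2)[of n z] by simp
    then show ?thesis using True by simp
  next
    case False
    then have "eventually (\<lambda>n. \<rho>s n z > 0) sequentially"
      using \<rho>0[of z] by (intro order_tendstoD(1)[OF \<rho>s(3)]) auto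
    then have "eventually (\<lambda>n. 0 \<le> Qs n z) sequentially"
      by eventually_elim (use nonneg in \<open>force simp: Qs_def cs_def\<close>)
    then have "(\<lambda>n. Qs n z powr (p / 2)) \<longlonglongrightarrow> Q z powr (p / 2)"
      using p by (intro tendsto_powr' Q tendsto_const) auto
    then show ?thesis by (intro tendsto_ennrealI tendsto_mult \<rho>s)
  qed
  have "(\<integral>\<^sup>+z. ennreal (Q z powr (p / 2)) * ennreal (\<rho> z) \<partial>lborel) = (\<integral>\<^sup>+z. liminf (\<lambda>n. ennreal (Qs n z powr (p / 2) * \<rho>s n z)) \<partial>lborel)"
    using \<rho>0 by (intro nn_integral_cong) (simp add: ennreal_mult[symmetric] lim_imp_Liminf[OF _ lim])
  also have "\<dots> \<le> liminf (\<lambda>n. \<integral>\<^sup>+z. ennreal (Qs n z powr (p / 2) * \<rho>s n z) \<partial>lborel)"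
    by (rule nn_integral_liminf) measurable
  also have "\<dots> \<le> K * (\<integral>\<^sup>+z. ennreal (\<bar>poly f z\<bar> powr p) * ennreal (\<rho> z) \<partial>lborel)"
  proof (rule Liminf_le)
    show "eventually (\<lambda>n. (\<integral>\<^sup>+z. ennreal (Qs n z powr (p / 2) * \<rho>s n z) \<partial>lborel) \<le> K * (\<integral>\<^sup>+z. ennreal (\<bar>poly f z\<bar> powr p) * ennreal (\<rho> z) \<partial>lborel)) sequentially"
    proof (rule always_eventually, rule allI)
      fix n
      have "(\<integral>\<^sup>+z. ennreal (Qs n z powr (p / 2) * \<rho>s n z) \<partial>lborel) \<le> K * (\<integral>\<^sup>+z. ennreal (\<bar>poly f z\<bar> powr p) * ennreal (\<rho>s n z) \<partial>lborel)"
        using ineq[of n] \<rho>s(1) by (simp add: Qs_def cs_def ennreal_mult)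
      also have "\<dots> \<le> K * (\<integral>\<^sup>+z. ennreal (\<bar>poly f z\<bar> powr p) * ennreal (\<rho> z) \<partial>lborel)"
        using \<rho>s(2) by (intro mult_left_mono nn_integral_mono ennreal_leI) auto
      finally show "(\<integral>\<^sup>+z. ennreal (Qs n z powr (p / 2) * \<rho>s n z) \<partial>lborel) \<le> K * (\<integral>\<^sup>+z. ennreal (\<bar>poly f z\<bar> powr p) * ennreal (\<rho> z) \<partial>lborel)" .
    qed
  qed simp
  finally show ?thesis by (simp add: Q_def c_def)
qed

subsection \<open>Jacobi polynomials\<close>

lemma nn_integral_restricted_density:
  fixes w :: "real \<Rightarrow> real"
  assumes [measurable]: "S \<in> sets borel" "w \<in> borel_measurable borel" "f \<in> borel_measurable borel"
  shows "(\<integral>\<^sup>+x. f x \<partial>density (restrict_space lborel S) (\<lambda>x. ennreal (w x))) = (\<integral>\<^sup>+x. f x * ennreal (indicator S x * w x) \<partial>lborel)"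
proof -
  have "(\<integral>\<^sup>+x. f x \<partial>density (restrict_space lborel S) (\<lambda>x. ennreal (w x))) = (\<integral>\<^sup>+x. ennreal (w x) * f x \<partial>restrict_space lborel S)"
    by (rule nn_integral_density) (auto intro!: measurable_restrict_space1)
  also have "\<dots> = (\<integral>\<^sup>+x. ennreal (w x) * f x * indicator S x \<partial>lborel)"
    by (rule nn_integral_restrict_space) auto
  also have "\<dots> = (\<integral>\<^sup>+x. f x * ennreal (indicator S x * w x) \<partial>lborel)"
    by (intro nn_integral_cong) (auto simp: mult_ac split: split_indicator)
  finally show ?thesis .
qed

lemma has_bochner_integral_restricted_density_iff:
  fixes w f :: "real \<Rightarrow> real"
  assumes [measurable]: "S \<in> sets borel" "w \<in> borel_measurable borel" "f \<in> borel_measurable borel"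
    and nn: "\<And>x. x \<in> S \<Longrightarrow> 0 \<le> w x"
  shows "has_bochner_integral (density (restrict_space lborel S) (\<lambda>x. ennreal (w x))) f r \<longleftrightarrow>
    has_bochner_integral lborel (\<lambda>x. indicator S x * w x * f x) r"
proof -
  have m: "f \<in> borel_measurable (restrict_space lborel S)" "w \<in> borel_measurable (restrict_space lborel S)"
    by (auto intro!: measurable_restrict_space1)
  have "AE x in restrict_space lborel S. 0 \<le> w x" using nn by (auto simp: space_restrict_space intro!: AE_I2)
  note d = integrable_density[OF m this] integral_density[OF m this]
  have eq: "indicator S x *\<^sub>R (w x *\<^sub>R f x) = indicator S x * w x * f x" for x by simp
  show ?thesis
    unfolding has_bochner_integral_iff d
    by (subst integrable_restrict_space, simp, subst integral_restrict_space, simp) (simp only: eq)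
qed

section \<open>Alternating sums of rising factorials\<close>

text \<open>Up to the sign \<open>(-1) ^ k\<close> this is the k-th forward difference of a
  polynomial of degree \<open>m\<close>. It is the source of orthogonality for the Jacobi and for
  the Laguerre polynomials.\<close>

definition alt_sum :: "nat \<Rightarrow> nat \<Rightarrow> real \<Rightarrow> real"
  where "alt_sum k m a = (\<Sum>j\<le>k. (-1) ^ j * real (k choose j) * pochhammer (a + real j) m)"

text \<open>Pascal's rule: one of the differences is carried out on \<open>f\<close>.\<close>

lemma alternating_binomial_sum_Suc:
  fixes f :: "nat \<Rightarrow> real"
  shows "(\<Sum>j\<le>Suc k. (-1) ^ j * real (Suc k choose j) * f j) = (\<Sum>j\<le>k. (-1) ^ j * real (k choose j) * (f j - f (Suc j)))"
proof -
  have "(\<Sum>j\<le>Suc k. (-1) ^ j * real (Suc k choose j) * f j) =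
    f 0 + (\<Sum>j\<le>k. (-1) ^ Suc j * real (Suc k choose Suc j) * f (Suc j))"
    by (subst sum.atMost_Suc_shift) simp
  also have "\<dots> = f 0 + (\<Sum>j\<le>k. (-1) ^ Suc j * real (k choose Suc j) * f (Suc j)) - (\<Sum>j\<le>k. (-1) ^ j * real (k choose j) * f (Suc j))"
  proof -
    have "(-1) ^ Suc j * real (Suc k choose Suc j) * f (Suc j) =
      (-1) ^ Suc j * real (k choose Suc j) * f (Suc j) - (-1) ^ j * real (k choose j) * f (Suc j)" for j
      by (simp add: algebra_simps)
    then show ?thesis by (simp only: sum_subtractf add_diff_eq)
  qed
  also have "f 0 + (\<Sum>j\<le>k. (-1) ^ Suc j * real (k choose Suc j) * f (Suc j)) = (\<Sum>j\<le>Suc k. (-1) ^ j * real (k choose j) * f j)"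
    by (subst sum.atMost_Suc_shift) simp
  also have "\<dots> = (\<Sum>j\<le>k. (-1) ^ j * real (k choose j) * f j)" by simp
  finally show ?thesis by (simp add: right_diff_distrib sum_subtractf)
qed

text \<open>A single difference lowers a rising factorial by one degree: the one of length
  \<open>m + 1\<close> at \<open>a\<close>, minus the one at \<open>a + 1\<close>, is
  \<open>- (m + 1)\<close> times the one of length \<open>m\<close> at \<open>a + 1\<close>.
  Iterating \<open>k\<close> times leaves zero or a factorial.\<close>

lemma alt_sum_eq:
  shows "m < k \<Longrightarrow> alt_sum k m a = 0" and "alt_sum k k a = (-1) ^ k * fact k"
proof (induction k arbitrary: m a)
  case (Suc k)
  have step: "alt_sum (Suc k) (Suc m) a = - (real m + 1) * alt_sum k m (a + 1)" for m a
  proof -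
    have "pochhammer (a + real j) (Suc m) - pochhammer (a + real (Suc j)) (Suc m) =
        - (real m + 1) * pochhammer (a + 1 + real j) m" for j
    proof -
      have "a + real (Suc j) = a + 1 + real j" "a + real j + 1 = a + 1 + real j" by auto
      then show ?thesis
        using pochhammer_rec[of "a + real j" m] pochhammer_rec'[of "a + 1 + real j" m]
        by (simp add: algebra_simps)
    qed
    then show ?thesis
      unfolding alt_sum_def alternating_binomial_sum_Suc by (simp add: sum_distrib_left mult_ac)
  qed
  {
    case 1
    show ?case
    proof (cases m)
      case 0
      then show ?thesis unfolding alt_sum_def alternating_binomial_sum_Suc by simp
    next
      case (Suc m')
      then show ?thesis using step[of m' a] Suc.IH(1)[of m' "a + 1"] 1 by simp
    qed
  next
    case 2
    show ?case using step[of k a] Suc.IH(2)[of "a + 1"] by (simp add: algebra_simps)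
  }
qed (simp_all add: alt_sum_def)

lemma alt_sum_rev: "(\<Sum>j\<le>k. (-1) ^ j * real (k choose j) * pochhammer (a + real (k - j)) m) = (-1) ^ k * alt_sum k m a"
proof -
  have "(\<Sum>j\<le>k. (-1) ^ j * real (k choose j) * pochhammer (a + real (k - j)) m) =
    (\<Sum>j\<le>k. (-1) ^ (k - j) * real (k choose (k - j)) * pochhammer (a + real (k - (k - j))) m)"
    using sum.nat_diff_reindex[of "\<lambda>j. (-1) ^ j * real (k choose j) * pochhammer (a + real (k - j)) m" "Suc k"]
    by (simp add: lessThan_Suc_atMost)
  also have "\<dots> = (\<Sum>j\<le>k. (-1) ^ k * ((-1) ^ j * real (k choose j) * pochhammer (a + real j) m))"
  proof (rule sum.cong[OF refl])
    fix j assume j: "j \<in> {..k}"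
    then have "(-1::real) ^ k = (-1) ^ (k - j) * (-1) ^ j" by (simp add: power_add[symmetric])
    then have "(-1::real) ^ k * (-1) ^ j = (-1) ^ (k - j)" by (simp add: mult.assoc power_mult_distrib[symmetric])
    moreover have "k choose (k - j) = k choose j" using j by (simp add: binomial_symmetric[symmetric])
    ultimately show "(-1) ^ (k - j) * real (k choose (k - j)) * pochhammer (a + real (k - (k - j))) m =
      (-1) ^ k * ((-1) ^ j * real (k choose j) * pochhammer (a + real j) m)"
      using j by (simp add: mult.assoc[symmetric])
  qed
  finally show ?thesis by (simp add: alt_sum_def sum_distrib_left)
qed

text \<open>Rising factorials are the form in which the coefficients recombine with Beta and Gamma
  moments.\<close>

lemma gchoose_eq_pochhammer:
  "j \<le> k \<Longrightarrow> (real k + a) gchoose (k - j) = pochhammer (a + 1 + real j) (k - j) / fact (k - j)"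
  by (simp add: gbinomial_pochhammer' of_nat_diff algebra_simps)

section \<open>The Jacobi measure and orthogonality\<close>

text \<open>The Beta integral under \<open>v = (1 + x) / 2\<close>: the powers contribute
  \<open>2 powr (a + b - 2)\<close> and the differential one more factor 2.\<close>

lemma beta_moment_integral:
  fixes a b :: real
  assumes "0 < a" "0 < b"
  shows "has_bochner_integral lborel (\<lambda>x. indicator {-1<..<1} x * ((1 - x) powr (a - 1) * (1 + x) powr (b - 1)))
    (2 powr (a + b - 1) * Beta a b)"
proof -
  let ?f = "\<lambda>v::real. ennreal (v powr (b - 1) * (1 - v) powr (a - 1)) * indicator {0..1} v"
  have "integral\<^sup>N lborel ?f = ennreal (Beta b a)"
    by (rule nn_integral_has_integral_lebesgue'[OF _ has_integral_Beta_real]) (use assms in auto)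
  also have "integral\<^sup>N lborel ?f = (\<integral>\<^sup>+v. ennreal (indicator {0..1} v * (v powr (b - 1) * (1 - v) powr (a - 1))) \<partial>lborel)"
    by (intro nn_integral_cong) (auto split: split_indicator)
  finally have bi: "has_bochner_integral lborel (\<lambda>v::real. indicator {0..1} v * (v powr (b - 1) * (1 - v) powr (a - 1))) (Beta b a)"
    using assms by (intro has_bochner_integral_nn_integral) (auto simp: Beta_def Gamma_real_pos less_imp_le)
  have "has_bochner_integral lborel (\<lambda>x. indicator {0..1} (1 / 2 + 1 / 2 * x) * ((1 / 2 + 1 / 2 * x) powr (b - 1) * (1 - (1 / 2 + 1 / 2 * x)) powr (a - 1)))
     (Beta b a /\<^sub>R \<bar>1 / 2\<bar>)"
    using lborel_has_bochner_integral_real_affine_iff[of "1 / 2" _ "Beta b a" "1 / 2"] bi by simp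
  then have "has_bochner_integral lborel (\<lambda>x. 2 powr (a + b - 2) * (indicator {0..1} (1 / 2 + 1 / 2 * x) * ((1 / 2 + 1 / 2 * x) powr (b - 1) * (1 - (1 / 2 + 1 / 2 * x)) powr (a - 1))))
     (2 powr (a + b - 2) * (Beta b a /\<^sub>R \<bar>1 / 2\<bar>))"
    by (rule has_bochner_integral_mult_right)
  moreover have "2 powr (a + b - 2) * (indicator {0..1} (1 / 2 + 1 / 2 * x) * ((1 / 2 + 1 / 2 * x) powr (b - 1) * (1 - (1 / 2 + 1 / 2 * x)) powr (a - 1))) =
     indicator {-1<..<1} x * ((1 - x) powr (a - 1) * (1 + x) powr (b - 1))" for x :: real
  proof (cases "x \<in> {-1<..<1}")
    case True
    have e1: "1 / 2 + 1 / 2 * x = (1 + x) / 2" "1 - (1 / 2 + 1 / 2 * x) = (1 - x) / 2" by (auto simp: field_simps)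
    have "2 powr (a + b - 2) = 2 powr (b - 1) * 2 powr (a - 1)" by (simp add: powr_add[symmetric] algebra_simps)
    then show ?thesis
      unfolding e1 using True by (simp add: powr_divide field_simps)
  next
    case False
    then show ?thesis by (auto simp: indicator_def field_simps)
  qed
  moreover have "2 powr (a + b - 2) * (Beta b a /\<^sub>R \<bar>1 / 2\<bar>) = 2 powr (a + b - 1) * Beta a b"
    using powr_add[of 2 "a + b - 2" 1] by (simp add: Beta_commute)
  ultimately show ?thesis by simp
qed

locale jacobi =
  fixes \<alpha> \<beta> :: real
  assumes \<alpha>: "-1 < \<alpha>" and \<beta>: "-1 < \<beta>"
begin

abbreviation "\<mu> \<equiv> jacobi_measure \<alpha> \<beta>"

definition \<eta> :: real
  where "\<eta> = Gamma (\<alpha> + \<beta> + 2) / (2 powr (\<alpha> + \<beta> + 1) * Gamma (\<alpha> + 1) * Gamma (\<beta> + 1))"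

lemma \<eta>_pos: "0 < \<eta>"
  using \<alpha> \<beta> by (simp add: \<eta>_def Gamma_real_pos)

lemma \<mu>_eq: "\<mu> = density (restrict_space lborel {-1<..<1}) (\<lambda>x. ennreal (\<eta> * (1 - x) powr \<alpha> * (1 + x) powr \<beta>))"
  by (simp add: jacobi_measure_def \<eta>_def)

lemma space_\<mu>: "space \<mu> = {-1<..<1}"
  by (simp add: \<mu>_eq space_restrict_space)

lemma measurable_\<mu> [measurable (raw)]: "f \<in> borel_measurable borel \<Longrightarrow> f \<in> borel_measurable \<mu>"
  unfolding \<mu>_eq by (auto intro!: measurable_restrict_space1)

lemma nn_integral_\<mu>:
  "f \<in> borel_measurable borel \<Longrightarrow> (\<integral>\<^sup>+x. f x \<partial>\<mu>) =
    (\<integral>\<^sup>+x. f x * ennreal (indicator {-1<..<1} x * (\<eta> * (1 - x) powr \<alpha> * (1 + x) powr \<beta>)) \<partial>lborel)"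
  unfolding \<mu>_eq by (rule nn_integral_restricted_density) auto

lemma has_bochner_integral_\<mu>_iff:
  "f \<in> borel_measurable borel \<Longrightarrow> has_bochner_integral \<mu> f r \<longleftrightarrow>
    has_bochner_integral lborel (\<lambda>x. indicator {-1<..<1} x * (\<eta> * (1 - x) powr \<alpha> * (1 + x) powr \<beta>) * f x) r"
  unfolding \<mu>_eq using \<eta>_pos by (intro has_bochner_integral_restricted_density_iff) auto

text \<open>Moments are taken in products of powers of \<open>(1 - x) / 2\<close> and
  \<open>(1 + x) / 2\<close>, the basis in which the Jacobi polynomials are given, because there
  they are quotients of Gamma functions.\<close>

lemma moment_\<mu>:
  "has_bochner_integral \<mu> (\<lambda>x. ((1 - x) / 2) ^ i * ((1 + x) / 2) ^ j)
    (pochhammer (\<alpha> + 1) i * pochhammer (\<beta> + 1) j / pochhammer (\<alpha> + \<beta> + 2) (i + j))"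
proof (subst has_bochner_integral_\<mu>_iff, measurable)
  define c where "c = \<eta> / 2 ^ (i + j)"
  have pos: "0 < \<alpha> + 1 + real i" "0 < \<beta> + 1 + real j" "0 < \<alpha> + 1" "0 < \<beta> + 1" "0 < \<alpha> + \<beta> + 2" using \<alpha> \<beta> by auto
  have "has_bochner_integral lborel (\<lambda>x. c * (indicator {-1<..<1} x * ((1 - x) powr ((\<alpha> + 1 + i) - 1) * (1 + x) powr ((\<beta> + 1 + j) - 1))))
    (c * (2 powr ((\<alpha> + 1 + i) + (\<beta> + 1 + j) - 1) * Beta (\<alpha> + 1 + i) (\<beta> + 1 + j)))"
    by (intro has_bochner_integral_mult_right beta_moment_integral pos)
  moreover have "c * (indicator {-1<..<1} x * ((1 - x) powr ((\<alpha> + 1 + i) - 1) * (1 + x) powr ((\<beta> + 1 + j) - 1))) =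
    indicator {-1<..<1} x * (\<eta> * (1 - x) powr \<alpha> * (1 + x) powr \<beta>) * (((1 - x) / 2) ^ i * ((1 + x) / 2) ^ j)" for x
  proof (cases "x \<in> {-1<..<1}")
    case True
    then have "(1 - x) powr (\<alpha> + real i) = (1 - x) powr \<alpha> * (1 - x) ^ i" "(1 + x) powr (\<beta> + real j) = (1 + x) powr \<beta> * (1 + x) ^ j"
      by (simp_all add: powr_add powr_realpow)
    then show ?thesis by (simp add: c_def power_divide power_add[of _ i j])
  qed simp
  moreover have "c * (2 powr ((\<alpha> + 1 + i) + (\<beta> + 1 + j) - 1) * Beta (\<alpha> + 1 + i) (\<beta> + 1 + j)) =
     pochhammer (\<alpha> + 1) i * pochhammer (\<beta> + 1) j / pochhammer (\<alpha> + \<beta> + 2) (i + j)"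
  proof -
    have nz: "\<alpha> + 1 \<notin> \<int>\<^sub>\<le>\<^sub>0" "\<beta> + 1 \<notin> \<int>\<^sub>\<le>\<^sub>0" "\<alpha> + \<beta> + 2 \<notin> \<int>\<^sub>\<le>\<^sub>0" using pos by (auto elim!: nonpos_Ints_cases)
    have G: "Gamma (\<alpha> + 1) \<noteq> 0" "Gamma (\<beta> + 1) \<noteq> 0" "Gamma (\<alpha> + \<beta> + 2) \<noteq> 0" using pos by (simp_all add: Gamma_real_pos less_imp_neq[symmetric])
    have e: "(\<alpha> + 1 + real i) + (\<beta> + 1 + real j) - 1 = (\<alpha> + \<beta> + 1) + real (i + j)"
      "\<alpha> + 1 + real i + (\<beta> + 1 + real j) = \<alpha> + \<beta> + 2 + real (i + j)"
      "\<alpha> + \<beta> + 2 + real (i + j) - 1 = (\<alpha> + \<beta> + 1) + real (i + j)" by auto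
    have p2: "2 powr ((\<alpha> + \<beta> + 1) + real (i + j)) = 2 powr (\<alpha> + \<beta> + 1) * 2 ^ (i + j)" by (simp only: powr_add powr_realpow)
    show ?thesis
      unfolding Beta_def e p2 pochhammer_Gamma[OF nz(1)] pochhammer_Gamma[OF nz(2)] pochhammer_Gamma[OF nz(3)] c_def \<eta>_def
      using G by (simp add: divide_simps)
  qed
  ultimately show "has_bochner_integral lborel
     (\<lambda>x. indicator {-1<..<1} x * (\<eta> * (1 - x) powr \<alpha> * (1 + x) powr \<beta>) * (((1 - x) / 2) ^ i * ((1 + x) / 2) ^ j))
     (pochhammer (\<alpha> + 1) i * pochhammer (\<beta> + 1) j / pochhammer (\<alpha> + \<beta> + 2) (i + j))"
    by (simp only:)
qed

definition c :: "nat \<Rightarrow> nat \<Rightarrow> real"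
  where "c k j = ((real k + \<alpha>) gchoose (k - j)) * ((real k + \<beta>) gchoose j)"

definition J :: "nat \<Rightarrow> real poly"
  where "J k = (\<Sum>j\<le>k. smult (c k j) ([:-1/2, 1/2:] ^ j * [:1/2, 1/2:] ^ (k - j)))"

lemma poly_J: "poly (J k) x = jacobi_poly \<alpha> \<beta> k x"
proof -
  have "poly [:-1/2, 1/2:] x = (x - 1) / 2" "poly [:1/2, 1/2:] x = (x + 1) / 2" by (auto simp: field_simps)
  then show ?thesis by (simp only: J_def jacobi_poly_def c_def poly_sum poly_smult poly_mult poly_power mult.assoc)
qed

lemma c_eq: "j \<le> k \<Longrightarrow> c k j = pochhammer (\<alpha> + 1 + real j) (k - j) / fact (k - j) * (pochhammer (\<beta> + 1 + real (k - j)) j / fact j)"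
  using gchoose_eq_pochhammer[of j k \<alpha>] gchoose_eq_pochhammer[of "k - j" k \<beta>] by (simp add: c_def)

lemma c_pos: "j \<le> k \<Longrightarrow> 0 < c k j"
  using \<alpha> \<beta> by (auto simp: c_eq intro!: mult_pos_pos divide_pos_pos pochhammer_pos)

text \<open>It plays two roles: \<open>2 ^ k\<close> times the leading coefficient of
  \<open>J k\<close>, and a bound for \<open>\<bar>J k\<bar>\<close> on \<open>[-1, 1]\<close>,
  since all \<open>c k j\<close> are positive.\<close>

definition Bc :: "nat \<Rightarrow> real"
  where "Bc k = (\<Sum>j\<le>k. c k j)"

lemma Bc_pos: "0 < Bc k"
  unfolding Bc_def by (intro sum_pos) (auto intro: c_pos)

lemma abs_J_le: "\<bar>x\<bar> \<le> 1 \<Longrightarrow> \<bar>poly (J k) x\<bar> \<le> Bc k"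
proof -
  assume x: "\<bar>x\<bar> \<le> 1"
  have "\<bar>poly (J k) x\<bar> \<le> (\<Sum>j\<le>k. \<bar>c k j * ((x - 1) / 2) ^ j * ((x + 1) / 2) ^ (k - j)\<bar>)"
    unfolding poly_J jacobi_poly_def c_def by (rule sum_abs)
  also have "\<dots> \<le> Bc k"
    unfolding Bc_def
  proof (rule sum_mono)
    fix j assume j: "j \<in> {..k}"
    have "\<bar>(x - 1) / 2\<bar> ^ j * \<bar>(x + 1) / 2\<bar> ^ (k - j) \<le> 1 * 1"
      using x by (intro mult_mono power_le_one) auto
    then have "c k j * (\<bar>(x - 1) / 2\<bar> ^ j * \<bar>(x + 1) / 2\<bar> ^ (k - j)) \<le> c k j * (1 * 1)"
      using c_pos[of j k] j by (intro mult_left_mono) auto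
    then show "\<bar>c k j * ((x - 1) / 2) ^ j * ((x + 1) / 2) ^ (k - j)\<bar> \<le> c k j"
      using c_pos[of j k] j by (simp add: abs_mult power_abs mult.assoc del: abs_divide)
  qed
  finally show ?thesis .
qed

lemma degree_J_le: "degree (J k) \<le> k"
  unfolding J_def
proof (rule degree_sum_le)
  fix j assume j: "j \<in> {..k}"
  have "degree ([:-1/2, 1/2:] ^ j * [:1/2, 1/2:] ^ (k - j) :: real poly) \<le> j + (k - j)"
    by (rule order_trans[OF degree_mult_le]) (simp add: degree_power_eq)
  then show "degree (smult (c k j) ([:-1/2, 1/2:] ^ j * [:1/2, 1/2:] ^ (k - j))) \<le> k"
    using j by (auto intro: order_trans[OF degree_smult_le])
qed simp

lemma coeff_J: "coeff (J k) k = Bc k / 2 ^ k"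
proof -
  have "coeff ([:-1/2, 1/2:] ^ j * [:1/2, 1/2:] ^ (k - j)) k = (1 / 2 :: real) ^ k" if "j \<le> k" for j
  proof -
    have d: "degree ([:-1/2, 1/2:] ^ j * [:1/2, 1/2:] ^ (k - j) :: real poly) = k"
      using that by (simp add: degree_mult_eq degree_power_eq)
    have "coeff ([:-1/2, 1/2:] ^ j * [:1/2, 1/2:] ^ (k - j)) k = lead_coeff ([:-1/2, 1/2:] ^ j * [:1/2, 1/2:] ^ (k - j) :: real poly)"
      unfolding d ..
    also have "\<dots> = (1 / 2) ^ j * (1 / 2) ^ (k - j)" unfolding lead_coeff_mult lead_coeff_power by simp
    also have "\<dots> = (1 / 2) ^ k" using that by (simp add: power_add[symmetric])
    finally show ?thesis .
  qed
  then have "coeff (J k) k = (\<Sum>j\<le>k. c k j * (1 / 2) ^ k)" by (simp add: J_def coeff_sum)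
  then show ?thesis by (simp add: Bc_def sum_divide_distrib power_one_over)
qed

lemma degree_J: "degree (J k) = k"
  using degree_J_le[of k] coeff_J[of k] Bc_pos[of k] by (intro antisym le_degree) auto

text \<open>For \<open>m \<le> k\<close> this is the integral of \<open>J k\<close> against the m-th
  power of \<open>(1 + x) / 2\<close>; the zero branch is orthogonality to lower degrees.\<close>

definition G :: "nat \<Rightarrow> nat \<Rightarrow> real"
  where "G k m = (if m < k then 0 else pochhammer (\<alpha> + 1) k * pochhammer (\<beta> + 1) k / pochhammer (\<alpha> + \<beta> + 2) (k + m))"

text \<open>After coefficients are multiplied by moments, the rising factorials split at
  \<open>j\<close> recombine into full ones. Only a binomial coefficient and a rising factorial of
  length \<open>m\<close> still depend on \<open>j\<close>, a reversed
  \<open>alt_sum\<close>.\<close>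

lemma integral_J_power:
  assumes "m \<le> k"
  shows "has_bochner_integral \<mu> (\<lambda>x. poly (J k) x * ((1 + x) / 2) ^ m) (G k m)"
proof -
  have "has_bochner_integral \<mu> (\<lambda>x. \<Sum>j\<le>k. (-1) ^ j * c k j * (((1 - x) / 2) ^ j * ((1 + x) / 2) ^ (k - j + m)))
    (\<Sum>j\<le>k. (-1) ^ j * c k j * (pochhammer (\<alpha> + 1) j * pochhammer (\<beta> + 1) (k - j + m) / pochhammer (\<alpha> + \<beta> + 2) (j + (k - j + m))))"
    by (intro has_bochner_integral_sum has_bochner_integral_mult_right moment_\<mu>)
  moreover have "(\<Sum>j\<le>k. (-1) ^ j * c k j * (((1 - x) / 2) ^ j * ((1 + x) / 2) ^ (k - j + m))) = poly (J k) x * ((1 + x) / 2) ^ m" for x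
  proof -
    have "((x - 1) / 2) ^ j = (-1) ^ j * ((1 - x) / 2) ^ j" for j
      by (simp add: power_mult_distrib[symmetric] minus_divide_left)
    then show ?thesis
      unfolding poly_J jacobi_poly_def c_def sum_distrib_right power_add by (simp only: mult_ac add.commute[of x 1])
  qed
  moreover have "(\<Sum>j\<le>k. (-1) ^ j * c k j * (pochhammer (\<alpha> + 1) j * pochhammer (\<beta> + 1) (k - j + m) / pochhammer (\<alpha> + \<beta> + 2) (j + (k - j + m)))) = G k m"
  proof -
    define D where "D = pochhammer (\<alpha> + \<beta> + 2) (k + m)"
    define A where "A = pochhammer (\<alpha> + 1) k * pochhammer (\<beta> + 1) k"
    have "(-1) ^ j * c k j * (pochhammer (\<alpha> + 1) j * pochhammer (\<beta> + 1) (k - j + m) / pochhammer (\<alpha> + \<beta> + 2) (j + (k - j + m))) =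
      A / D / fact k * ((-1) ^ j * real (k choose j) * pochhammer (\<beta> + 1 + real (k - j)) m)" if j: "j \<le> k" for j
    proof -
      have 1: "pochhammer (\<alpha> + 1) k = pochhammer (\<alpha> + 1) j * pochhammer (\<alpha> + 1 + real j) (k - j)"
        using pochhammer_product'[of "\<alpha> + 1" j "k - j"] j by simp
      have 2: "pochhammer (\<beta> + 1) k = pochhammer (\<beta> + 1) (k - j) * pochhammer (\<beta> + 1 + real (k - j)) j"
        using pochhammer_product'[of "\<beta> + 1" "k - j" j] j by simp
      have 3: "pochhammer (\<beta> + 1) (k - j + m) = pochhammer (\<beta> + 1) (k - j) * pochhammer (\<beta> + 1 + real (k - j)) m"
        by (rule pochhammer_product')
      have 4: "real (k choose j) = fact k / (fact j * fact (k - j))" using j by (simp add: binomial_fact)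
      have 5: "j + (k - j + m) = k + m" using j by simp
      show ?thesis unfolding c_eq[OF j] A_def 1 2 3 4 5 D_def[symmetric] by (simp add: field_simps)
    qed
    then have "(\<Sum>j\<le>k. (-1) ^ j * c k j * (pochhammer (\<alpha> + 1) j * pochhammer (\<beta> + 1) (k - j + m) / pochhammer (\<alpha> + \<beta> + 2) (j + (k - j + m)))) =
      (\<Sum>j\<le>k. A / D / fact k * ((-1) ^ j * real (k choose j) * pochhammer (\<beta> + 1 + real (k - j)) m))"
      by (intro sum.cong) auto
    also have "\<dots> = A / D / fact k * ((-1) ^ k * alt_sum k m (\<beta> + 1))"
      by (simp only: sum_distrib_left[symmetric] alt_sum_rev)
    also have "\<dots> = G k m"
      using assms alt_sum_eq(1)[of m k "\<beta> + 1"] alt_sum_eq(2)[of k "\<beta> + 1"] by (cases "m = k") (auto simp: G_def A_def D_def power_mult_distrib[symmetric])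
    finally show ?thesis .
  qed
  ultimately show ?thesis by simp
qed

text \<open>Rewriting \<open>p\<close> in powers of \<open>(1 + x) / 2\<close> leaves only the top
  coefficient; the dilation multiplies it by \<open>2 ^ k\<close>.\<close>

lemma integral_J_poly:
  assumes p: "degree p \<le> k"
  shows "has_bochner_integral \<mu> (\<lambda>x. poly (J k) x * poly p x) (coeff p k * 2 ^ k * G k k)"
proof -
  define q where "q = pcompose p [:-1, 2:]"
  have q: "degree q \<le> k" using p by (simp add: q_def degree_pcompose)
  have pq: "poly p x = poly q ((1 + x) / 2)" for x by (simp add: q_def poly_pcompose add_divide_distrib)
  have "poly p x = (\<Sum>i\<le>k. coeff q i * ((1 + x) / 2) ^ i)" for x
    by (subst pq, subst poly_altdef, rule sum.mono_neutral_left) (use q in \<open>auto simp: coeff_eq_0\<close>)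
  then have eq: "poly (J k) x * poly p x = (\<Sum>i\<le>k. coeff q i * (poly (J k) x * ((1 + x) / 2) ^ i))" for x
    by (simp add: sum_distrib_left mult_ac)
  have "has_bochner_integral \<mu> (\<lambda>x. \<Sum>i\<le>k. coeff q i * (poly (J k) x * ((1 + x) / 2) ^ i)) (\<Sum>i\<le>k. coeff q i * G k i)"
    by (intro has_bochner_integral_sum has_bochner_integral_mult_right integral_J_power) auto
  moreover have "(\<Sum>i\<le>k. coeff q i * G k i) = (\<Sum>i\<le>k. if i = k then coeff q k * G k k else 0)"
    by (intro sum.cong) (auto simp: G_def)
  moreover have "coeff q k = coeff p k * 2 ^ k"
  proof (cases "degree p = k")
    case True
    have "degree q = k" using True by (simp add: q_def degree_pcompose)
    then have "coeff q k = lead_coeff q" by simp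
    also have "\<dots> = lead_coeff p * 2 ^ degree p" unfolding q_def by (subst lead_coeff_comp) auto
    finally show ?thesis using True by simp
  next
    case False
    then have "degree p < k" using p by simp
    then show ?thesis by (simp add: q_def coeff_eq_0 degree_pcompose)
  qed
  ultimately show ?thesis by (simp add: eq)
qed

lemma G_pos: "0 < G k k"
  using \<alpha> \<beta> by (auto simp: G_def intro!: divide_pos_pos mult_pos_pos pochhammer_pos)

text \<open>\<open>integral_J_poly\<close> is applied to the factor of lower degree; the leading
  coefficient \<open>Bc k / 2 ^ k\<close> absorbs the power of two.\<close>

lemma orthogonal_J: "has_bochner_integral \<mu> (\<lambda>x. poly (J j) x * poly (J k) x) (if j = k then Bc k * G k k else 0)"
proof -
  have *: "has_bochner_integral \<mu> (\<lambda>x. poly (J j) x * poly (J k) x) (if j = k then Bc k * G k k else 0)" if "k \<le> j" for j k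
    using integral_J_poly[of "J k" j] that degree_J[of k] coeff_J[of k] by (auto simp: coeff_eq_0)
  show ?thesis using *[of k j] *[of j k] by (cases "k \<le> j") (auto simp: mult.commute)
qed

lemma jacobi_sqnorm_eq: "jacobi_sqnorm \<alpha> \<beta> k = Bc k * G k k"
  using orthogonal_J[of k k] by (simp add: jacobi_sqnorm_def poly_J power2_eq_square has_bochner_integral_iff)

lemma eigenvalue_ge: "real k * (real k - 1) \<le> jacobi_eigenvalue \<alpha> \<beta> k"
  using \<alpha> \<beta> by (auto simp: jacobi_eigenvalue_def intro!: mult_left_mono)

lemma eigenvalue_pos: "1 \<le> k \<Longrightarrow> 0 < jacobi_eigenvalue \<alpha> \<beta> k"
  using \<alpha> \<beta> by (auto simp: jacobi_eigenvalue_def intro!: mult_pos_pos)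

lemma pochhammer_le_power: "0 < x \<Longrightarrow> x + real n \<le> R \<Longrightarrow> pochhammer x n \<le> R ^ n" for x R :: real
proof (induction n)
  case (Suc n)
  have "pochhammer x (Suc n) = (x + real n) * pochhammer x n" by (simp add: pochhammer_rec')
  also have "\<dots> \<le> R * R ^ n" using Suc by (intro mult_mono pochhammer_nonneg Suc.IH) (auto simp: pochhammer_nonneg)
  finally show ?case by simp
qed simp

lemma power_le_pochhammer: "0 \<le> x \<Longrightarrow> x ^ n \<le> pochhammer x n" for x :: real
proof (induction n)
  case (Suc n)
  have "x * x ^ n \<le> (x + real n) * pochhammer x n" using Suc by (intro mult_mono Suc.IH) auto
  then show ?case by (simp add: pochhammer_rec')
qed simp

text \<open>The quadratic growth of the eigenvalues beats the crude bound \<open>(K + 2 * k) ^ (6 * k)\<close> on the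
  normalised polynomials.\<close>

lemma summable_J:
  assumes s: "0 < s" and x: "\<bar>x\<bar> \<le> 1"
  shows "summable (\<lambda>k. exp (- jacobi_eigenvalue \<alpha> \<beta> k * s) * \<bar>poly (J k) x\<bar> / sqrt (Bc k * G k k))"
proof -
  \<comment> \<open>The absolute values bound the factors of the rising factorials, the reciprocals
    bound \<open>1 / pochhammer (\<alpha> + 1) k\<close> and its analogue for
    \<open>\<beta>\<close>, which deteriorate as a parameter approaches -1.\<close>
  define K where "K = \<bar>\<alpha>\<bar> + \<bar>\<beta>\<bar> + 3 + 1 / (\<alpha> + 1) + 1 / (\<beta> + 1)"
  have K: "3 \<le> K" "1 / (\<alpha> + 1) \<le> K" "1 / (\<beta> + 1) \<le> K" using \<alpha> \<beta> by (auto simp: K_def)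
  have K3: "\<bar>\<alpha>\<bar> + \<bar>\<beta>\<bar> + 3 \<le> K" using \<alpha> \<beta> by (simp add: K_def)
  define R where "R k = K + 2 * real k" for k
  have R1: "1 \<le> R k" for k using K by (simp add: R_def)
  have Bc: "Bc k \<le> R k ^ (2 * k)" for k
  proof -
    have "c k j \<le> R k ^ k" if j: "j \<le> k" for j
    proof -
      have "pochhammer (\<alpha> + 1 + real j) (k - j) \<le> R k ^ (k - j)" "pochhammer (\<beta> + 1 + real (k - j)) j \<le> R k ^ j"
        using \<alpha> \<beta> j K3 by (auto intro!: pochhammer_le_power simp: R_def)
      then have "pochhammer (\<alpha> + 1 + real j) (k - j) / fact (k - j) * (pochhammer (\<beta> + 1 + real (k - j)) j / fact j) \<le> R k ^ (k - j) / 1 * (R k ^ j / 1)"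
        using \<alpha> \<beta> R1[of k] by (intro mult_mono frac_le) (auto intro!: divide_nonneg_nonneg pochhammer_nonneg)
      then show ?thesis using j by (simp add: c_eq power_add[symmetric])
    qed
    then have "Bc k \<le> (\<Sum>j\<le>k. R k ^ k)" unfolding Bc_def by (intro sum_mono) auto
    also have "\<dots> = (real k + 1) * R k ^ k" by simp
    also have "\<dots> \<le> R k ^ k * R k ^ k"
    proof (rule mult_right_mono)
      show "real k + 1 \<le> R k ^ k"
      proof (cases k)
        case (Suc k')
        have "real k + 1 \<le> R k" using K by (simp add: R_def)
        also have "\<dots> \<le> R k ^ k" using R1[of k] Suc by (simp add: self_le_power)
        finally show ?thesis .
      qed simp
    qed (use R1[of k] in auto)
    finally show ?thesis by (simp add: power_add[symmetric] mult_2)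
  qed
  have G: "1 / G k k \<le> R k ^ (4 * k)" for k
  proof -
    have "1 / pochhammer (\<alpha> + 1) k \<le> 1 / (\<alpha> + 1) ^ k"
      using \<alpha> power_le_pochhammer[of "\<alpha> + 1" k] by (intro divide_left_mono) (auto intro!: mult_pos_pos pochhammer_pos)
    also have "\<dots> = (1 / (\<alpha> + 1)) ^ k" by (simp add: power_divide)
    also have "\<dots> \<le> R k ^ k" using K \<alpha> by (intro power_mono) (auto simp: R_def)
    finally have a: "1 / pochhammer (\<alpha> + 1) k \<le> R k ^ k" .
    have "1 / pochhammer (\<beta> + 1) k \<le> 1 / (\<beta> + 1) ^ k"
      using \<beta> power_le_pochhammer[of "\<beta> + 1" k] by (intro divide_left_mono) (auto intro!: mult_pos_pos pochhammer_pos)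
    also have "\<dots> = (1 / (\<beta> + 1)) ^ k" by (simp add: power_divide)
    also have "\<dots> \<le> R k ^ k" using K \<beta> by (intro power_mono) (auto simp: R_def)
    finally have b: "1 / pochhammer (\<beta> + 1) k \<le> R k ^ k" .
    have "pochhammer (\<alpha> + \<beta> + 2) (k + k) \<le> R k ^ (k + k)"
      using \<alpha> \<beta> K3 by (intro pochhammer_le_power) (auto simp: R_def)
    then have "(1 / pochhammer (\<alpha> + 1) k) * (1 / pochhammer (\<beta> + 1) k) * pochhammer (\<alpha> + \<beta> + 2) (k + k) \<le> R k ^ k * R k ^ k * R k ^ (k + k)"
      using \<alpha> \<beta> R1[of k] by (intro mult_mono a b) (auto intro!: mult_nonneg_nonneg divide_nonneg_nonneg pochhammer_nonneg)
    moreover have "4 * k = k + k + (k + k)" by simp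
    ultimately show ?thesis by (simp only: power_add) (simp add: G_def mult_ac)
  qed
  define u where "u k = 2 * exp (6 * real k * ln (K + 2 * real k) - s * (real k * (real k - 1)))" for k :: nat
  have "summable u"
  proof (rule summable_comparison_test_bigo)
    show "summable (\<lambda>k. norm (1 / real k ^ 2))" using inverse_power_summable[of 2, where 'a = real] by (simp add: inverse_eq_divide)
    show "u \<in> O(\<lambda>k. 1 / real k ^ 2)" unfolding u_def using s K by real_asymp
  qed
  then show ?thesis
  proof (rule summable_comparison_test'[where N = 0])
    fix k :: nat
    have B0: "0 < Bc k" "0 < G k k" by (auto intro: Bc_pos G_pos)
    have "\<bar>poly (J k) x\<bar> / sqrt (Bc k * G k k) \<le> Bc k / sqrt (Bc k * G k k)"
      using abs_J_le[OF x] B0 by (intro divide_right_mono) auto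
    also have "\<dots> = sqrt (Bc k * (1 / G k k))"
    proof -
      have "Bc k = sqrt (Bc k) * sqrt (Bc k)" using B0 by simp
      then show ?thesis using B0 by (simp add: real_sqrt_mult real_sqrt_divide divide_simps)
    qed
    also have "\<dots> \<le> sqrt (R k ^ (2 * k) * R k ^ (4 * k))"
      using Bc[of k] G[of k] B0 R1[of k] by (intro real_sqrt_le_mono mult_mono) auto
    also have "\<dots> = R k ^ (3 * k)"
      using R1[of k] by (intro real_sqrt_unique) (auto simp: power_add[symmetric] power_mult[symmetric])
    also have "\<dots> \<le> R k ^ (6 * k)" using R1[of k] by (intro power_increasing) auto
    also have "\<dots> = exp (6 * real k * ln (K + 2 * real k))"
    proof -
      have "R k ^ (6 * k) = R k powr (real (6 * k))" by (rule powr_realpow[symmetric]) (use R1[of k] in linarith)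
      then show ?thesis using R1[of k] by (simp add: powr_def R_def)
    qed
    finally have "\<bar>poly (J k) x\<bar> / sqrt (Bc k * G k k) \<le> exp (6 * real k * ln (K + 2 * real k))" .
    moreover have "exp (- jacobi_eigenvalue \<alpha> \<beta> k * s) \<le> exp (- s * (real k * (real k - 1)))"
      using mult_right_mono[OF eigenvalue_ge[of k], of s] s by (simp add: mult.commute)
    ultimately have "exp (- jacobi_eigenvalue \<alpha> \<beta> k * s) * (\<bar>poly (J k) x\<bar> / sqrt (Bc k * G k k)) \<le>
      exp (- s * (real k * (real k - 1))) * exp (6 * real k * ln (K + 2 * real k))"
      using B0 by (intro mult_mono) auto
    also have "\<dots> \<le> u k" by (simp add: u_def mult_exp_exp)
    finally show "norm (exp (- jacobi_eigenvalue \<alpha> \<beta> k * s) * \<bar>poly (J k) x\<bar> / sqrt (Bc k * G k k)) \<le> u k"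
      using B0 by simp
  qed
qed

lemma emeasure_\<mu>: "emeasure \<mu> (space \<mu>) = 1"
  using moment_\<mu>[of 0 0] by (intro emeasure_space_eq_1) simp

lemma poly_in_Lp:
  assumes p: "0 < p"
  shows "poly q \<in> Lp_space p \<mu>"
proof -
  interpret finite_measure \<mu> by (rule finite_measureI) (simp add: emeasure_\<mu>)
  have m: "poly q \<in> borel_measurable \<mu>"
    by (intro measurable_\<mu> borel_measurable_continuous_onI continuous_intros)
  have "compact (poly q ` {-1..1})" by (intro compact_continuous_image continuous_intros) auto
  then obtain B where B: "\<forall>x\<in>{-1..1}. \<bar>poly q x\<bar> \<le> B"
    by (auto dest!: compact_imp_bounded simp: bounded_iff)
  have "integrable \<mu> (\<lambda>x. \<bar>poly q x\<bar> powr p)"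
  proof (rule integrable_const_bound)
    show "AE x in \<mu>. norm (\<bar>poly q x\<bar> powr p) \<le> B powr p"
      using B p by (intro AE_I2) (auto simp: space_\<mu> intro!: powr_mono2)
    show "(\<lambda>x. \<bar>poly q x\<bar> powr p) \<in> borel_measurable \<mu>" using m by measurable
  qed
  with m show ?thesis by (simp add: Lp_space_def)
qed

lemma jacobi_poisson_poly:
  assumes t: "0 < t" and x: "x \<in> {-1<..<1}"
  shows "jacobi_poisson \<alpha> \<beta> t (\<lambda>y. \<Sum>k\<le>N. a k * poly (J k) y) x =
    (\<Sum>k\<le>N. a k * exp (- t * sqrt (jacobi_eigenvalue \<alpha> \<beta> k)) * poly (J k) x)"
  unfolding jacobi_poisson_def
proof (rule orthogonal_poisson[where h = "\<lambda>k. Bc k * G k k" and S = "{-1..1}" and M = \<mu>])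
  show "0 < Bc k * G k k" for k by (intro mult_pos_pos Bc_pos G_pos)
  show "0 \<le> jacobi_eigenvalue \<alpha> \<beta> k" for k
    using eigenvalue_pos[of k] by (cases "k = 0") (auto simp: jacobi_eigenvalue_def)
  show "integrable \<mu> (\<lambda>y. poly (J j) y * poly (J k) y)" "(\<integral>y. poly (J j) y * poly (J k) y \<partial>\<mu>) = (if j = k then Bc k * G k k else 0)" for j k
    using orthogonal_J[of j k] by (simp_all add: has_bochner_integral_iff)
  show "summable (\<lambda>k. exp (- jacobi_eigenvalue \<alpha> \<beta> k * s) * \<bar>poly (J k) x\<bar> / sqrt (Bc k * G k k))" if "0 < s" "x \<in> {-1..1}" for s x
    using that by (intro summable_J) auto
  show "jacobi_semigroup \<alpha> \<beta> s f x = (\<integral>y. (\<Sum>k. exp (- jacobi_eigenvalue \<alpha> \<beta> k * s) / (Bc k * G k k) * poly (J k) x * poly (J k) y) * f y \<partial>\<mu>)" for s f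
    by (simp add: jacobi_semigroup_def jacobi_sqnorm_eq poly_J)
qed (use t x in \<open>auto simp: space_\<mu>\<close>)

lemma eigenvalue_0: "jacobi_eigenvalue \<alpha> \<beta> 0 = 0"
  by (simp add: jacobi_eigenvalue_def)

lemma jacobi_g_poly:
  assumes x: "x \<in> {-1<..<1}"
  shows "jacobi_g \<alpha> \<beta> (\<lambda>y. \<Sum>k\<le>N. a k * poly (J k) y) x =
    enn_powr (ennreal (g_form N (jacobi_eigenvalue \<alpha> \<beta>) (\<lambda>k. a k * poly (J k) x) (\<lambda>k. a k * poly (pderiv (J k)) x) (1 - x\<^sup>2))) (1 / 2)"
    and "0 \<le> g_form N (jacobi_eigenvalue \<alpha> \<beta>) A B (1 - x\<^sup>2)"
proof -
  have w: "0 \<le> 1 - x\<^sup>2" using x by (simp add: abs_square_le_1 abs_le_iff)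
  show "jacobi_g \<alpha> \<beta> (\<lambda>y. \<Sum>k\<le>N. a k * poly (J k) y) x =
    enn_powr (ennreal (g_form N (jacobi_eigenvalue \<alpha> \<beta>) (\<lambda>k. a k * poly (J k) x) (\<lambda>k. a k * poly (pderiv (J k)) x) (1 - x\<^sup>2))) (1 / 2)"
    unfolding jacobi_g_def g_function_def
    by (subst g_function_exp_sum(3)[where S = "{-1<..<1}" and E = J and c = a and N = N and lam = "jacobi_eigenvalue \<alpha> \<beta>"])
      (use x w in \<open>auto simp: jacobi_poisson_poly degree_J eigenvalue_pos eigenvalue_0\<close>)
  show "0 \<le> g_form N (jacobi_eigenvalue \<alpha> \<beta>) A B (1 - x\<^sup>2)"
    by (rule g_integral_exp_sum(2)) (use w eigenvalue_pos in auto)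
qed

text \<open>The change of variables \<open>x = b + a * z\<close> and the time change \<open>t = s / sqrt \<theta>\<close>.\<close>

lemma affine_transfer:
  fixes a b \<theta> \<kappa> p C :: real
  assumes a: "a \<noteq> 0" and \<theta>: "0 < \<theta>" and \<kappa>: "0 < \<kappa>" and p: "0 < p" and C: "0 \<le> C"
    and \<rho>: "\<And>z. \<rho> z = \<kappa> * (indicator {-1<..<1} (b + a * z) * ((1 - (b + a * z)) powr \<alpha> * (1 + (b + a * z)) powr \<beta>))"
    and hyp: "\<And>f. f \<in> Lp_space p \<mu> \<Longrightarrow> Lp_norm_enn p \<mu> (jacobi_g \<alpha> \<beta> f) \<le> ennreal C * Lp_norm p \<mu> f"
  obtains E where "orthogonal_polys (weight_functional \<rho>) E" "\<And>k. lead_coeff (E k) = 1"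
    "\<And>N A B z. 0 \<le> g_form N (\<lambda>k. jacobi_eigenvalue \<alpha> \<beta> k / \<theta>) A B ((1 - (b + a * z)\<^sup>2) / (a\<^sup>2 * \<theta>)) \<or> \<rho> z = 0"
    "\<And>f N. degree f \<le> N \<Longrightarrow> (\<integral>\<^sup>+z. ennreal ((g_form N (\<lambda>k. jacobi_eigenvalue \<alpha> \<beta> k / \<theta>)
        (\<lambda>k. weight_functional \<rho> (f * E k) / weight_functional \<rho> (E k * E k) * poly (E k) z)
        (\<lambda>k. weight_functional \<rho> (f * E k) / weight_functional \<rho> (E k * E k) * poly (pderiv (E k)) z)
        ((1 - (b + a * z)\<^sup>2) / (a\<^sup>2 * \<theta>))) powr (p / 2)) * ennreal (\<rho> z) \<partial>lborel)
      \<le> ennreal (C powr p) * (\<integral>\<^sup>+z. ennreal (\<bar>poly f z\<bar> powr p) * ennreal (\<rho> z) \<partial>lborel)"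
proof -
  define lin where "lin = [:b, a:]"
  define inv where "inv = [:- b / a, 1 / a:]"
  have lin: "poly lin z = b + a * z" "degree lin = 1" "lead_coeff lin = a" for z using a by (simp_all add: lin_def mult.commute)
  have inv: "poly inv (b + a * z) = z" "b + a * poly inv x = x" for z x using a by (simp_all add: inv_def field_simps)
  have inv_lin: "pcompose inv lin = [:0, 1:]" using a by (simp add: inv_def lin_def pcompose_pCons)
  define \<delta> where "\<delta> x = indicator {-1<..<1} x * (\<eta> * (1 - x) powr \<alpha> * (1 + x) powr \<beta>)" for x :: real
  \<comment> \<open>The Jacobian and the two normalisations collected in one constant. It multiplies
    both integrals of the inequality and is cancelled at the end.\<close>
  define K where "K = \<bar>a\<bar> * \<eta> / \<kappa>"
  have K: "0 < K" using a \<eta>_pos \<kappa> by (simp add: K_def)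
  have \<delta>\<rho>: "\<bar>a\<bar> * \<delta> (b + a * z) = K * \<rho> z" for z
    using \<kappa> by (simp add: \<delta>_def \<rho> K_def)
  have \<rho>0: "0 \<le> \<rho> z" for z using \<kappa> by (simp add: \<rho>)
  have [measurable]: "\<rho> \<in> borel_measurable borel" unfolding \<rho>[abs_def] by measurable
  have nn: "(\<integral>\<^sup>+x. f x \<partial>\<mu>) = ennreal K * (\<integral>\<^sup>+z. f (b + a * z) * ennreal (\<rho> z) \<partial>lborel)"
    if [measurable]: "f \<in> borel_measurable borel" for f
  proof -
    have [measurable]: "\<delta> \<in> borel_measurable borel" unfolding \<delta>_def by measurable
    have "(\<integral>\<^sup>+x. f x \<partial>\<mu>) = (\<integral>\<^sup>+x. f x * ennreal (\<delta> x) \<partial>lborel)"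
      unfolding \<delta>_def by (rule nn_integral_\<mu>) measurable
    also have "\<dots> = ennreal \<bar>a\<bar> * (\<integral>\<^sup>+z. f (b + a * z) * ennreal (\<delta> (b + a * z)) \<partial>lborel)"
      by (rule nn_integral_real_affine) (use a in auto)
    also have "\<dots> = (\<integral>\<^sup>+z. ennreal \<bar>a\<bar> * (f (b + a * z) * ennreal (\<delta> (b + a * z))) \<partial>lborel)"
      by (rule nn_integral_cmult[symmetric]) measurable
    also have "\<dots> = (\<integral>\<^sup>+z. ennreal K * (f (b + a * z) * ennreal (\<rho> z)) \<partial>lborel)"
    proof (rule nn_integral_cong)
      fix z
      have "ennreal \<bar>a\<bar> * ennreal (\<delta> (b + a * z)) = ennreal K * ennreal (\<rho> z)"
        using \<delta>\<rho>[of z] K \<rho>0[of z] by (simp add: ennreal_mult'[symmetric])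
      then show "ennreal \<bar>a\<bar> * (f (b + a * z) * ennreal (\<delta> (b + a * z))) = ennreal K * (f (b + a * z) * ennreal (\<rho> z))"
        by (metis mult.left_commute)
    qed
    also have "\<dots> = ennreal K * (\<integral>\<^sup>+z. f (b + a * z) * ennreal (\<rho> z) \<partial>lborel)"
      by (rule nn_integral_cmult) measurable
    finally show ?thesis .
  qed
  have bi: "has_bochner_integral lborel (\<lambda>z. f (b + a * z) * \<rho> z) (r / K)"
    if [measurable]: "f \<in> borel_measurable borel" and f: "has_bochner_integral \<mu> f r" for f r
  proof -
    have "has_bochner_integral lborel (\<lambda>x. \<delta> x * f x) r"
      using f unfolding \<delta>_def by (subst (asm) has_bochner_integral_\<mu>_iff) auto
    then have "has_bochner_integral lborel (\<lambda>z. \<delta> (b + a * z) * f (b + a * z)) (r /\<^sub>R \<bar>a\<bar>)"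
      using lborel_has_bochner_integral_real_affine_iff[OF a, of "\<lambda>x. \<delta> x * f x" r b] by simp
    then have "has_bochner_integral lborel (\<lambda>z. (\<bar>a\<bar> / K) * (\<delta> (b + a * z) * f (b + a * z))) ((\<bar>a\<bar> / K) * (r /\<^sub>R \<bar>a\<bar>))"
      by (rule has_bochner_integral_mult_right)
    moreover have "(\<bar>a\<bar> / K) * (\<delta> (b + a * z) * f (b + a * z)) = f (b + a * z) * \<rho> z" for z
    proof -
      have "(\<bar>a\<bar> / K) * (\<delta> (b + a * z) * f (b + a * z)) = (\<bar>a\<bar> * \<delta> (b + a * z)) / K * f (b + a * z)" by simp
      then show ?thesis using K by (simp add: \<delta>\<rho>)
    qed
    moreover have "(\<bar>a\<bar> / K) * (r /\<^sub>R \<bar>a\<bar>) = r / K" using a by simp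
    ultimately show ?thesis by (simp only:)
  qed
  have J0: "J k \<noteq> 0" for k using coeff_J[of k] Bc_pos[of k] by auto
  define lc where "lc k = lead_coeff (pcompose (J k) lin)" for k
  have lc0: "lc k \<noteq> 0" for k
    unfolding lc_def using lead_coeff_comp[of lin "J k"] lin a J0[of k] by simp
  define E where "E k = smult (1 / lc k) (pcompose (J k) lin)" for k
  have pE: "poly (E k) z = poly (J k) (b + a * z) / lc k" for k z
    by (simp add: E_def poly_pcompose lin)
  have degE: "degree (E k) = k" for k using lc0[of k] by (simp add: E_def degree_pcompose lin degree_J)
  have lcE: "lead_coeff (E k) = 1" for k using lc0[of k] by (simp add: E_def lc_def)
  have E0: "E k \<noteq> 0" for k using lcE[of k] by auto
  have intE: "has_bochner_integral lborel (\<lambda>z. poly (E j) z * poly (E k) z * \<rho> z) ((if j = k then Bc k * G k k else 0) / (lc j * lc k) / K)" for j k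
  proof -
    have "has_bochner_integral \<mu> (\<lambda>x. poly (J j) x * poly (J k) x / (lc j * lc k)) ((if j = k then Bc k * G k k else 0) / (lc j * lc k))"
      by (intro has_bochner_integral_divide_zero orthogonal_J)
    then have "has_bochner_integral lborel (\<lambda>z. poly (J j) (b + a * z) * poly (J k) (b + a * z) / (lc j * lc k) * \<rho> z) ((if j = k then Bc k * G k k else 0) / (lc j * lc k) / K)"
      by (intro bi) measurable
    then show ?thesis by (simp add: pE)
  qed
  have int_poly: "integrable lborel (\<lambda>z. poly q z * \<rho> z)" for q
  proof -
    have "integrable \<mu> (poly (pcompose q inv))"
    proof -
      interpret finite_measure \<mu> by (rule finite_measureI) (simp add: emeasure_\<mu>)
      have "compact (poly (pcompose q inv) ` {-1..1})" by (intro compact_continuous_image continuous_intros) auto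
      then obtain B where B: "\<forall>x\<in>{-1..1}. \<bar>poly (pcompose q inv) x\<bar> \<le> B"
        by (auto dest!: compact_imp_bounded simp: bounded_iff)
      show ?thesis
        by (rule integrable_const_bound[where B = B]) (use B in \<open>auto simp: space_\<mu> intro!: AE_I2\<close>)
    qed
    then obtain r where "has_bochner_integral \<mu> (poly (pcompose q inv)) r" by (auto simp: has_bochner_integral_iff)
    from bi[OF _ this] show ?thesis by (simp add: poly_pcompose inv has_bochner_integral_iff)
  qed
  have lin_\<rho>: "linear_functional (weight_functional \<rho>)" by (rule weight_functional_linear[OF int_poly])
  have orthE: "orthogonal_polys (weight_functional \<rho>) E"
    unfolding orthogonal_polys_def weight_functional_def poly_mult
    using intE lc0 K G_pos Bc_pos degE E0 lin_\<rho>[unfolded weight_functional_def]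
    by (auto simp: has_bochner_integral_iff weight_functional_def[abs_def] less_imp_neq[symmetric])
  have scale: "g_form N (\<lambda>k. jacobi_eigenvalue \<alpha> \<beta> k / \<theta>) A B (w / (c\<^sup>2 * \<theta>)) =
      g_form N (jacobi_eigenvalue \<alpha> \<beta>) A (\<lambda>k. B k / c) w" for N A B w c
    by (rule g_form_scale[OF \<theta>]) (rule eigenvalue_pos)
  have nonneg: "0 \<le> g_form N (\<lambda>k. jacobi_eigenvalue \<alpha> \<beta> k / \<theta>) A B ((1 - (b + a * z)\<^sup>2) / (a\<^sup>2 * \<theta>)) \<or> \<rho> z = 0" for N A B z
  proof (cases "b + a * z \<in> {-1<..<1}")
    case True
    then show ?thesis
      unfolding scale using jacobi_g_poly(2) by blast
  qed (simp add: \<rho>)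
  have ineq: "(\<integral>\<^sup>+z. ennreal ((g_form N (\<lambda>k. jacobi_eigenvalue \<alpha> \<beta> k / \<theta>)
        (\<lambda>k. weight_functional \<rho> (f * E k) / weight_functional \<rho> (E k * E k) * poly (E k) z)
        (\<lambda>k. weight_functional \<rho> (f * E k) / weight_functional \<rho> (E k * E k) * poly (pderiv (E k)) z)
        ((1 - (b + a * z)\<^sup>2) / (a\<^sup>2 * \<theta>))) powr (p / 2)) * ennreal (\<rho> z) \<partial>lborel)
      \<le> ennreal (C powr p) * (\<integral>\<^sup>+z. ennreal (\<bar>poly f z\<bar> powr p) * ennreal (\<rho> z) \<partial>lborel)"
    if f: "degree f \<le> N" for f N
  proof -
    define d where "d k = weight_functional \<rho> (f * E k) / weight_functional \<rho> (E k * E k)" for k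
    \<comment> \<open>The polynomial pulled back to the interval: \<open>F\<close> at
      \<open>b + a * z\<close> is \<open>f\<close> at \<open>z\<close>, so the hypothesis for
      \<open>F\<close> becomes the inequality for \<open>f\<close>.\<close>
    define F where "F = pcompose f inv"
    have "f = (\<Sum>k<Suc N. smult (d k) (E k))"
      unfolding d_def by (rule orthogonal_polys_expansion[OF orthE]) (use f in simp)
    then have "poly f z = (\<Sum>k<Suc N. d k * poly (E k) z)" for z by (metis (no_types, lifting) poly_smult poly_sum sum.cong)
    then have fz: "poly f z = (\<Sum>k\<le>N. d k * poly (E k) z)" for z by (simp add: lessThan_Suc_atMost)
    have F: "poly F = (\<lambda>x. \<Sum>k\<le>N. (d k / lc k) * poly (J k) x)"
    proof
      fix x show "poly F x = (\<Sum>k\<le>N. (d k / lc k) * poly (J k) x)"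
        by (simp add: F_def poly_pcompose fz pE inv)
    qed
    define Q where "Q x = g_form N (jacobi_eigenvalue \<alpha> \<beta>) (\<lambda>k. d k / lc k * poly (J k) x) (\<lambda>k. d k / lc k * poly (pderiv (J k)) x) (1 - x\<^sup>2)" for x
    have [measurable]: "Q \<in> borel_measurable borel" unfolding Q_def g_form_def by measurable
    have gQ: "enn_powr (jacobi_g \<alpha> \<beta> (poly F) x) p = ennreal (Q x powr (p / 2))" if "x \<in> space \<mu>" for x
    proof -
      have x: "x \<in> {-1<..<1}" using that by (simp add: space_\<mu>)
      show ?thesis
        unfolding F jacobi_g_poly(1)[OF x] Q_def[symmetric]
        using p jacobi_g_poly(2)[OF x, of N] by (simp add: enn_powr_ennreal Q_def powr_powr)
    qed
    have QE: "Q (b + a * z) = g_form N (\<lambda>k. jacobi_eigenvalue \<alpha> \<beta> k / \<theta>) (\<lambda>k. d k * poly (E k) z) (\<lambda>k. d k * poly (pderiv (E k)) z)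
        ((1 - (b + a * z)\<^sup>2) / (a\<^sup>2 * \<theta>))" for z
    proof -
      have "d k * poly (pderiv (E k)) z / a = d k / lc k * poly (pderiv (J k)) (b + a * z)" for k
        using a by (simp add: E_def pderiv_smult pderiv_pcompose poly_pcompose lin) (simp add: lin_def pderiv_pCons)
      moreover have "d k * poly (E k) z = d k / lc k * poly (J k) (b + a * z)" for k by (simp add: pE)
      ultimately show ?thesis
        unfolding scale Q_def by presburger
    qed
    have "(\<integral>\<^sup>+x. ennreal (Q x powr (p / 2)) \<partial>\<mu>) \<le> ennreal (C powr p) * (\<integral>\<^sup>+x. ennreal (\<bar>poly F x\<bar> powr p) \<partial>\<mu>)"
      using hyp[OF poly_in_Lp[OF p, of F]] unfolding Lp_norm_enn_le_iff[OF p C poly_in_Lp[OF p]]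
      by (simp add: gQ cong: nn_integral_cong)
    then have "ennreal K * (\<integral>\<^sup>+z. ennreal (Q (b + a * z) powr (p / 2)) * ennreal (\<rho> z) \<partial>lborel) \<le>
      ennreal (C powr p) * (ennreal K * (\<integral>\<^sup>+z. ennreal (\<bar>poly F (b + a * z)\<bar> powr p) * ennreal (\<rho> z) \<partial>lborel))"
      by (subst (asm) nn, measurable, subst (asm) nn, measurable)
    then have "ennreal K * (\<integral>\<^sup>+z. ennreal (Q (b + a * z) powr (p / 2)) * ennreal (\<rho> z) \<partial>lborel) \<le>
      ennreal K * (ennreal (C powr p) * (\<integral>\<^sup>+z. ennreal (\<bar>poly f z\<bar> powr p) * ennreal (\<rho> z) \<partial>lborel))"
      by (simp add: F_def poly_pcompose inv mult.left_commute)
    then have "(\<integral>\<^sup>+z. ennreal (Q (b + a * z) powr (p / 2)) * ennreal (\<rho> z) \<partial>lborel) \<le>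
      ennreal (C powr p) * (\<integral>\<^sup>+z. ennreal (\<bar>poly f z\<bar> powr p) * ennreal (\<rho> z) \<partial>lborel)"
      using K by (simp add: ennreal_mult_le_mult_iff)
    then show ?thesis unfolding QE d_def .
  qed
  show thesis
    by (rule that[OF orthE lcE nonneg ineq])
qed

end

subsection \<open>Laguerre polynomials and the Hille--Hardy formula\<close>

text \<open>Once the lower coefficients agree, the difference may be divided by
  \<open>h ^ n\<close>, and letting \<open>h\<close> tend to 0 isolates the next
  coefficient.\<close>

lemma powser_coeffs_unique:
  fixes a b :: "nat \<Rightarrow> real"
  assumes e: "0 < e" and a: "\<And>h. \<bar>h\<bar> < e \<Longrightarrow> (\<lambda>n. a n * h ^ n) sums f h"
    and b: "\<And>h. \<bar>h\<bar> < e \<Longrightarrow> (\<lambda>n. b n * h ^ n) sums f h"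
  shows "a n = b n"
proof (induction n rule: less_induct)
  case (less n)
  define c where "c k = a (k + n) - b (k + n)" for k
  have "(\<lambda>k. c k * h ^ k) sums 0" if h: "h \<noteq> 0" "norm h < e" for h
  proof -
    have "(\<lambda>k. (a k - b k) * h ^ k) sums 0"
      using sums_diff[OF a[of h] b[of h]] h by (simp add: left_diff_distrib)
    then have "(\<lambda>k. (a (k + n) - b (k + n)) * h ^ (k + n)) sums 0"
      by (subst sums_iff_shift) (simp add: less.IH)
    then have "(\<lambda>k. c k * h ^ k * h ^ n) sums 0" by (simp add: c_def power_add mult.assoc)
    then show ?thesis using sums_mult2_iff[of "h ^ n" "\<lambda>k. c k * h ^ k" 0] h by simp
  qed
  then have "((\<lambda>h. 0) \<longlongrightarrow> c 0) (at (0::real))" by (rule powser_limit_0_strong[OF e])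
  then have "c 0 = 0" by (simp add: tendsto_const_iff)
  then show ?case by (simp add: c_def)
qed

text \<open>Absolute summability over all pairs of indices permits summing by rows or by
  antidiagonals. Generating functions below are rearranged through this lemma.\<close>

lemma sums_antidiagonal:
  fixes b :: "nat \<Rightarrow> nat \<Rightarrow> real"
  assumes B: "\<And>j. (\<lambda>m. \<bar>b j m\<bar>) sums B j" "summable B"
    and a: "\<And>j. (\<lambda>m. b j m) sums a j"
  shows "(\<lambda>k. \<Sum>j\<le>k. b j (k - j)) sums (\<Sum>j. a j)"
    and "summable (\<lambda>k. \<Sum>j\<le>k. \<bar>b j (k - j)\<bar>)"
proof -
  have hB: "((\<lambda>m. \<bar>b j m\<bar>) has_sum B j) UNIV" for j
    using B(1) by (intro norm_summable_imp_has_sum) (auto simp: sums_iff)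
  have B0: "0 \<le> B j" for j by (rule has_sum_nonneg[OF hB]) simp
  have ha: "((\<lambda>m. b j m) has_sum a j) UNIV" for j
    using B(1) a by (intro norm_summable_imp_has_sum) (auto simp: sums_iff)
  have "(B has_sum (\<Sum>j. B j)) UNIV"
    using B(2) B0 by (intro norm_summable_imp_has_sum) auto
  then have BB: "(B has_sum (\<Sum>j. B j)) UNIV" "B summable_on UNIV" by (auto intro: has_sum_imp_summable)
  have "(\<lambda>(j, m). \<bar>b j m\<bar>) summable_on (UNIV \<times> UNIV)"
    by (rule summable_on_SigmaI[where g = B]) (use hB BB in auto)
  then have hs: "((\<lambda>(j, m). \<bar>b j m\<bar>) has_sum (\<Sum>j. B j)) (UNIV \<times> UNIV)"
    by (intro has_sum_SigmaI[where g = B]) (use hB BB in auto)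
  then have abs: "(\<lambda>jm. norm ((\<lambda>(j, m). b j m) jm)) summable_on (UNIV \<times> UNIV)"
    by (auto simp: case_prod_unfold intro: has_sum_imp_summable)
  then have sm: "(\<lambda>(j, m). b j m) summable_on (UNIV \<times> UNIV)" by (rule abs_summable_summable)
  have "summable (\<lambda>j. \<bar>a j\<bar>)"
  proof (rule summable_comparison_test'[OF B(2)])
    show "norm \<bar>a j\<bar> \<le> B j" for j
      using summable_rabs[of "b j"] B(1)[of j] a[of j] by (auto simp: sums_iff)
  qed
  then have "(a has_sum (\<Sum>j. a j)) UNIV"
    by (intro norm_summable_imp_has_sum) (auto intro: summable_sums summable_rabs_cancel)
  moreover have "(a has_sum (\<Sum>\<^sub>\<infinity>jm\<in>UNIV \<times> UNIV. (\<lambda>(j, m). b j m) jm)) UNIV"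
    by (rule has_sum_SigmaD[OF has_sum_infsum[OF sm]]) (simp add: ha)
  ultimately have "(\<Sum>\<^sub>\<infinity>jm\<in>UNIV \<times> UNIV. (\<lambda>(j, m). b j m) jm) = (\<Sum>j. a j)" by (metis has_sum_unique)
  then have tot: "((\<lambda>(j, m). b j m) has_sum (\<Sum>j. a j)) (UNIV \<times> UNIV)" using has_sum_infsum[OF sm] by simp
  have bij: "bij_betw (\<lambda>(k, j). (j, k - j)) (SIGMA k:UNIV. {..k}) (UNIV \<times> UNIV :: (nat \<times> nat) set)"
    by (rule bij_betw_byWitness[where f' = "\<lambda>(j, m). (j + m, j)"]) auto
  have "((\<lambda>(k, j). b j (k - j)) has_sum (\<Sum>j. a j)) (SIGMA k:UNIV. {..k})"
    using has_sum_reindex_bij_betw[OF bij, of "\<lambda>(j, m). b j m"] tot by (simp add: case_prod_unfold)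
  then have "((\<lambda>k. \<Sum>j\<le>k. b j (k - j)) has_sum (\<Sum>j. a j)) UNIV"
    by (rule has_sum_SigmaD) (simp add: has_sum_finite)
  then show "(\<lambda>k. \<Sum>j\<le>k. b j (k - j)) sums (\<Sum>j. a j)" by (rule has_sum_imp_sums)
  have "((\<lambda>(k, j). \<bar>b j (k - j)\<bar>) has_sum (\<Sum>j. B j)) (SIGMA k:UNIV. {..k})"
    using has_sum_reindex_bij_betw[OF bij, of "\<lambda>(j, m). \<bar>b j m\<bar>"] hs by (simp add: case_prod_unfold)
  then have "((\<lambda>k. \<Sum>j\<le>k. \<bar>b j (k - j)\<bar>) has_sum (\<Sum>j. B j)) UNIV"
    by (rule has_sum_SigmaD) (simp add: has_sum_finite)
  then show "summable (\<lambda>k. \<Sum>j\<le>k. \<bar>b j (k - j)\<bar>)" by (blast dest: has_sum_imp_sums sums_summable)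
qed

text \<open>Newton's binomial series with exponent \<open>- a\<close> at \<open>- \<rho>\<close>;
  the signs combine into a rising factorial.\<close>

lemma pochhammer_powser:
  fixes a \<rho> :: real
  assumes "\<bar>\<rho>\<bar> < 1"
  shows "(\<lambda>m. pochhammer a m / fact m * \<rho> ^ m) sums (1 - \<rho>) powr (- a)"
proof -
  have "((- a) gchoose m) * (- \<rho>) ^ m = pochhammer a m / fact m * \<rho> ^ m" for m
    by (simp add: gbinomial_pochhammer power_mult_distrib[symmetric] flip: power_minus)
  then show ?thesis using gen_binomial_real[of "- \<rho>" "- a"] assms by simp
qed

lemma exp_powser: "(\<lambda>n. x ^ n / fact n) sums exp x" for x :: real
  using exp_converges[of x] by (simp add: divide_inverse mult.commute)

locale laguerre =
  fixes \<alpha> :: real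
  assumes \<alpha>: "-1 < \<alpha>"
begin

text \<open>The sign of each coefficient is left with the variable, as a power of
  \<open>- x\<close>, so that \<open>l k j\<close> is positive.\<close>

definition l :: "nat \<Rightarrow> nat \<Rightarrow> real"
  where "l k j = pochhammer (\<alpha> + 1 + real j) (k - j) / fact (k - j) / fact j"

lemma l_pos: "0 < l k j"
  using \<alpha> by (auto simp: l_def intro!: divide_pos_pos pochhammer_pos)

lemma laguerre_poly_eq: "laguerre_poly \<alpha> k x = (\<Sum>j\<le>k. l k j * (- x) ^ j)"
  unfolding laguerre_poly_def by (intro sum.cong refl) (simp add: gchoose_eq_pochhammer l_def)

text \<open>All coefficients in powers of \<open>- x\<close> are positive. Questions of absolute
  convergence thus reduce to convergence at the negative argument
  \<open>- \<bar>x\<bar>\<close>.\<close>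

lemma abs_laguerre_poly_le: "\<bar>laguerre_poly \<alpha> k x\<bar> \<le> laguerre_poly \<alpha> k (- \<bar>x\<bar>)"
proof -
  have "\<bar>laguerre_poly \<alpha> k x\<bar> \<le> (\<Sum>j\<le>k. \<bar>l k j * (- x) ^ j\<bar>)"
    unfolding laguerre_poly_eq by (rule sum_abs)
  also have "\<dots> = laguerre_poly \<alpha> k (- \<bar>x\<bar>)"
    unfolding laguerre_poly_eq using l_pos by (intro sum.cong refl) (simp add: abs_mult power_abs less_imp_le abs_of_pos)
  finally show ?thesis .
qed

text \<open>The exponential is expanded, each term carrying a power of \<open>1 - \<rho>\<close>
  with exponent \<open>- \<alpha> - 1 - j\<close>; the binomial series turns this into a double
  series whose antidiagonal sums are the Laguerre polynomials. Absolute convergence is the same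
  formula at \<open>- \<bar>x\<bar>\<close> and \<open>\<bar>\<rho>\<bar>\<close>.\<close>

lemma laguerre_generating:
  assumes \<rho>: "\<bar>\<rho>\<bar> < 1"
  shows "(\<lambda>k. laguerre_poly \<alpha> k x * \<rho> ^ k) sums ((1 - \<rho>) powr (- \<alpha> - 1) * exp (- (x * \<rho> / (1 - \<rho>))))"
    and "summable (\<lambda>k. \<bar>laguerre_poly \<alpha> k x\<bar> * \<bar>\<rho>\<bar> ^ k)"
proof -
  define b where "b x \<rho> j m = (x * \<rho>) ^ j / fact j * (pochhammer (\<alpha> + 1 + real j) m / fact m * \<rho> ^ m)" for x \<rho> j m
  have inner: "(\<lambda>m. b x \<rho> j m) sums ((1 - \<rho>) powr (- \<alpha> - 1) * ((x * \<rho> / (1 - \<rho>)) ^ j / fact j))" if \<rho>: "\<bar>\<rho>\<bar> < 1" for x \<rho> j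
  proof -
    have "(\<lambda>m. b x \<rho> j m) sums ((x * \<rho>) ^ j / fact j * (1 - \<rho>) powr (- (\<alpha> + 1 + real j)))"
      unfolding b_def by (intro sums_mult pochhammer_powser \<rho>)
    moreover have "(1 - \<rho>) powr (- (\<alpha> + 1 + real j)) = (1 - \<rho>) powr (- \<alpha> - 1) / (1 - \<rho>) ^ j"
    proof -
      have "- (\<alpha> + 1 + real j) = - \<alpha> - 1 - real j" by simp
      then show ?thesis using \<rho> powr_diff[of "1 - \<rho>" "- \<alpha> - 1" "real j"] by (simp only: powr_realpow)
    qed
    ultimately show ?thesis by (simp add: power_divide mult.commute)
  qed
  have outer: "(\<lambda>j. (1 - \<rho>) powr (- \<alpha> - 1) * ((x * \<rho> / (1 - \<rho>)) ^ j / fact j)) sums ((1 - \<rho>) powr (- \<alpha> - 1) * exp (x * \<rho> / (1 - \<rho>)))" for x \<rho> :: real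
    by (intro sums_mult exp_powser)
  have abs_b: "\<bar>b x \<rho> j m\<bar> = b \<bar>x\<bar> \<bar>\<rho>\<bar> j m" for x \<rho> j m
  proof -
    have "0 \<le> pochhammer (\<alpha> + 1 + real j) m" using \<alpha> by (intro pochhammer_nonneg) simp
    then show ?thesis by (simp add: b_def abs_mult power_abs power_mult_distrib)
  qed
  have diag: "(\<Sum>j\<le>k. b (- x) \<rho> j (k - j)) = laguerre_poly \<alpha> k x * \<rho> ^ k" for x \<rho> k
  proof -
    have "b (- x) \<rho> j (k - j) = l k j * (- x) ^ j * \<rho> ^ k" if "j \<le> k" for j
    proof -
      have "\<rho> ^ k = \<rho> ^ j * \<rho> ^ (k - j)" using that by (simp add: power_add[symmetric])
      moreover have "(- x * \<rho>) ^ j = (- x) ^ j * \<rho> ^ j" by (rule power_mult_distrib)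
      ultimately show ?thesis unfolding b_def l_def by (simp only:) (simp add: mult_ac)
    qed
    then show ?thesis unfolding laguerre_poly_eq sum_distrib_right by (intro sum.cong) auto
  qed
  have main: "(\<lambda>k. laguerre_poly \<alpha> k x * \<rho> ^ k) sums ((1 - \<rho>) powr (- \<alpha> - 1) * exp (- (x * \<rho> / (1 - \<rho>))))" if \<rho>: "\<bar>\<rho>\<bar> < 1" for x \<rho>
  proof -
    have "\<bar>\<bar>\<rho>\<bar>\<bar> < 1" using \<rho> by simp
    from sums_antidiagonal(1)[of "b (- x) \<rho>", unfolded abs_b, OF inner[OF this] sums_summable[OF outer] inner[OF \<rho>]]
    show ?thesis using outer[of \<rho> "- x"] by (simp add: diag sums_iff)
  qed
  show "(\<lambda>k. laguerre_poly \<alpha> k x * \<rho> ^ k) sums ((1 - \<rho>) powr (- \<alpha> - 1) * exp (- (x * \<rho> / (1 - \<rho>))))" by (rule main[OF \<rho>])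
  have "summable (\<lambda>k. laguerre_poly \<alpha> k (- \<bar>x\<bar>) * \<bar>\<rho>\<bar> ^ k)" using main[of "\<bar>\<rho>\<bar>" "- \<bar>x\<bar>"] \<rho> by (simp add: sums_iff)
  then show "summable (\<lambda>k. \<bar>laguerre_poly \<alpha> k x\<bar> * \<bar>\<rho>\<bar> ^ k)"
    by (rule summable_comparison_test'[where N = 0]) (simp add: abs_mult mult_right_mono abs_laguerre_poly_le)
qed

text \<open>The generating function at \<open>r + h\<close> is expanded in powers of
  \<open>h\<close> in two ways. The binomial theorem for the powers of \<open>r + h\<close> yields
  the sums on the left; the factorisation of \<open>1 - (r + h)\<close> as
  \<open>q * (1 - h / q)\<close> yields the generating function at \<open>x / q\<close> and
  \<open>h / q\<close>. Coefficients are then compared.\<close>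

lemma laguerre_shifted_generating:
  assumes r: "0 \<le> r" "r < 1"
  shows "(\<lambda>m. real ((m + j) choose j) * r ^ m * laguerre_poly \<alpha> (m + j) x) sums
      ((1 - r) powr (- \<alpha> - 1) * exp (- (x * r / (1 - r))) * (laguerre_poly \<alpha> j (x / (1 - r)) / (1 - r) ^ j))"
    and "summable (\<lambda>m. real ((m + j) choose j) * r ^ m * \<bar>laguerre_poly \<alpha> (m + j) x\<bar>)"
proof -
  define q where "q = 1 - r"
  have q: "0 < q" using r by (simp add: q_def)
  let ?L = "laguerre_poly \<alpha>"
  have sm: "summable (\<lambda>m. real ((m + j) choose j) * r ^ m * \<bar>?L (m + j) x\<bar>)" for j x
  proof -
    \<comment> \<open>With this choice \<open>r + h\<close> is still below 1, and one term of the
      binomial expansion of \<open>(r + h) ^ (m + j)\<close> bounds the binomial weight up to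
      \<open>1 / h ^ j\<close>.\<close>
    define h where "h = q / 2"
    have h: "0 < h" "\<bar>r + h\<bar> < 1" using r q by (simp_all add: h_def q_def field_simps)
    have s: "summable (\<lambda>k. \<bar>?L (k + j) x\<bar> * \<bar>r + h\<bar> ^ (k + j))"
      using laguerre_generating(2)[OF h(2), of x] by (subst summable_iff_shift)
    show ?thesis
    proof (rule summable_comparison_test'[OF summable_mult[OF s, of "1 / h ^ j"], of 0])
      fix m
      have "real ((m + j) choose j) * r ^ m * h ^ j \<le> (r + h) ^ (m + j)"
      proof -
        have "(h + r) ^ (m + j) = (\<Sum>i\<le>m + j. real ((m + j) choose i) * h ^ i * r ^ (m + j - i))"
          by (rule binomial_ring)
        also have "\<dots> \<ge> (\<Sum>i\<in>{j}. real ((m + j) choose i) * h ^ i * r ^ (m + j - i))"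
          using h r by (intro sum_mono2) auto
        finally show ?thesis by (simp add: add.commute mult_ac)
      qed
      then have "real ((m + j) choose j) * r ^ m \<le> 1 / h ^ j * (r + h) ^ (m + j)"
        using h(1) by (simp add: pos_le_divide_eq)
      from mult_right_mono[OF this, of "\<bar>?L (m + j) x\<bar>"]
      show "norm (real ((m + j) choose j) * r ^ m * \<bar>?L (m + j) x\<bar>) \<le> 1 / h ^ j * (\<bar>?L (m + j) x\<bar> * \<bar>r + h\<bar> ^ (m + j))"
        using r h by (simp add: mult_ac)
    qed
  qed
  show "summable (\<lambda>m. real ((m + j) choose j) * r ^ m * \<bar>?L (m + j) x\<bar>)" by (rule sm)
  define t where "t j = (\<Sum>m. real ((m + j) choose j) * r ^ m * ?L (m + j) x)" for j
  have t: "(\<lambda>m. real ((m + j) choose j) * r ^ m * ?L (m + j) x) sums t j" for j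
    unfolding t_def by (rule summable_sums, rule summable_rabs_cancel) (use sm[of j x] in \<open>simp add: abs_mult r\<close>)
  define T where "T j = (\<Sum>m. real ((m + j) choose j) * r ^ m * \<bar>?L (m + j) x\<bar>)" for j
  have T: "(\<lambda>m. real ((m + j) choose j) * r ^ m * \<bar>?L (m + j) x\<bar>) sums T j" for j
    unfolding T_def by (rule summable_sums[OF sm])
  \<comment> \<open>The generating function at \<open>r + h\<close>, already factored through
    \<open>1 - (r + h) = q * (1 - h / q)\<close>.\<close>
  define g where "g h = q powr (- \<alpha> - 1) * exp (- (x * r / q)) * ((1 - h / q) powr (- \<alpha> - 1) * exp (- (x / q * (h / q) / (1 - h / q))))" for h
  have "t j = q powr (- \<alpha> - 1) * exp (- (x * r / q)) * (?L j (x / q) / q ^ j)" for j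
  proof (rule powser_coeffs_unique[OF q, where f = g])
    fix h assume h: "\<bar>h\<bar> < q"
    have "\<bar>h / q\<bar> < 1" using h q by simp
    from sums_mult[OF laguerre_generating(1)[OF this, of "x / q"], of "q powr (- \<alpha> - 1) * exp (- (x * r / q))"]
    show "(\<lambda>j. q powr (- \<alpha> - 1) * exp (- (x * r / q)) * (?L j (x / q) / q ^ j) * h ^ j) sums g h"
      by (simp add: g_def power_divide mult_ac)
    have rh: "\<bar>r + h\<bar> < 1" "\<bar>r + \<bar>h\<bar>\<bar> < 1" "0 < q - h" using h r by (auto simp: q_def)
    define b where "b j m = h ^ j * (real ((m + j) choose j) * r ^ m * ?L (m + j) x)" for j m
    have bb: "(\<lambda>m. \<bar>b j m\<bar>) sums (\<bar>h\<bar> ^ j * T j)" for j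
      using sums_mult[OF T[of j], of "\<bar>h\<bar> ^ j"] r by (simp add: b_def abs_mult power_abs)
    \<comment> \<open>The rearrangement is run backwards here: the antidiagonal sums of the absolute
      values are \<open>\<bar>L\<^sub>k x\<bar>\<close> times the k-th power of
      \<open>r + \<bar>h\<bar>\<close>, which is less than 1.\<close>
    have "summable (\<lambda>j. \<bar>h\<bar> ^ j * T j)"
    proof -
      have diag: "(\<Sum>j\<le>k. \<bar>h\<bar> ^ j * (real ((k - j + j) choose j) * r ^ (k - j) * \<bar>?L (k - j + j) x\<bar>)) = \<bar>?L k x\<bar> * \<bar>r + \<bar>h\<bar>\<bar> ^ k" for k
        using binomial_ring[of "\<bar>h\<bar>" r k] r by (simp add: sum_distrib_left mult_ac add.commute)
      have "(\<lambda>(j, m). \<bar>b j m\<bar>) summable_on UNIV \<times> UNIV"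
      proof -
        have bij: "bij_betw (\<lambda>(k, j). (j, k - j)) (SIGMA k:UNIV. {..k}) (UNIV \<times> UNIV :: (nat \<times> nat) set)"
          by (rule bij_betw_byWitness[where f' = "\<lambda>(j, m). (j + m, j)"]) auto
        have eqk: "(\<Sum>j\<le>k. \<bar>b j (k - j)\<bar>) = \<bar>?L k x\<bar> * \<bar>r + \<bar>h\<bar>\<bar> ^ k" for k
          unfolding diag[symmetric] using r by (intro sum.cong) (auto simp: b_def abs_mult power_abs)
        have "(\<lambda>k. \<bar>?L k x\<bar> * \<bar>r + \<bar>h\<bar>\<bar> ^ k) summable_on UNIV"
          using laguerre_generating(2)[OF rh(2), of x] by (intro norm_summable_imp_summable_on) (simp add: abs_mult power_abs)
        then have "(\<lambda>(k, j). \<bar>b j (k - j)\<bar>) summable_on (SIGMA k:UNIV. {..k})"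
          by (intro summable_on_SigmaI[where g = "\<lambda>k. \<bar>?L k x\<bar> * \<bar>r + \<bar>h\<bar>\<bar> ^ k"]) (auto simp: has_sum_finite_iff eqk)
        then show ?thesis
          using summable_on_reindex_bij_betw[OF bij, of "\<lambda>(j, m). \<bar>b j m\<bar>"] by (simp add: case_prod_unfold)
      qed
      then have "(\<lambda>j. \<Sum>\<^sub>\<infinity>m. \<bar>b j m\<bar>) summable_on UNIV"
        by (rule summable_on_Sigma_banach)
      moreover have "(\<Sum>\<^sub>\<infinity>m. \<bar>b j m\<bar>) = \<bar>h\<bar> ^ j * T j" for j
        by (intro infsumI norm_summable_imp_has_sum) (use bb[of j] in \<open>auto simp: sums_iff\<close>)
      ultimately have "(\<lambda>j. \<bar>h\<bar> ^ j * T j) summable_on UNIV" by simp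
      then show ?thesis by (rule summable_on_imp_summable)
    qed
    from sums_antidiagonal(1)[OF bb this, of "\<lambda>j. h ^ j * t j"]
    have s1: "(\<lambda>k. \<Sum>j\<le>k. b j (k - j)) sums (\<Sum>j. h ^ j * t j)" unfolding b_def by (simp add: sums_mult t)
    moreover have "(\<Sum>j\<le>k. b j (k - j)) = ?L k x * (r + h) ^ k" for k
      using binomial_ring[of h r k] by (simp add: b_def sum_distrib_left mult_ac add.commute)
    moreover have "(\<lambda>k. ?L k x * (r + h) ^ k) sums ((1 - (r + h)) powr (- \<alpha> - 1) * exp (- (x * (r + h) / (1 - (r + h)))))"
      by (rule laguerre_generating(1)[OF rh(1)])
    moreover have "(1 - (r + h)) powr (- \<alpha> - 1) * exp (- (x * (r + h) / (1 - (r + h)))) = g h"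
    proof -
      have "1 - (r + h) = q * (1 - h / q)" using q by (simp add: q_def field_simps)
      moreover have "0 < 1 - h / q" using rh q by simp
      ultimately have p: "(1 - (r + h)) powr (- \<alpha> - 1) = q powr (- \<alpha> - 1) * (1 - h / q) powr (- \<alpha> - 1)"
        using q by (simp add: powr_mult)
      have r': "r = 1 - q" by (simp add: q_def)
      have "1 - h / q = (q - h) / q" using q by (simp add: diff_divide_distrib)
      then have e2: "x / q * (h / q) / (1 - h / q) = x * h / (q * (q - h))" using q rh by simp
      have e1: "1 - (r + h) = q - h" by (simp add: q_def)
      have e3: "x * (r + h) / (q - h) = x * r / q + x * h / (q * (q - h))"
        using q rh(3) unfolding r' by (simp add: divide_simps) (simp add: algebra_simps)
      have e: "exp (- (x * (r + h) / (1 - (r + h)))) = exp (- (x * r / q)) * exp (- (x / q * (h / q) / (1 - h / q)))"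
        unfolding e1 e2 e3 by (simp add: exp_add[symmetric])
      show ?thesis unfolding g_def p e by simp
    qed
    ultimately have val: "(\<Sum>j. h ^ j * t j) = g h" by (metis (no_types, lifting) sums_cong sums_unique2)
    have "summable (\<lambda>j. h ^ j * t j)"
    proof (rule summable_comparison_test'[OF \<open>summable (\<lambda>j. \<bar>h\<bar> ^ j * T j)\<close>, of 0])
      fix j
      have "\<bar>t j\<bar> \<le> T j"
        using summable_rabs[of "\<lambda>m. real ((m + j) choose j) * r ^ m * ?L (m + j) x"] sm[of j x] r by (simp add: t_def T_def abs_mult)
      then show "norm (h ^ j * t j) \<le> \<bar>h\<bar> ^ j * T j" by (simp add: abs_mult power_abs mult_left_mono)
    qed
    then show "(\<lambda>j. t j * h ^ j) sums g h" using val by (simp add: sums_iff mult.commute)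
  qed
  then show "(\<lambda>m. real ((m + j) choose j) * r ^ m * ?L (m + j) x) sums
      ((1 - r) powr (- \<alpha> - 1) * exp (- (x * r / (1 - r))) * (?L j (x / (1 - r)) / (1 - r) ^ j))"
    using t[of j] by (simp add: q_def)
qed

text \<open>The confluent limit function \<open>\<^sub>0F\<^sub>1(; \<alpha> + 1; z)\<close>, which replaces the modified Bessel function
  \<open>I\<^sub>\<alpha> (2 * sqrt z) = z powr (\<alpha> / 2) * F z / Gamma (\<alpha> + 1)\<close> of the usual statement.\<close>

definition F :: "real \<Rightarrow> real"
  where "F z = (\<Sum>n. z ^ n / (fact n * pochhammer (\<alpha> + 1) n))"

lemma pochhammer_\<alpha>_pos: "0 < pochhammer (\<alpha> + 1) n"
  using \<alpha> by (intro pochhammer_pos) simp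

text \<open>Comparison with the even terms of the series of \<open>exp (2 * sqrt z)\<close>: since
  \<open>(2 * n) choose n \<le> 4 ^ n\<close>, the reciprocal of \<open>fact n * fact n\<close> is
  at most \<open>4 ^ n / fact (2 * n)\<close>. The maximum and the factor \<open>2 * n + 1\<close>
  pay for replacing the rising factorial by \<open>fact n\<close>.\<close>

lemma F_coeff_bound: "1 / (fact n * pochhammer (\<alpha> + 1) n) \<le> max 1 (1 / (\<alpha> + 1)) * ((real (2 * n) + 1) * (4 ^ n / fact (2 * n)))"
proof -
  define C where "C = max 1 (1 / (\<alpha> + 1))"
  have C: "1 \<le> C" "1 / (\<alpha> + 1) \<le> C" by (auto simp: C_def)
  have "1 / pochhammer (\<alpha> + 1) n \<le> C * ((real (2 * n) + 1) / fact n)"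
  proof (cases n)
    case (Suc m)
    have "fact m \<le> pochhammer (\<alpha> + 1 + 1) m"
    proof -
      have "pochhammer (1::real) m \<le> pochhammer (\<alpha> + 1 + 1) m"
      proof (induction m)
        case (Suc m)
        have "0 \<le> pochhammer (1::real) m" by (intro pochhammer_nonneg) simp
        then show ?case using Suc \<alpha> by (simp only: pochhammer_rec') (intro mult_mono, auto)
      qed simp
      then show ?thesis by (simp add: pochhammer_fact)
    qed
    then have "(\<alpha> + 1) * fact m \<le> pochhammer (\<alpha> + 1) n"
      using \<alpha> by (simp add: Suc pochhammer_rec mult_left_mono)
    then have "1 / pochhammer (\<alpha> + 1) n \<le> 1 / ((\<alpha> + 1) * fact m)"
      using \<alpha> pochhammer_\<alpha>_pos[of n] by (intro divide_left_mono) (auto intro!: mult_pos_pos)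
    also have "\<dots> = 1 / (\<alpha> + 1) * (real n / fact n)" by (simp add: Suc fact_Suc del: of_nat_Suc)
    also have "\<dots> \<le> C * ((real (2 * n) + 1) / fact n)"
      using C by (intro mult_mono divide_right_mono) auto
    finally show ?thesis .
  qed (use C in simp)
  then have "1 / fact n * (1 / pochhammer (\<alpha> + 1) n) \<le> 1 / fact n * (C * ((real (2 * n) + 1) / fact n))"
    by (intro mult_left_mono) auto
  also have "\<dots> = C * ((real (2 * n) + 1) * (1 / (fact n * fact n)))" by simp
  also have "\<dots> \<le> C * ((real (2 * n) + 1) * (4 ^ n / fact (2 * n)))"
  proof (intro mult_left_mono)
    have "(2 * n) choose n \<le> 2 ^ (2 * n)" by (rule binomial_le_pow2)
    then have "real ((2 * n) choose n) \<le> real (2 ^ (2 * n))" by (rule of_nat_mono)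
    also have "real (2 ^ (2 * n)) = 4 ^ n" by (simp add: power_mult)
    finally have "real ((2 * n) choose n) \<le> 4 ^ n" .
    moreover have "real ((2 * n) choose n) = fact (2 * n) / (fact n * fact n)" by (simp add: binomial_fact)
    ultimately have "fact (2 * n) / (fact n * fact n) \<le> (4 ^ n :: real)" by simp
    then have "(fact (2 * n) / (fact n * fact n)) / fact (2 * n) \<le> (4 ^ n / fact (2 * n) :: real)"
      by (rule divide_right_mono) simp
    then show "1 / (fact n * fact n) \<le> (4 ^ n / fact (2 * n) :: real)" by simp
  qed (use C in auto)
  finally show ?thesis by (simp add: C_def)
qed

lemma exp_moment_sums: "(\<lambda>m. (real m + 1) * (u ^ m / fact m)) sums ((1 + u) * exp u)" for u :: real
proof -
  have "(\<lambda>m. u * (u ^ m / fact m)) sums (u * exp u)" by (intro sums_mult exp_powser)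
  then have "(\<lambda>m. real (Suc m) * (u ^ Suc m / fact (Suc m))) sums (u * exp u)"
    by (simp add: fact_Suc del: of_nat_Suc)
  then have "(\<lambda>m. real m * (u ^ m / fact m)) sums (u * exp u)"
    using sums_Suc[of "\<lambda>m. real m * (u ^ m / fact m)" "u * exp u"] by simp
  from sums_add[OF this exp_powser[of u]] show ?thesis by (simp add: algebra_simps add_divide_distrib)
qed

text \<open>By \<open>F_coeff_bound\<close> the series is dominated by the even terms of
  \<open>exp_moment_sums\<close> at \<open>u = 2 * sqrt \<bar>z\<bar>\<close>. The rate 2 in the
  exponential must not be worse, because it is balanced exactly against the Gaussian part of the
  kernel.\<close>

lemma F_abs_summable: "summable (\<lambda>n. \<bar>z ^ n / (fact n * pochhammer (\<alpha> + 1) n)\<bar>)"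
  and F_bound: "0 \<le> z \<Longrightarrow> F z \<le> max 1 (1 / (\<alpha> + 1)) * ((1 + 2 * sqrt z) * exp (2 * sqrt z))"
proof -
  define C where "C = max 1 (1 / (\<alpha> + 1))"
  define g where "g u m = (real m + 1) * (u ^ m / fact m)" for u :: real and m
  have bound: "\<bar>z ^ n / (fact n * pochhammer (\<alpha> + 1) n)\<bar> \<le> C * g (2 * sqrt \<bar>z\<bar>) (2 * n)" for z n
  proof -
    have "\<bar>z ^ n / (fact n * pochhammer (\<alpha> + 1) n)\<bar> = \<bar>z\<bar> ^ n * (1 / (fact n * pochhammer (\<alpha> + 1) n))"
      using pochhammer_\<alpha>_pos[of n] by (simp add: abs_mult power_abs)
    also have "\<dots> \<le> \<bar>z\<bar> ^ n * (C * ((real (2 * n) + 1) * (4 ^ n / fact (2 * n))))"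
      unfolding C_def by (intro mult_left_mono F_coeff_bound) auto
    also have "\<dots> = C * g (2 * sqrt \<bar>z\<bar>) (2 * n)"
    proof -
      have "(2 * sqrt \<bar>z\<bar>) ^ (2 * n) = 4 ^ n * \<bar>z\<bar> ^ n" by (simp add: power_mult power_mult_distrib)
      then show ?thesis unfolding g_def by (simp only:) simp
    qed
    finally show ?thesis .
  qed
  have g0: "0 \<le> g u m" if "0 \<le> u" for u m using that by (simp add: g_def)
  have gs: "summable (\<lambda>n. g (2 * sqrt \<bar>z\<bar>) (2 * n))" "(\<Sum>n. g (2 * sqrt \<bar>z\<bar>) (2 * n)) \<le> (1 + 2 * sqrt \<bar>z\<bar>) * exp (2 * sqrt \<bar>z\<bar>)" for z
  proof -
    have g: "g (2 * sqrt \<bar>z\<bar>) sums ((1 + 2 * sqrt \<bar>z\<bar>) * exp (2 * sqrt \<bar>z\<bar>))"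
      unfolding g_def[abs_def] by (rule exp_moment_sums)
    have nn: "0 \<le> g (2 * sqrt \<bar>z\<bar>) m" for m by (rule g0) simp
    show s: "summable (\<lambda>n. g (2 * sqrt \<bar>z\<bar>) (2 * n))"
      using summable_reindex[of "g (2 * sqrt \<bar>z\<bar>)" "\<lambda>n. 2 * n"] sums_summable[OF g] nn by (simp add: o_def inj_on_def)
    have "(\<Sum>n. (g (2 * sqrt \<bar>z\<bar>) \<circ> (\<lambda>n. 2 * n)) n) \<le> (\<Sum>n. g (2 * sqrt \<bar>z\<bar>) n)"
      by (rule suminf_reindex_mono) (use sums_summable[OF g] nn in \<open>auto simp: inj_on_def\<close>)
    then show "(\<Sum>n. g (2 * sqrt \<bar>z\<bar>) (2 * n)) \<le> (1 + 2 * sqrt \<bar>z\<bar>) * exp (2 * sqrt \<bar>z\<bar>)"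
      using g by (simp add: o_def sums_iff)
  qed
  show s: "summable (\<lambda>n. \<bar>z ^ n / (fact n * pochhammer (\<alpha> + 1) n)\<bar>)" for z
    by (rule summable_comparison_test'[OF summable_mult[OF gs(1)[of z], of C], of 0]) (simp only: real_norm_def abs_idempotent bound)
  assume z: "0 \<le> z"
  have "F z \<le> (\<Sum>n. C * g (2 * sqrt \<bar>z\<bar>) (2 * n))"
    unfolding F_def
    by (rule suminf_le[OF order_trans[OF abs_ge_self bound] summable_rabs_cancel[OF s] summable_mult[OF gs(1)]])
  also have "\<dots> = C * (\<Sum>n. g (2 * sqrt \<bar>z\<bar>) (2 * n))" by (rule suminf_mult[OF gs(1)])
  also have "\<dots> \<le> C * ((1 + 2 * sqrt \<bar>z\<bar>) * exp (2 * sqrt \<bar>z\<bar>))"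
    by (intro mult_left_mono gs(2)) (simp add: C_def)
  finally show "F z \<le> max 1 (1 / (\<alpha> + 1)) * ((1 + 2 * sqrt z) * exp (2 * sqrt z))" using z by (simp add: C_def)
qed

lemma F_nonneg: "0 \<le> z \<Longrightarrow> 0 \<le> F z"
  unfolding F_def using pochhammer_\<alpha>_pos
  by (intro suminf_nonneg summable_rabs_cancel[OF F_abs_summable]) (auto intro!: divide_nonneg_pos mult_pos_pos)

text \<open>The Cauchy product of the series of \<open>exp w\<close> and of
  \<open>F (- X * w)\<close>; the rising factorial of length \<open>k\<close> splits at each index.
  Absolute convergence follows from the same formula at \<open>- \<bar>X\<bar>\<close> and
  \<open>\<bar>w\<bar>\<close>.\<close>

lemma laguerre_bessel_sums:
  "(\<lambda>j. laguerre_poly \<alpha> j X * w ^ j / pochhammer (\<alpha> + 1) j) sums (exp w * F (- X * w))"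
  and "summable (\<lambda>j. \<bar>laguerre_poly \<alpha> j X * w ^ j / pochhammer (\<alpha> + 1) j\<bar>)"
proof -
  have main: "(\<lambda>j. laguerre_poly \<alpha> j X * w ^ j / pochhammer (\<alpha> + 1) j) sums (exp w * F (- X * w))" for X w
  proof -
    let ?a = "\<lambda>i. (- X * w) ^ i / (fact i * pochhammer (\<alpha> + 1) i)" and ?b = "\<lambda>m. w ^ m / fact m"
    have "summable (\<lambda>k. norm (?b k))" using sums_summable[OF exp_powser[of "\<bar>w\<bar>"]] by (simp add: power_abs)
    from Cauchy_product_sums[of ?a ?b, OF _ this] F_abs_summable[of "- X * w"]
    have "(\<lambda>k. \<Sum>i\<le>k. ?a i * ?b (k - i)) sums (F (- X * w) * exp w)"
      using exp_powser[of w] by (simp add: F_def sums_iff)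
    moreover have "(\<Sum>i\<le>k. ?a i * ?b (k - i)) = laguerre_poly \<alpha> k X * w ^ k / pochhammer (\<alpha> + 1) k" for k
    proof -
      have "?a i * ?b (k - i) = l k i * (- X) ^ i * w ^ k / pochhammer (\<alpha> + 1) k" if i: "i \<le> k" for i
      proof -
        have "pochhammer (\<alpha> + 1) k = pochhammer (\<alpha> + 1) i * pochhammer (\<alpha> + 1 + real i) (k - i)"
          using pochhammer_product'[of "\<alpha> + 1" i "k - i"] i by simp
        moreover have "pochhammer (\<alpha> + 1 + real i) (k - i) \<noteq> 0" "pochhammer (\<alpha> + 1) i \<noteq> 0"
          using \<alpha> by (auto intro!: less_imp_neq[symmetric] pochhammer_pos)
        moreover have "w ^ k = w ^ i * w ^ (k - i)" using i by (simp add: power_add[symmetric])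
        moreover have "(- X * w) ^ i = (- X) ^ i * w ^ i" by (rule power_mult_distrib)
        ultimately show ?thesis unfolding l_def by (simp only:) (simp add: divide_simps)
      qed
      then show ?thesis unfolding laguerre_poly_eq sum_distrib_right sum_divide_distrib by (intro sum.cong) auto
    qed
    ultimately show ?thesis by (simp add: mult.commute)
  qed
  show "(\<lambda>j. laguerre_poly \<alpha> j X * w ^ j / pochhammer (\<alpha> + 1) j) sums (exp w * F (- X * w))" by (rule main)
  show "summable (\<lambda>j. \<bar>laguerre_poly \<alpha> j X * w ^ j / pochhammer (\<alpha> + 1) j\<bar>)"
  proof (rule summable_comparison_test'[OF sums_summable[OF main[of "- \<bar>X\<bar>" "\<bar>w\<bar>"]], of 0])
    fix j
    show "norm \<bar>laguerre_poly \<alpha> j X * w ^ j / pochhammer (\<alpha> + 1) j\<bar> \<le> laguerre_poly \<alpha> j (- \<bar>X\<bar>) * \<bar>w\<bar> ^ j / pochhammer (\<alpha> + 1) j"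
      using pochhammer_\<alpha>_pos[of j] abs_laguerre_poly_le[of j X]
      by (simp add: abs_mult power_abs divide_right_mono mult_right_mono)
  qed
qed

text \<open>The squared norm of the k-th Laguerre polynomial in the normalised measure,
  \<open>Gamma (k + \<alpha> + 1) / (Gamma (\<alpha> + 1) * fact k)\<close>.\<close>

definition h :: "nat \<Rightarrow> real"
  where "h k = pochhammer (\<alpha> + 1) k / fact k"

lemma h_pos: "0 < h k"
  using pochhammer_\<alpha>_pos by (simp add: h_def)

definition hardy :: "real \<Rightarrow> real \<Rightarrow> real \<Rightarrow> real"
  where "hardy r x y = (1 - r) powr (- \<alpha> - 1) * exp (- ((x + y) * r / (1 - r))) * F (x * y * r / (1 - r)\<^sup>2)"

text \<open>The polynomial in \<open>y\<close> is expanded in powers of \<open>y\<close>. For each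
  power the sum over degrees is a shifted generating function in \<open>x\<close>; what remains is
  the series of \<open>laguerre_bessel_sums\<close> at \<open>x / q\<close> and
  \<open>- y * r / q\<close>.\<close>

theorem hille_hardy:
  assumes r: "0 \<le> r" "r < 1"
  shows "(\<lambda>k. r ^ k / h k * laguerre_poly \<alpha> k x * laguerre_poly \<alpha> k y) sums hardy r x y"
proof -
  let ?L = "laguerre_poly \<alpha>"
  define q where "q = 1 - r"
  have q: "0 < q" using r by (simp add: q_def)
  define A where "A = q powr (- \<alpha> - 1) * exp (- (x * r / q))"
  define c where "c j = (- y * r) ^ j / pochhammer (\<alpha> + 1) j" for j
  define b where "b j m = c j * (real ((m + j) choose j) * r ^ m * ?L (m + j) x)" for j m
  have inner: "(\<lambda>m. b j m) sums (A * (?L j (x / q) * (- y * r / q) ^ j / pochhammer (\<alpha> + 1) j))" for j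
  proof -
    have "(- y * r / q) ^ j = (- y * r) ^ j / q ^ j" by (rule power_divide)
    then show ?thesis
      using sums_mult[OF laguerre_shifted_generating(1)[OF r, of j x], of "c j"]
      unfolding b_def c_def A_def q_def by (simp add: mult_ac)
  qed
  have b_abs: "(\<lambda>m. \<bar>b j m\<bar>) sums (\<bar>c j\<bar> * (\<Sum>m. real ((m + j) choose j) * r ^ m * \<bar>?L (m + j) x\<bar>))" for j
    using sums_mult[OF summable_sums[OF laguerre_shifted_generating(2)[OF r, of j x]], of "\<bar>c j\<bar>"] r
    by (simp add: b_def abs_mult)
  have "summable (\<lambda>j. \<bar>c j\<bar> * (\<Sum>m. real ((m + j) choose j) * r ^ m * \<bar>?L (m + j) x\<bar>))"
  proof (rule summable_comparison_test')
    \<comment> \<open>The constant \<open>A\<close> with \<open>x\<close> replaced by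
      \<open>- \<bar>x\<bar>\<close>, where the Laguerre polynomials are nonnegative and
      dominate.\<close>
    define A' where "A' = q powr (- \<alpha> - 1) * exp (\<bar>x\<bar> * r / q)"
    show "summable (\<lambda>j. A' * (?L j (- \<bar>x\<bar> / q) * (\<bar>y\<bar> * r / q) ^ j / pochhammer (\<alpha> + 1) j))"
      using laguerre_bessel_sums(1)[of "- \<bar>x\<bar> / q" "\<bar>y\<bar> * r / q"] by (intro summable_mult) (rule sums_summable)
    fix j
    have "(\<Sum>m. real ((m + j) choose j) * r ^ m * \<bar>?L (m + j) x\<bar>) \<le> (\<Sum>m. real ((m + j) choose j) * r ^ m * ?L (m + j) (- \<bar>x\<bar>))"
      using r by (intro suminf_le laguerre_shifted_generating(2) sums_summable[OF laguerre_shifted_generating(1)] mult_left_mono abs_laguerre_poly_le) auto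
    also have "\<dots> = A' * (?L j (- \<bar>x\<bar> / q) / q ^ j)"
      using sums_unique[OF laguerre_shifted_generating(1)[OF r, of j "- \<bar>x\<bar>"]] by (simp add: A'_def q_def)
    finally have le: "(\<Sum>m. real ((m + j) choose j) * r ^ m * \<bar>?L (m + j) x\<bar>) \<le> A' * (?L j (- \<bar>x\<bar> / q) / q ^ j)" .
    have nn: "0 \<le> (\<Sum>m. real ((m + j) choose j) * r ^ m * \<bar>?L (m + j) x\<bar>)"
      using r by (intro suminf_nonneg laguerre_shifted_generating(2)) auto
    have "norm (\<bar>c j\<bar> * (\<Sum>m. real ((m + j) choose j) * r ^ m * \<bar>?L (m + j) x\<bar>)) = \<bar>c j\<bar> * (\<Sum>m. real ((m + j) choose j) * r ^ m * \<bar>?L (m + j) x\<bar>)"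
      by (rule trans[OF real_norm_def abs_of_nonneg]) (intro mult_nonneg_nonneg nn abs_ge_zero)
    also have "\<dots> \<le> \<bar>c j\<bar> * (A' * (?L j (- \<bar>x\<bar> / q) / q ^ j))"
      by (rule mult_left_mono[OF le abs_ge_zero])
    also have "\<dots> = (\<bar>y\<bar> * r) ^ j / pochhammer (\<alpha> + 1) j * (A' * (?L j (- \<bar>x\<bar> / q) / q ^ j))"
      using pochhammer_\<alpha>_pos[of j] r by (simp add: c_def abs_mult power_abs)
    finally show "norm (\<bar>c j\<bar> * (\<Sum>m. real ((m + j) choose j) * r ^ m * \<bar>?L (m + j) x\<bar>)) \<le>
      A' * (?L j (- \<bar>x\<bar> / q) * (\<bar>y\<bar> * r / q) ^ j / pochhammer (\<alpha> + 1) j)"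
      by (simp add: power_divide mult_ac)
  qed
  from sums_antidiagonal(1)[OF b_abs this inner]
  have "(\<lambda>k. \<Sum>j\<le>k. b j (k - j)) sums (\<Sum>j. A * (?L j (x / q) * (- y * r / q) ^ j / pochhammer (\<alpha> + 1) j))" .
  also have "(\<Sum>j. A * (?L j (x / q) * (- y * r / q) ^ j / pochhammer (\<alpha> + 1) j)) = A * (exp (- y * r / q) * F (- (x / q) * (- y * r / q)))"
    by (rule sums_unique[symmetric]) (intro sums_mult laguerre_bessel_sums)
  also have "\<dots> = hardy r x y"
  proof -
    have e1: "exp (- (x * r / q)) * exp (- y * r / q) = exp (- ((x + y) * r / q))"
      by (simp add: mult_exp_exp add_divide_distrib[symmetric] algebra_simps)
    have e2: "- (x / q) * (- y * r / q) = x * y * r / q\<^sup>2" by (simp add: power2_eq_square)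
    show ?thesis unfolding hardy_def A_def q_def[symmetric] e1[symmetric] e2 by (simp only: mult.assoc)
  qed
  also have "(\<lambda>k. \<Sum>j\<le>k. b j (k - j)) = (\<lambda>k. r ^ k / h k * ?L k x * ?L k y)"
  proof
    fix k
    have "b j (k - j) = r ^ k / h k * ?L k x * (l k j * (- y) ^ j)" if j: "j \<le> k" for j
    proof -
      have "pochhammer (\<alpha> + 1) k = pochhammer (\<alpha> + 1) j * pochhammer (\<alpha> + 1 + real j) (k - j)"
        using pochhammer_product'[of "\<alpha> + 1" j "k - j"] j by simp
      moreover have "pochhammer (\<alpha> + 1 + real j) (k - j) \<noteq> 0" "pochhammer (\<alpha> + 1) j \<noteq> 0"
        using \<alpha> by (auto intro!: less_imp_neq[symmetric] pochhammer_pos)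
      moreover have "r ^ k = r ^ j * r ^ (k - j)" using j by (simp add: power_add[symmetric])
      moreover have "real ((k - j + j) choose j) = fact k / (fact j * fact (k - j))" "k - j + j = k" using j by (simp_all add: binomial_fact)
      moreover have "(- y * r) ^ j = (- y) ^ j * r ^ j" by (rule power_mult_distrib)
      ultimately show ?thesis unfolding l_def b_def c_def h_def by (simp only:) (simp add: divide_simps)
    qed
    then show "(\<Sum>j\<le>k. b j (k - j)) = r ^ k / h k * ?L k x * ?L k y"
      unfolding laguerre_poly_eq[of k y] sum_distrib_left by (intro sum.cong) auto
  qed
  finally show ?thesis .
qed

end

text \<open>With \<open>r = exp (- s)\<close> this converts powers of \<open>1 / (1 - r)\<close> in
  kernel bounds into the powers of \<open>1 + 1 / s\<close> demanded by
  \<open>kernel_semigroup\<close>.\<close>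

lemma inverse_one_minus_exp_le:
  fixes s :: real
  assumes s: "0 < s"
  shows "1 / (1 - exp (- s)) \<le> 1 + 1 / s"
proof -
  have "exp (- s) \<le> 1 / (1 + s)"
    using exp_ge_add_one_self[of s] s by (simp add: exp_minus inverse_eq_divide frac_le)
  moreover have "s / (1 + s) = 1 - 1 / (1 + s)" using s by (simp add: diff_divide_eq_iff)
  ultimately have "s / (1 + s) \<le> 1 - exp (- s)" by simp
  moreover have "0 < s / (1 + s)" using s by simp
  ultimately have "1 / (1 - exp (- s)) \<le> 1 / (s / (1 + s))" by (intro frac_le) auto
  then show ?thesis using s by (simp add: add_divide_distrib)
qed

lemma gamma_integral:
  fixes a :: real
  assumes "0 < a"
  shows "has_bochner_integral lborel (\<lambda>x. indicator {0<..} x * (x powr (a - 1) * exp (- x))) (Gamma a)"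
proof -
  let ?f = "\<lambda>x::real. ennreal (x powr (a - 1) / exp x) * indicator {0..} x"
  have "integral\<^sup>N lborel ?f = ennreal (Gamma a)"
    by (rule nn_integral_has_integral_lebesgue'[OF _ Gamma_integral_real]) (use assms in auto)
  also have "integral\<^sup>N lborel ?f = (\<integral>\<^sup>+x. ennreal (indicator {0<..} x * (x powr (a - 1) * exp (- x))) \<partial>lborel)"
    by (intro nn_integral_cong) (auto simp: exp_minus divide_inverse split: split_indicator)
  finally show ?thesis
    using assms by (intro has_bochner_integral_nn_integral) (auto simp: Gamma_real_pos less_imp_le)
qed

section \<open>The Laguerre measure, orthogonality and the heat kernel\<close>

context laguerre
begin

abbreviation "\<mu> \<equiv> laguerre_measure \<alpha>"

lemma space_\<mu>: "space \<mu> = {0<..}"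
  by (simp add: laguerre_measure_def space_restrict_space)

lemma measurable_\<mu>: "f \<in> borel_measurable borel \<Longrightarrow> f \<in> borel_measurable \<mu>"
  unfolding laguerre_measure_def by (auto intro!: measurable_restrict_space1)

lemma Gamma_pos: "0 < Gamma (\<alpha> + 1)"
  using \<alpha> by (simp add: Gamma_real_pos)

lemma has_bochner_integral_\<mu>_iff:
  "f \<in> borel_measurable borel \<Longrightarrow> has_bochner_integral \<mu> f r \<longleftrightarrow>
    has_bochner_integral lborel (\<lambda>x. indicator {0<..} x * (x powr \<alpha> * exp (- x) / Gamma (\<alpha> + 1)) * f x) r"
  unfolding laguerre_measure_def using Gamma_pos
  by (intro has_bochner_integral_restricted_density_iff) auto

lemma moment_\<mu>: "has_bochner_integral \<mu> (\<lambda>x. x ^ m) (pochhammer (\<alpha> + 1) m)"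
proof (subst has_bochner_integral_\<mu>_iff, measurable)
  have "0 < \<alpha> + 1 + real m" using \<alpha> by simp
  from has_bochner_integral_divide_zero[OF gamma_integral[OF this], of "Gamma (\<alpha> + 1)"]
  have "has_bochner_integral lborel (\<lambda>x. indicator {0<..} x * (x powr (\<alpha> + 1 + real m - 1) * exp (- x)) / Gamma (\<alpha> + 1)) (Gamma (\<alpha> + 1 + real m) / Gamma (\<alpha> + 1))" .
  moreover have "indicator {0<..} x * (x powr (\<alpha> + 1 + real m - 1) * exp (- x)) / Gamma (\<alpha> + 1) =
    indicator {0<..} x * (x powr \<alpha> * exp (- x) / Gamma (\<alpha> + 1)) * x ^ m" for x :: real
    by (auto simp: indicator_def powr_add powr_realpow)
  moreover have "Gamma (\<alpha> + 1 + real m) / Gamma (\<alpha> + 1) = pochhammer (\<alpha> + 1) m"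
    using \<alpha> by (subst pochhammer_Gamma) (auto elim!: nonpos_Ints_cases)
  ultimately show "has_bochner_integral lborel (\<lambda>x. indicator {0<..} x * (x powr \<alpha> * exp (- x) / Gamma (\<alpha> + 1)) * x ^ m) (pochhammer (\<alpha> + 1) m)"
    by (simp only:)
qed

sublocale fin: finite_measure \<mu>
  using moment_\<mu>[of 0] by (intro finite_measureI) (simp add: emeasure_space_eq_1)

definition Laguerre :: "nat \<Rightarrow> real poly"
  where "Laguerre k = (\<Sum>j\<le>k. monom (l k j * (- 1) ^ j) j)"

lemma poly_Laguerre: "poly (Laguerre k) x = laguerre_poly \<alpha> k x"
  unfolding Laguerre_def laguerre_poly_eq power_minus[of x] by (simp add: poly_sum poly_monom mult.assoc)

lemma coeff_Laguerre: "coeff (Laguerre k) k = (- 1) ^ k / fact k"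
  by (simp add: Laguerre_def coeff_sum l_def sum.delta)

lemma degree_Laguerre: "degree (Laguerre k) = k"
proof (rule antisym)
  show "degree (Laguerre k) \<le> k"
    unfolding Laguerre_def by (rule degree_sum_le) (auto intro: order_trans[OF degree_monom_le])
  show "k \<le> degree (Laguerre k)" by (rule le_degree) (simp add: coeff_Laguerre)
qed

text \<open>Coefficients times moments give a multiple of \<open>alt_sum k m (\<alpha> + 1)\<close>:
  the integral vanishes as a k-th difference of a polynomial of degree \<open>m < k\<close>.\<close>

lemma integral_Laguerre_power:
  assumes m: "m \<le> k"
  shows "has_bochner_integral \<mu> (\<lambda>x. poly (Laguerre k) x * x ^ m) (if m = k then pochhammer (\<alpha> + 1) k * (- 1) ^ k else 0)"
proof -
  have "has_bochner_integral \<mu> (\<lambda>x. \<Sum>j\<le>k. l k j * (- 1) ^ j * x ^ (j + m)) (\<Sum>j\<le>k. l k j * (- 1) ^ j * pochhammer (\<alpha> + 1) (j + m))"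
    by (intro has_bochner_integral_sum has_bochner_integral_mult_right moment_\<mu>)
  moreover have "(\<Sum>j\<le>k. l k j * (- 1) ^ j * x ^ (j + m)) = poly (Laguerre k) x * x ^ m" for x
    unfolding poly_Laguerre laguerre_poly_eq power_minus[of x] sum_distrib_right by (simp add: power_add mult_ac)
  moreover have "l k j * (- 1) ^ j * pochhammer (\<alpha> + 1) (j + m) =
    pochhammer (\<alpha> + 1) k / fact k * ((- 1) ^ j * real (k choose j) * pochhammer (\<alpha> + 1 + real j) m)" if j: "j \<le> k" for j
  proof -
    have 1: "pochhammer (\<alpha> + 1) k = pochhammer (\<alpha> + 1) j * pochhammer (\<alpha> + 1 + real j) (k - j)"
      using pochhammer_product'[of "\<alpha> + 1" j "k - j"] j by simp
    have 2: "pochhammer (\<alpha> + 1) (j + m) = pochhammer (\<alpha> + 1) j * pochhammer (\<alpha> + 1 + real j) m"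
      by (rule pochhammer_product')
    have 3: "real (k choose j) = fact k / (fact j * fact (k - j))" using j by (simp add: binomial_fact)
    show ?thesis unfolding l_def 1 2 3 by (simp add: field_simps)
  qed
  then have "(\<Sum>j\<le>k. l k j * (- 1) ^ j * pochhammer (\<alpha> + 1) (j + m)) = pochhammer (\<alpha> + 1) k / fact k * alt_sum k m (\<alpha> + 1)"
    unfolding alt_sum_def sum_distrib_left by (intro sum.cong) auto
  moreover have "pochhammer (\<alpha> + 1) k / fact k * alt_sum k m (\<alpha> + 1) = (if m = k then pochhammer (\<alpha> + 1) k * (- 1) ^ k else 0)"
    using m alt_sum_eq(1)[of m k "\<alpha> + 1"] alt_sum_eq(2)[of k "\<alpha> + 1"] by auto
  ultimately show ?thesis by (simp only:)
qed

lemma orthogonal_Laguerre: "has_bochner_integral \<mu> (\<lambda>x. poly (Laguerre j) x * poly (Laguerre k) x) (if j = k then h k else 0)"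
proof -
  have *: "has_bochner_integral \<mu> (\<lambda>x. poly (Laguerre j) x * poly (Laguerre k) x) (if j = k then h k else 0)" if kj: "k \<le> j" for j k
  proof -
    have eq: "poly (Laguerre j) x * poly (Laguerre k) x = (\<Sum>i\<le>k. coeff (Laguerre k) i * (poly (Laguerre j) x * x ^ i))" for x
      unfolding poly_altdef[of "Laguerre k"] degree_Laguerre by (simp add: sum_distrib_left mult_ac)
    have "has_bochner_integral \<mu> (\<lambda>x. \<Sum>i\<le>k. coeff (Laguerre k) i * (poly (Laguerre j) x * x ^ i))
       (\<Sum>i\<le>k. coeff (Laguerre k) i * (if i = j then pochhammer (\<alpha> + 1) j * (- 1) ^ j else 0))"
      using kj by (intro has_bochner_integral_sum has_bochner_integral_mult_right integral_Laguerre_power) auto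
    moreover have "(\<Sum>i\<le>k. coeff (Laguerre k) i * (if i = j then pochhammer (\<alpha> + 1) j * (- 1) ^ j else 0)) = (if j = k then h k else 0)"
    proof (cases "j = k")
      case True
      have "(\<Sum>i\<le>k. coeff (Laguerre k) i * (if i = k then pochhammer (\<alpha> + 1) k * (- 1) ^ k else 0)) = coeff (Laguerre k) k * (pochhammer (\<alpha> + 1) k * (- 1) ^ k)"
        by (simp add: if_distrib sum.delta cong: if_cong)
      also have "\<dots> = h k" by (simp add: coeff_Laguerre h_def mult_ac power_mult_distrib[symmetric] flip: power_add)
      finally show ?thesis by (simp only: True refl if_True)
    qed (use kj in \<open>auto intro!: sum.neutral\<close>)
    ultimately show ?thesis by (simp add: eq)
  qed
  show ?thesis using *[of k j] *[of j k] by (cases "k \<le> j") (auto simp: mult.commute)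
qed

text \<open>The Hille-Hardy series converges on the diagonal, and
  \<open>summable_of_diagonal\<close> extracts the growth bound from it.\<close>

lemma summable_Laguerre:
  assumes s: "0 < s"
  shows "summable (\<lambda>k. exp (- real k * s) * \<bar>poly (Laguerre k) x\<bar> / sqrt (h k))"
proof -
  have "exp (- real k * s) = exp (- s) ^ k" for k by (simp add: exp_of_nat_mult[symmetric])
  then show ?thesis
    using summable_of_diagonal[OF _ _ h_pos sums_summable[OF hille_hardy[of "exp (- s)" x x]]] s
    by (simp add: poly_Laguerre)
qed

definition heat_kernel :: "real \<Rightarrow> real \<Rightarrow> real \<Rightarrow> real"
  where "heat_kernel s x y = (\<Sum>k. exp (- real k * s) / h k * poly (Laguerre k) x * poly (Laguerre k) y)"

lemma laguerre_semigroup_eq: "laguerre_semigroup \<alpha> s f x = (\<integral>y. heat_kernel s x y * f y \<partial>\<mu>)"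
proof -
  have "Gamma (\<alpha> + 1) * fact k / Gamma (real k + \<alpha> + 1) = 1 / h k" for k
  proof -
    have "\<alpha> + 1 \<notin> \<int>\<^sub>\<le>\<^sub>0" using \<alpha> by (auto elim!: nonpos_Ints_cases)
    from pochhammer_Gamma[OF this, of k] have "Gamma (\<alpha> + 1 + real k) = pochhammer (\<alpha> + 1) k * Gamma (\<alpha> + 1)"
      using Gamma_pos by simp
    moreover have "real k + \<alpha> + 1 = \<alpha> + 1 + real k" by simp
    ultimately show ?thesis unfolding h_def using Gamma_pos by (simp only:) simp
  qed
  then have "exp (- real k * s) * (Gamma (\<alpha> + 1) * fact k / Gamma (real k + \<alpha> + 1)) = exp (- real k * s) / h k" for k s
    by simp
  then show ?thesis by (simp only: laguerre_semigroup_def heat_kernel_def poly_Laguerre)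
qed

lemma heat_kernel_eq: "0 < s \<Longrightarrow> heat_kernel s x y = hardy (exp (- s)) x y"
proof -
  assume s: "0 < s"
  have "exp (- real k * s) = exp (- s) ^ k" for k by (simp add: exp_of_nat_mult[symmetric])
  then show ?thesis
    using sums_unique[OF hille_hardy[of "exp (- s)" x y]] s by (simp add: heat_kernel_def poly_Laguerre)
qed

lemma laguerre_poisson_poly:
  assumes t: "0 < t"
  shows "laguerre_poisson \<alpha> t (\<lambda>y. \<Sum>k\<le>N. a k * poly (Laguerre k) y) x = (\<Sum>k\<le>N. a k * exp (- t * sqrt (real k)) * poly (Laguerre k) x)"
  unfolding laguerre_poisson_def
proof (rule orthogonal_poisson[where h = h and S = UNIV and M = \<mu>])
  show "integrable \<mu> (\<lambda>y. poly (Laguerre j) y * poly (Laguerre k) y)" "(\<integral>y. poly (Laguerre j) y * poly (Laguerre k) y \<partial>\<mu>) = (if j = k then h k else 0)" for j k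
    using orthogonal_Laguerre[of j k] by (simp_all add: has_bochner_integral_iff)
  show "laguerre_semigroup \<alpha> s f x = (\<integral>y. (\<Sum>k. exp (- real k * s) / h k * poly (Laguerre k) x * poly (Laguerre k) y) * f y \<partial>\<mu>)" for s f
    unfolding laguerre_semigroup_eq heat_kernel_def ..
qed (use t h_pos summable_Laguerre in auto)

text \<open>Termwise differentiation raises the parameter by one, so the derivative is an instance
  of the same function for \<open>\<alpha> + 1\<close>, and its bounds are already available
  there.\<close>

lemma F_deriv: "(F has_real_derivative laguerre.F (\<alpha> + 1) z / (\<alpha> + 1)) (at z)"
proof -
  interpret L1: laguerre "\<alpha> + 1" by unfold_locales (use \<alpha> in simp)
  define c where "c n = 1 / (fact n * pochhammer (\<alpha> + 1) n)" for n
  have F: "F = (\<lambda>z. \<Sum>n. c n * z ^ n)" by (simp add: F_def c_def fun_eq_iff)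
  have "summable (\<lambda>n. c n * z ^ n)" for z
    using summable_rabs_cancel[OF F_abs_summable[of z]] by (simp add: c_def)
  then have "DERIV F z :> (\<Sum>n. diffs c n * z ^ n)"
    unfolding F by (rule termdiffs_strong_converges_everywhere)
  moreover have "diffs c n * z ^ n = 1 / (\<alpha> + 1) * (z ^ n / (fact n * pochhammer (\<alpha> + 1 + 1) n))" for n
    by (simp add: diffs_def c_def pochhammer_rec fact_Suc del: of_nat_Suc)
  ultimately have "DERIV F z :> (\<Sum>n. 1 / (\<alpha> + 1) * (z ^ n / (fact n * pochhammer (\<alpha> + 1 + 1) n)))" by simp
  also have "(\<Sum>n. 1 / (\<alpha> + 1) * (z ^ n / (fact n * pochhammer (\<alpha> + 1 + 1) n))) = 1 / (\<alpha> + 1) * L1.F z"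
    unfolding L1.F_def by (rule suminf_mult) (rule summable_rabs_cancel[OF L1.F_abs_summable])
  finally show ?thesis by simp
qed

definition hardy' :: "real \<Rightarrow> real \<Rightarrow> real \<Rightarrow> real"
  where "hardy' r x y = (1 - r) powr (- \<alpha> - 1) * (exp (- ((x + y) * (r / (1 - r)))) * (- (r / (1 - r))) * F (x * (y * r / (1 - r)\<^sup>2)) +
    laguerre.F (\<alpha> + 1) (x * (y * r / (1 - r)\<^sup>2)) / (\<alpha> + 1) * (y * r / (1 - r)\<^sup>2) * exp (- ((x + y) * (r / (1 - r)))))"

lemma hardy_deriv: "((\<lambda>x. hardy r x y) has_real_derivative hardy' r x y) (at x)"
proof -
  define c d where "c = y * r / (1 - r)\<^sup>2" and "d = r / (1 - r)"
  have "((\<lambda>x. F (x * c)) has_real_derivative laguerre.F (\<alpha> + 1) (x * c) / (\<alpha> + 1) * c) (at x)"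
    by (rule DERIV_chain2[OF F_deriv]) (auto intro!: derivative_eq_intros)
  moreover have "((\<lambda>x. exp (- ((x + y) * d))) has_real_derivative exp (- ((x + y) * d)) * (- d)) (at x)"
    by (auto intro!: derivative_eq_intros)
  ultimately have "((\<lambda>x. (1 - r) powr (- \<alpha> - 1) * (exp (- ((x + y) * d)) * F (x * c))) has_real_derivative
    (1 - r) powr (- \<alpha> - 1) * (exp (- ((x + y) * d)) * (- d) * F (x * c) + laguerre.F (\<alpha> + 1) (x * c) / (\<alpha> + 1) * c * exp (- ((x + y) * d)))) (at x)"
    by (intro DERIV_cmult DERIV_mult)
  moreover have "hardy r x y = (1 - r) powr (- \<alpha> - 1) * (exp (- ((x + y) * d)) * F (x * c))" for x
    by (simp add: hardy_def c_def d_def mult.assoc)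
  ultimately show ?thesis unfolding hardy'_def c_def[symmetric] d_def[symmetric] by (simp only:)
qed

end

text \<open>The exponents combine to \<open>x - (w - v)\<^sup>2 / q\<close> with \<open>v = sqrt x\<close>, \<open>w = sqrt (r y)\<close>,
  \<open>q = 1 - r\<close>, and the Gaussian factor absorbs every power of \<open>y\<close>.\<close>

lemma bessel_factor_bound:
  fixes x y r :: real and j :: nat
  assumes r: "0 < r" "r < 1" and x: "0 < x" and y: "0 < y" and j: "j \<le> 1"
  shows "(r * y) ^ j * exp (- ((x + y) * r / (1 - r))) * ((1 + 2 * sqrt (x * y * r / (1 - r)\<^sup>2)) * exp (2 * sqrt (x * y * r / (1 - r)\<^sup>2)))
    \<le> 2 * exp 3 * (1 + sqrt x) ^ 4 * exp x / (1 - r)"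
proof -
  define q v w d where "q = 1 - r" and "v = sqrt x" and "w = sqrt (r * y)" and "d = \<bar>w - v\<bar>"
  have q: "0 < q" "q \<le> 1" "r = 1 - q" using r by (auto simp: q_def)
  have v: "0 < v" "v\<^sup>2 = x" and w: "0 < w" "w\<^sup>2 = r * y" using x y r by (auto simp: v_def w_def)
  have d: "0 \<le> d" "d\<^sup>2 = (w - v)\<^sup>2" "w \<le> v + d" by (auto simp: d_def)
  have sz: "sqrt (x * y * r / (1 - r)\<^sup>2) = v * w / q"
  proof (rule real_sqrt_unique)
    show "(v * w / q)\<^sup>2 = x * y * r / (1 - r)\<^sup>2"
      unfolding power_divide power_mult_distrib v(2) w(2) by (simp add: q_def mult_ac)
    show "0 \<le> v * w / q" using v w q(1) by simp
  qed
  have "- ((x + y) * r / q) + 2 * (v * w / q) = x - d\<^sup>2 / q"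
  proof -
    have "- ((x + y) * r) + 2 * (v * w) = x * q - d\<^sup>2"
    proof -
      have "y * r = w\<^sup>2" using w(2) by (simp add: mult.commute)
      then have "(x + y) * r = x * (1 - q) + w\<^sup>2" by (simp add: distrib_right q(3))
      then show ?thesis unfolding d(2) power2_diff v(2) by (simp add: algebra_simps)
    qed
    then have "(- ((x + y) * r) + 2 * (v * w)) / q = (x * q - d\<^sup>2) / q" by simp
    moreover have "(- a + 2 * b) / q = - (a / q) + 2 * (b / q)" for a b by (simp add: diff_divide_distrib)
    moreover have "(x * q - a) / q = x - a / q" for a using q(1) by (simp add: diff_divide_distrib)
    ultimately show ?thesis by (simp only:)
  qed
  also have "\<dots> \<le> x - d\<^sup>2"
  proof -
    have "d\<^sup>2 * q \<le> d\<^sup>2 * 1" using q by (intro mult_left_mono) auto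
    then show ?thesis using q(1) by (simp add: pos_le_divide_eq)
  qed
  finally have ex: "exp (- ((x + y) * r / q)) * exp (2 * (v * w / q)) \<le> exp x * exp (- d\<^sup>2)"
    unfolding mult_exp_exp by simp
  have "1 + 2 * (v * w / q) \<le> (1 + 2 * (v * w)) / q"
    using q by (simp add: add_divide_distrib)
  also have "\<dots> \<le> 2 * (1 + v)\<^sup>2 * (1 + d) / q"
  proof (rule divide_right_mono)
    have "v * w \<le> v * (v + d)" using v d by (intro mult_left_mono) auto
    moreover have "0 \<le> v * d" "0 \<le> d * v\<^sup>2" using v(1) d(1) by auto
    moreover have "2 * (1 + v)\<^sup>2 * (1 + d) = 2 + 4 * v + 2 * v\<^sup>2 + 2 * d + 4 * (v * d) + 2 * (d * v\<^sup>2)"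
      by (simp add: power2_eq_square algebra_simps)
    moreover have "v * (v + d) = v\<^sup>2 + v * d" by (simp add: power2_eq_square distrib_left)
    ultimately show "1 + 2 * (v * w) \<le> 2 * (1 + v)\<^sup>2 * (1 + d)"
      using v(1) d(1) by linarith
  qed (use q in simp)
  finally have a: "1 + 2 * (v * w / q) \<le> 2 * (1 + v)\<^sup>2 * (1 + d) / q" .
  have b: "(r * y) ^ j \<le> (1 + v)\<^sup>2 * (1 + d)\<^sup>2"
  proof -
    have "(1 + v) * (1 + d) = 1 + v + d + v * d" by (simp add: algebra_simps)
    moreover have "0 \<le> v * d" using v d by simp
    ultimately have "w \<le> (1 + v) * (1 + d)" using d(3) by linarith
    then have "w\<^sup>2 \<le> ((1 + v) * (1 + d))\<^sup>2" using w by (intro power_mono) auto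
    moreover have "1 \<le> (1 + v)\<^sup>2 * (1 + d)\<^sup>2"
      using mult_mono[of 1 "(1 + v)\<^sup>2" 1 "(1 + d)\<^sup>2"] v d by (simp add: one_le_power)
    ultimately show ?thesis using j w(2) by (cases "j = 0") (auto simp: power_mult_distrib le_Suc_eq)
  qed
  \<comment> \<open>The cube collects one factor \<open>1 + d\<close> from the polynomial part of
    the Bessel bound and two from the power of \<open>r * y\<close>. The maximum of
    \<open>3 * d - d\<^sup>2\<close> is 9/4.\<close>
  have c: "(1 + d) ^ 3 * exp (- d\<^sup>2) \<le> exp 3"
  proof -
    have "(1 + d) ^ 3 \<le> exp d ^ 3" using d(1) by (intro power_mono) (auto simp: exp_ge_add_one_self)
    also have "\<dots> = exp (3 * d)" by (simp add: exp_of_nat_mult[symmetric])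
    finally have "(1 + d) ^ 3 * exp (- d\<^sup>2) \<le> exp (3 * d) * exp (- d\<^sup>2)" by (intro mult_right_mono) auto
    also have "\<dots> = exp (3 * d - d\<^sup>2)" by (simp add: mult_exp_exp)
    also have "\<dots> \<le> exp 3"
    proof -
      have "0 \<le> (d - 3 / 2)\<^sup>2" by simp
      then have "3 * d - d\<^sup>2 \<le> 3" by (simp add: power2_eq_square algebra_simps)
      then show ?thesis by simp
    qed
    finally show ?thesis .
  qed
  have "(r * y) ^ j * exp (- ((x + y) * r / q)) * ((1 + 2 * (v * w / q)) * exp (2 * (v * w / q))) =
    (r * y) ^ j * (1 + 2 * (v * w / q)) * (exp (- ((x + y) * r / q)) * exp (2 * (v * w / q)))" by simp
  also have "\<dots> \<le> ((1 + v)\<^sup>2 * (1 + d)\<^sup>2) * (2 * (1 + v)\<^sup>2 * (1 + d) / q) * (exp x * exp (- d\<^sup>2))"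
    using r y v w q d by (intro mult_mono a b ex) auto
  also have "\<dots> = 2 * (1 + v) ^ 4 * exp x / q * ((1 + d) ^ 3 * exp (- d\<^sup>2))"
  proof -
    have "(a\<^sup>2 * b\<^sup>2) * (2 * a\<^sup>2 * b / q) * (X * Y) = 2 * a ^ 4 * X / q * (b ^ 3 * Y)" for a b X Y :: real
      by (simp add: power2_eq_square power3_eq_cube power4_eq_xxxx)
    then show ?thesis .
  qed
  also have "\<dots> \<le> 2 * (1 + v) ^ 4 * exp x / q * exp 3"
    using q v by (intro mult_left_mono c) auto
  also have "2 * (1 + v) ^ 4 * exp x / q * exp 3 = 2 * exp 3 * (1 + v) ^ 4 * exp x / q" by simp
  finally show ?thesis unfolding q_def[symmetric] v_def[symmetric] sz[folded q_def] .
qed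

context laguerre
begin

text \<open>The case \<open>j = 0\<close> of \<open>bessel_factor_bound\<close> handles the kernel.
  Differentiation in \<open>x\<close> produces a factor \<open>y * r / (1 - r)\<^sup>2\<close>, for
  which the case \<open>j = 1\<close> is needed. The total exponent is \<open>m\<close> from the
  power prefactor, 1 from that lemma and at most 2 from the derivative.\<close>

lemma hardy_bounds:
  obtains D N where "0 \<le> D" "\<And>r x y. 0 < r \<Longrightarrow> r < 1 \<Longrightarrow> 0 < x \<Longrightarrow> 0 < y \<Longrightarrow>
    \<bar>hardy r x y\<bar> \<le> D * ((1 + sqrt x) ^ 4 * exp x) * (1 / (1 - r)) ^ N \<and>
    \<bar>hardy' r x y\<bar> \<le> D * ((1 + sqrt x) ^ 4 * exp x) * (1 / (1 - r)) ^ N"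
proof -
  interpret L1: laguerre "\<alpha> + 1" by unfold_locales (use \<alpha> in simp)
  \<comment> \<open>\<open>c\<close> and \<open>c1\<close> are the constants of
    \<open>F_bound\<close> for the parameters \<open>\<alpha>\<close> and
    \<open>\<alpha> + 1\<close>; \<open>m\<close> is an integer exponent above
    \<open>\<alpha> + 1\<close>.\<close>
  define c c1 m where "c = max 1 (1 / (\<alpha> + 1))" and "c1 = max 1 (1 / (\<alpha> + 1 + 1)) / (\<alpha> + 1)" and "m = nat \<lceil>\<alpha> + 1\<rceil>"
  define D where "D = (c + c1) * (2 * exp 3)"
  have c: "0 \<le> c" "0 \<le> c1" using \<alpha> by (auto simp: c_def c1_def)
  show thesis
  proof (rule that[of D "m + 3"], goal_cases)
    case 1
    then show ?case using c by (simp add: D_def)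
  next
    case (2 r x y)
    define q e z Y B where "q = 1 - r" and "e = exp (- ((x + y) * (r / (1 - r))))" and "z = x * (y * r / (1 - r)\<^sup>2)"
      and "Y = (1 + 2 * sqrt z) * exp (2 * sqrt z)" and "B = 2 * exp 3 * ((1 + sqrt x) ^ 4 * exp x)"
    have q: "0 < q" "q \<le> 1" "1 \<le> 1 / q" using 2 by (auto simp: q_def)
    have z: "0 \<le> z" and e: "0 < e" and B: "0 \<le> B" using 2 by (auto simp: z_def e_def B_def)
    have b0: "e * Y \<le> B * (1 / q)" and b1: "(r * y) * (e * Y) \<le> B * (1 / q)"
      using bessel_factor_bound[of r x y 0] bessel_factor_bound[of r x y 1] 2
      by (simp_all add: e_def Y_def B_def z_def q_def mult.assoc)
    have F0: "0 \<le> F z" "F z \<le> c * Y" using F_nonneg[OF z] F_bound[OF z] by (simp_all add: c_def Y_def)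
    have F1: "0 \<le> L1.F z / (\<alpha> + 1)" "L1.F z / (\<alpha> + 1) \<le> c1 * Y"
      using L1.F_nonneg[OF z] L1.F_bound[OF z] \<alpha> divide_right_mono[OF L1.F_bound[OF z], of "\<alpha> + 1"] by (simp_all add: c1_def Y_def)
    have pw: "q powr (- \<alpha> - 1) \<le> (1 / q) ^ m"
    proof -
      have "q powr (- \<alpha> - 1) = (1 / q) powr (\<alpha> + 1)" proof -
        have "- \<alpha> - 1 = - (\<alpha> + 1)" by simp
        then have "q powr (- \<alpha> - 1) = 1 / q powr (\<alpha> + 1)" by (simp only: powr_minus_divide)
        then show ?thesis using q by (simp add: powr_divide)
      qed
      also have "\<dots> \<le> (1 / q) powr real m" using q \<alpha> by (intro powr_mono) (auto simp: m_def)
      also have "\<dots> = (1 / q) ^ m" using q by (simp add: powr_realpow)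
      finally show ?thesis .
    qed
    have G0: "e * F z \<le> c * (B * (1 / q))"
    proof -
      have "e * F z \<le> e * (c * Y)" using F0 e by (intro mult_left_mono) auto
      also have "\<dots> = c * (e * Y)" by simp
      also have "\<dots> \<le> c * (B * (1 / q))" using c by (intro mult_left_mono b0)
      finally show ?thesis .
    qed
    have G1: "r * y * (e * (L1.F z / (\<alpha> + 1))) \<le> c1 * (B * (1 / q))"
    proof -
      have "r * y * (e * (L1.F z / (\<alpha> + 1))) \<le> r * y * (e * (c1 * Y))" using F1 e 2 by (intro mult_left_mono) auto
      also have "\<dots> = c1 * (r * y * (e * Y))" by simp
      also have "\<dots> \<le> c1 * (B * (1 / q))" using c by (intro mult_left_mono b1)
      finally show ?thesis .
    qed
    have up: "q powr (- \<alpha> - 1) * X \<le> D * ((1 + sqrt x) ^ 4 * exp x) * (1 / q) ^ (m + 3)"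
      if X: "0 \<le> X" "X \<le> (c + c1) * B * (1 / q) ^ 3" for X
    proof -
      have "q powr (- \<alpha> - 1) * X \<le> (1 / q) ^ m * ((c + c1) * B * (1 / q) ^ 3)" using X q by (intro mult_mono pw) auto
      also have "\<dots> = D * ((1 + sqrt x) ^ 4 * exp x) * (1 / q) ^ (m + 3)" unfolding power_add B_def D_def by (simp only: mult_ac)
      finally show ?thesis .
    qed
    have p1: "1 / q \<le> (1 / q) ^ 3" "(1 / q) ^ 2 \<le> (1 / q) ^ 3"
      using power_increasing[of 1 3 "1 / q"] power_increasing[of 2 3 "1 / q"] q(3) by auto
    have H: "hardy r x y = q powr (- \<alpha> - 1) * (e * F z)"
      by (simp add: hardy_def e_def z_def q_def mult.assoc)
    have "\<bar>hardy r x y\<bar> \<le> D * ((1 + sqrt x) ^ 4 * exp x) * (1 / q) ^ (m + 3)"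
    proof -
      have "c * (B * (1 / q)) \<le> (c + c1) * (B * (1 / q) ^ 3)"
        using c B p1 q by (intro mult_mono) auto
      then have "q powr (- \<alpha> - 1) * (e * F z) \<le> D * ((1 + sqrt x) ^ 4 * exp x) * (1 / q) ^ (m + 3)"
        using G0 F0 e by (intro up) (auto simp: mult.assoc)
      moreover have "\<bar>hardy r x y\<bar> = q powr (- \<alpha> - 1) * (e * F z)" unfolding H using F0 e by simp
      ultimately show ?thesis by simp
    qed
    moreover have "\<bar>hardy' r x y\<bar> \<le> D * ((1 + sqrt x) ^ 4 * exp x) * (1 / q) ^ (m + 3)"
    proof -
      define U V where "U = r / q * (e * F z)" and "V = 1 / q\<^sup>2 * (r * y * (e * (L1.F z / (\<alpha> + 1))))"
      have H': "hardy' r x y = q powr (- \<alpha> - 1) * (- U + V)"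
      proof -
        have "P * (E * (- u) * f + G * (y * r / w) * E) = P * (- (u * (E * f)) + 1 / w * (r * y * (E * G)))" for P E u f G w :: real
          by (simp add: mult_ac)
        then show ?thesis
          unfolding hardy'_def U_def V_def e_def z_def q_def .
      qed
      have "0 \<le> e * F z" "0 \<le> e * (L1.F z / (\<alpha> + 1))" using F0(1) F1(1) e by (blast intro: mult_nonneg_nonneg less_imp_le)+
      moreover have "0 \<le> r / q" "0 \<le> 1 / q\<^sup>2" "0 \<le> r * y" using 2 q by simp_all
      ultimately have UV: "0 \<le> U" "0 \<le> V" unfolding U_def V_def by (blast intro: mult_nonneg_nonneg)+
      then have "\<bar>- U + V\<bar> \<le> U + V" by linarith
      then have a: "\<bar>hardy' r x y\<bar> \<le> q powr (- \<alpha> - 1) * (U + V)"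
        unfolding H' abs_mult abs_of_nonneg[OF powr_ge_zero] by (rule mult_left_mono) simp
      have "U \<le> (1 / q) * (c * (B * (1 / q)))"
        unfolding U_def using \<open>0 \<le> e * F z\<close> q 2 by (intro mult_mono G0 divide_right_mono) auto
      also have "\<dots> = c * B * (1 / q) ^ 2" by (simp add: power2_eq_square)
      also have "\<dots> \<le> c * B * (1 / q) ^ 3" using c B by (intro mult_left_mono p1) auto
      finally have "U \<le> c * B * (1 / q) ^ 3" .
      moreover have "V \<le> 1 / q\<^sup>2 * (c1 * (B * (1 / q)))"
        unfolding V_def using q by (intro mult_left_mono G1) auto
      moreover have "1 / q\<^sup>2 * (c1 * (B * (1 / q))) = c1 * B * (1 / q) ^ 3" by (simp add: power2_eq_square power3_eq_cube)
      ultimately have "U + V \<le> (c + c1) * B * (1 / q) ^ 3" unfolding distrib_right by linarith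
      from up[OF add_nonneg_nonneg[OF UV] this] a show ?thesis by (rule order_trans[rotated])
    qed
    ultimately show ?case unfolding q_def by (rule conjI)
  qed
qed

lemma kernel_semigroup_laguerre: "kernel_semigroup \<mu> {0<..} heat_kernel (\<lambda>s x y. hardy' (exp (- s)) x y)"
proof
  fix x :: real
  have "(\<lambda>p. poly (Laguerre k) (snd p)) \<in> borel_measurable (borel \<Otimes>\<^sub>M \<mu>)" for k
    by (rule measurable_compose[OF measurable_snd]) (auto intro!: measurable_\<mu> borel_measurable_continuous_onI continuous_intros)
  note [measurable] = this
  show "(\<lambda>(s, y). heat_kernel s x y) \<in> borel_measurable (borel \<Otimes>\<^sub>M \<mu>)"
    unfolding heat_kernel_def split_beta by measurable
  show "((\<lambda>z. heat_kernel s z y) has_real_derivative hardy' (exp (- s)) x y) (at x)" if "0 < s" for s y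
    unfolding heat_kernel_eq[OF that] by (rule hardy_deriv)
  assume x: "x \<in> {0<..}"
  obtain D N where D: "0 \<le> D" and *: "\<And>r x y. 0 < r \<Longrightarrow> r < 1 \<Longrightarrow> 0 < x \<Longrightarrow> 0 < y \<Longrightarrow>
    \<bar>hardy r x y\<bar> \<le> D * ((1 + sqrt x) ^ 4 * exp x) * (1 / (1 - r)) ^ N \<and>
    \<bar>hardy' r x y\<bar> \<le> D * ((1 + sqrt x) ^ 4 * exp x) * (1 / (1 - r)) ^ N"
    using hardy_bounds by blast
  \<comment> \<open>The ball of radius \<open>x\<close> around \<open>x\<close> stays in the
    half-line and below \<open>2 * x\<close>, where the increasing factor of the kernel bound is
    largest.\<close>
  define A where "A = D * ((1 + sqrt (2 * x)) ^ 4 * exp (2 * x))"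
  have A: "0 \<le> A" and x0: "0 < x" using D x by (simp_all add: A_def)
  show "\<exists>d>0. \<exists>A\<ge>0. \<exists>N. \<forall>z\<in>ball x d. z \<in> {0<..} \<and>
      (\<forall>s>0. \<forall>y\<in>space \<mu>. \<bar>heat_kernel s z y\<bar> \<le> A * (1 + 1 / s) ^ N \<and> \<bar>hardy' (exp (- s)) z y\<bar> \<le> A * (1 + 1 / s) ^ N)"
  proof (rule exI[of _ x], rule conjI[OF x0], rule exI[of _ A], rule conjI[OF A], rule exI[of _ N], intro conjI ballI allI impI)
    fix z assume "z \<in> ball x x"
    then have z: "0 < z" "z \<le> 2 * x" by (auto simp: dist_real_def)
    then show "z \<in> {0<..}" by simp
    fix s y :: real assume s: "0 < s" and "y \<in> space \<mu>"
    then have y: "0 < y" by (simp add: space_\<mu>)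
    have "(1 / (1 - exp (- s))) ^ N \<le> (1 + 1 / s) ^ N"
      using s by (intro power_mono inverse_one_minus_exp_le) auto
    moreover have "D * ((1 + sqrt z) ^ 4 * exp z) \<le> A"
      unfolding A_def using z D by (intro mult_left_mono mult_mono power_mono) auto
    ultimately have "D * ((1 + sqrt z) ^ 4 * exp z) * (1 / (1 - exp (- s))) ^ N \<le> A * (1 + 1 / s) ^ N"
      using s D x by (intro mult_mono) (auto simp: A_def)
    then show "\<bar>heat_kernel s z y\<bar> \<le> A * (1 + 1 / s) ^ N" "\<bar>hardy' (exp (- s)) z y\<bar> \<le> A * (1 + 1 / s) ^ N"
      using *[of "exp (- s)" z y] s z y by (auto simp: heat_kernel_eq)
  qed
qed

end

subsection \<open>Hermite polynomials and the Mehler formula\<close>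

text \<open>The coefficients of the generating function \<open>exp (2 * x * t - t\<^sup>2)\<close>
  in \<open>t\<close>.\<close>

definition hermite_fact :: "nat \<Rightarrow> real \<Rightarrow> real"
  where "hermite_fact k x = hermite_poly k x / fact k"

text \<open>The summation range is made independent of the degree, so that three consecutive degrees
  can be added termwise.\<close>

lemma hermite_fact_eq:
  assumes "k \<le> 2 * K + 1"
  shows "hermite_fact k x = (\<Sum>j\<le>K. if 2 * j \<le> k then (- 1) ^ j / fact j * (2 * x) ^ (k - 2 * j) / fact (k - 2 * j) else 0)"
proof -
  have "{..K} \<inter> {j. 2 * j \<le> k} = {..k div 2}" using assms by auto
  then show ?thesis
    unfolding hermite_fact_def hermite_poly_def by (simp add: sum.If_cases)
qed

lemma hermite_fact_0: "hermite_fact 0 x = 1" and hermite_fact_1: "hermite_fact (Suc 0) x = 2 * x"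
  by (simp_all add: hermite_fact_def hermite_poly_def)

text \<open>The factor \<open>k + 2\<close> is split as \<open>(k + 2 - 2 * j) + 2 * j\<close> in
  each term: the first part lowers the power of \<open>2 * x\<close>, the second shifts the index
  \<open>j\<close>.\<close>

lemma hermite_fact_rec: "real (Suc (Suc k)) * hermite_fact (Suc (Suc k)) x = 2 * x * hermite_fact (Suc k) x - 2 * hermite_fact k x"
proof -
  define K where "K = k + 1"
  define t where "t n j = (if 2 * j \<le> n then (- 1) ^ j / fact j * (2 * x) ^ (n - 2 * j) / fact (n - 2 * j) else 0)" for n j
  have h: "hermite_fact n x = (\<Sum>j\<le>K. t n j)" if "n \<le> k + 2" for n
    unfolding t_def using that by (intro hermite_fact_eq) (simp add: K_def)
  have pw: "real (Suc n) * (C * y ^ Suc n / fact (Suc n)) = y * (C * y ^ n / fact n)" for y C :: real and n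
    by (simp add: fact_Suc del: of_nat_Suc)
  have 1: "real (Suc (Suc k) - 2 * j) * t (Suc (Suc k)) j = 2 * x * t (Suc k) j" for j
  proof (cases "2 * j \<le> Suc k")
    case True
    then obtain n where n: "Suc k = 2 * j + n" using le_Suc_ex by blast
    have e: "Suc (Suc k) - 2 * j = Suc n" "Suc k - 2 * j = n" "2 * j \<le> Suc (Suc k)" using n by auto
    show ?thesis unfolding t_def e using True e(3) pw[of n "(- 1) ^ j / fact j" "2 * x"] by (simp only: if_True)
  next
    case False
    then have "Suc (Suc k) \<le> 2 * j" by simp
    then show ?thesis using False by (simp add: t_def)
  qed
  have "(\<Sum>j\<le>K. real (2 * j) * t (Suc (Suc k)) j) = (\<Sum>j\<le>K. - 2 * t k j)"
  proof -
    have "(\<Sum>j\<le>K. real (2 * j) * t (Suc (Suc k)) j) = (\<Sum>j\<le>k. real (2 * Suc j) * t (Suc (Suc k)) (Suc j))"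
      unfolding K_def Suc_eq_plus1[symmetric] by (subst sum.atMost_Suc_shift) simp
    also have "\<dots> = (\<Sum>j\<le>k. - 2 * t k j)"
    proof (rule sum.cong[OF refl])
      fix j
      have "real (Suc j) / fact (Suc j) = 1 / (fact j :: real)" by (simp add: fact_Suc del: of_nat_Suc)
      moreover have "real (2 * Suc j) * ((-1) ^ Suc j / fact (Suc j)) = 2 * (-1) ^ Suc j * (real (Suc j) / fact (Suc j))"
        unfolding of_nat_mult by (simp del: of_nat_Suc fact_Suc mult_Suc_right)
      ultimately have c: "real (2 * Suc j) * ((-1) ^ Suc j / fact (Suc j)) = - 2 * ((-1) ^ j / fact j :: real)"
        by simp
      show "real (2 * Suc j) * t (Suc (Suc k)) (Suc j) = - 2 * t k j"
      proof (cases "2 * j \<le> k")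
        case True
        define Z where "Z = (2 * x) ^ (k - 2 * j) / fact (k - 2 * j)"
        have "t (Suc (Suc k)) (Suc j) = (-1) ^ Suc j / fact (Suc j) * Z" "t k j = (-1) ^ j / fact j * Z"
          using True by (simp_all add: t_def Z_def del: fact_Suc power_Suc)
        then show ?thesis by (simp only: mult.assoc[symmetric] c)
      qed (simp add: t_def)
    qed
    also have "\<dots> = (\<Sum>j\<le>K. - 2 * t k j)" by (simp add: K_def t_def)
    finally show ?thesis .
  qed
  moreover have "real (Suc (Suc k)) * t (Suc (Suc k)) j = real (Suc (Suc k) - 2 * j) * t (Suc (Suc k)) j + real (2 * j) * t (Suc (Suc k)) j" for j
  proof (cases "2 * j \<le> Suc (Suc k)")
    case True
    then have "real (Suc (Suc k)) = real (Suc (Suc k) - 2 * j) + real (2 * j)" by (simp only: of_nat_add[symmetric] le_add_diff_inverse2)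
    then show ?thesis by (metis distrib_right)
  qed (simp add: t_def)
  ultimately have "real (Suc (Suc k)) * (\<Sum>j\<le>K. t (Suc (Suc k)) j) = 2 * x * (\<Sum>j\<le>K. t (Suc k) j) - 2 * (\<Sum>j\<le>K. t k j)"
    by (simp add: sum_distrib_left sum.distrib 1 sum_negf)
  then show ?thesis by (simp add: h)
qed

section \<open>The Mehler formula through its differential equation\<close>

definition mehler_coeff :: "real \<Rightarrow> real \<Rightarrow> nat \<Rightarrow> real"
  where "mehler_coeff x y k = hermite_poly k x * hermite_poly k y / (2 ^ k * fact k)"

lemma mehler_coeff_hermite_fact: "mehler_coeff x y k = fact k / 2 ^ k * hermite_fact k x * hermite_fact k y"
  by (simp add: mehler_coeff_def hermite_fact_def)

text \<open>The coefficient recurrence corresponding to the differential equation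
  \<open>(1 - r\<^sup>2)\<^sup>2 K' = (r (1 - r\<^sup>2) + 2xy (1 + r\<^sup>2) - 2r (x\<^sup>2 + y\<^sup>2)) K\<close> of the Mehler kernel.\<close>

lemma mehler_coeff_rec:
  fixes x y :: real
  defines "a \<equiv> mehler_coeff x y"
  shows "real (k + 4) * a (k + 4) = 2 * x * y * a (k + 3) + (2 * real k + 5 - 2 * (x\<^sup>2 + y\<^sup>2)) * a (k + 2)
    + 2 * x * y * a (k + 1) - (real k + 1) * a k"
proof -
  define K where "K = real k"
  have K: "0 \<le> K" by (simp add: K_def)
  define u0 u1 v0 v1 where "u0 = hermite_fact k x" and "u1 = hermite_fact (k + 1) x" and "v0 = hermite_fact k y" and "v1 = hermite_fact (k + 1) y"
  define u2 v2 u3 v3 u4 v4 where "u2 = hermite_fact (k + 2) x" and "v2 = hermite_fact (k + 2) y" and "u3 = hermite_fact (k + 3) x" and "v3 = hermite_fact (k + 3) y"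
    and "u4 = hermite_fact (k + 4) x" and "v4 = hermite_fact (k + 4) y"
  have r2: "(K + 2) * u2 = 2 * x * u1 - 2 * u0" "(K + 2) * v2 = 2 * y * v1 - 2 * v0"
    using hermite_fact_rec[of k x] hermite_fact_rec[of k y] by (simp_all add: K_def u0_def u1_def u2_def v0_def v1_def v2_def add.commute)
  have r3: "(K + 3) * u3 = 2 * x * u2 - 2 * u1" "(K + 3) * v3 = 2 * y * v2 - 2 * v1"
    using hermite_fact_rec[of "k + 1" x] hermite_fact_rec[of "k + 1" y] by (simp_all add: K_def u3_def u1_def u2_def v3_def v1_def v2_def numeral_eq_Suc add_ac)
  have r4: "(K + 4) * u4 = 2 * x * u3 - 2 * u2" "(K + 4) * v4 = 2 * y * v3 - 2 * v2"
    using hermite_fact_rec[of "k + 2" x] hermite_fact_rec[of "k + 2" y] by (simp_all add: K_def u3_def u4_def u2_def v3_def v4_def v2_def numeral_eq_Suc add_ac)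
  define F where "F = (fact k / 2 ^ k :: real)"
  have f: "fact (k + 1) / 2 ^ (k + 1) = F * (K + 1) / 2"
    "fact (k + 2) / 2 ^ (k + 2) = F * (K + 1) * (K + 2) / 4"
    "fact (k + 3) / 2 ^ (k + 3) = F * (K + 1) * (K + 2) * (K + 3) / 8"
    "fact (k + 4) / 2 ^ (k + 4) = F * (K + 1) * (K + 2) * (K + 3) * (K + 4) / 16"
    by (simp_all add: F_def K_def numeral_eq_Suc algebra_simps)
  have a: "a k = F * u0 * v0" "a (k + 1) = F * (K + 1) / 2 * u1 * v1" "a (k + 2) = F * (K + 1) * (K + 2) / 4 * u2 * v2"
    "a (k + 3) = F * (K + 1) * (K + 2) * (K + 3) / 8 * u3 * v3" "a (k + 4) = F * (K + 1) * (K + 2) * (K + 3) * (K + 4) / 16 * u4 * v4"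
    unfolding a_def mehler_coeff_hermite_fact f F_def[symmetric]
    by (simp_all only: u0_def u1_def u2_def u3_def u4_def v0_def v1_def v2_def v3_def v4_def)
  \<comment> \<open>The recurrences are solved downwards, so all quantities are expressed by the
    degrees \<open>k + 2\<close> and \<open>k + 3\<close>. The claim becomes a polynomial
    identity.\<close>
  have u1: "u0 = x * u1 - (K + 2) / 2 * u2" "v0 = y * v1 - (K + 2) / 2 * v2" using r2 by (simp_all add: field_simps)
  have u2: "u1 = x * u2 - (K + 3) / 2 * u3" "v1 = y * v2 - (K + 3) / 2 * v3" using r3 by (simp_all add: field_simps)
  have u4: "u4 * (K + 4) = 2 * x * u3 - 2 * u2" "v4 * (K + 4) = 2 * y * v3 - 2 * v2" using r4 by (simp_all add: mult.commute)
  have "(K + 4) * a (k + 4) = F * (K + 1) * (K + 2) * (K + 3) / 16 * ((u4 * (K + 4)) * (v4 * (K + 4)))"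
    unfolding a by (simp add: algebra_simps)
  also have "\<dots> = F * (K + 1) * (K + 2) * (K + 3) / 16 * ((2 * x * u3 - 2 * u2) * (2 * y * v3 - 2 * v2))"
    unfolding u4 ..
  also have "\<dots> = 2 * x * y * a (k + 3) + (2 * K + 5 - 2 * (x\<^sup>2 + y\<^sup>2)) * a (k + 2) + 2 * x * y * a (k + 1) - (K + 1) * a k"
    unfolding a u1 u2 by (simp add: field_simps power2_eq_square)
  finally show ?thesis by (simp add: K_def add.commute)
qed

text \<open>The four starting values of a recurrence of order four. After the first they are the
  recurrence at \<open>k = -3, -2, -1\<close> with coefficients of negative index set to
  zero.\<close>

lemma mehler_coeff_0: "mehler_coeff x y 0 = 1"
  and mehler_coeff_1: "mehler_coeff x y 1 = 2 * x * y"
  and mehler_coeff_2: "2 * mehler_coeff x y 2 = (1 - 2 * (x\<^sup>2 + y\<^sup>2)) + 2 * x * y * (2 * x * y)"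
  and mehler_coeff_3: "3 * mehler_coeff x y 3 = 2 * x * y * mehler_coeff x y 2 + (3 - 2 * (x\<^sup>2 + y\<^sup>2)) * (2 * x * y) + 2 * x * y"
proof -
  have h2: "hermite_fact 2 x = 2 * x\<^sup>2 - 1" for x
    using hermite_fact_rec[of 0 x] by (simp add: hermite_fact_0 hermite_fact_1 numeral_2_eq_2 power2_eq_square algebra_simps)
  have h3: "hermite_fact 3 x = (4 * x ^ 3 - 6 * x) / 3" for x
  proof -
    have h2': "hermite_fact (Suc (Suc 0)) x = 2 * x * x - 1" using h2[of x] by (simp add: numeral_2_eq_2 power2_eq_square[unfolded numeral_2_eq_2])
    have "real (Suc (Suc 1)) * hermite_fact (Suc (Suc 1)) x = 2 * x * (2 * x * x - 1) - 2 * (2 * x)"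
      using hermite_fact_rec[of 1 x] unfolding One_nat_def h2' hermite_fact_1 .
    then show ?thesis by (simp add: numeral_3_eq_3 field_simps)
  qed
  show "mehler_coeff x y 0 = 1" by (simp add: mehler_coeff_hermite_fact hermite_fact_0)
  show "mehler_coeff x y 1 = 2 * x * y" by (simp add: mehler_coeff_hermite_fact hermite_fact_1)
  have m2: "mehler_coeff x y 2 = (2 * x\<^sup>2 - 1) * (2 * y\<^sup>2 - 1) / 2"
    by (simp add: mehler_coeff_hermite_fact h2 fact_numeral)
  show "2 * mehler_coeff x y 2 = (1 - 2 * (x\<^sup>2 + y\<^sup>2)) + 2 * x * y * (2 * x * y)"
    unfolding m2 by (simp add: field_simps power2_eq_square)
  have m3: "mehler_coeff x y 3 = 3 / 4 * ((4 * x ^ 3 - 6 * x) / 3 * ((4 * y ^ 3 - 6 * y) / 3))"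
    by (simp add: mehler_coeff_hermite_fact h3 fact_numeral)
  show "3 * mehler_coeff x y 3 = 2 * x * y * mehler_coeff x y 2 + (3 - 2 * (x\<^sup>2 + y\<^sup>2)) * (2 * x * y) + 2 * x * y"
    unfolding m2 m3 by (simp add: field_simps power2_eq_square power3_eq_cube)
qed

text \<open>Coefficient comparison in the differential equation gives a recurrence of order four
  together with its starting values, the same as for \<open>mehler_coeff\<close>. The series is
  complex because it will be the Taylor expansion of a holomorphic function.\<close>

lemma mehler_ode_unique:
  fixes F :: "complex fps" and x y :: real
  defines "P \<equiv> fps_const (of_real (2 * x * y))" and "S \<equiv> fps_const (of_real (2 * (x\<^sup>2 + y\<^sup>2)))"
  assumes ode: "fps_deriv F * (1 - fps_X ^ 2) ^ 2 = (fps_X * (1 - fps_X ^ 2) + P * (1 + fps_X ^ 2) - S * fps_X) * F"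
    and F0: "fps_nth F 0 = 1"
  shows "fps_nth F n = of_real (mehler_coeff x y n)"
proof -
  define a where "a = fps_nth F"
  define p s :: complex where "p = of_real (2 * x * y)" and "s = of_real (2 * (x\<^sup>2 + y\<^sup>2))"
  have L: "fps_deriv F * (1 - fps_X ^ 2) ^ 2 = fps_deriv F - 2 * (fps_X ^ 2 * fps_deriv F) + fps_X ^ 4 * fps_deriv F"
    by (simp add: power2_eq_square algebra_simps power4_eq_xxxx)
  have R: "(fps_X * (1 - fps_X ^ 2) + P * (1 + fps_X ^ 2) - S * fps_X) * F =
     fps_X ^ 1 * F - fps_X ^ 3 * F + P * F + P * (fps_X ^ 2 * F) - S * (fps_X ^ 1 * F)"
    by (simp add: power2_eq_square algebra_simps power3_eq_cube)
  have "fps_nth (fps_deriv F - 2 * (fps_X ^ 2 * fps_deriv F) + fps_X ^ 4 * fps_deriv F) n =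
      fps_nth (fps_X ^ 1 * F - fps_X ^ 3 * F + P * F + P * (fps_X ^ 2 * F) - S * (fps_X ^ 1 * F)) n" for n
    using ode unfolding L R by simp
  then have eqn: "of_nat (n + 1) * a (n + 1) - 2 * (if n < 2 then 0 else of_nat (n - 2 + 1) * a (n - 2 + 1)) +
      (if n < 4 then 0 else of_nat (n - 4 + 1) * a (n - 4 + 1)) =
     (if n < 1 then 0 else a (n - 1)) - (if n < 3 then 0 else a (n - 3)) + p * a n + p * (if n < 2 then 0 else a (n - 2)) -
     s * (if n < 1 then 0 else a (n - 1))" for n
    by (simp only: fps_add_nth fps_sub_nth fps_mult_left_const_nth fps_X_power_mult_nth fps_deriv_nth P_def S_def
        fps_numeral_nth fps_numeral_fps_const a_def p_def s_def)
  have a0: "a 0 = 1" using F0 by (simp add: a_def)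
  have a1: "a 1 = p" using eqn[of 0] a0 by simp
  have a2: "2 * a 2 = (1 - s) + p * p" using eqn[of 1] a0 a1 by (simp add: numeral_2_eq_2 algebra_simps)
  have a3: "3 * a 3 = p * a 2 + (3 - s) * p + p" using eqn[of 2] a0 a1 by (simp add: numeral_2_eq_2 numeral_3_eq_3 algebra_simps)
  \<comment> \<open>At \<open>k = 0\<close> the contribution of \<open>fps_X ^ 4\<close> is absent;
    in the general formula its factor is zero there, so both cases have the same form.\<close>
  have ak: "of_nat (k + 4) * a (k + 4) = p * a (k + 3) + (2 * of_nat k + 5 - s) * a (k + 2) + p * a (k + 1) - (of_nat k + 1) * a k" for k
  proof (cases k)
    case 0
    then show ?thesis using eqn[of 3] by (simp add: numeral_eq_Suc algebra_simps)
  next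
    case (Suc k')
    then show ?thesis using eqn[of "k + 3"] by (simp add: numeral_eq_Suc algebra_simps)
  qed
  define m :: "nat \<Rightarrow> complex" where "m n = of_real (mehler_coeff x y n)" for n
  have m0: "m 0 = 1" "m 1 = p" using mehler_coeff_0[of x y] mehler_coeff_1[of x y] by (simp_all add: m_def p_def)
  have "of_real (2 * mehler_coeff x y 2) = (of_real ((1 - 2 * (x\<^sup>2 + y\<^sup>2)) + 2 * x * y * (2 * x * y)) :: complex)"
    by (simp only: mehler_coeff_2)
  then have m2: "2 * m 2 = (1 - s) + p * p" by (simp add: m_def p_def s_def)
  have "of_real (3 * mehler_coeff x y 3) = (of_real (2 * x * y * mehler_coeff x y 2 + (3 - 2 * (x\<^sup>2 + y\<^sup>2)) * (2 * x * y) + 2 * x * y) :: complex)"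
    by (simp only: mehler_coeff_3)
  then have m3: "3 * m 3 = p * m 2 + (3 - s) * p + p" by (simp add: m_def p_def s_def)
  have mk: "of_nat (k + 4) * m (k + 4) = p * m (k + 3) + (2 * of_nat k + 5 - s) * m (k + 2) + p * m (k + 1) - (of_nat k + 1) * m k" for k
  proof -
    have "of_real (real (k + 4) * mehler_coeff x y (k + 4)) = (of_real (2 * x * y * mehler_coeff x y (k + 3) + (2 * real k + 5 - 2 * (x\<^sup>2 + y\<^sup>2)) * mehler_coeff x y (k + 2)
      + 2 * x * y * mehler_coeff x y (k + 1) - (real k + 1) * mehler_coeff x y k) :: complex)"
      by (simp only: mehler_coeff_rec)
    then show ?thesis by (simp add: m_def p_def s_def)
  qed
  have "a n = m n"
  proof (induction n rule: less_induct)
    case (less n)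
    consider "n = 0" | "n = 1" | "n = 2" | "n = 3" | k where "n = k + 4"
    proof -
      have "n = 0 \<or> n = 1 \<or> n = 2 \<or> n = 3 \<or> n = (n - 4) + 4" by arith
      then show thesis using that by blast
    qed
    then show ?case
    proof cases
      case 5
      have "of_nat (k + 4) * a (k + 4) = of_nat (k + 4) * m (k + 4)"
        unfolding ak mk using less.IH[of k] less.IH[of "k + 1"] less.IH[of "k + 2"] less.IH[of "k + 3"] 5 by simp
      moreover have "of_nat (k + 4) \<noteq> (0 :: complex)" by (simp only: of_nat_eq_0_iff)
      ultimately show ?thesis using 5 mult_cancel_left by blast
    next
      case 3
      have "2 * a 2 = 2 * m 2" using a2 m2 by simp
      then show ?thesis using 3 by simp
    next
      case 4
      have "3 * a 3 = 3 * m 3" using a3 m3 less.IH[of 2] 4 by simp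
      then show ?thesis using 4 by simp
    qed (use a0 a1 m0 in auto)
  qed
  then show ?thesis by (simp add: a_def m_def)
qed

text \<open>The closed form is holomorphic in the unit disc and solves the differential equation,
  which determines its Taylor coefficients. Holomorphy also yields convergence for all
  \<open>\<bar>r\<bar> < 1\<close>, with no estimate of Hermite polynomials.\<close>

lemma mehler_formula:
  fixes r x y :: real
  assumes r: "\<bar>r\<bar> < 1"
  shows "(\<lambda>k. mehler_coeff x y k * r ^ k) sums
    ((1 - r\<^sup>2) powr (- 1 / 2) * exp ((2 * x * y * r - r\<^sup>2 * (x\<^sup>2 + y\<^sup>2)) / (1 - r\<^sup>2)))"
proof -
  define P S :: complex where "P = of_real (2 * x * y)" and "S = of_real (2 * (x\<^sup>2 + y\<^sup>2))"
  define K where "K z = (1 - z\<^sup>2) powr (- 1 / 2) * exp ((P * z - z\<^sup>2 * S / 2) / (1 - z\<^sup>2))" for z :: complex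
  define K' where "K' z = (z * (1 - z\<^sup>2) + P * (1 + z\<^sup>2) - S * z) / (1 - z\<^sup>2)\<^sup>2 * K z" for z
  \<comment> \<open>\<open>1 - z\<^sup>2\<close> has positive real part in the disc and so avoids
    the branch cut of the principal power.\<close>
  have re: "0 < Re (1 - z\<^sup>2)" and nz: "1 - z\<^sup>2 \<noteq> 0" and nn: "1 - z\<^sup>2 \<notin> \<real>\<^sub>\<le>\<^sub>0" if "z \<in> ball 0 1" for z :: complex
  proof -
    have "norm (z\<^sup>2) < 1" using that by (simp add: norm_power power_less_one_iff)
    then have "Re (z\<^sup>2) < 1" using complex_Re_le_cmod[of "z\<^sup>2"] by linarith
    then show re: "0 < Re (1 - z\<^sup>2)" by simp
    then show "1 - z\<^sup>2 \<noteq> 0" by auto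
    show "1 - z\<^sup>2 \<notin> \<real>\<^sub>\<le>\<^sub>0" using re by (auto simp: complex_nonpos_Reals_iff)
  qed
  have dK: "(K has_field_derivative K' z) (at z)" if z: "z \<in> ball 0 1" for z
  proof -
    define q where "q = 1 - z\<^sup>2"
    have q: "q \<noteq> 0" "q \<notin> \<real>\<^sub>\<le>\<^sub>0" using nz[OF z] nn[OF z] by (auto simp: q_def)
    have dq: "((\<lambda>z. 1 - z\<^sup>2) has_field_derivative - 2 * z) (at z)" by (auto intro!: derivative_eq_intros)
    have "((\<lambda>z. (1 - z\<^sup>2) powr (- 1 / 2)) has_field_derivative (- 1 / 2) * q powr (- 1 / 2 - 1) * (- 2 * z)) (at z)"
      using DERIV_chain2[OF has_field_derivative_powr[OF q(2)[unfolded q_def], of "- 1 / 2"] dq] by (simp add: q_def)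
    moreover have "q powr (- 1 / 2 - 1) = q powr (- 1 / 2) / q" using q(1) powr_diff[of q "- 1 / 2" 1] by simp
    ultimately have d1: "((\<lambda>z. (1 - z\<^sup>2) powr (- 1 / 2)) has_field_derivative z / q * q powr (- 1 / 2)) (at z)" by (simp add: mult.commute)
    have d2: "((\<lambda>z. (P * z - z\<^sup>2 * S / 2) / (1 - z\<^sup>2)) has_field_derivative
        (((P - z * S) * q + (P * z - z\<^sup>2 * S / 2) * (2 * z)) / q\<^sup>2)) (at z)"
      using q by (auto intro!: derivative_eq_intros simp: q_def power2_eq_square)
    have "(K has_field_derivative
      z / q * q powr (- 1 / 2) * exp ((P * z - z\<^sup>2 * S / 2) / q) +
      (exp ((P * z - z\<^sup>2 * S / 2) / q) * (((P - z * S) * q + (P * z - z\<^sup>2 * S / 2) * (2 * z)) / q\<^sup>2)) * q powr (- 1 / 2)) (at z)"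
      using DERIV_mult[OF d1 DERIV_chain2[OF DERIV_exp d2]] unfolding K_def[abs_def] q_def .
    moreover have "z / q * q powr (- 1 / 2) * exp ((P * z - z\<^sup>2 * S / 2) / q) +
      (exp ((P * z - z\<^sup>2 * S / 2) / q) * (((P - z * S) * q + (P * z - z\<^sup>2 * S / 2) * (2 * z)) / q\<^sup>2)) * q powr (- 1 / 2) = K' z"
    proof -
      have "(P - z * S) * q + (P * z - z\<^sup>2 * S / 2) * (2 * z) = P * (1 + z\<^sup>2) - S * z"
        by (simp add: q_def algebra_simps power2_eq_square)
      moreover have "z / q = z * q / q\<^sup>2" using q(1) by (simp add: power2_eq_square)
      ultimately have "z / q + ((P - z * S) * q + (P * z - z\<^sup>2 * S / 2) * (2 * z)) / q\<^sup>2 = (z * q + P * (1 + z\<^sup>2) - S * z) / q\<^sup>2"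
        by (simp only: add_divide_distrib[symmetric]) (simp add: algebra_simps)
      moreover have "A * u * v + (v * B) * u = (A + B) * (u * v)" for A B u v :: complex by (simp add: algebra_simps)
      ultimately show ?thesis unfolding K'_def K_def q_def[symmetric] by (simp only:)
    qed
    ultimately show ?thesis by simp
  qed
  have hol: "K holomorphic_on ball 0 1" unfolding holomorphic_on_open[OF open_ball] using dK by blast
  have fK: "K has_fps_expansion fps_expansion K 0"
    by (rule has_fps_expansion_fps_expansion[OF _ _ hol]) auto
  have e1: "(\<lambda>z. deriv K z * (1 - z ^ 2) ^ 2) has_fps_expansion fps_deriv (fps_expansion K 0) * (1 - fps_X ^ 2) ^ 2"
    by (intro fps_expansion_intros fK)
  have e2: "(\<lambda>z. (z * (1 - z ^ 2) + P * (1 + z ^ 2) - S * z) * K z) has_fps_expansion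
      (fps_X * (1 - fps_X ^ 2) + fps_const P * (1 + fps_X ^ 2) - fps_const S * fps_X) * fps_expansion K 0"
    by (intro fps_expansion_intros fK)
  have ev: "eventually (\<lambda>z. deriv K z * (1 - z ^ 2) ^ 2 = (z * (1 - z ^ 2) + P * (1 + z ^ 2) - S * z) * K z) (nhds 0)"
  proof -
    have "eventually (\<lambda>z. z \<in> ball (0::complex) 1) (nhds 0)" by (intro eventually_nhds_in_open) auto
    then show ?thesis
    proof eventually_elim
      fix z :: complex assume z: "z \<in> ball 0 1"
      show "deriv K z * (1 - z ^ 2) ^ 2 = (z * (1 - z ^ 2) + P * (1 + z ^ 2) - S * z) * K z"
        using nz[OF z] DERIV_imp_deriv[OF dK[OF z]] by (simp add: K'_def)
    qed
  qed
  have ode: "fps_deriv (fps_expansion K 0) * (1 - fps_X ^ 2) ^ 2 =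
    (fps_X * (1 - fps_X ^ 2) + fps_const P * (1 + fps_X ^ 2) - fps_const S * fps_X) * fps_expansion K 0"
    using e1 unfolding has_fps_expansion_cong[OF ev refl] by (rule fps_expansion_unique_complex[OF _ e2])
  have nth: "fps_nth (fps_expansion K 0) n = of_real (mehler_coeff x y n)" for n
    by (rule mehler_ode_unique) (use ode in \<open>auto simp: P_def S_def fps_expansion_def K_def\<close>)
  have "(\<lambda>n. (deriv ^^ n) K 0 / fact n * (of_real r - 0) ^ n) sums K (of_real r)"
    by (rule holomorphic_power_series[OF hol]) (use r in simp)
  then have "(\<lambda>n. of_real (mehler_coeff x y n * r ^ n)) sums K (of_real r)"
    using nth by (simp only: fps_expansion_def fps_nth_Abs_fps diff_zero of_real_mult of_real_power)
  moreover have "K (of_real r) = of_real ((1 - r\<^sup>2) powr (- 1 / 2) * exp ((2 * x * y * r - r\<^sup>2 * (x\<^sup>2 + y\<^sup>2)) / (1 - r\<^sup>2)))"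
  proof -
    have "0 < 1 - r\<^sup>2" using r by (simp add: abs_square_less_1)
    then have "of_real ((1 - r\<^sup>2) powr (- 1 / 2)) = ((1 - (of_real r)\<^sup>2) powr (- 1 / 2) :: complex)"
      using powr_of_real[of "1 - r\<^sup>2" "- 1 / 2"] by simp
    moreover have "(P * of_real r - (of_real r)\<^sup>2 * S / 2) / (1 - (of_real r)\<^sup>2) = of_real ((2 * x * y * r - r\<^sup>2 * (x\<^sup>2 + y\<^sup>2)) / (1 - r\<^sup>2))"
      by (simp add: P_def S_def)
    ultimately show ?thesis unfolding K_def by (simp only: of_real_mult exp_of_real)
  qed
  ultimately show ?thesis by (simp only: sums_of_real_iff)
qed

section \<open>Hermite polynomials as a polynomial sequence and their Gaussian orthogonality\<close>

text \<open>The raising recursion is used because \<open>2 * x\<close> minus differentiation is the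
  adjoint of differentiation for the Gaussian measure.\<close>

fun Hermite :: "nat \<Rightarrow> real poly" where
  "Hermite 0 = 1"
| "Hermite (Suc k) = [:0, 2:] * Hermite k - pderiv (Hermite k)"

text \<open>Differentiating the recursion and inserting the induction hypothesis reproduces the
  recursion one degree lower.\<close>

lemma pderiv_Hermite: "pderiv (Hermite (Suc k)) = smult (2 * real (Suc k)) (Hermite k)"
proof (induction k)
  case (Suc k)
  have "pderiv (Hermite (Suc (Suc k))) = smult 2 (Hermite (Suc k)) + ([:0, 2:] * pderiv (Hermite (Suc k)) - pderiv (pderiv (Hermite (Suc k))))"
    by (simp only: Hermite.simps(2)[of "Suc k"]) (simp add: pderiv_diff pderiv_mult pderiv_pCons pderiv_smult del: Hermite.simps)
  also have "[:0, 2:] * pderiv (Hermite (Suc k)) - pderiv (pderiv (Hermite (Suc k))) = smult (2 * real (Suc k)) (Hermite (Suc k))"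
    unfolding Suc.IH pderiv_smult mult_smult_right smult_diff_right[symmetric] Hermite.simps(2)[symmetric] ..
  also have "smult 2 (Hermite (Suc k)) + smult (2 * real (Suc k)) (Hermite (Suc k)) = smult (2 * real (Suc (Suc k))) (Hermite (Suc k))"
    unfolding smult_add_left[symmetric] by simp
  finally show ?case .
qed (simp add: pderiv_pCons)

lemma degree_Hermite_le: "degree (Hermite k) \<le> k"
proof (induction k)
  case (Suc k)
  have "degree (Hermite (Suc k)) \<le> max (degree ([:0, 2:] * Hermite k)) (degree (pderiv (Hermite k)))"
    unfolding Hermite.simps by (rule degree_diff_le_max)
  also have "\<dots> \<le> Suc k"
  proof (rule max.boundedI)
    have "degree ([:0, 2:] * Hermite k) \<le> degree [:0, 2::real:] + degree (Hermite k)" by (rule degree_mult_le)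
    also have "\<dots> \<le> Suc k" using Suc by simp
    finally show "degree ([:0, 2:] * Hermite k) \<le> Suc k" .
    show "degree (pderiv (Hermite k)) \<le> Suc k" using Suc unfolding degree_pderiv by simp
  qed
  finally show ?case .
qed simp

lemma coeff_Hermite: "coeff (Hermite k) k = 2 ^ k"
proof (induction k)
  case (Suc k)
  have "coeff (pderiv (Hermite k)) (Suc k) = 0"
    using degree_Hermite_le[of k] by (simp add: coeff_pderiv coeff_eq_0)
  then show ?case using Suc by (simp add: mult_pCons_left)
qed simp

lemma degree_Hermite: "degree (Hermite k) = k"
  using degree_Hermite_le[of k] le_degree[of "Hermite k" k] by (simp add: coeff_Hermite)

lemma poly_Hermite: "poly (Hermite k) x = hermite_poly k x"
proof -
  \<comment> \<open>Two consecutive degrees are carried along, as the recurrence of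
    \<open>hermite_fact\<close> has three terms.\<close>
  have "poly (Hermite k) x = fact k * hermite_fact k x \<and> poly (Hermite (Suc k)) x = fact (Suc k) * hermite_fact (Suc k) x"
  proof (induction k)
    case 0
    then show ?case by (simp add: hermite_fact_0 hermite_fact_1)
  next
    case (Suc k)
    have "poly (Hermite (Suc (Suc k))) x = 2 * x * poly (Hermite (Suc k)) x - 2 * real (Suc k) * poly (Hermite k) x"
      by (simp only: Hermite.simps(2)[of "Suc k"] pderiv_Hermite) (simp del: Hermite.simps)
    also have "\<dots> = fact (Suc k) * (2 * x * hermite_fact (Suc k) x - 2 * hermite_fact k x)"
      using Suc by (simp add: algebra_simps del: Hermite.simps)
    also have "\<dots> = fact (Suc (Suc k)) * hermite_fact (Suc (Suc k)) x"
      unfolding hermite_fact_rec[symmetric] fact_Suc[of "Suc k"] by (simp add: mult_ac del: fact_Suc)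
    finally show ?case using Suc by (simp only: simp_thms)
  qed
  then show ?thesis by (simp add: hermite_fact_def)
qed

text \<open>The Gaussian measure in the shape of the other two, a density on a restricted space, so
  that the lemmas about such densities apply.\<close>

lemma gauss_measure_eq: "gauss_measure = density (restrict_space lborel UNIV) (\<lambda>x. ennreal (exp (- x\<^sup>2) / sqrt pi))"
proof -
  have "restrict_space lborel UNIV = (lborel :: real measure)"
    by (rule measure_eqI) (auto simp: sets_restrict_space emeasure_restrict_space)
  then show ?thesis by (simp add: gauss_measure_def)
qed

lemma sets_gauss: "sets gauss_measure = sets borel"
  by (simp add: gauss_measure_def)

lemma moment_gauss:
  "has_bochner_integral gauss_measure (\<lambda>x. x ^ m) (if even m then fact m / (4 ^ (m div 2) * fact (m div 2)) else 0)"
proof -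
  \<comment> \<open>The weight is the centred normal density of variance 1/2.\<close>
  define \<sigma> where "\<sigma> = sqrt (1 / 2)"
  have \<sigma>: "0 < \<sigma>" "\<sigma>\<^sup>2 = 1 / 2" by (simp_all add: \<sigma>_def)
  have d: "normal_density 0 \<sigma> x = exp (- x\<^sup>2) / sqrt pi" for x
    by (simp add: normal_density_def \<sigma>)
  have iff: "has_bochner_integral gauss_measure (\<lambda>x. x ^ m) r \<longleftrightarrow> has_bochner_integral lborel (\<lambda>x. normal_density 0 \<sigma> x * (x - 0) ^ m) r" for r
    unfolding gauss_measure_eq by (subst has_bochner_integral_restricted_density_iff) (auto simp: d)
  show ?thesis
  proof (cases "even m")
    case True
    then obtain k where k: "m = 2 * k" by (elim evenE)
    show ?thesis using normal_moment_even[OF \<sigma>(1), of 0 k] \<sigma> unfolding iff by (simp add: k)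
  next
    case False
    then obtain k where k: "m = 2 * k + 1" by (elim oddE)
    show ?thesis using normal_moment_odd[OF \<sigma>(1), of 0 k] unfolding iff by (simp add: k)
  qed
qed

interpretation gauss: finite_measure gauss_measure
  using moment_gauss[of 0] by (intro finite_measureI) (simp add: emeasure_space_eq_1)

text \<open>The factor 1 keeps the integrand an explicit function of \<open>x\<close>, so that
  evaluation rules such as \<open>poly_add\<close> can be used under the integral.\<close>

definition gauss_integral :: "real poly \<Rightarrow> real"
  where "gauss_integral q = (\<integral>x. 1 * poly q x \<partial>gauss_measure)"

lemma integrable_poly_gauss: "integrable gauss_measure (poly q)"
  unfolding poly_altdef using moment_gauss by (intro Bochner_Integration.integrable_sum integrable_mult_right) (auto simp: has_bochner_integral_iff)

lemma gauss_integral_0: "gauss_integral 0 = 0"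
  by (simp only: gauss_integral_def poly_0) simp

lemma gauss_integral_add: "gauss_integral (p + q) = gauss_integral p + gauss_integral q"
  unfolding gauss_integral_def poly_add mult_1 by (intro Bochner_Integration.integral_add integrable_poly_gauss)

lemma gauss_integral_diff: "gauss_integral (p - q) = gauss_integral p - gauss_integral q"
  unfolding gauss_integral_def poly_diff mult_1 by (intro Bochner_Integration.integral_diff integrable_poly_gauss)

lemma gauss_integral_smult: "gauss_integral (smult c p) = c * gauss_integral p"
  unfolding gauss_integral_def poly_smult by simp

lemma gauss_integral_monom: "gauss_integral (monom c m) = c * (if even m then fact m / (4 ^ (m div 2) * fact (m div 2)) else 0)"
  using moment_gauss[of m] by (simp add: gauss_integral_def poly_monom has_bochner_integral_iff)

text \<open>On monomials the formula of Gaussian integration by parts is the recursion between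
  consecutive even moments; odd moments vanish. Linearity does the rest.\<close>

lemma gauss_integral_by_parts: "gauss_integral ([:0, 2:] * q) = gauss_integral (pderiv q)"
proof -
  have m: "2 * gauss_integral (monom c (Suc n)) = gauss_integral (pderiv (monom c n))" for n and c :: real
  proof (cases n)
    case 0
    then show ?thesis by (simp add: gauss_integral_monom pderiv_monom gauss_integral_0)
  next
    case (Suc k)
    show ?thesis
    proof (cases "even k")
      case True
      then obtain b where b: "k = 2 * b" by (elim evenE)
      have "f * ((1 + 2 * x) * (2 + 2 * x)) / (2 * (g * ((1 + x) * e))) = (1 + 2 * x) * f / (e * g)"
        if "0 \<le> x" "e \<noteq> 0" "g \<noteq> 0" for f g e x :: real
      proof -
        have y: "1 + x \<noteq> 0" "2 + 2 * x = 2 * (1 + x)" using that by simp_all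
        have "f * (a * (2 * y)) / (2 * (g * (y * e))) = a * f / (e * g)" if "y \<noteq> 0" for a y :: real
          using that \<open>e \<noteq> 0\<close> \<open>g \<noteq> 0\<close> by (simp add: field_simps)
        then show ?thesis using y(1) unfolding y(2) .
      qed
      from this[of "real b" "4 ^ b" "fact b" "fact (2 * b)"]
      have "c * (fact (2 * b) * ((1 + 2 * real b) * (2 + 2 * real b)) / (2 * (fact b * ((1 + real b) * 4 ^ b)))) =
        c * ((1 + 2 * real b) * fact (2 * b) / (4 ^ b * fact b))" by simp
      then show ?thesis
        unfolding Suc b by (simp add: gauss_integral_monom pderiv_monom mult_ac)
    qed (simp add: Suc gauss_integral_monom pderiv_monom)
  qed
  \<comment> \<open>The extra monomial makes the induction over \<open>q\<close> work: each
    coefficient removed from \<open>q\<close> raises \<open>n\<close> by one.\<close>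
  have "2 * gauss_integral (monom 1 (Suc n) * q) = gauss_integral (pderiv (monom 1 n * q))" for n
  proof (induction q arbitrary: n)
    case 0
    then show ?case by (simp add: gauss_integral_0)
  next
    case (pCons a q)
    have e: "monom 1 n * pCons a q = monom a n + monom 1 (Suc n) * q" for n
      by (simp add: mult_pCons_right smult_monom monom_Suc)
    show ?case unfolding e gauss_integral_add pderiv_add distrib_left pCons.IH m ..
  qed
  from this[of 0] have "2 * gauss_integral (pCons 0 q) = gauss_integral (pderiv q)" by (simp add: monom_Suc)
  moreover have "[:0, 2:] * q = smult 2 (pCons 0 q)" by simp
  ultimately show ?thesis by (simp only: gauss_integral_smult)
qed

text \<open>Integration by parts moves the raising operator onto the other factor as a derivative
  (\<open>rec\<close>), and \<open>pderiv_Hermite\<close> then lowers both degrees together.\<close>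

lemma gauss_integral_Hermite: "gauss_integral (Hermite j * Hermite k) = (if j = k then 2 ^ k * fact k else 0)"
proof (induction k arbitrary: j)
  have rec: "gauss_integral (q * Hermite (Suc k)) = gauss_integral (pderiv q * Hermite k)" for q k
  proof -
    have "q * Hermite (Suc k) = [:0, 2:] * (q * Hermite k) - q * pderiv (Hermite k)" by (simp add: algebra_simps)
    then have "gauss_integral (q * Hermite (Suc k)) = gauss_integral (pderiv (q * Hermite k)) - gauss_integral (q * pderiv (Hermite k))"
      by (simp only: gauss_integral_diff gauss_integral_by_parts)
    also have "\<dots> = gauss_integral (pderiv q * Hermite k)" by (simp add: pderiv_mult gauss_integral_add mult.commute)
    finally show ?thesis .
  qed
  {
    case 0
    show ?case
    proof (cases j)
      case (Suc i)
      then have "gauss_integral (Hermite j * Hermite 0) = gauss_integral (1 * Hermite (Suc i))" by simp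
      also have "\<dots> = 0" by (subst rec) (simp add: gauss_integral_0)
      finally show ?thesis using Suc by simp
    qed (use gauss_integral_monom[of 1 0] in simp)
  next
    case (Suc k)
    show ?case
    proof (cases j)
      case 0
      then show ?thesis by (subst rec) (simp add: gauss_integral_0)
    next
      case (Suc i)
      then show ?thesis unfolding rec Suc pderiv_Hermite mult_smult_left gauss_integral_smult Suc.IH by simp
    qed
  }
qed

lemma orthogonal_Hermite:
  "has_bochner_integral gauss_measure (\<lambda>x. poly (Hermite j) x * poly (Hermite k) x) (if j = k then 2 ^ k * fact k else 0)"
proof -
  have "poly (Hermite j * Hermite k) = (\<lambda>x. poly (Hermite j) x * poly (Hermite k) x)" by (simp add: fun_eq_iff)
  then show ?thesis
    using gauss_integral_Hermite[of j k] integrable_poly_gauss[of "Hermite j * Hermite k"] by (simp add: has_bochner_integral_iff gauss_integral_def)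
qed

section \<open>The Mehler kernel and its bounds\<close>

definition mehler :: "real \<Rightarrow> real \<Rightarrow> real \<Rightarrow> real"
  where "mehler r x y = (1 - r\<^sup>2) powr (- 1 / 2) * exp ((2 * x * y * r - r\<^sup>2 * (x\<^sup>2 + y\<^sup>2)) / (1 - r\<^sup>2))"

lemma summable_Hermite:
  assumes s: "0 < s"
  shows "summable (\<lambda>k. exp (- real k * s) * \<bar>poly (Hermite k) x\<bar> / sqrt (2 ^ k * fact k))"
proof -
  have e: "exp (- real k * s) = exp (- s) ^ k" for k by (simp add: exp_of_nat_mult[symmetric])
  have "(\<lambda>k. mehler_coeff x x k * exp (- s) ^ k) = (\<lambda>k. exp (- s) ^ k / (2 ^ k * fact k) * poly (Hermite k) x * poly (Hermite k) x)"
    by (simp add: fun_eq_iff mehler_coeff_def poly_Hermite)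
  then have "summable (\<lambda>k. exp (- s) ^ k / (2 ^ k * fact k) * poly (Hermite k) x * poly (Hermite k) x)"
    using sums_summable[OF mehler_formula[of "exp (- s)" x x]] s by simp
  from summable_of_diagonal[OF _ _ _ this] s show ?thesis unfolding e by simp
qed

definition gauss_kernel :: "real \<Rightarrow> real \<Rightarrow> real \<Rightarrow> real"
  where "gauss_kernel s x y = (\<Sum>k. exp (- real k * s) / (2 ^ k * fact k) * poly (Hermite k) x * poly (Hermite k) y)"

lemma gauss_semigroup_eq: "gauss_semigroup s f x = (\<integral>y. gauss_kernel s x y * f y \<partial>gauss_measure)"
  by (simp only: gauss_semigroup_def gauss_kernel_def poly_Hermite)

lemma gauss_kernel_eq: "0 < s \<Longrightarrow> gauss_kernel s x y = mehler (exp (- s)) x y"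
proof -
  assume s: "0 < s"
  have "exp (- real k * s) / (2 ^ k * fact k) * poly (Hermite k) x * poly (Hermite k) y = mehler_coeff x y k * exp (- s) ^ k" for k
    by (simp add: exp_of_nat_mult[symmetric] mehler_coeff_def poly_Hermite)
  then show ?thesis
    using sums_unique[OF mehler_formula[of "exp (- s)" x y]] s by (simp add: gauss_kernel_def mehler_def)
qed

lemma gauss_poisson_poly:
  assumes t: "0 < t"
  shows "gauss_poisson t (\<lambda>y. \<Sum>k\<le>N. a k * poly (Hermite k) y) x = (\<Sum>k\<le>N. a k * exp (- t * sqrt (real k)) * poly (Hermite k) x)"
  unfolding gauss_poisson_def
proof (rule orthogonal_poisson[where h = "\<lambda>k. 2 ^ k * fact k" and S = UNIV and M = gauss_measure])
  show "integrable gauss_measure (\<lambda>y. poly (Hermite j) y * poly (Hermite k) y)" "(\<integral>y. poly (Hermite j) y * poly (Hermite k) y \<partial>gauss_measure) = (if j = k then 2 ^ k * fact k else 0)" for j k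
    using orthogonal_Hermite[of j k] by (simp_all add: has_bochner_integral_iff)
  show "gauss_semigroup s f x = (\<integral>y. (\<Sum>k. exp (- real k * s) / (2 ^ k * fact k) * poly (Hermite k) x * poly (Hermite k) y) * f y \<partial>gauss_measure)" for s f
    unfolding gauss_semigroup_eq gauss_kernel_def ..
qed (use t summable_Hermite in auto)

definition mehler' :: "real \<Rightarrow> real \<Rightarrow> real \<Rightarrow> real"
  where "mehler' r x y = mehler r x y * ((2 * y * r - r\<^sup>2 * (2 * x)) / (1 - r\<^sup>2))"

lemma mehler_deriv: "((\<lambda>x. mehler r x y) has_real_derivative mehler' r x y) (at x)"
proof -
  have "((\<lambda>x. (2 * x * y * r - r\<^sup>2 * (x\<^sup>2 + y\<^sup>2)) * (1 / (1 - r\<^sup>2))) has_real_derivative (2 * y * r - r\<^sup>2 * (2 * x)) * (1 / (1 - r\<^sup>2))) (at x)"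
    by (rule DERIV_cmult_right) (auto intro!: derivative_eq_intros)
  from DERIV_cmult[OF DERIV_fun_exp[OF this], of "(1 - r\<^sup>2) powr (- 1 / 2)"]
  show ?thesis unfolding mehler_def mehler'_def by (simp add: mult.assoc)
qed

text \<open>Completing the square writes the exponent as
  \<open>x\<^sup>2 - d\<^sup>2 / (1 - r\<^sup>2)\<close> with
  \<open>d = \<bar>r * y - x\<bar>\<close>, and the Gaussian in \<open>d\<close> absorbs the factor
  linear in \<open>y\<close> of the derivative. One power of \<open>1 / (1 - r)\<close> covers the
  prefactor, the other the quotient produced by differentiation.\<close>

lemma mehler_bounds:
  assumes r: "0 < r" "r < 1"
  shows "\<bar>mehler r x y\<bar> \<le> 2 * (1 + \<bar>x\<bar>) * exp (x\<^sup>2) * (1 / (1 - r)) ^ 2"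
    and "\<bar>mehler' r x y\<bar> \<le> 2 * (1 + \<bar>x\<bar>) * exp (x\<^sup>2) * (1 / (1 - r)) ^ 2"
proof -
  define q d where "q = 1 - r\<^sup>2" and "d = \<bar>r * y - x\<bar>"
  have "r\<^sup>2 \<le> r" using r power_decreasing[of 1 2 r] by simp
  then have q: "0 < q" "q \<le> 1" "1 - r \<le> q" using r by (simp_all add: q_def)
  have q1: "1 / q \<le> 1 / (1 - r)" "1 \<le> 1 / (1 - r)" using q r by (simp_all add: frac_le)
  have d: "0 \<le> d" "d\<^sup>2 = (r * y - x)\<^sup>2" by (simp_all add: d_def)
  have "(2 * x * y * r - r\<^sup>2 * (x\<^sup>2 + y\<^sup>2)) = x\<^sup>2 * q - d\<^sup>2"
    unfolding d(2) q_def by (simp add: power2_eq_square algebra_simps)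
  then have "(2 * x * y * r - r\<^sup>2 * (x\<^sup>2 + y\<^sup>2)) / q = x\<^sup>2 - d\<^sup>2 / q"
    using q by (simp add: diff_divide_distrib)
  also have "\<dots> \<le> x\<^sup>2 - d\<^sup>2"
  proof -
    have "d\<^sup>2 * q \<le> d\<^sup>2 * 1" using q by (intro mult_left_mono) auto
    then show ?thesis using q(1) by (simp add: pos_le_divide_eq)
  qed
  finally have e: "exp ((2 * x * y * r - r\<^sup>2 * (x\<^sup>2 + y\<^sup>2)) / q) \<le> exp (x\<^sup>2) * exp (- d\<^sup>2)"
    unfolding mult_exp_exp by simp
  have pw: "q powr (- 1 / 2) \<le> 1 / (1 - r)"
  proof -
    have "q powr (- 1 / 2) \<le> q powr - 1" using q by (intro powr_mono') auto
    also have "\<dots> = 1 / q" using q by (simp add: powr_minus_divide)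
    finally show ?thesis using q1 by simp
  qed
  have m1: "mehler r x y \<le> (1 / (1 - r)) * (exp (x\<^sup>2) * exp (- d\<^sup>2))"
    unfolding mehler_def q_def[symmetric] by (rule mult_mono[OF pw e]) (use r in auto)
  have m0: "0 \<le> mehler r x y" by (simp add: mehler_def)
  note m = m0 m1
  have "d \<le> exp (d\<^sup>2)"
  proof -
    have "0 \<le> (d - 1 / 2)\<^sup>2" by simp
    then have "d \<le> 1 + d\<^sup>2" by (simp add: power2_eq_square algebra_simps)
    then show ?thesis using exp_ge_add_one_self[of "d\<^sup>2"] by linarith
  qed
  then have dd: "d * exp (- d\<^sup>2) \<le> 1" by (simp add: exp_minus field_simps)
  have e1: "exp (- d\<^sup>2) \<le> 1" by simp
  have up: "(1 / (1 - r)) * exp (x\<^sup>2) * u \<le> 2 * (1 + \<bar>x\<bar>) * exp (x\<^sup>2) * (1 / (1 - r)) ^ 2" if "u \<le> 2 * (1 + \<bar>x\<bar>) * (1 / (1 - r))" for u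
  proof -
    have "(1 / (1 - r)) * exp (x\<^sup>2) * u \<le> (1 / (1 - r)) * exp (x\<^sup>2) * (2 * (1 + \<bar>x\<bar>) * (1 / (1 - r)))"
      using that r by (intro mult_left_mono) auto
    then show ?thesis by (simp add: power2_eq_square mult_ac)
  qed
  have one: "1 * 1 \<le> 2 * (1 + \<bar>x\<bar>) * (1 / (1 - r))" using q1(2) by (intro mult_mono) auto
  have "\<bar>mehler r x y\<bar> \<le> (1 / (1 - r)) * exp (x\<^sup>2) * exp (- d\<^sup>2)" using m by simp
  also have "\<dots> \<le> 2 * (1 + \<bar>x\<bar>) * exp (x\<^sup>2) * (1 / (1 - r)) ^ 2" using one e1 by (intro up) linarith
  finally show "\<bar>mehler r x y\<bar> \<le> 2 * (1 + \<bar>x\<bar>) * exp (x\<^sup>2) * (1 / (1 - r)) ^ 2" .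
  have "\<bar>(2 * y * r - r\<^sup>2 * (2 * x)) / q\<bar> \<le> 2 * (d + \<bar>x\<bar>) * (1 / (1 - r))"
  proof -
    have "2 * y * r - r\<^sup>2 * (2 * x) = 2 * ((r * y - x) + x * q)" by (simp add: q_def algebra_simps)
    moreover have "\<bar>(r * y - x) + x * q\<bar> \<le> d + \<bar>x\<bar>"
    proof -
      have "\<bar>x * q\<bar> \<le> \<bar>x\<bar> * 1" unfolding abs_mult using q by (intro mult_left_mono) auto
      then show ?thesis using abs_triangle_ineq[of "r * y - x" "x * q"] by (simp add: d_def)
    qed
    ultimately have "\<bar>2 * y * r - r\<^sup>2 * (2 * x)\<bar> \<le> 2 * (d + \<bar>x\<bar>)" by (simp only: abs_mult) simp
    then have "\<bar>2 * y * r - r\<^sup>2 * (2 * x)\<bar> * (1 / q) \<le> 2 * (d + \<bar>x\<bar>) * (1 / (1 - r))"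
      using q q1 d by (intro mult_mono) auto
    then show ?thesis using q by simp
  qed
  then have "\<bar>mehler' r x y\<bar> \<le> (1 / (1 - r)) * (exp (x\<^sup>2) * exp (- d\<^sup>2)) * (2 * (d + \<bar>x\<bar>) * (1 / (1 - r)))"
    unfolding mehler'_def abs_mult q_def[symmetric] using m r by (intro mult_mono) auto
  also have "\<dots> = (1 / (1 - r)) * exp (x\<^sup>2) * (2 * (d * exp (- d\<^sup>2) + \<bar>x\<bar> * exp (- d\<^sup>2)) * (1 / (1 - r)))"
    by (simp only: distrib_left distrib_right mult_ac)
  also have "\<dots> \<le> 2 * (1 + \<bar>x\<bar>) * exp (x\<^sup>2) * (1 / (1 - r)) ^ 2"
  proof (intro up mult_right_mono mult_left_mono)
    have "\<bar>x\<bar> * exp (- d\<^sup>2) \<le> \<bar>x\<bar> * 1" by (intro mult_left_mono e1) auto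
    then show "d * exp (- d\<^sup>2) + \<bar>x\<bar> * exp (- d\<^sup>2) \<le> 1 + \<bar>x\<bar>" using dd by linarith
  qed (use r in auto)
  finally show "\<bar>mehler' r x y\<bar> \<le> 2 * (1 + \<bar>x\<bar>) * exp (x\<^sup>2) * (1 / (1 - r)) ^ 2" .
qed

lemma kernel_semigroup_gauss: "kernel_semigroup gauss_measure UNIV gauss_kernel (\<lambda>s x y. mehler' (exp (- s)) x y)"
proof
  fix x :: real
  have [measurable]: "(\<lambda>p. poly (Hermite k) (snd p)) \<in> borel_measurable (borel \<Otimes>\<^sub>M gauss_measure)" for k
    by (rule measurable_compose[OF measurable_snd])
      (auto simp: measurable_cong_sets[OF sets_gauss refl] intro!: borel_measurable_continuous_onI continuous_intros)
  show "(\<lambda>(s, y). gauss_kernel s x y) \<in> borel_measurable (borel \<Otimes>\<^sub>M gauss_measure)"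
    unfolding gauss_kernel_def split_beta by measurable
  show "((\<lambda>z. gauss_kernel s z y) has_real_derivative mehler' (exp (- s)) x y) (at x)" if "0 < s" for s y
    unfolding gauss_kernel_eq[OF that] by (rule mehler_deriv)
  define A where "A = 2 * (1 + (\<bar>x\<bar> + 1)) * exp ((\<bar>x\<bar> + 1)\<^sup>2)"
  have A: "0 \<le> A" by (simp add: A_def)
  show "\<exists>d>0. \<exists>A\<ge>0. \<exists>N. \<forall>z\<in>ball x d. z \<in> UNIV \<and>
      (\<forall>s>0. \<forall>y\<in>space gauss_measure. \<bar>gauss_kernel s z y\<bar> \<le> A * (1 + 1 / s) ^ N \<and> \<bar>mehler' (exp (- s)) z y\<bar> \<le> A * (1 + 1 / s) ^ N)"
  proof (rule exI[of _ 1], rule conjI[OF zero_less_one], rule exI[of _ A], rule conjI[OF A], rule exI[of _ 2], intro conjI ballI allI impI)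
    fix z assume "z \<in> ball x 1"
    then have z: "\<bar>z\<bar> \<le> \<bar>x\<bar> + 1" by (auto simp: dist_real_def)
    show "z \<in> UNIV" by simp
    fix s y :: real assume s: "0 < s"
    have "(1 / (1 - exp (- s))) ^ 2 \<le> (1 + 1 / s) ^ 2"
      using s by (intro power_mono inverse_one_minus_exp_le) auto
    moreover have "2 * (1 + \<bar>z\<bar>) * exp (z\<^sup>2) \<le> A"
      unfolding A_def using z abs_le_square_iff[of z "\<bar>x\<bar> + 1"] by (intro mult_mono) auto
    ultimately have "2 * (1 + \<bar>z\<bar>) * exp (z\<^sup>2) * (1 / (1 - exp (- s))) ^ 2 \<le> A * (1 + 1 / s) ^ 2"
      using s A by (intro mult_mono) auto
    then show "\<bar>gauss_kernel s z y\<bar> \<le> A * (1 + 1 / s) ^ 2" "\<bar>mehler' (exp (- s)) z y\<bar> \<le> A * (1 + 1 / s) ^ 2"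
      using mehler_bounds[of "exp (- s)" z y] s by (auto simp: gauss_kernel_eq)
  qed
qed

subsection \<open>Transference\<close>

text \<open>Where \<open>\<bar>u\<bar>\<close> exceeds \<open>d\<close>, the power
  \<open>p - 1\<close> of \<open>\<bar>u\<bar> / d\<close> is at least 1. On a finite measure space
  this gives convergence in L^1 from convergence in L^p, with \<open>d\<close> chosen as the size of
  the error.\<close>

lemma abs_le_plus_powr:
  fixes d p :: real
  assumes d: "0 < d" and p: "1 < p"
  shows "\<bar>u\<bar> \<le> d + d powr (1 - p) * \<bar>u\<bar> powr p"
proof (cases "\<bar>u\<bar> \<le> d")
  case False
  have "1 = (\<bar>u\<bar> / d) powr 0" using False d by simp
  also have "\<dots> \<le> (\<bar>u\<bar> / d) powr (p - 1)" using False d p by (intro powr_mono) auto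
  finally have "\<bar>u\<bar> \<le> \<bar>u\<bar> * (\<bar>u\<bar> / d) powr (p - 1)" by (simp add: mult_le_cancel_left1)
  also have "\<dots> = d powr (1 - p) * \<bar>u\<bar> powr p"
    using False d by (simp add: powr_divide powr_diff)
  finally show ?thesis using d by simp
qed (simp add: add_increasing2)

text \<open>A case distinction on which summand dominates. In contrast to
  \<open>abs_add_powr_le\<close>, the main term keeps a coefficient close to 1, and this preserves
  the constant in the limit.\<close>

lemma abs_powr_add_le:
  fixes a b d p :: real
  assumes d: "0 < d" and p: "0 < p"
  shows "\<bar>a + b\<bar> powr p \<le> (1 + d) powr p * \<bar>a\<bar> powr p + (1 + 1 / d) powr p * \<bar>b\<bar> powr p"
proof (cases "\<bar>b\<bar> \<le> d * \<bar>a\<bar>")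
  case True
  then have "\<bar>a + b\<bar> \<le> (1 + d) * \<bar>a\<bar>" by (simp add: algebra_simps)
  then have "\<bar>a + b\<bar> powr p \<le> ((1 + d) * \<bar>a\<bar>) powr p" using p by (intro powr_mono2) auto
  also have "\<dots> = (1 + d) powr p * \<bar>a\<bar> powr p" using d by (simp add: powr_mult)
  finally show ?thesis by (simp add: add_increasing2)
next
  case False
  then have "\<bar>a\<bar> \<le> 1 / d * \<bar>b\<bar>" using d by (simp add: field_simps)
  then have "\<bar>a + b\<bar> \<le> (1 + 1 / d) * \<bar>b\<bar>" by (simp add: algebra_simps)
  then have "\<bar>a + b\<bar> powr p \<le> ((1 + 1 / d) * \<bar>b\<bar>) powr p" using p by (intro powr_mono2) auto
  also have "\<dots> = (1 + 1 / d) powr p * \<bar>b\<bar> powr p" using d by (simp add: powr_mult)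
  finally show ?thesis by (simp add: add_increasing)
qed

text \<open>Fatou's lemma is applied to polynomial approximants, whose derivatives in
  \<open>t\<close> and whose forms \<open>Q\<close> in \<open>x\<close> are measurable: once in
  \<open>t\<close> for each point (\<open>I_le\<close>), once in \<open>x\<close>. The g-function of
  \<open>f\<close> enters through pointwise upper bounds.\<close>

lemma (in kernel_semigroup) g_inequality_extend:
  fixes p C :: real
  assumes p: "1 < p" and C: "0 \<le> C"
    and S: "space M = S" "S \<in> sets borel" "sets M = sets (restrict_space borel S)"
    and dense: "\<And>f \<epsilon>. f \<in> borel_measurable borel \<Longrightarrow> (\<integral>\<^sup>+x. ennreal (\<bar>f x\<bar> powr p) \<partial>M) < \<infinity> \<Longrightarrow> 0 < \<epsilon> \<Longrightarrow>
        \<exists>q::real poly. (\<integral>\<^sup>+x. ennreal (\<bar>f x - poly q x\<bar> powr p) \<partial>M) < ennreal \<epsilon>"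
    and poly: "\<And>q::real poly. \<exists>Q \<in> borel_measurable borel. (\<forall>x\<in>S. 0 \<le> Q x \<and>
        (\<integral>\<^sup>+ t\<in>{0<..}. ennreal (t * ((deriv (\<lambda>s. subordinated T s (poly q) x) t)\<^sup>2 + w x * (deriv (\<lambda>z. subordinated T t (poly q) z) x)\<^sup>2)) \<partial>lborel) = ennreal (Q x)) \<and>
        (\<integral>\<^sup>+x. ennreal (Q x powr (p / 2)) \<partial>M) \<le> ennreal (C powr p) * (\<integral>\<^sup>+x. ennreal (\<bar>poly q x\<bar> powr p) \<partial>M)"
    and poly_meas: "\<And>(q::real poly) x. x \<in> S \<Longrightarrow> \<exists>D1 \<in> borel_measurable borel. \<exists>D2 \<in> borel_measurable borel. \<forall>t>0.
        deriv (\<lambda>s. subordinated T s (poly q) x) t = D1 t \<and> deriv (\<lambda>z. subordinated T t (poly q) z) x = D2 t"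
    and f: "f \<in> Lp_space p M"
  shows "Lp_norm_enn p M (g_function (subordinated T) w f) \<le> ennreal C * Lp_norm p M f"
proof -
  define I where "I f x = (\<integral>\<^sup>+ t\<in>{0<..}. ennreal (t * ((deriv (\<lambda>s. subordinated T s f x) t)\<^sup>2 + w x * (deriv (\<lambda>z. subordinated T t f z) x)\<^sup>2)) \<partial>lborel)" for f x
  have p0: "0 < p" using p by simp
  \<comment> \<open>Elements of \<open>Lp_space\<close> are measurable on \<open>M\<close> only;
    extension by zero off \<open>S\<close> makes them Borel functions, as \<open>dense\<close>
    requires.\<close>
  have mM: "f \<in> borel_measurable M \<Longrightarrow> (\<lambda>x. if x \<in> S then f x else 0) \<in> borel_measurable borel" for f :: "real \<Rightarrow> real"
  proof -
    assume "f \<in> borel_measurable M"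
    then have "(\<lambda>x. indicator S x *\<^sub>R f x) \<in> borel_measurable borel"
      unfolding measurable_cong_sets[OF S(3) refl] using S(2) by (subst (asm) borel_measurable_restrict_space_iff) auto
    moreover have "(\<lambda>x. indicator S x *\<^sub>R f x) = (\<lambda>x. if x \<in> S then f x else 0)" by (auto simp: fun_eq_iff)
    ultimately show ?thesis by (simp only:)
  qed
  have bM: "f \<in> borel_measurable borel \<Longrightarrow> f \<in> borel_measurable M" for f :: "real \<Rightarrow> 'a::topological_space"
    by (simp add: measurable_cong_sets[OF S(3) refl] measurable_restrict_space1)
  have polyM [measurable]: "poly q \<in> borel_measurable M" for q :: "real poly"
    by (intro bM borel_measurable_continuous_onI continuous_intros)
  have fM [measurable]: "f \<in> borel_measurable M" and fp: "integrable M (\<lambda>x. \<bar>f x\<bar> powr p)"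
    using f by (auto simp: Lp_space_def)
  define J where "J = (\<integral>x. \<bar>f x\<bar> powr p \<partial>M)"
  have J: "(\<integral>\<^sup>+x. ennreal (\<bar>f x\<bar> powr p) \<partial>M) = ennreal J" "0 \<le> J"
    unfolding J_def by (auto intro!: nn_integral_eq_integral fp)
  have "\<exists>q::real poly. (\<integral>\<^sup>+x. ennreal (\<bar>f x - poly q x\<bar> powr p) \<partial>M) < ennreal \<epsilon>" if e: "0 < \<epsilon>" for \<epsilon>
  proof -
    have "(\<integral>\<^sup>+x. ennreal (\<bar>if x \<in> S then f x else 0\<bar> powr p) \<partial>M) = (\<integral>\<^sup>+x. ennreal (\<bar>f x\<bar> powr p) \<partial>M)"
      using S(1) by (intro nn_integral_cong) auto
    then have "(\<integral>\<^sup>+x. ennreal (\<bar>if x \<in> S then f x else 0\<bar> powr p) \<partial>M) < \<infinity>" using J by simp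
    from dense[OF mM[OF fM] this e] obtain q :: "real poly" where "(\<integral>\<^sup>+x. ennreal (\<bar>(if x \<in> S then f x else 0) - poly q x\<bar> powr p) \<partial>M) < ennreal \<epsilon>" by blast
    moreover have "(\<integral>\<^sup>+x. ennreal (\<bar>(if x \<in> S then f x else 0) - poly q x\<bar> powr p) \<partial>M) = (\<integral>\<^sup>+x. ennreal (\<bar>f x - poly q x\<bar> powr p) \<partial>M)"
      using S(1) by (intro nn_integral_cong) auto
    ultimately show ?thesis by auto
  qed
  then have "\<exists>q::real poly. (\<integral>\<^sup>+x. ennreal (\<bar>f x - poly q x\<bar> powr p) \<partial>M) < ennreal ((1 / (real n + 1)) powr p)" for n by simp
  then obtain q :: "nat \<Rightarrow> real poly" where q: "\<And>n. (\<integral>\<^sup>+x. ennreal (\<bar>f x - poly (q n) x\<bar> powr p) \<partial>M) < ennreal ((1 / (real n + 1)) powr p)"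
    by metis
  have hp: "integrable M (\<lambda>x. \<bar>f x - poly (q n) x\<bar> powr p)" for n
    using q[of n] by (intro integrableI_nonneg) (auto intro: less_trans)
  have hp_le: "(\<integral>x. \<bar>f x - poly (q n) x\<bar> powr p \<partial>M) \<le> (1 / (real n + 1)) powr p" for n
  proof -
    have "ennreal (\<integral>x. \<bar>f x - poly (q n) x\<bar> powr p \<partial>M) \<le> ennreal ((1 / (real n + 1)) powr p)"
      using q[of n] by (subst nn_integral_eq_integral[symmetric]) (auto intro: hp)
    then show ?thesis by simp
  qed
  have int_of_powr: "integrable M u" if [measurable]: "u \<in> borel_measurable M" and u: "integrable M (\<lambda>x. \<bar>u x\<bar> powr p)" for u
  proof (rule Bochner_Integration.integrable_bound)
    show "integrable M (\<lambda>x. 1 + 1 * \<bar>u x\<bar> powr p)" using u by simp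
    show "AE x in M. norm (u x) \<le> norm (1 + 1 * \<bar>u x\<bar> powr p)"
      using abs_le_plus_powr[OF zero_less_one p] by (intro AE_I2) auto
  qed simp
  have fi: "integrable M f" by (rule int_of_powr[OF fM fp])
  have hi: "integrable M (\<lambda>x. f x - poly (q n) x)" for n by (rule int_of_powr[OF _ hp]) measurable
  have qi: "integrable M (poly (q n))" for n
    using Bochner_Integration.integrable_diff[OF fi hi[of n]] by simp
  have lim: "(\<lambda>n. \<integral>x. \<bar>f x - poly (q n) x\<bar> \<partial>M) \<longlonglongrightarrow> 0"
  proof (rule tendsto_sandwich[OF _ _ tendsto_const])
    show "eventually (\<lambda>n. 0 \<le> (\<integral>x. \<bar>f x - poly (q n) x\<bar> \<partial>M)) sequentially" by simp
    show "eventually (\<lambda>n. (\<integral>x. \<bar>f x - poly (q n) x\<bar> \<partial>M) \<le> 1 / (real n + 1) * (measure M (space M) + 1)) sequentially"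
    proof (rule always_eventually, rule allI)
      fix n
      \<comment> \<open>The p-th power error of \<open>q n\<close> is at most
        \<open>d powr p\<close>, so \<open>abs_le_plus_powr\<close> with this \<open>d\<close>
        bounds the L^1 error by \<open>d\<close> times the total mass plus one.\<close>
      define d where "d = 1 / (real n + 1)"
      have d: "0 < d" by (simp add: d_def)
      have "(\<integral>x. \<bar>f x - poly (q n) x\<bar> \<partial>M) \<le> (\<integral>x. d + d powr (1 - p) * \<bar>f x - poly (q n) x\<bar> powr p \<partial>M)"
        by (intro integral_mono abs_le_plus_powr d p) (use hi hp in auto)
      also have "\<dots> = d * measure M (space M) + d powr (1 - p) * (\<integral>x. \<bar>f x - poly (q n) x\<bar> powr p \<partial>M)"
        using hp[of n] by (simp add: mult.commute)
      also have "\<dots> \<le> d * measure M (space M) + d powr (1 - p) * d powr p"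
        using hp_le[of n] by (intro add_left_mono mult_left_mono) (auto simp: d_def)
      also have "d powr (1 - p) * d powr p = d" using d by (simp add: powr_add[symmetric])
      finally show "(\<integral>x. \<bar>f x - poly (q n) x\<bar> \<partial>M) \<le> 1 / (real n + 1) * (measure M (space M) + 1)"
        by (simp add: d_def distrib_left)
    qed
    have "(\<lambda>n. inverse (real (Suc n)) * (measure M (space M) + 1)) \<longlonglongrightarrow> 0 * (measure M (space M) + 1)"
      by (intro tendsto_mult LIMSEQ_inverse_real_of_nat tendsto_const)
    then show "(\<lambda>n. 1 / (real n + 1) * (measure M (space M) + 1)) \<longlonglongrightarrow> 0"
      by (simp add: inverse_eq_divide add.commute)
  qed
  obtain Q where Q: "\<And>n. Q n \<in> borel_measurable borel" "\<And>n x. x \<in> S \<Longrightarrow> 0 \<le> Q n x \<and> I (poly (q n)) x = ennreal (Q n x)"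
    "\<And>n. (\<integral>\<^sup>+x. ennreal (Q n x powr (p / 2)) \<partial>M) \<le> ennreal (C powr p) * (\<integral>\<^sup>+x. ennreal (\<bar>poly (q n) x\<bar> powr p) \<partial>M)"
  proof -
    have "\<forall>n. \<exists>Q. Q \<in> borel_measurable borel \<and> (\<forall>x\<in>S. 0 \<le> Q x \<and> I (poly (q n)) x = ennreal (Q x)) \<and>
      (\<integral>\<^sup>+x. ennreal (Q x powr (p / 2)) \<partial>M) \<le> ennreal (C powr p) * (\<integral>\<^sup>+x. ennreal (\<bar>poly (q n) x\<bar> powr p) \<partial>M)"
      using poly unfolding I_def by (intro allI) blast
    from choice[OF this] show thesis using that by blast
  qed
  have Qm [measurable]: "Q n \<in> borel_measurable M" for n by (rule bM[OF Q(1)])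
  have I_le: "I f x \<le> liminf (\<lambda>n. ennreal (Q n x))" if x: "x \<in> S" for x
  proof -
    define G where "G f t = ennreal (t * ((deriv (\<lambda>s. subordinated T s f x) t)\<^sup>2 + w x * (deriv (\<lambda>z. subordinated T t f z) x)\<^sup>2)) * indicator {0<..} t" for f and t :: real
    have meas: "G (poly (q n)) \<in> borel_measurable lborel" for n
    proof -
      obtain D1 D2 where [measurable]: "D1 \<in> borel_measurable borel" "D2 \<in> borel_measurable borel"
        and D: "\<forall>t>0. deriv (\<lambda>s. subordinated T s (poly (q n)) x) t = D1 t \<and> deriv (\<lambda>z. subordinated T t (poly (q n)) z) x = D2 t"
        using poly_meas[OF x, of "q n"] by blast
      have "G (poly (q n)) = (\<lambda>t. ennreal (t * ((D1 t)\<^sup>2 + w x * (D2 t)\<^sup>2)) * indicator {0<..} t)"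
        using D by (auto simp: G_def fun_eq_iff split: split_indicator)
      then show ?thesis by simp
    qed
    have "G f t = liminf (\<lambda>n. G (poly (q n)) t)" for t
    proof (cases "0 < t")
      case True
      note l = poisson_derivs_tendsto[OF x True fi qi lim]
      have "(\<lambda>n. G (poly (q n)) t) \<longlonglongrightarrow> G f t"
        unfolding G_def using True by (simp, intro tendsto_ennrealI tendsto_intros l)
      then show ?thesis by (simp add: lim_imp_Liminf)
    qed (simp add: G_def Liminf_const)
    then have "I f x = (\<integral>\<^sup>+t. liminf (\<lambda>n. G (poly (q n)) t) \<partial>lborel)" by (simp add: I_def G_def)
    also have "\<dots> \<le> liminf (\<lambda>n. \<integral>\<^sup>+t. G (poly (q n)) t \<partial>lborel)"
      by (rule nn_integral_liminf) (rule meas)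
    also have "(\<lambda>n. \<integral>\<^sup>+t. G (poly (q n)) t \<partial>lborel) = (\<lambda>n. ennreal (Q n x))"
      using Q(2)[OF x] by (simp add: G_def I_def)
    finally show ?thesis .
  qed
  have p2: "0 < p / 2" using p0 by simp
  have "(\<integral>\<^sup>+x. enn_powr (g_function (subordinated T) w f x) p \<partial>M) = (\<integral>\<^sup>+x. enn_powr (I f x) (p / 2) \<partial>M)"
    using p0 by (simp add: g_function_def I_def enn_powr_enn_powr)
  also have "\<dots> \<le> (\<integral>\<^sup>+x. liminf (\<lambda>n. ennreal (Q n x powr (p / 2))) \<partial>M)"
  proof (rule nn_integral_mono)
    fix x assume "x \<in> space M"
    then have x: "x \<in> S" by (simp add: S(1))
    have "enn_powr (I f x) (p / 2) \<le> enn_powr (liminf (\<lambda>n. ennreal (Q n x))) (p / 2)"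
      using I_le[OF x] enn_powr_le_iff[OF p2] by blast
    also have "\<dots> \<le> liminf (\<lambda>n. enn_powr (ennreal (Q n x)) (p / 2))" by (rule enn_powr_liminf_le[OF p2])
    also have "(\<lambda>n. enn_powr (ennreal (Q n x)) (p / 2)) = (\<lambda>n. ennreal (Q n x powr (p / 2)))"
      using Q(2)[OF x] by (simp add: enn_powr_ennreal)
    finally show "enn_powr (I f x) (p / 2) \<le> liminf (\<lambda>n. ennreal (Q n x powr (p / 2)))" .
  qed
  also have "\<dots> \<le> liminf (\<lambda>n. \<integral>\<^sup>+x. ennreal (Q n x powr (p / 2)) \<partial>M)"
    by (rule nn_integral_liminf) measurable
  also have "\<dots> \<le> ennreal (C powr p * J)"
  proof -
    let ?L = "liminf (\<lambda>n. \<integral>\<^sup>+x. ennreal (Q n x powr (p / 2)) \<partial>M)"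
    \<comment> \<open>First \<open>n\<close> tends to infinity with \<open>d\<close> fixed, which
      removes the error term; afterwards \<open>d\<close> tends to 0 and the factor
      \<open>(1 + d) powr p\<close> disappears.\<close>
    have "?L \<le> ennreal (C powr p * ((1 + d) powr p * J))" if d: "0 < d" for d
    proof -
      have b: "(\<integral>\<^sup>+x. ennreal (Q n x powr (p / 2)) \<partial>M) \<le> ennreal (C powr p * ((1 + d) powr p * J + (1 + 1 / d) powr p * (1 / (real n + 1)) powr p))" for n
      proof -
        have "(\<integral>\<^sup>+x. ennreal (\<bar>poly (q n) x\<bar> powr p) \<partial>M) \<le> (\<integral>\<^sup>+x. ennreal ((1 + d) powr p * \<bar>f x\<bar> powr p + (1 + 1 / d) powr p * \<bar>f x - poly (q n) x\<bar> powr p) \<partial>M)"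
        proof (rule nn_integral_mono, rule ennreal_leI)
          fix x
          show "\<bar>poly (q n) x\<bar> powr p \<le> (1 + d) powr p * \<bar>f x\<bar> powr p + (1 + 1 / d) powr p * \<bar>f x - poly (q n) x\<bar> powr p"
            using abs_powr_add_le[OF d p0, of "f x" "poly (q n) x - f x"] by (simp add: abs_minus_commute)
        qed
        also have "\<dots> = ennreal (\<integral>x. (1 + d) powr p * \<bar>f x\<bar> powr p + (1 + 1 / d) powr p * \<bar>f x - poly (q n) x\<bar> powr p \<partial>M)"
          using fp hp[of n] by (intro nn_integral_eq_integral) auto
        also have "(\<integral>x. (1 + d) powr p * \<bar>f x\<bar> powr p + (1 + 1 / d) powr p * \<bar>f x - poly (q n) x\<bar> powr p \<partial>M) =
          (1 + d) powr p * J + (1 + 1 / d) powr p * (\<integral>x. \<bar>f x - poly (q n) x\<bar> powr p \<partial>M)"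
          using fp hp[of n] by (simp add: J_def)
        also have "ennreal \<dots> \<le> ennreal ((1 + d) powr p * J + (1 + 1 / d) powr p * (1 / (real n + 1)) powr p)"
          by (intro ennreal_leI add_left_mono mult_left_mono hp_le) auto
        finally have "ennreal (C powr p) * (\<integral>\<^sup>+x. ennreal (\<bar>poly (q n) x\<bar> powr p) \<partial>M) \<le>
          ennreal (C powr p) * ennreal ((1 + d) powr p * J + (1 + 1 / d) powr p * (1 / (real n + 1)) powr p)"
          by (rule mult_left_mono) simp
        also have "\<dots> = ennreal (C powr p * ((1 + d) powr p * J + (1 + 1 / d) powr p * (1 / (real n + 1)) powr p))"
          using J(2) by (intro ennreal_mult[symmetric] add_nonneg_nonneg mult_nonneg_nonneg) auto
        finally show ?thesis by (rule order_trans[OF Q(3)])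
      qed
      have "(\<lambda>n. (1 / (real n + 1)) powr p) \<longlonglongrightarrow> 0"
        using LIMSEQ_inverse_real_of_nat p0
        by (intro tendsto_zero_powrI[OF _ tendsto_const]) (simp_all add: inverse_eq_divide add.commute)
      then have "(\<lambda>n. C powr p * ((1 + d) powr p * J + (1 + 1 / d) powr p * (1 / (real n + 1)) powr p)) \<longlonglongrightarrow> C powr p * ((1 + d) powr p * J + (1 + 1 / d) powr p * 0)"
        by (intro tendsto_intros)
      then have "liminf (\<lambda>n. ennreal (C powr p * ((1 + d) powr p * J + (1 + 1 / d) powr p * (1 / (real n + 1)) powr p))) = ennreal (C powr p * ((1 + d) powr p * J))"
        by (intro lim_imp_Liminf) (auto intro: tendsto_ennrealI)
      moreover have "?L \<le> liminf (\<lambda>n. ennreal (C powr p * ((1 + d) powr p * J + (1 + 1 / d) powr p * (1 / (real n + 1)) powr p)))"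
        by (intro Liminf_mono always_eventually allI b)
      ultimately show ?thesis by simp
    qed
    then have le: "?L \<le> ennreal (C powr p * ((1 + inverse (real (Suc n))) powr p * J))" for n by simp
    have "(\<lambda>n. C powr p * ((1 + inverse (real (Suc n))) powr p * J)) \<longlonglongrightarrow> C powr p * ((1 + 0) powr p * J)"
      by (intro tendsto_intros LIMSEQ_inverse_real_of_nat) auto
    from tendsto_ennrealI[OF this] have "(\<lambda>n. ennreal (C powr p * ((1 + inverse (real (Suc n))) powr p * J))) \<longlonglongrightarrow> ennreal (C powr p * J)"
      by simp
    then show ?thesis by (rule LIMSEQ_le_const) (use le in blast)
  qed
  finally show ?thesis
    unfolding Lp_norm_enn_le_iff[OF p0 C f] using J by (simp add: ennreal_mult)
qed

text \<open>The density result concerns Borel measures on the whole line. The measure on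
  \<open>S\<close> is therefore extended by zero, which changes no integral of a Borel
  function.\<close>

lemma density_dense:
  fixes w :: "real \<Rightarrow> real"
  assumes [measurable]: "S \<in> sets borel" "w \<in> borel_measurable borel"
    and p: "0 < p" and c: "0 < c"
    and mom: "(\<integral>\<^sup>+x. ennreal (exp (c * \<bar>x\<bar>)) \<partial>density (restrict_space lborel S) (\<lambda>x. ennreal (w x))) < \<infinity>"
    and f [measurable]: "f \<in> borel_measurable borel"
    and fp: "(\<integral>\<^sup>+x. ennreal (\<bar>f x\<bar> powr p) \<partial>density (restrict_space lborel S) (\<lambda>x. ennreal (w x))) < \<infinity>" and e: "0 < \<epsilon>"
  shows "\<exists>q::real poly. (\<integral>\<^sup>+x. ennreal (\<bar>f x - poly q x\<bar> powr p) \<partial>density (restrict_space lborel S) (\<lambda>x. ennreal (w x))) < ennreal \<epsilon>"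
proof -
  define N where "N = density lborel (\<lambda>x. ennreal (indicator S x * w x))"
  have eq: "(\<integral>\<^sup>+x. u x \<partial>density (restrict_space lborel S) (\<lambda>x. ennreal (w x))) = (\<integral>\<^sup>+x. u x \<partial>N)"
    if [measurable]: "u \<in> borel_measurable borel" for u :: "real \<Rightarrow> ennreal"
    unfolding N_def by (subst nn_integral_restricted_density, measurable, subst nn_integral_density) (auto simp: mult.commute)
  have mom': "(\<integral>\<^sup>+x. ennreal (exp (c * \<bar>x\<bar>)) \<partial>N) < \<infinity>" using mom by (subst (asm) eq) auto
  interpret finite_measure N
  proof (rule finite_measureI)
    have "emeasure N (space N) = (\<integral>\<^sup>+x. 1 \<partial>N)" by simp
    also have "\<dots> \<le> (\<integral>\<^sup>+x. ennreal (exp (c * \<bar>x\<bar>)) \<partial>N)"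
      using c by (intro nn_integral_mono) (simp flip: ennreal_1)
    finally show "emeasure N (space N) \<noteq> \<infinity>" using mom' by (auto simp: top_unique)
  qed
  interpret exp_moment_measure N p c
  proof
    show "sets N = sets borel" by (simp add: N_def)
    show "AE x in N. P x" if "AE x in lborel. P x" for P
      using that unfolding N_def by (subst AE_density) (auto elim: eventually_mono)
  qed (use p c mom' in auto)
  have "(\<integral>\<^sup>+x. ennreal (\<bar>f x\<bar> powr p) \<partial>N) < \<infinity>" using fp by (subst (asm) eq) auto
  from polynomials_dense[OF f this e] show ?thesis by (simp add: eq)
qed

text \<open>The part common to both limits: \<open>\<rho>s\<close>, \<open>lams\<close> and
  \<open>ws\<close> are the rescaled Jacobi weight, eigenvalues and coefficient of the space
  derivative, with limits \<open>\<rho>\<close>, \<open>real k\<close> and \<open>w\<close>. The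
  weight \<open>\<rho>\<close> carries no normalisation, which sits in \<open>K\<close>.\<close>

lemma (in kernel_semigroup) jacobi_transference:
  fixes p C K c :: real and \<rho> w :: "real \<Rightarrow> real" and \<rho>s ws :: "nat \<Rightarrow> real \<Rightarrow> real" and lams :: "nat \<Rightarrow> nat \<Rightarrow> real"
    and Pk :: "nat \<Rightarrow> real poly" and h :: "nat \<Rightarrow> real"
  assumes p: "1 < p" and C: "0 \<le> C" and S: "open S"
    and M: "M = density (restrict_space lborel S) (\<lambda>x. ennreal (K * \<rho> x))" and K: "0 < K"
    and \<rho>_meas [measurable]: "\<rho> \<in> borel_measurable borel" and \<rho>_supp: "\<And>x. x \<notin> S \<Longrightarrow> \<rho> x = 0"
    and c: "0 < c" and exp_mom: "(\<integral>\<^sup>+x. ennreal (exp (c * \<bar>x\<bar>)) \<partial>M) < \<infinity>"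
    and mom: "\<And>m. integrable M (\<lambda>x. x ^ m)"
    and deg: "\<And>k. degree (Pk k) = k" and h: "\<And>k. 0 < h k"
    and orth: "\<And>j k. has_bochner_integral M (\<lambda>x. poly (Pk j) x * poly (Pk k) x) (if j = k then h k else 0)"
    and poisson: "\<And>N a t x. 0 < t \<Longrightarrow> x \<in> S \<Longrightarrow>
        subordinated T t (\<lambda>y. \<Sum>k\<le>N. a k * poly (Pk k) y) x = (\<Sum>k\<le>N. a k * exp (- t * sqrt (real k)) * poly (Pk k) x)"
    and \<rho>s: "\<And>n z. 0 \<le> \<rho>s n z" "\<And>n z. \<rho>s n z \<le> \<rho> z" "\<And>z. (\<lambda>n. \<rho>s n z) \<longlonglongrightarrow> \<rho> z"
    and \<rho>s_meas: "\<And>n. \<rho>s n \<in> borel_measurable borel"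
    and lams: "\<And>k. (\<lambda>n. lams n k) \<longlonglongrightarrow> real k"
    and ws: "\<And>z. (\<lambda>n. ws n z) \<longlonglongrightarrow> w z" and ws_meas: "\<And>n. ws n \<in> borel_measurable borel"
    and w0: "\<And>z. z \<in> S \<Longrightarrow> 0 \<le> w z"
    and approx: "\<And>n. \<exists>E. orthogonal_polys (weight_functional (\<rho>s n)) E \<and> (\<forall>k. lead_coeff (E k) = 1) \<and>
        (\<forall>N A B z. 0 \<le> g_form N (lams n) A B (ws n z) \<or> \<rho>s n z = 0) \<and>
        (\<forall>f N. degree f \<le> N \<longrightarrow> (\<integral>\<^sup>+z. ennreal ((g_form N (lams n)
            (\<lambda>k. weight_functional (\<rho>s n) (f * E k) / weight_functional (\<rho>s n) (E k * E k) * poly (E k) z)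
            (\<lambda>k. weight_functional (\<rho>s n) (f * E k) / weight_functional (\<rho>s n) (E k * E k) * poly (pderiv (E k)) z)
            (ws n z)) powr (p / 2)) * ennreal (\<rho>s n z) \<partial>lborel)
          \<le> ennreal (C powr p) * (\<integral>\<^sup>+z. ennreal (\<bar>poly f z\<bar> powr p) * ennreal (\<rho>s n z) \<partial>lborel))"
    and f: "f \<in> Lp_space p M"
  shows "Lp_norm_enn p M (g_function (subordinated T) w f) \<le> ennreal C * Lp_norm p M f"
proof -
  have \<rho>0: "0 \<le> \<rho> z" for z using \<rho>s(1,2) order_trans by blast
  have S_meas [measurable]: "S \<in> sets borel" using S by simp
  have sp: "space M = S" by (simp add: M space_restrict_space)
  have se: "sets M = sets (restrict_space borel S)" by (simp add: M sets_restrict_space)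
  have [measurable]: "(\<lambda>z. K * \<rho> z) \<in> borel_measurable borel" by measurable
  have nnM: "(\<integral>\<^sup>+x. u x \<partial>M) = ennreal K * (\<integral>\<^sup>+x. u x * ennreal (\<rho> x) \<partial>lborel)"
    if [measurable]: "u \<in> borel_measurable borel" for u :: "real \<Rightarrow> ennreal"
  proof -
    have "(\<integral>\<^sup>+x. u x \<partial>M) = (\<integral>\<^sup>+x. u x * ennreal (indicator S x * (K * \<rho> x)) \<partial>lborel)"
      unfolding M by (rule nn_integral_restricted_density) measurable
    also have "\<dots> = (\<integral>\<^sup>+x. ennreal K * (u x * ennreal (\<rho> x)) \<partial>lborel)"
      using K \<rho>_supp by (intro nn_integral_cong) (auto simp: indicator_def ennreal_mult \<rho>0 mult_ac)
    also have "\<dots> = ennreal K * (\<integral>\<^sup>+x. u x * ennreal (\<rho> x) \<partial>lborel)" by (rule nn_integral_cmult) measurable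
    finally show ?thesis .
  qed
  have hbiM: "has_bochner_integral M (poly q) r \<Longrightarrow> has_bochner_integral lborel (\<lambda>z. poly q z * \<rho> z) (r / K)" for q r
  proof -
    assume "has_bochner_integral M (poly q) r"
    then have "has_bochner_integral lborel (\<lambda>x. indicator S x * (K * \<rho> x) * poly q x) r"
      unfolding M using K \<rho>0 by (subst (asm) has_bochner_integral_restricted_density_iff) auto
    from has_bochner_integral_divide_zero[OF this, of K]
    have "has_bochner_integral lborel (\<lambda>x. indicator S x * (K * \<rho> x) * poly q x / K) (r / K)" .
    moreover have "indicator S x * (K * \<rho> x) * poly q x / K = poly q x * \<rho> x" for x
      using K \<rho>_supp[of x] by (auto simp: indicator_def)
    ultimately show ?thesis by (simp only:)
  qed
  have intM: "integrable M (poly q)" for q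
    unfolding poly_altdef using mom by (intro Bochner_Integration.integrable_sum integrable_mult_right)
  have int\<rho>: "integrable lborel (\<lambda>z. poly q z * \<rho> z)" for q
    using hbiM[of q "\<integral>x. poly q x \<partial>M"] intM[of q] by (auto simp: has_bochner_integral_iff)
  have wf: "weight_functional \<rho> (Pk j * Pk k) = (if j = k then h k / K else 0)" for j k
  proof -
    have "poly (Pk j * Pk k) = (\<lambda>x. poly (Pk j) x * poly (Pk k) x)" by (simp add: fun_eq_iff)
    then show ?thesis
      using hbiM[of "Pk j * Pk k"] orth[of j k] by (auto simp: weight_functional_def has_bochner_integral_iff)
  qed
  have lin: "linear_functional (weight_functional \<rho>)" by (rule weight_functional_linear) (rule int\<rho>)
  have Pk0: "Pk k \<noteq> 0" for k using wf[of k k] h[of k] K by (auto simp: weight_functional_def)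
  \<comment> \<open>Monic versions, since only these are comparable with the rescaled Jacobi
    polynomials in the limit.\<close>
  define l E where "l k = lead_coeff (Pk k)" and "E k = smult (1 / l k) (Pk k)" for k
  have l: "l k \<noteq> 0" for k using Pk0[of k] by (simp add: l_def)
  have wfE: "weight_functional \<rho> (E j * E k) = (if j = k then h k / K / (l k * l k) else 0)" for j k
    using lin unfolding E_def linear_functional_def by (simp add: wf)
  have orthE: "orthogonal_polys (weight_functional \<rho>) E" and leadE: "lead_coeff (E k) = 1" for k
    unfolding orthogonal_polys_def using lin wfE h K l Pk0
    by (auto simp: E_def deg l_def order_less_imp_not_eq2)
  have pE: "poly (E k) x = poly (Pk k) x / l k" for k x by (simp add: E_def)
  have degE: "degree (E k) = k" for k using orthE by (simp add: orthogonal_polys_def)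
  define cf where "cf q k = weight_functional \<rho> (q * E k) / weight_functional \<rho> (E k * E k)" for q k
  have exps: "subordinated T t (poly q) x = (\<Sum>k\<le>degree q. cf q k * exp (- t * sqrt (real k)) * poly (E k) x)"
    if "0 < t" "x \<in> S" for t x q
  proof -
    have "q = (\<Sum>k<Suc (degree q). smult (cf q k) (E k))"
      unfolding cf_def by (rule orthogonal_polys_expansion[OF orthE]) simp
    from arg_cong[OF this, of poly]
    have "poly q = (\<lambda>y. \<Sum>k\<le>degree q. cf q k / l k * poly (Pk k) y)"
      by (simp add: poly_sum pE lessThan_Suc_atMost fun_eq_iff)
    then have "subordinated T t (poly q) x = subordinated T t (\<lambda>y. \<Sum>k\<le>degree q. cf q k / l k * poly (Pk k) y) x"
      by (rule arg_cong)
    also have "\<dots> = (\<Sum>k\<le>degree q. cf q k / l k * exp (- t * sqrt (real k)) * poly (Pk k) x)"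
      by (rule poisson[OF that])
    also have "\<dots> = (\<Sum>k\<le>degree q. cf q k * exp (- t * sqrt (real k)) * poly (E k) x)"
      by (simp add: pE)
    finally show ?thesis .
  qed
  define G where "G q x = g_form (degree q) real
    (\<lambda>k. cf q k * poly (E k) x) (\<lambda>k. cf q k * poly (pderiv (E k)) x) (w x)" for q x
  have w_meas [measurable]: "w \<in> borel_measurable borel" by (rule borel_measurable_LIMSEQ_real[OF ws ws_meas])
  have G_meas [measurable]: "G q \<in> borel_measurable borel" for q
    unfolding G_def g_form_def by measurable
  define good where "good n E \<longleftrightarrow> orthogonal_polys (weight_functional (\<rho>s n)) E \<and> (\<forall>k. lead_coeff (E k) = 1) \<and>
        (\<forall>N A B z. 0 \<le> g_form N (lams n) A B (ws n z) \<or> \<rho>s n z = 0) \<and>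
        (\<forall>f N. degree f \<le> N \<longrightarrow> (\<integral>\<^sup>+z. ennreal ((g_form N (lams n)
            (\<lambda>k. weight_functional (\<rho>s n) (f * E k) / weight_functional (\<rho>s n) (E k * E k) * poly (E k) z)
            (\<lambda>k. weight_functional (\<rho>s n) (f * E k) / weight_functional (\<rho>s n) (E k * E k) * poly (pderiv (E k)) z)
            (ws n z)) powr (p / 2)) * ennreal (\<rho>s n z) \<partial>lborel)
          \<le> ennreal (C powr p) * (\<integral>\<^sup>+z. ennreal (\<bar>poly f z\<bar> powr p) * ennreal (\<rho>s n z) \<partial>lborel))" for n E
  have "\<forall>n. \<exists>E. good n E" unfolding good_def using approx by (rule allI)
  from choice[OF this] obtain En where En: "\<And>n. good n (En n)" by auto
  have ineq: "(\<integral>\<^sup>+z. ennreal (G q z powr (p / 2)) * ennreal (\<rho> z) \<partial>lborel)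
      \<le> ennreal (C powr p) * (\<integral>\<^sup>+z. ennreal (\<bar>poly q z\<bar> powr p) * ennreal (\<rho> z) \<partial>lborel)" for q
    unfolding G_def cf_def
  proof (rule polynomial_g_inequality_limit[where \<rho>s = \<rho>s and lams = lams and ws = ws and En = En])
    show "0 < p" using p by simp
    show "orthogonal_polys (weight_functional (\<rho>s n)) (En n)" "lead_coeff (En n k) = 1" for n k
      using En[of n] unfolding good_def by blast+
    show "(\<integral>\<^sup>+z. ennreal ((g_form (degree q) (lams n)
        (\<lambda>k. weight_functional (\<rho>s n) (q * En n k) / weight_functional (\<rho>s n) (En n k * En n k) * poly (En n k) z)
        (\<lambda>k. weight_functional (\<rho>s n) (q * En n k) / weight_functional (\<rho>s n) (En n k * En n k) * poly (pderiv (En n k)) z)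
        (ws n z)) powr (p / 2)) * ennreal (\<rho>s n z) \<partial>lborel)
      \<le> ennreal (C powr p) * (\<integral>\<^sup>+z. ennreal (\<bar>poly q z\<bar> powr p) * ennreal (\<rho>s n z) \<partial>lborel)" for n
      using En[of n] unfolding good_def by blast
    show "0 \<le> g_form (degree q) (lams n)
        (\<lambda>k. weight_functional (\<rho>s n) (q * En n k) / weight_functional (\<rho>s n) (En n k * En n k) * poly (En n k) z)
        (\<lambda>k. weight_functional (\<rho>s n) (q * En n k) / weight_functional (\<rho>s n) (En n k * En n k) * poly (pderiv (En n k)) z)
        (ws n z) \<or> \<rho>s n z = 0" for n z
      using En[of n] unfolding good_def by blast
    show "0 < real k" if "1 \<le> k" for k using that by simp
  qed (fact \<rho>s \<rho>_meas \<rho>s_meas int\<rho> orthE leadE lams ws ws_meas order_refl)+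
  have G0: "0 \<le> G q x" and Geq: "(\<integral>\<^sup>+ t\<in>{0<..}. ennreal (t * ((deriv (\<lambda>s. subordinated T s (poly q) x) t)\<^sup>2 + w x * (deriv (\<lambda>z. subordinated T t (poly q) z) x)\<^sup>2)) \<partial>lborel) = ennreal (G q x)"
    if x: "x \<in> S" for q x
  proof -
    show "0 \<le> G q x" unfolding G_def by (rule g_integral_exp_sum(2)) (use w0[OF x] in auto)
    show "(\<integral>\<^sup>+ t\<in>{0<..}. ennreal (t * ((deriv (\<lambda>s. subordinated T s (poly q) x) t)\<^sup>2 + w x * (deriv (\<lambda>z. subordinated T t (poly q) z) x)\<^sup>2)) \<partial>lborel) = ennreal (G q x)"
      unfolding G_def by (rule g_function_exp_sum(3)[OF S x, where P = "subordinated T" and f = "poly q" and lam = real and E = E, OF exps]) (use w0[OF x] degE[of 0] in auto)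
  qed
  show ?thesis
  proof (rule g_inequality_extend[OF p C sp S_meas se _ _ _ f])
    fix u :: "real \<Rightarrow> real" and \<epsilon> :: real
    assume "u \<in> borel_measurable borel" "(\<integral>\<^sup>+x. ennreal (\<bar>u x\<bar> powr p) \<partial>M) < \<infinity>" "0 < \<epsilon>"
    then show "\<exists>q::real poly. (\<integral>\<^sup>+x. ennreal (\<bar>u x - poly q x\<bar> powr p) \<partial>M) < ennreal \<epsilon>"
      using density_dense[of S "\<lambda>x. K * \<rho> x" p c u \<epsilon>] exp_mom p c unfolding M by simp
  next
    fix q :: "real poly"
    have "(\<integral>\<^sup>+x. ennreal (G q x powr (p / 2)) \<partial>M) \<le> ennreal (C powr p) * (\<integral>\<^sup>+x. ennreal (\<bar>poly q x\<bar> powr p) \<partial>M)"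
      using mult_left_mono[OF ineq[of q], of "ennreal K"] by (simp add: nnM mult_ac)
    then show "\<exists>Q \<in> borel_measurable borel. (\<forall>x\<in>S. 0 \<le> Q x \<and>
        (\<integral>\<^sup>+ t\<in>{0<..}. ennreal (t * ((deriv (\<lambda>s. subordinated T s (poly q) x) t)\<^sup>2 + w x * (deriv (\<lambda>z. subordinated T t (poly q) z) x)\<^sup>2)) \<partial>lborel) = ennreal (Q x)) \<and>
        (\<integral>\<^sup>+x. ennreal (Q x powr (p / 2)) \<partial>M) \<le> ennreal (C powr p) * (\<integral>\<^sup>+x. ennreal (\<bar>poly q x\<bar> powr p) \<partial>M)"
      using G0 Geq G_meas[of q] by (intro bexI[of _ "G q"]) blast+
  next
    fix q :: "real poly" and x assume x: "x \<in> S"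
    define D1 D2 where "D1 t = - (\<Sum>k=1..degree q. sqrt (real k) * exp (- t * sqrt (real k)) * (cf q k * poly (E k) x))"
      and "D2 t = (\<Sum>k=1..degree q. exp (- t * sqrt (real k)) * (cf q k * poly (pderiv (E k)) x))" for t
    have "D1 \<in> borel_measurable borel" "D2 \<in> borel_measurable borel"
      unfolding D1_def D2_def by measurable
    moreover have "deriv (\<lambda>s. subordinated T s (poly q) x) t = D1 t \<and> deriv (\<lambda>z. subordinated T t (poly q) z) x = D2 t" if "0 < t" for t
      unfolding D1_def D2_def
      by (intro conjI g_function_exp_sum(1,2)[OF S x, where P = "subordinated T" and f = "poly q" and lam = real and E = E and w = w, OF exps]) (use w0[OF x] degE[of 0] that in auto)
    ultimately show "\<exists>D1 \<in> borel_measurable borel. \<exists>D2 \<in> borel_measurable borel. \<forall>t>0.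
        deriv (\<lambda>s. subordinated T s (poly q) x) t = D1 t \<and> deriv (\<lambda>z. subordinated T t (poly q) z) x = D2 t"
      by blast
  qed
qed

section \<open>The two limits of the Jacobi setting\<close>

lemma one_minus_powr_le_exp:
  fixes x m :: real
  assumes "0 < m" "x < m"
  shows "(1 - x / m) powr m \<le> exp (- x)"
proof -
  have p: "0 < 1 - x / m" using assms by simp
  have "m * ln (1 - x / m) \<le> m * (- (x / m))"
    using ln_le_minus_one[OF p] assms by (intro mult_left_mono) auto
  then show ?thesis using p assms by (simp add: powr_def)
qed

text \<open>The cut-off reflects that a rescaled Jacobi weight vanishes outside the image of the
  interval \<open>(-1, 1)\<close>; for fixed \<open>x\<close> it is eventually inactive, and Euler's
  limit applies.\<close>

lemma one_minus_powr_tendsto_exp: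
  "(\<lambda>n. if x < real (Suc n) then (1 - x / real (Suc n)) powr real (Suc n) else 0) \<longlonglongrightarrow> exp (- x)"
proof -
  have "(\<lambda>n. (1 + - x / real (Suc n)) ^ Suc n) \<longlonglongrightarrow> exp (- x)"
    by (rule LIMSEQ_Suc[OF tendsto_exp_limit_sequentially])
  moreover have "eventually (\<lambda>n. (1 + - x / real (Suc n)) ^ Suc n = (if x < real (Suc n) then (1 - x / real (Suc n)) powr real (Suc n) else 0)) sequentially"
  proof -
    have "eventually (\<lambda>n. n > nat \<lceil>\<bar>x\<bar>\<rceil>) sequentially" by (rule eventually_gt_at_top)
    then show ?thesis
    proof eventually_elim
      case (elim n)
      then have x: "x < real (Suc n)" by linarith
      then have "0 < 1 - x / real (Suc n)" by (simp del: of_nat_Suc)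
      then show ?case using x by (simp add: powr_realpow del: of_nat_Suc power_Suc)
    qed
  qed
  ultimately show ?thesis by (rule Lim_transform_eventually)
qed

lemma gauss_g_bound:
  fixes p C :: real
  assumes p: "1 < p" and C: "0 \<le> C"
    and hyp: "\<And>\<alpha> \<beta> f. \<lbrakk>\<alpha> > -1; \<beta> > -1; f \<in> Lp_space p (jacobi_measure \<alpha> \<beta>)\<rbrakk> \<Longrightarrow>
           Lp_norm_enn p (jacobi_measure \<alpha> \<beta>) (jacobi_g \<alpha> \<beta> f) \<le> ennreal C * Lp_norm p (jacobi_measure \<alpha> \<beta>) f"
    and f: "f \<in> Lp_space p gauss_measure"
  shows "Lp_norm_enn p gauss_measure (gauss_g f) \<le> ennreal C * Lp_norm p gauss_measure f"
proof -
  interpret ks: kernel_semigroup gauss_measure UNIV gauss_kernel "\<lambda>s x y. mehler' (exp (- s)) x y"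
    by (rule kernel_semigroup_gauss)
  have T: "ks.T = gauss_semigroup" by (simp add: fun_eq_iff ks.T_def gauss_semigroup_eq)
  \<comment> \<open>Both Jacobi parameters are \<open>m n\<close>; the successor keeps the scaling
    factor positive. With slope \<open>1 / sqrt (m n)\<close> and time factor
    \<open>2 * m n\<close>, the eigenvalue \<open>k * (k + 2 * m n + 1)\<close> is rescaled to tend
    to \<open>k\<close>, and the coefficient \<open>1 - x\<^sup>2\<close> becomes
    \<open>(1 - z\<^sup>2 / m n) / 2\<close>, which explains the 1/2 in the Gaussian
    g-function.\<close>
  define m where "m n = real (Suc n)" for n
  have m: "0 < m n" "-1 < m n" for n by (simp_all add: m_def)
  define \<rho>s where "\<rho>s n z = 1 * (indicator {-1<..<1} (0 + (1 / sqrt (m n)) * z) *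
    ((1 - (0 + (1 / sqrt (m n)) * z)) powr m n * (1 + (0 + (1 / sqrt (m n)) * z)) powr m n))" for n and z :: real
  have \<rho>s_eq: "\<rho>s n z = (if z\<^sup>2 < m n then (1 - z\<^sup>2 / m n) powr m n else 0)" for n z
  proof -
    define u where "u = 1 / sqrt (m n) * z"
    have u2: "u\<^sup>2 = z\<^sup>2 / m n" using m(1)[of n] by (simp add: u_def power_mult_distrib power_divide)
    have "u \<in> {-1<..<1} \<longleftrightarrow> \<bar>u\<bar> < 1" by auto
    also have "\<dots> \<longleftrightarrow> u\<^sup>2 < 1" by (simp add: abs_square_less_1)
    also have "\<dots> \<longleftrightarrow> z\<^sup>2 < m n" using m(1)[of n] by (simp add: u2)
    finally have iff: "u \<in> {-1<..<1} \<longleftrightarrow> z\<^sup>2 < m n" .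
    have "(1 - u) powr m n * (1 + u) powr m n = (1 - z\<^sup>2 / m n) powr m n" if "u \<in> {-1<..<1}"
    proof -
      have "(1 - u) * (1 + u) = 1 - u\<^sup>2" by (simp add: power2_eq_square algebra_simps)
      then have "(1 - u) * (1 + u) = 1 - z\<^sup>2 / m n" by (simp only: u2)
      then show ?thesis using that by (simp add: powr_mult[symmetric])
    qed
    then show ?thesis unfolding \<rho>s_def u_def[symmetric] using iff by (simp add: indicator_def)
  qed
  show ?thesis
    unfolding gauss_g_def gauss_poisson_def T[symmetric]
  proof (rule ks.jacobi_transference[where K = "1 / sqrt pi" and \<rho> = "\<lambda>x. exp (- x\<^sup>2)" and c = 1 and Pk = Hermite
        and h = "\<lambda>k. 2 ^ k * fact k" and \<rho>s = \<rho>s and lams = "\<lambda>n k. jacobi_eigenvalue (m n) (m n) k / (2 * m n)"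
        and ws = "\<lambda>n z. (1 - (0 + (1 / sqrt (m n)) * z)\<^sup>2) / ((1 / sqrt (m n))\<^sup>2 * (2 * m n))"])
    show "gauss_measure = density (restrict_space lborel UNIV) (\<lambda>x. ennreal (1 / sqrt pi * exp (- x\<^sup>2)))"
      by (simp add: gauss_measure_eq)
    show "(\<integral>\<^sup>+x. ennreal (exp (1 * \<bar>x\<bar>)) \<partial>gauss_measure) < \<infinity>"
    proof -
      have "(\<integral>\<^sup>+x. ennreal (exp (1 * \<bar>x\<bar>)) \<partial>gauss_measure) =
        (\<integral>\<^sup>+x. ennreal (exp (1 * \<bar>x\<bar>)) * ennreal (indicator UNIV x * (exp (- x\<^sup>2) / sqrt pi)) \<partial>lborel)"
        unfolding gauss_measure_eq by (rule nn_integral_restricted_density) auto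
      also have "\<dots> \<le> (\<integral>\<^sup>+x. ennreal (exp (1 / 2) * sqrt 2 * normal_density 0 1 x) \<partial>lborel)"
      proof (rule nn_integral_mono)
        fix x :: real
        have "0 \<le> (\<bar>x\<bar> - 1)\<^sup>2" by simp
        then have "\<bar>x\<bar> - x\<^sup>2 \<le> 1 / 2 - x\<^sup>2 / 2" by (simp add: power2_diff)
        then have "exp \<bar>x\<bar> * exp (- x\<^sup>2) \<le> exp (1 / 2) * exp (- x\<^sup>2 / 2)" unfolding mult_exp_exp by simp
        then have "exp \<bar>x\<bar> * exp (- x\<^sup>2) / sqrt pi \<le> exp (1 / 2) * exp (- x\<^sup>2 / 2) / sqrt pi" by (simp add: divide_right_mono)
        also have "\<dots> = exp (1 / 2) * sqrt 2 * normal_density 0 1 x"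
          by (simp add: normal_density_def real_sqrt_mult)
        finally show "ennreal (exp (1 * \<bar>x\<bar>)) * ennreal (indicator UNIV x * (exp (- x\<^sup>2) / sqrt pi)) \<le> ennreal (exp (1 / 2) * sqrt 2 * normal_density 0 1 x)"
          by (subst ennreal_mult[symmetric]) auto
      qed
      also have "\<dots> = ennreal (\<integral>x. exp (1 / 2) * sqrt 2 * normal_density 0 1 x \<partial>lborel)"
        by (intro nn_integral_eq_integral integrable_mult_right integrable_normal_density) auto
      finally show ?thesis by (rule le_less_trans) simp
    qed
    show "integrable gauss_measure (\<lambda>x. x ^ k)" for k
      using moment_gauss[of k] by (simp add: has_bochner_integral_iff)
    show "subordinated ks.T t (\<lambda>y. \<Sum>k\<le>N. a k * poly (Hermite k) y) x = (\<Sum>k\<le>N. a k * exp (- t * sqrt (real k)) * poly (Hermite k) x)"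
      if "0 < t" for N a t x
      unfolding T using gauss_poisson_poly[OF that] by (simp add: gauss_poisson_def)
    show "0 \<le> \<rho>s n z" "\<rho>s n z \<le> exp (- z\<^sup>2)" for n z
      using one_minus_powr_le_exp[OF m(1), of "z\<^sup>2" n] by (simp_all add: \<rho>s_eq)
    show "(\<lambda>n. \<rho>s n z) \<longlonglongrightarrow> exp (- z\<^sup>2)" for z
      unfolding \<rho>s_eq m_def by (rule one_minus_powr_tendsto_exp)
    show "\<rho>s n \<in> borel_measurable borel" for n unfolding \<rho>s_eq[abs_def] by measurable
    show "(\<lambda>n. jacobi_eigenvalue (m n) (m n) k / (2 * m n)) \<longlonglongrightarrow> real k" for k
      unfolding jacobi_eigenvalue_def m_def by real_asymp
    show "(\<lambda>n. (1 - (0 + (1 / sqrt (m n)) * z)\<^sup>2) / ((1 / sqrt (m n))\<^sup>2 * (2 * m n))) \<longlonglongrightarrow> 1 / 2" for z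
    proof -
      have "(1 - (0 + (1 / sqrt (m n)) * z)\<^sup>2) / ((1 / sqrt (m n))\<^sup>2 * (2 * m n)) = (1 - z\<^sup>2 / real (Suc n)) / 2" for n
        using m(1)[of n] by (simp add: power_mult_distrib power_divide m_def del: of_nat_Suc)
      moreover have "(\<lambda>n. (1 - z\<^sup>2 / real (Suc n)) / 2) \<longlonglongrightarrow> (1 - 0) / 2"
        by (intro tendsto_intros LIMSEQ_Suc[OF lim_const_over_n]) simp
      ultimately show ?thesis by (simp only: diff_zero)
    qed
    show "\<exists>E. orthogonal_polys (weight_functional (\<rho>s n)) E \<and> (\<forall>k. lead_coeff (E k) = 1) \<and>
        (\<forall>N A B z. 0 \<le> g_form N (\<lambda>k. jacobi_eigenvalue (m n) (m n) k / (2 * m n)) A B ((1 - (0 + (1 / sqrt (m n)) * z)\<^sup>2) / ((1 / sqrt (m n))\<^sup>2 * (2 * m n))) \<or> \<rho>s n z = 0) \<and>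
        (\<forall>f N. degree f \<le> N \<longrightarrow> (\<integral>\<^sup>+z. ennreal ((g_form N (\<lambda>k. jacobi_eigenvalue (m n) (m n) k / (2 * m n))
            (\<lambda>k. weight_functional (\<rho>s n) (f * E k) / weight_functional (\<rho>s n) (E k * E k) * poly (E k) z)
            (\<lambda>k. weight_functional (\<rho>s n) (f * E k) / weight_functional (\<rho>s n) (E k * E k) * poly (pderiv (E k)) z)
            ((1 - (0 + (1 / sqrt (m n)) * z)\<^sup>2) / ((1 / sqrt (m n))\<^sup>2 * (2 * m n)))) powr (p / 2)) * ennreal (\<rho>s n z) \<partial>lborel)
          \<le> ennreal (C powr p) * (\<integral>\<^sup>+z. ennreal (\<bar>poly f z\<bar> powr p) * ennreal (\<rho>s n z) \<partial>lborel))" for n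
    proof -
      interpret J: jacobi "m n" "m n" by unfold_locales (rule m)+
      have nz: "1 / sqrt (m n) \<noteq> 0" "0 < 2 * m n" "0 < p" using m(1)[of n] p by auto
      show ?thesis
        by (rule J.affine_transfer[OF nz(1,2) zero_less_one nz(3) C \<rho>s_def hyp[OF m(2) m(2)]]) blast+
    qed
  qed (use p C f orthogonal_Hermite degree_Hermite in \<open>auto intro!: borel_measurable_continuous_onI continuous_intros\<close>)
qed

lemma laguerre_g_bound:
  fixes p C \<alpha> :: real
  assumes p: "1 < p" and C: "0 \<le> C" and \<alpha>: "-1 < \<alpha>"
    and hyp: "\<And>\<alpha> \<beta> f. \<lbrakk>\<alpha> > -1; \<beta> > -1; f \<in> Lp_space p (jacobi_measure \<alpha> \<beta>)\<rbrakk> \<Longrightarrow>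
           Lp_norm_enn p (jacobi_measure \<alpha> \<beta>) (jacobi_g \<alpha> \<beta> f) \<le> ennreal C * Lp_norm p (jacobi_measure \<alpha> \<beta>) f"
    and f: "f \<in> Lp_space p (laguerre_measure \<alpha>)"
  shows "Lp_norm_enn p (laguerre_measure \<alpha>) (laguerre_g \<alpha> f) \<le> ennreal C * Lp_norm p (laguerre_measure \<alpha>) f"
proof -
  interpret L: laguerre \<alpha> by unfold_locales (rule \<alpha>)
  interpret ks: kernel_semigroup "laguerre_measure \<alpha>" "{0<..}" L.heat_kernel "\<lambda>s x y. L.hardy' (exp (- s)) x y"
    by (rule L.kernel_semigroup_laguerre)
  have T: "ks.T = laguerre_semigroup \<alpha>" by (simp add: fun_eq_iff ks.T_def L.laguerre_semigroup_eq)
  define m where "m n = real (Suc n)" for n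
  have m: "0 < m n" "-1 < m n" for n by (simp_all add: m_def)
  \<comment> \<open>Removes the constants produced by \<open>1 - x = 2 * z / m n\<close> and
    \<open>1 + x = 2 * (1 - z / m n)\<close>. The slope is negative because the exponent
    \<open>\<alpha>\<close> lives at the endpoint \<open>x = 1\<close>, which must be mapped to
    \<open>z = 0\<close>. With time factor \<open>m n\<close>, the coefficient
    \<open>1 - x\<^sup>2\<close> becomes \<open>z - z\<^sup>2 / m n\<close>.\<close>
  define \<kappa> where "\<kappa> n = 1 / ((2 / m n) powr \<alpha> * 2 powr m n)" for n
  have \<kappa>: "0 < \<kappa> n" for n using m(1)[of n] by (simp add: \<kappa>_def)
  define \<rho> where "\<rho> z = indicator {0<..} z * (z powr \<alpha> * exp (- z))" for z :: real
  define \<rho>s where "\<rho>s n z = \<kappa> n * (indicator {-1<..<1} (1 + (- 2 / m n) * z) *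
    ((1 - (1 + (- 2 / m n) * z)) powr \<alpha> * (1 + (1 + (- 2 / m n) * z)) powr m n))" for n and z :: real
  have \<rho>s_eq: "\<rho>s n z = (if 0 < z then z powr \<alpha> else 0) * (if z < m n then (1 - z / m n) powr m n else 0)" for n z
  proof -
    have e: "1 - (1 + (- 2 / m n) * z) = 2 / m n * z" "1 + (1 + (- 2 / m n) * z) = 2 * (1 - z / m n)"
      by (simp_all add: right_diff_distrib)
    have iff: "1 + (- 2 / m n) * z \<in> {-1<..<1} \<longleftrightarrow> 0 < z \<and> z < m n"
    proof -
      have "1 + (- 2 / m n) * z \<in> {-1<..<1} \<longleftrightarrow> 0 < 2 / m n * z \<and> 2 / m n * z < 2" by auto
      also have "\<dots> \<longleftrightarrow> 0 < z \<and> z < m n" using m(1)[of n] by (simp add: zero_less_divide_iff zero_less_mult_iff pos_divide_less_eq)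
      finally show ?thesis .
    qed
    have "\<kappa> n * ((2 / m n * z) powr \<alpha> * (2 * (1 - z / m n)) powr m n) = z powr \<alpha> * (1 - z / m n) powr m n" if "0 < z" "z < m n"
    proof -
      have "(2 / m n * z) powr \<alpha> = (2 / m n) powr \<alpha> * z powr \<alpha>" by (rule powr_mult)
      moreover have "(2 * (1 - z / m n)) powr m n = 2 powr m n * (1 - z / m n) powr m n" by (rule powr_mult)
      ultimately have "\<kappa> n * ((2 / m n * z) powr \<alpha> * (2 * (1 - z / m n)) powr m n) =
        \<kappa> n * ((2 / m n) powr \<alpha> * 2 powr m n) * (z powr \<alpha> * (1 - z / m n) powr m n)" by (simp only: mult_ac)
      moreover have "\<kappa> n * ((2 / m n) powr \<alpha> * 2 powr m n) = 1" using m(1)[of n] by (simp add: \<kappa>_def)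
      ultimately show ?thesis by simp
    qed
    then show ?thesis unfolding \<rho>s_def e iff indicator_def using iff by auto
  qed
  show ?thesis
    unfolding laguerre_g_def laguerre_poisson_def T[symmetric]
  proof (rule ks.jacobi_transference[where K = "1 / Gamma (\<alpha> + 1)" and \<rho> = \<rho> and c = "1 / 2" and Pk = L.Laguerre
        and h = L.h and \<rho>s = \<rho>s and lams = "\<lambda>n k. jacobi_eigenvalue \<alpha> (m n) k / m n"
        and ws = "\<lambda>n z. (1 - (1 + (- 2 / m n) * z)\<^sup>2) / ((- 2 / m n)\<^sup>2 * m n)"])
    show [measurable]: "\<rho> \<in> borel_measurable borel" unfolding \<rho>_def by measurable
    show M: "laguerre_measure \<alpha> = density (restrict_space lborel {0<..}) (\<lambda>x. ennreal (1 / Gamma (\<alpha> + 1) * \<rho> x))"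
      unfolding laguerre_measure_def
      by (rule density_cong) (auto intro!: measurable_restrict_space1 AE_I2 simp: \<rho>_def space_restrict_space)
    show "(\<integral>\<^sup>+x. ennreal (exp (1 / 2 * \<bar>x\<bar>)) \<partial>laguerre_measure \<alpha>) < \<infinity>"
    proof -
      \<comment> \<open>Half of the decay \<open>exp (- x)\<close> is spent on the exponential
        moment; what remains is the Gamma integrand at \<open>x / 2\<close>.\<close>
      define g where "g x = indicator {0<..} x * (x powr (\<alpha> + 1 - 1) * exp (- x))" for x :: real
      have "has_bochner_integral lborel g (Gamma (\<alpha> + 1))" unfolding g_def using gamma_integral[of "\<alpha> + 1"] \<alpha> by simp
      then have "integrable lborel (\<lambda>x. g (0 + 1 / 2 * x))"
        by (subst (asm) lborel_has_bochner_integral_real_affine_iff[of "1 / 2" _ _ 0]) (auto simp: has_bochner_integral_iff)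
      then have int: "integrable lborel (\<lambda>x. 2 powr \<alpha> / Gamma (\<alpha> + 1) * g (0 + 1 / 2 * x))" by simp
      have "(\<integral>\<^sup>+x. ennreal (exp (1 / 2 * \<bar>x\<bar>)) \<partial>laguerre_measure \<alpha>) =
        (\<integral>\<^sup>+x. ennreal (exp (1 / 2 * \<bar>x\<bar>)) * ennreal (indicator {0<..} x * (1 / Gamma (\<alpha> + 1) * \<rho> x)) \<partial>lborel)"
        unfolding M by (rule nn_integral_restricted_density) auto
      also have "\<dots> = (\<integral>\<^sup>+x. ennreal (2 powr \<alpha> / Gamma (\<alpha> + 1) * g (0 + 1 / 2 * x)) \<partial>lborel)"
      proof (rule nn_integral_cong)
        fix x :: real
        have "exp (1 / 2 * \<bar>x\<bar>) * (indicator {0<..} x * (1 / Gamma (\<alpha> + 1) * \<rho> x)) = 2 powr \<alpha> / Gamma (\<alpha> + 1) * g (0 + 1 / 2 * x)"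
        proof (cases "0 < x")
          case True
          have "x powr \<alpha> = 2 powr \<alpha> * (1 / 2 * x) powr \<alpha>" using powr_mult[of 2 "1 / 2 * x" \<alpha>] True by simp
          moreover have "exp (- x) * exp (1 / 2 * x) = exp (- (1 / 2 * x))" unfolding mult_exp_exp by simp
          moreover have "exp (1 / 2 * x) * (1 / Gamma (\<alpha> + 1) * (x powr \<alpha> * exp (- x))) = x powr \<alpha> / Gamma (\<alpha> + 1) * (exp (- x) * exp (1 / 2 * x))" by simp
          ultimately show ?thesis using True by (simp add: \<rho>_def g_def)
        qed (simp add: g_def)
        then show "ennreal (exp (1 / 2 * \<bar>x\<bar>)) * ennreal (indicator {0<..} x * (1 / Gamma (\<alpha> + 1) * \<rho> x)) = ennreal (2 powr \<alpha> / Gamma (\<alpha> + 1) * g (0 + 1 / 2 * x))"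
          using L.Gamma_pos by (subst ennreal_mult[symmetric]) (auto simp: \<rho>_def)
      qed
      also have "\<dots> = ennreal (\<integral>x. 2 powr \<alpha> / Gamma (\<alpha> + 1) * g (0 + 1 / 2 * x) \<partial>lborel)"
        using L.Gamma_pos by (intro nn_integral_eq_integral int) (auto simp: g_def)
      finally show ?thesis by simp
    qed
    show "integrable (laguerre_measure \<alpha>) (\<lambda>x. x ^ k)" for k
      using L.moment_\<mu>[of k] by (simp add: has_bochner_integral_iff)
    show "subordinated ks.T t (\<lambda>y. \<Sum>k\<le>N. a k * poly (L.Laguerre k) y) x = (\<Sum>k\<le>N. a k * exp (- t * sqrt (real k)) * poly (L.Laguerre k) x)"
      if "0 < t" for N a t x
      unfolding T using L.laguerre_poisson_poly[OF that] by (simp add: laguerre_poisson_def)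
    show "0 \<le> \<rho>s n z" "\<rho>s n z \<le> \<rho> z" for n z
      using one_minus_powr_le_exp[OF m(1), of z n] by (auto simp: \<rho>s_eq \<rho>_def intro!: mult_left_mono)
    show "(\<lambda>n. \<rho>s n z) \<longlonglongrightarrow> \<rho> z" for z
    proof -
      have "(\<lambda>n. \<rho>s n z) \<longlonglongrightarrow> (if 0 < z then z powr \<alpha> else 0) * exp (- z)"
        unfolding \<rho>s_eq m_def by (intro tendsto_mult tendsto_const one_minus_powr_tendsto_exp)
      moreover have "(if 0 < z then z powr \<alpha> else 0) * exp (- z) = \<rho> z" by (simp add: \<rho>_def)
      ultimately show ?thesis by (simp only:)
    qed
    show "\<rho>s n \<in> borel_measurable borel" for n unfolding \<rho>s_eq[abs_def] by measurable
    show "(\<lambda>n. jacobi_eigenvalue \<alpha> (m n) k / m n) \<longlonglongrightarrow> real k" for k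
      unfolding jacobi_eigenvalue_def m_def by real_asymp
    show "(\<lambda>n. (1 - (1 + (- 2 / m n) * z)\<^sup>2) / ((- 2 / m n)\<^sup>2 * m n)) \<longlonglongrightarrow> z" for z
    proof -
      have "(1 - (1 + (- 2 / m n) * z)\<^sup>2) / ((- 2 / m n)\<^sup>2 * m n) = z - z\<^sup>2 / real (Suc n)" for n
        using m(1)[of n] unfolding m_def[symmetric] by (simp add: power2_eq_square field_simps)
      moreover have "(\<lambda>n. z - z\<^sup>2 / real (Suc n)) \<longlonglongrightarrow> z - 0"
        by (intro tendsto_intros LIMSEQ_Suc[OF lim_const_over_n])
      ultimately show ?thesis by simp
    qed
    show "\<exists>E. orthogonal_polys (weight_functional (\<rho>s n)) E \<and> (\<forall>k. lead_coeff (E k) = 1) \<and>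
        (\<forall>N A B z. 0 \<le> g_form N (\<lambda>k. jacobi_eigenvalue \<alpha> (m n) k / m n) A B ((1 - (1 + (- 2 / m n) * z)\<^sup>2) / ((- 2 / m n)\<^sup>2 * m n)) \<or> \<rho>s n z = 0) \<and>
        (\<forall>f N. degree f \<le> N \<longrightarrow> (\<integral>\<^sup>+z. ennreal ((g_form N (\<lambda>k. jacobi_eigenvalue \<alpha> (m n) k / m n)
            (\<lambda>k. weight_functional (\<rho>s n) (f * E k) / weight_functional (\<rho>s n) (E k * E k) * poly (E k) z)
            (\<lambda>k. weight_functional (\<rho>s n) (f * E k) / weight_functional (\<rho>s n) (E k * E k) * poly (pderiv (E k)) z)
            ((1 - (1 + (- 2 / m n) * z)\<^sup>2) / ((- 2 / m n)\<^sup>2 * m n))) powr (p / 2)) * ennreal (\<rho>s n z) \<partial>lborel)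
          \<le> ennreal (C powr p) * (\<integral>\<^sup>+z. ennreal (\<bar>poly f z\<bar> powr p) * ennreal (\<rho>s n z) \<partial>lborel))" for n
    proof -
      interpret J: jacobi \<alpha> "m n" by unfold_locales (rule \<alpha> m)+
      have nz: "- 2 / m n \<noteq> 0" "0 < p" using m(1)[of n] p by auto
      show ?thesis
        by (rule J.affine_transfer[OF nz(1) m(1) \<kappa> nz(2) C \<rho>s_def hyp[OF \<alpha> m(2)]]) blast+
    qed
  qed (use p C f L.orthogonal_Laguerre L.degree_Laguerre L.h_pos L.Gamma_pos in \<open>auto simp: \<rho>_def\<close>)
qed

theorem theorem2p2:
  fixes p C :: real
  assumes "1 < p"
    and "\<And>\<alpha> \<beta> f. \<lbrakk>\<alpha> > -1; \<beta> > -1; f \<in> Lp_space p (jacobi_measure \<alpha> \<beta>)\<rbrakk> \<Longrightarrow>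
           Lp_norm_enn p (jacobi_measure \<alpha> \<beta>) (jacobi_g \<alpha> \<beta> f)
             \<le> ennreal C * Lp_norm p (jacobi_measure \<alpha> \<beta>) f"
  shows "(\<forall>f \<in> Lp_space p gauss_measure.
            Lp_norm_enn p gauss_measure (gauss_g f) \<le> ennreal C * Lp_norm p gauss_measure f) \<and>
         (\<forall>\<alpha> > -1. \<forall>f \<in> Lp_space p (laguerre_measure \<alpha>).
            Lp_norm_enn p (laguerre_measure \<alpha>) (laguerre_g \<alpha> f)
              \<le> ennreal C * Lp_norm p (laguerre_measure \<alpha>) f)"
proof -
  \<comment> \<open>\<open>ennreal\<close> sends negative numbers to 0, so a negative
    \<open>C\<close> is replaced by 0; nonnegativity is what allows \<open>C powr p\<close> to
    represent the p-th power of the constant.\<close>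
  have C: "ennreal C = ennreal (max C 0)" by (simp add: max_def ennreal_neg)
  note hyp = assms(2)[unfolded C]
  have "Lp_norm_enn p gauss_measure (gauss_g f) \<le> ennreal (max C 0) * Lp_norm p gauss_measure f"
    if "f \<in> Lp_space p gauss_measure" for f
    by (rule gauss_g_bound[OF assms(1) _ hyp that]) auto
  moreover have "Lp_norm_enn p (laguerre_measure \<alpha>) (laguerre_g \<alpha> f) \<le> ennreal (max C 0) * Lp_norm p (laguerre_measure \<alpha>) f"
    if "-1 < \<alpha>" "f \<in> Lp_space p (laguerre_measure \<alpha>)" for \<alpha> f
    by (rule laguerre_g_bound[OF assms(1) _ that(1) hyp that(2)]) auto
  ultimately show ?thesis unfolding C by blast
qed

end
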